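(* Let $r,s\ge1$ and $d=r+s$, with $d$ treated as a bounded constant. Given a sample $z^{[n]}=(z^1,\dots,z^n)\in\mathbb{R}^{d\times n}$, $z^i=(x^i,y^i)\in\mathbb{R}^r\times\mathbb{R}^s$, there are algorithms computing the U-statistics $U_D,U_R,U_{\tau^*_P},U_{\tau^*_J}$ exactly with the following asymptotic running times as $n\to\infty$: (a) $U_D(z^{[n]})$ in time $O(n\log_2(n)^{d-1})$; (b) $U_R(z^{[n]})$ in time $O(n^d)$; (c) $U_{\tau^*_P}(z^{[n]})$ and $U_{\tau^*_J}(z^{[n]})$ in time $O(n^2\log_2(n)^{2d-1})$.
   Context: Time is counted in unit-cost operations (comparisons, array accesses, arithmetic). For $w^{[m]}=(w^1,\dots,w^m)\in\mathbb{R}^{q\times m}$ and $\sigma\in S_m$, $w^{\sigma[m]}=(w^{\sigma^{-1}(1)},\dots,w^{\sigma^{-1}(m)})$. For $a,b\in\mathbb{R}^q$, $a\preceq b$ means $a_\ell\le b_\ell$ for all $\ell$, and $a\prec b$ means $a_\ell<b_\ell$ for all $\ell$. A relation between lists, such as $w^3,w^4\not\preceq w^1,w^2$ or $w^1,w^2\prec w^3,w^4$, means that it holds for every pair (left element, right element). Let $H_{\tau^*}=\langle(1\ 4),(2\ 3)\rangle\le S_m$. Given functions $I_X:\mathbb{R}^{r\times m}\to\{0,1\}$, $I_Y:\mathbb{R}^{s\times m}\to\{0,1\}$ and a constant $c>0$, let $$k(z^{[m]})=c\Big(\sum_{\sigma\in H_{\tau^*}}\mathrm{sign}(\sigma)I_X(x^{\sigma[m]})\Big)\Big(\sum_{\sigma\in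 H_{\tau^*}}\mathrm{sign}(\sigma)I_Y(y^{\sigma[m]})\Big),\quad\kappa(z^{[m]})=\frac1{m!}\sum_{\sigma\in S_m}k(z^{\sigma[m]}),$$ and for $n\ge m$ let $U(z^{[n]})=\binom nm^{-1}\sum_{1\le i_1<\dots<i_m\le n}\kappa(z^{i_1},\dots,z^{i_m})$. The four U-statistics are obtained as follows. $U_D$: $m=5$, $c=\frac14$, $I_X,I_Y$ both given (in dimensions $r$ and $s$) by $I(w^{[5]})=1_{[w^1,w^2\preceq w^5]}1_{[w^3,w^4\not\preceq w^5]}$. $U_R$: $m=4+d$, $c=\frac14$, $I_X(w^{[4+d]})=1_{[w^1,w^2\preceq u]}1_{[w^3,w^4\not\preceq u]}$ with $u=(w^5_1,\dots,w^{4+r}_r)$, and $I_Y(w^{[4+d]})=1_{[w^1,w^2\preceq v]}1_{[w^3,w^4\not\preceq v]}$ with $v=(w^{4+r+1}_1,\dots,w^{4+r+s}_s)$. $U_{\tau^*_P}$: $m=4$, $c=1$, $I_X,I_Y$ both given by $I_P(w^{[4]})=1_{[w^3,w^4\not\preceq w^1,w^2]}$. $U_{\tau^*_J}$: $m=4$, $c=1$, $I_X,I_Y$ both given by $I_J(w^{[4]})=1_{[w^1,w^2\prec w^3,w^4]}$. *)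

theory Defs
  imports Complex_Main "HOL-Library.FuncSet" "HOL-Library.Landau_Symbols"
    "HOL-Algebra.Sym_Groups"
begin

section \<open>The U-statistics\<close>

text \<open>
  An element \<open>w\<close> of $\mathbb{R}^{q\times m}$ is a function \<open>nat \<Rightarrow> nat \<Rightarrow> real\<close>: \<open>w i l\<close> is the
  coordinate \<open>l \<in> {1..q}\<close> of the column \<open>i \<in> {1..m}\<close>. Values outside these ranges are never used.
\<close>

type_synonym tuple = "nat \<Rightarrow> nat \<Rightarrow> real"

definition perm_tuple :: "(nat \<Rightarrow> nat) \<Rightarrow> tuple \<Rightarrow> tuple" where
  "perm_tuple \<sigma> w = (\<lambda>i. w (inv_into UNIV \<sigma> i))"

definition preceq :: "nat \<Rightarrow> (nat \<Rightarrow> real) \<Rightarrow> (nat \<Rightarrow> real) \<Rightarrow> bool" where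
  "preceq q a b \<longleftrightarrow> (\<forall>l\<in>{1..q}. a l \<le> b l)"

definition prec :: "nat \<Rightarrow> (nat \<Rightarrow> real) \<Rightarrow> (nat \<Rightarrow> real) \<Rightarrow> bool" where
  "prec q a b \<longleftrightarrow> (\<forall>l\<in>{1..q}. a l < b l)"

definition H_tau :: "nat \<Rightarrow> (nat \<Rightarrow> nat) set" where
  "H_tau m = generate (sym_group m) {transpose 1 4, transpose 2 3}"

definition x_part :: "tuple \<Rightarrow> tuple" where
  "x_part z = z"

definition y_part :: "nat \<Rightarrow> tuple \<Rightarrow> tuple" where
  "y_part r z = (\<lambda>i l. z i (r + l))"

text \<open>
  The indicator functions take the dimension \<open>q\<close> as first argument, so that \<open>x_part z\<close>, used with
  dimension \<open>r\<close>, is the tuple of the first \<open>r\<close> coordinates of the columns of \<open>z\<close>.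
\<close>

definition kernel :: "nat \<Rightarrow> nat \<Rightarrow> nat \<Rightarrow> real \<Rightarrow> (nat \<Rightarrow> tuple \<Rightarrow> real) \<Rightarrow> (nat \<Rightarrow> tuple \<Rightarrow> real)
    \<Rightarrow> tuple \<Rightarrow> real" where
  "kernel r s m c IX IY z =
     c * (\<Sum>\<sigma>\<in>H_tau m. of_int (sign \<sigma>) * IX r (perm_tuple \<sigma> (x_part z)))
       * (\<Sum>\<sigma>\<in>H_tau m. of_int (sign \<sigma>) * IY s (perm_tuple \<sigma> (y_part r z)))"

definition symmetrize :: "nat \<Rightarrow> (tuple \<Rightarrow> real) \<Rightarrow> tuple \<Rightarrow> real" where
  "symmetrize m k z = 1 / fact m * (\<Sum>\<sigma> | \<sigma> permutes {1..m}. k (perm_tuple \<sigma> z))"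

definition U_stat :: "nat \<Rightarrow> (tuple \<Rightarrow> real) \<Rightarrow> nat \<Rightarrow> tuple \<Rightarrow> real" where
  "U_stat m \<kappa> n z =
     1 / real (n choose m) *
       (\<Sum>i\<in>{i \<in> {1..m} \<rightarrow>\<^sub>E {1..n}. strict_mono_on {1..m} i}. \<kappa> (\<lambda>j. z (i j)))"

definition I_D :: "nat \<Rightarrow> tuple \<Rightarrow> real" where
  "I_D q w = of_bool (preceq q (w 1) (w 5) \<and> preceq q (w 2) (w 5))
           * of_bool (\<not> preceq q (w 3) (w 5) \<and> \<not> preceq q (w 4) (w 5))"

text \<open>
  The reference point of the following indicator takes its coordinate \<open>l\<close> from column \<open>off + l\<close>.
\<close>

definition I_R :: "nat \<Rightarrow> nat \<Rightarrow> tuple \<Rightarrow> real" where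
  "I_R off q w = (let u = (\<lambda>l. w (off + l) l) in
       of_bool (preceq q (w 1) u \<and> preceq q (w 2) u)
     * of_bool (\<not> preceq q (w 3) u \<and> \<not> preceq q (w 4) u))"

definition I_P :: "nat \<Rightarrow> tuple \<Rightarrow> real" where
  "I_P q w = of_bool (\<not> preceq q (w 3) (w 1) \<and> \<not> preceq q (w 3) (w 2)
                    \<and> \<not> preceq q (w 4) (w 1) \<and> \<not> preceq q (w 4) (w 2))"

definition I_J :: "nat \<Rightarrow> tuple \<Rightarrow> real" where
  "I_J q w = of_bool (prec q (w 1) (w 3) \<and> prec q (w 1) (w 4)
                    \<and> prec q (w 2) (w 3) \<and> prec q (w 2) (w 4))"

definition U_D :: "nat \<Rightarrow> nat \<Rightarrow> nat \<Rightarrow> tuple \<Rightarrow> real" where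
  "U_D r s = U_stat 5 (symmetrize 5 (kernel r s 5 (1/4) I_D I_D))"

definition U_R :: "nat \<Rightarrow> nat \<Rightarrow> nat \<Rightarrow> tuple \<Rightarrow> real" where
  "U_R r s = (let m = 4 + (r + s) in
     U_stat m (symmetrize m (kernel r s m (1/4) (I_R 4) (I_R (4 + r)))))"

definition U_tau_P :: "nat \<Rightarrow> nat \<Rightarrow> nat \<Rightarrow> tuple \<Rightarrow> real" where
  "U_tau_P r s = U_stat 4 (symmetrize 4 (kernel r s 4 1 I_P I_P))"

definition U_tau_J :: "nat \<Rightarrow> nat \<Rightarrow> nat \<Rightarrow> tuple \<Rightarrow> real" where
  "U_tau_J r s = U_stat 4 (symmetrize 4 (kernel r s 4 1 I_J I_J))"


section \<open>Unit-cost algorithms\<close>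

text \<open>
  Algorithms are programs of a structured random access machine over the reals. A program uses
  finitely many arrays of natural numbers and finitely many arrays of reals, both named by
  numerals; a scalar variable is a cell of an array. Array indices are natural numbers, and all
  cells not holding input are initially 0. Every constant, array access, arithmetic operation,
  comparison, Boolean connective, assignment and branch costs one unit.

  There are no real constants and no rounding of reals to integers, so that neither precomputed
  information nor unbounded data can be packed into a real number and unpacked again. For the same
  reason integers live in machine words: a program only runs as long as all its integer constants,
  sums and products are at most a word bound \<open>B\<close>, which will be polynomial in the sample size.
  (Differences, quotients and remainders of natural numbers cannot grow.) Subtraction of natural
  numbers is truncated and division by 0 yields 0, as usual in HOL.
\<close>

datatype iexp =
    IConst nat
  | IArr nat iexp
  | IAdd iexp iexp
  | ISub iexp iexp
  | IMul iexp iexp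
  | IDiv iexp iexp
  | IMod iexp iexp

datatype rexp =
    RArr nat iexp
  | ROfNat iexp
  | RAdd rexp rexp
  | RSub rexp rexp
  | RMul rexp rexp
  | RDiv rexp rexp

datatype bexp =
    ILess iexp iexp
  | RLess rexp rexp
  | BNot bexp
  | BAnd bexp bexp

datatype prog =
    Skip
  | IAssign nat iexp iexp
  | RAssign nat iexp rexp
  | Seq prog prog
  | If bexp prog prog
  | While bexp prog

record store =
  imem :: "nat \<Rightarrow> nat \<Rightarrow> nat"
  rmem :: "nat \<Rightarrow> nat \<Rightarrow> real"

primrec ival :: "store \<Rightarrow> iexp \<Rightarrow> nat" where
  "ival S (IConst k) = k"
| "ival S (IArr a e) = imem S a (ival S e)"
| "ival S (IAdd e f) = ival S e + ival S f"
| "ival S (ISub e f) = ival S e - ival S f"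
| "ival S (IMul e f) = ival S e * ival S f"
| "ival S (IDiv e f) = ival S e div ival S f"
| "ival S (IMod e f) = ival S e mod ival S f"

primrec rval :: "store \<Rightarrow> rexp \<Rightarrow> real" where
  "rval S (RArr a e) = rmem S a (ival S e)"
| "rval S (ROfNat e) = real (ival S e)"
| "rval S (RAdd e f) = rval S e + rval S f"
| "rval S (RSub e f) = rval S e - rval S f"
| "rval S (RMul e f) = rval S e * rval S f"
| "rval S (RDiv e f) = rval S e / rval S f"

primrec bval :: "store \<Rightarrow> bexp \<Rightarrow> bool" where
  "bval S (ILess e f) = (ival S e < ival S f)"
| "bval S (RLess e f) = (rval S e < rval S f)"
| "bval S (BNot b) = (\<not> bval S b)"
| "bval S (BAnd b c) = (bval S b \<and> bval S c)"

primrec icost :: "iexp \<Rightarrow> nat" where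
  "icost (IConst k) = 1"
| "icost (IArr a e) = 1 + icost e"
| "icost (IAdd e f) = 1 + icost e + icost f"
| "icost (ISub e f) = 1 + icost e + icost f"
| "icost (IMul e f) = 1 + icost e + icost f"
| "icost (IDiv e f) = 1 + icost e + icost f"
| "icost (IMod e f) = 1 + icost e + icost f"

primrec rcost :: "rexp \<Rightarrow> nat" where
  "rcost (RArr a e) = 1 + icost e"
| "rcost (ROfNat e) = 1 + icost e"
| "rcost (RAdd e f) = 1 + rcost e + rcost f"
| "rcost (RSub e f) = 1 + rcost e + rcost f"
| "rcost (RMul e f) = 1 + rcost e + rcost f"
| "rcost (RDiv e f) = 1 + rcost e + rcost f"

primrec bcost :: "bexp \<Rightarrow> nat" where
  "bcost (ILess e f) = 1 + icost e + icost f"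
| "bcost (RLess e f) = 1 + rcost e + rcost f"
| "bcost (BNot b) = 1 + bcost b"
| "bcost (BAnd b c) = 1 + bcost b + bcost c"

primrec isafe :: "nat \<Rightarrow> store \<Rightarrow> iexp \<Rightarrow> bool" where
  "isafe B S (IConst k) = (k \<le> B)"
| "isafe B S (IArr a e) = isafe B S e"
| "isafe B S (IAdd e f) = (isafe B S e \<and> isafe B S f \<and> ival S e + ival S f \<le> B)"
| "isafe B S (ISub e f) = (isafe B S e \<and> isafe B S f)"
| "isafe B S (IMul e f) = (isafe B S e \<and> isafe B S f \<and> ival S e * ival S f \<le> B)"
| "isafe B S (IDiv e f) = (isafe B S e \<and> isafe B S f)"
| "isafe B S (IMod e f) = (isafe B S e \<and> isafe B S f)"

primrec rsafe :: "nat \<Rightarrow> store \<Rightarrow> rexp \<Rightarrow> bool" where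
  "rsafe B S (RArr a e) = isafe B S e"
| "rsafe B S (ROfNat e) = isafe B S e"
| "rsafe B S (RAdd e f) = (rsafe B S e \<and> rsafe B S f)"
| "rsafe B S (RSub e f) = (rsafe B S e \<and> rsafe B S f)"
| "rsafe B S (RMul e f) = (rsafe B S e \<and> rsafe B S f)"
| "rsafe B S (RDiv e f) = (rsafe B S e \<and> rsafe B S f)"

primrec bsafe :: "nat \<Rightarrow> store \<Rightarrow> bexp \<Rightarrow> bool" where
  "bsafe B S (ILess e f) = (isafe B S e \<and> isafe B S f)"
| "bsafe B S (RLess e f) = (rsafe B S e \<and> rsafe B S f)"
| "bsafe B S (BNot b) = bsafe B S b"
| "bsafe B S (BAnd b c) = (bsafe B S b \<and> bsafe B S c)"

definition iupd :: "nat \<Rightarrow> nat \<Rightarrow> nat \<Rightarrow> store \<Rightarrow> store" where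
  "iupd a j v S = S\<lparr>imem := (imem S)(a := (imem S a)(j := v))\<rparr>"

definition rupd :: "nat \<Rightarrow> nat \<Rightarrow> real \<Rightarrow> store \<Rightarrow> store" where
  "rupd a j v S = S\<lparr>rmem := (rmem S)(a := (rmem S a)(j := v))\<rparr>"

text \<open>
  \<open>exec B p S t S'\<close>: with word bound \<open>B\<close>, started in store \<open>S\<close>, the program \<open>p\<close> terminates in
  store \<open>S'\<close> after exactly \<open>t\<close> unit-cost operations.
\<close>

inductive exec :: "nat \<Rightarrow> prog \<Rightarrow> store \<Rightarrow> nat \<Rightarrow> store \<Rightarrow> bool" for B where
  Skip: "exec B Skip S 1 S"
| IAssign: "isafe B S e \<Longrightarrow> isafe B S f \<Longrightarrow>
    exec B (IAssign a e f) S (1 + icost e + icost f) (iupd a (ival S e) (ival S f) S)"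
| RAssign: "isafe B S e \<Longrightarrow> rsafe B S f \<Longrightarrow>
    exec B (RAssign a e f) S (1 + icost e + rcost f) (rupd a (ival S e) (rval S f) S)"
| Seq: "exec B p S t S' \<Longrightarrow> exec B q S' t' S'' \<Longrightarrow> exec B (Seq p q) S (t + t') S''"
| IfTrue: "bsafe B S b \<Longrightarrow> bval S b \<Longrightarrow> exec B p S t S' \<Longrightarrow>
    exec B (If b p q) S (1 + bcost b + t) S'"
| IfFalse: "bsafe B S b \<Longrightarrow> \<not> bval S b \<Longrightarrow> exec B q S t S' \<Longrightarrow>
    exec B (If b p q) S (1 + bcost b + t) S'"
| WhileFalse: "bsafe B S b \<Longrightarrow> \<not> bval S b \<Longrightarrow> exec B (While b p) S (1 + bcost b) S"
| WhileTrue: "bsafe B S b \<Longrightarrow> bval S b \<Longrightarrow> exec B p S t S' \<Longrightarrow> exec B (While b p) S' t' S'' \<Longrightarrow>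
    exec B (While b p) S (1 + bcost b + t + t') S''"

inductive_cases exec_SkipE: "exec B Skip S t S'"
inductive_cases exec_IAssignE: "exec B (IAssign a e f) S t S'"
inductive_cases exec_RAssignE: "exec B (RAssign a e f) S t S'"
inductive_cases exec_SeqE: "exec B (Seq p q) S t S'"
inductive_cases exec_IfE: "exec B (If b p q) S t S'"
inductive_cases exec_WhileE: "exec B (While b p) S t S'"

lemma exec_deterministic:
  "exec B p S t S' \<Longrightarrow> exec B p S u S'' \<Longrightarrow> u = t \<and> S'' = S'"
proof (induction arbitrary: u S'' rule: exec.induct)
  case (Skip S)
  then show ?case by (auto elim: exec_SkipE)
next
  case (IAssign S e f a)
  from IAssign(3) show ?case by (rule exec_IAssignE) auto
next
  case (RAssign S e f a)
  from RAssign(3) show ?case by (rule exec_RAssignE) auto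
next
  case (Seq p S t S' q t' S'')
  from Seq(5) show ?case by (rule exec_SeqE) (auto dest!: Seq.IH)
next
  case (IfTrue S b p t S' q)
  from IfTrue(5) show ?case by (rule exec_IfE) (use IfTrue.hyps(2) in \<open>auto dest!: IfTrue.IH\<close>)
next
  case (IfFalse S b q t S' p)
  from IfFalse(5) show ?case by (rule exec_IfE) (use IfFalse.hyps(2) in \<open>auto dest!: IfFalse.IH\<close>)
next
  case (WhileFalse S b p)
  from WhileFalse(3) show ?case by (rule exec_WhileE) (use WhileFalse.hyps(2) in auto)
next
  case (WhileTrue S b p t S' t' S'')
  from WhileTrue(7) show ?case
    by (rule exec_WhileE) (use WhileTrue.hyps(2) in \<open>auto dest!: WhileTrue.IH\<close>)
qed

text \<open>
  Input: \<open>n\<close> is in cell 0 of integer array 0, and the \<open>n * d\<close> coordinates of the sample are stored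
  point by point from cell 0 of real array 0 on. The result is returned in cell 0 of real array 1.
\<close>

definition input_store :: "nat \<Rightarrow> nat \<Rightarrow> tuple \<Rightarrow> store" where
  "input_store d n z =
     \<lparr> imem = (\<lambda>a j. if a = 0 \<and> j = 0 then n else 0),
       rmem = (\<lambda>a j. if a = 0 \<and> j < n * d then z (j div d + 1) (j mod d + 1) else 0) \<rparr>"

definition output_of :: "store \<Rightarrow> real" where
  "output_of S = rmem S 1 0"

text \<open>
  One program works for all sample sizes \<open>n \<ge> m\<close>, where the statistic of order \<open>m\<close> is defined.
  \<open>T n\<close> bounds its running time on all samples of size \<open>n\<close>.
\<close>

definition computable_in_time ::
    "nat \<Rightarrow> nat \<Rightarrow> (nat \<Rightarrow> tuple \<Rightarrow> real) \<Rightarrow> (nat \<Rightarrow> real) \<Rightarrow> bool" where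
  "computable_in_time d m U g \<longleftrightarrow>
     (\<exists>p w T. T \<in> O(g) \<and>
        (\<forall>n\<ge>m. \<forall>z. \<exists>t S. exec (n ^ w) p (input_store d n z) t S \<and>
           output_of S = U n z \<and> real t \<le> T n))"

end

theory Submission
  imports Defs
begin

text \<open>
  All four statistics reduce to counting dominated points. The alternating sum over \<open>H_tau\<close> of an
  indicator of the first two kinds is a product of differences of the indicators \<open>w\<^sup>i \<preceq> u\<close>, so for a
  fixed reference point \<open>u\<close> the sum over the columns 1 to 4 is a polynomial in the numbers of points
  dominated by \<open>u\<close> in the \<open>x\<close>, the \<open>y\<close> and all coordinates. For \<open>U_D\<close> there are \<open>n\<close> reference points, and
  the counts come from sorting the last coordinate and sweeping along it with a range tree for the
  others; for \<open>U_R\<close> there are \<open>n ^ d\<close> of them, and the counts are prefix sums over the grid of ranks.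

  For the sign covariances both factors are built from a binary relation between columns. Antisymmetry
  leaves one term of the first alternating sum, and the sum over pairwise distinct columns differs
  from the sum over all columns by a term in quadratic time. In the latter sum, each pair of columns is a
  point with \<open>2 * d\<close> coordinates, such that the relations between the pairs (2, 3) and (1, 4) mean
  dominance. Counting dominance among these \<open>n\<^sup>2\<close> points gives the bound.
\<close>

section \<open>Reasoning about programs\<close>

text \<open>The exponent of the logarithm is one less than the dimension because the sweep removes
  one coordinate: insertions and queries only concern the \<open>D - 1\<close> others, and each of
  them visits \<open>L ^ (D - 1)\<close> cells of a tree of depth \<open>L\<close>, one for every
  choice of a height per coordinate. For pairs of columns the dimension is \<open>2 * d\<close>, and
  passing from \<open>n\<close> to \<open>2 * (n * n)\<close> points changes the logarithm by a
  constant factor only.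

  Ties in the data are allowed, so points enter the trees and grids through ranks that reproduce
  \<open>\<le>\<close> exactly, equal values included.

  Two resources besides time shape the programs. The tree is addressed as a box with side
  \<open>2 ^ Suc L\<close>, in general far more cells than there are steps; this is compatible with
  the time bound because cells start at 0 and no pass ever runs over the whole box. And every
  address, counter and code has to fit into a word: for fixed \<open>d\<close> they are polynomial
  in \<open>n\<close>, and the side conditions on \<open>B\<close> are the polynomials that occur.
  Counts, in contrast, are kept as reals wherever they enter the final polynomial, which therefore
  needs no word bound.\<close>

definition run :: "nat \<Rightarrow> prog \<Rightarrow> store \<Rightarrow> nat \<Rightarrow> (store \<Rightarrow> bool) \<Rightarrow> bool" where
  "run B p S T Q \<longleftrightarrow> (\<exists>t S'. exec B p S t S' \<and> t \<le> T \<and> Q S')"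

lemma run_mono:
  assumes "run B p S T Q" "T \<le> T'" "\<And>S'. Q S' \<Longrightarrow> Q' S'"
  shows "run B p S T' Q'"
  using assms unfolding run_def by (meson le_trans)

lemma run_Seq:
  assumes "run B p S T R" "\<And>S'. R S' \<Longrightarrow> run B q S' T' Q"
  shows "run B (Seq p q) S (T + T') Q"
proof -
  obtain t S' where 1: "exec B p S t S'" "t \<le> T" "R S'"
    using assms(1) by (auto simp: run_def)
  obtain t' S'' where 2: "exec B q S' t' S''" "t' \<le> T'" "Q S''"
    using assms(2)[OF 1(3)] by (auto simp: run_def)
  have "exec B (Seq p q) S (t + t') S''"
    using 1 2 by (intro exec.Seq)
  moreover have "t + t' \<le> T + T'"
    using 1 2 by simp
  ultimately show ?thesis
    using 2 unfolding run_def by blast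
qed

section \<open>Loop-free programs\<close>

primrec effect :: "prog \<Rightarrow> store \<Rightarrow> store" where
  "effect Skip S = S"
| "effect (IAssign a e f) S = iupd a (ival S e) (ival S f) S"
| "effect (RAssign a e f) S = rupd a (ival S e) (rval S f) S"
| "effect (Seq p q) S = effect q (effect p S)"
| "effect (If b p q) S = (if bval S b then effect p S else effect q S)"
| "effect (While b p) S = S"

text \<open>Loops are unsafe by definition. So \<open>effect\<close> is exact on every safe program,
  and correctness and word bounds of loop-free code become matters of simplification.\<close>

primrec psafe :: "nat \<Rightarrow> prog \<Rightarrow> store \<Rightarrow> bool" where
  "psafe B Skip S = True"
| "psafe B (IAssign a e f) S = (isafe B S e \<and> isafe B S f)"
| "psafe B (RAssign a e f) S = (isafe B S e \<and> rsafe B S f)"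
| "psafe B (Seq p q) S = (psafe B p S \<and> psafe B q (effect p S))"
| "psafe B (If b p q) S = (bsafe B S b \<and> (if bval S b then psafe B p S else psafe B q S))"
| "psafe B (While b p) S = False"

text \<open>Both branches of a conditional are charged: the bound then does not depend on the store
  and can serve as a constant cost per round of a loop.\<close>

primrec pcost :: "prog \<Rightarrow> nat" where
  "pcost Skip = 1"
| "pcost (IAssign a e f) = 1 + icost e + icost f"
| "pcost (RAssign a e f) = 1 + icost e + rcost f"
| "pcost (Seq p q) = pcost p + pcost q"
| "pcost (If b p q) = 1 + bcost b + pcost p + pcost q"
| "pcost (While b p) = 0"

lemma exec_straight: "psafe B p S \<Longrightarrow> \<exists>t\<le>pcost p. exec B p S t (effect p S)"
proof (induction p arbitrary: S)
  case (Seq p q)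
  obtain t t' where "t \<le> pcost p" "exec B p S t (effect p S)" "t' \<le> pcost q"
      "exec B q (effect p S) t' (effect q (effect p S))"
    using Seq.IH(1)[of S] Seq.IH(2)[of "effect p S"] Seq.prems by auto
  then show ?case
    by (intro exI[of _ "t + t'"]) (auto intro: exec.Seq)
next
  case (If b p q)
  show ?case
  proof (cases "bval S b")
    case True
    then obtain t where "t \<le> pcost p" "exec B p S t (effect p S)"
      using If.IH(1)[of S] If.prems by auto
    then show ?thesis
      using True If.prems exec.IfTrue[of B S b p t "effect p S" q]
      by (intro exI[of _ "1 + bcost b + t"]) auto
  next
    case False
    then obtain t where "t \<le> pcost q" "exec B q S t (effect q S)"
      using If.IH(2)[of S] If.prems by auto
    then show ?thesis
      using False If.prems exec.IfFalse[of B S b q t "effect q S" p]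
      by (intro exI[of _ "1 + bcost b + t"]) auto
  qed
next
  case Skip
  show ?case
    using exec.Skip[of B S] by auto
next
  case (IAssign a e f)
  then show ?case
    using exec.IAssign[of B S e f a] by auto
next
  case (RAssign a e f)
  then show ?case
    using exec.RAssign[of B S e f a] by auto
qed auto

lemma run_straight:
  assumes "psafe B p S" "pcost p \<le> T" "Q (effect p S)"
  shows "run B p S T Q"
  using exec_straight[OF assms(1)] assms(2,3) unfolding run_def by (meson le_trans)

lemma run_If:
  assumes "bsafe B S b" "bval S b \<Longrightarrow> run B p S T Q" "\<not> bval S b \<Longrightarrow> run B q S T Q"
  shows "run B (If b p q) S (1 + bcost b + T) Q"
proof (cases "bval S b")
  case True
  then obtain t S' where t: "exec B p S t S'" "t \<le> T" "Q S'"
    using assms by (auto simp: run_def)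
  have "exec B (If b p q) S (1 + bcost b + t) S'"
    using assms True t by (intro exec.IfTrue)
  then show ?thesis
    using t unfolding run_def by (meson add_left_mono)
next
  case False
  then obtain t S' where t: "exec B q S t S'" "t \<le> T" "Q S'"
    using assms by (auto simp: run_def)
  have "exec B (If b p q) S (1 + bcost b + t) S'"
    using assms False t by (intro exec.IfFalse)
  then show ?thesis
    using t unfolding run_def by (meson add_left_mono)
qed

abbreviation seq_infix :: "prog \<Rightarrow> prog \<Rightarrow> prog" (infixl ";;" 55) where
  "p ;; q \<equiv> Seq p q"

lemma imem_iupd [simp]: "imem (iupd a j v S) = (imem S)(a := (imem S a)(j := v))"
  and rmem_iupd [simp]: "rmem (iupd a j v S) = rmem S"
  and imem_rupd [simp]: "imem (rupd a j x S) = imem S"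
  and rmem_rupd [simp]: "rmem (rupd a j x S) = (rmem S)(a := (rmem S a)(j := x))"
  by (simp_all add: iupd_def rupd_def)

abbreviation Var :: "nat \<Rightarrow> iexp" where
  "Var a \<equiv> IArr a (IConst 0)"

abbreviation RVar :: "nat \<Rightarrow> rexp" where
  "RVar a \<equiv> RArr a (IConst 0)"

abbreviation ISet :: "nat \<Rightarrow> iexp \<Rightarrow> prog" where
  "ISet a e \<equiv> IAssign a (IConst 0) e"

abbreviation RSet :: "nat \<Rightarrow> rexp \<Rightarrow> prog" where
  "RSet a e \<equiv> RAssign a (IConst 0) e"

section \<open>Counting loops\<close>

definition For :: "nat \<Rightarrow> nat \<Rightarrow> prog \<Rightarrow> prog" where
  "For c m p = Seq (ISet c (IConst 0))
     (While (ILess (Var c) (Var m)) (Seq p (ISet c (IAdd (Var c) (IConst 1)))))"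

text \<open>A round costs 12 units beyond the body, 6 for the test and 6 for the increment; the
  final 9 are 3 for the initial assignment and 6 for the failing test. The bound is read from
  \<open>m\<close> in every round, so the invariant has to fix its value, and it has to be
  insensitive to the counter, which changes after the body.\<close>

lemma run_For:
  fixes P :: "nat \<Rightarrow> store \<Rightarrow> bool"
  assumes "P 0 S" and B: "N < B"
    and counter: "\<And>i S v. P i S \<Longrightarrow> P i (iupd c 0 v S)"
    and bound: "\<And>i S. P i S \<Longrightarrow> imem S m 0 = N"
    and step: "\<And>i S. i < N \<Longrightarrow> P i S \<Longrightarrow> imem S c 0 = i \<Longrightarrow>
      run B p S T (\<lambda>S'. P (Suc i) S' \<and> imem S' c 0 = i)"
    and post: "\<And>S. P N S \<Longrightarrow> imem S c 0 = N \<Longrightarrow> Q S"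
  shows "run B (For c m p) S (N * (T + 12) + 9) Q"
proof -
  let ?b = "ILess (Var c) (Var m)"
  let ?w = "While ?b (Seq p (ISet c (IAdd (Var c) (IConst 1))))"
  have loop: "run B ?w S (k * (T + 12) + 6) Q"
    if "P i S" "imem S c 0 = i" "i + k = N" for i k S
    using that
  proof (induction k arbitrary: i S)
    case 0
    have "exec B ?w S (1 + bcost ?b) S"
      using 0 bound[OF 0(1)] by (intro exec.WhileFalse) auto
    then show ?case
      using 0 post[of S] unfolding run_def by (intro exI[of _ "1 + bcost ?b"] exI[of _ S]) auto
  next
    case (Suc k)
    have "i < N"
      using Suc.prems by simp
    have m: "imem S m 0 = N"
      using bound Suc.prems by blast
    obtain t S1 where 1: "exec B p S t S1" "t \<le> T" "P (Suc i) S1" "imem S1 c 0 = i"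
      using step[OF \<open>i < N\<close> Suc.prems(1,2)] by (auto simp: run_def)
    let ?S2 = "iupd c 0 (Suc i) S1"
    have "exec B (ISet c (IAdd (Var c) (IConst 1))) S1
        (1 + icost (IConst 0) + icost (IAdd (Var c) (IConst 1)))
        (iupd c (ival S1 (IConst 0)) (ival S1 (IAdd (Var c) (IConst 1))) S1)"
      using B \<open>i < N\<close> 1 by (intro exec.IAssign) auto
    then have 2: "exec B (ISet c (IAdd (Var c) (IConst 1))) S1 6 ?S2"
      using 1 by (simp add: eval_nat_numeral)
    obtain t' S' where 3: "exec B ?w ?S2 t' S'" "t' \<le> k * (T + 12) + 6" "Q S'"
      using Suc.IH[of "Suc i" ?S2] counter[OF 1(3)] Suc.prems by (auto simp: run_def)
    have "exec B ?w S (1 + bcost ?b + (t + 6) + t') S'"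
      using \<open>i < N\<close> Suc.prems m 1 2 3 B by (intro exec.WhileTrue[where S' = ?S2] exec.Seq) auto
    then show ?case
      using 1 3 unfolding run_def
      by (intro exI[of _ "1 + bcost ?b + (t + 6) + t'"] exI[of _ S']) auto
  qed
  have "run B (ISet c (IConst 0)) S 3 (\<lambda>S'. S' = iupd c 0 0 S)"
    by (rule run_straight) auto
  then have "run B (For c m p) S (3 + (N * (T + 12) + 6)) Q"
    unfolding For_def
    by (rule run_Seq) (use loop[of 0 "iupd c 0 0 S" N] counter[OF assms(1)] in auto)
  then show ?thesis
    by (rule run_mono) auto
qed

text \<open>The frame condition of all specifications: \<open>X\<close> and \<open>Y\<close> list
  the integer and the real arrays that may have changed. Whole arrays are fine enough a unit, as
  scalars are arrays too.\<close>

definition same :: "nat set \<Rightarrow> nat set \<Rightarrow> store \<Rightarrow> store \<Rightarrow> bool" where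
  "same X Y S S' \<longleftrightarrow> (\<forall>a. a \<notin> X \<longrightarrow> imem S' a = imem S a) \<and> (\<forall>a. a \<notin> Y \<longrightarrow> rmem S' a = rmem S a)"

lemma same_refl [simp]: "same X Y S S"
  by (simp add: same_def)

lemma same_trans: "same X Y S S' \<Longrightarrow> same X' Y' S' S'' \<Longrightarrow> X' \<subseteq> X \<Longrightarrow> Y' \<subseteq> Y \<Longrightarrow> same X Y S S''"
  unfolding same_def by (metis subsetD)

lemma same_mono: "same X Y S S' \<Longrightarrow> X \<subseteq> X' \<Longrightarrow> Y \<subseteq> Y' \<Longrightarrow> same X' Y' S S'"
  unfolding same_def by blast

lemma same_iupd [simp]: "a \<in> X \<Longrightarrow> same X Y S (iupd a j v S') = same X Y S S'"
  unfolding same_def by auto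

lemma same_rupd [simp]: "a \<in> Y \<Longrightarrow> same X Y S (rupd a j v S') = same X Y S S'"
  unfolding same_def by auto

lemma same_imem: "same X Y S S' \<Longrightarrow> a \<notin> X \<Longrightarrow> imem S' a = imem S a"
  and same_rmem: "same X Y S S' \<Longrightarrow> a \<notin> Y \<Longrightarrow> rmem S' a = rmem S a"
  unfolding same_def by auto

section \<open>Sums and products of a fixed number of expressions\<close>

primrec seqs :: "prog list \<Rightarrow> prog" where
  "seqs [] = Skip"
| "seqs (p # ps) = Seq p (seqs ps)"

primrec isum :: "(nat \<Rightarrow> iexp) \<Rightarrow> nat \<Rightarrow> iexp" where
  "isum f 0 = IConst 0"
| "isum f (Suc k) = IAdd (isum f k) (f k)"

primrec iprod :: "(nat \<Rightarrow> iexp) \<Rightarrow> nat \<Rightarrow> iexp" where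
  "iprod f 0 = IConst 1"
| "iprod f (Suc k) = IMul (iprod f k) (f k)"

lemma ival_isum [simp]: "ival S (isum f k) = (\<Sum>j<k. ival S (f j))"
  by (induction k) auto

lemma ival_iprod [simp]: "ival S (iprod f k) = (\<Prod>j<k. ival S (f j))"
  by (induction k) auto

lemma isafe_isum: "(\<And>j. j < k \<Longrightarrow> isafe B S (f j)) \<Longrightarrow> (\<Sum>j<k. ival S (f j)) \<le> B \<Longrightarrow> isafe B S (isum f k)"
  by (induction k) auto

text \<open>All partial products have to be bounded, because a later factor 0 can hide a large one.
  For sums this cannot happen.\<close>

lemma isafe_iprod:
  "(\<And>j. j < k \<Longrightarrow> isafe B S (f j)) \<Longrightarrow> (\<And>j. j \<le> k \<Longrightarrow> (\<Prod>i<j. ival S (f i)) \<le> B) \<Longrightarrow>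
    isafe B S (iprod f k)"
proof (induction k)
  case 0
  then show ?case
    using "0.prems"(2)[of 0] by simp
next
  case (Suc k)
  then have "isafe B S (iprod f k)"
    by simp
  then show ?case
    using Suc.prems(1)[of k] Suc.prems(2)[of "Suc k"] by simp
qed

lemma isafe_iprod_pow:
  assumes "\<And>j. j < k \<Longrightarrow> isafe B S (f j)" "\<And>j. j < k \<Longrightarrow> ival S (f j) \<le> b" "b \<ge> 1" "b ^ k \<le> B"
  shows "isafe B S (iprod f k)"
proof (rule isafe_iprod)
  fix j assume "j \<le> k"
  have "(\<Prod>i<j. ival S (f i)) \<le> (\<Prod>i<j. b)"
    using assms \<open>j \<le> k\<close> by (intro prod_mono) auto
  also have "\<dots> \<le> b ^ k"
    using assms(3) \<open>j \<le> k\<close> by (simp add: power_increasing)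
  finally show "(\<Prod>i<j. ival S (f i)) \<le> B"
    using assms by simp
qed (use assms in auto)

section \<open>Digits and dyadic decompositions\<close>

definition digit :: "nat \<Rightarrow> nat \<Rightarrow> nat \<Rightarrow> nat" where
  "digit b i k = i div b ^ k mod b"

definition encode :: "nat \<Rightarrow> nat \<Rightarrow> (nat \<Rightarrow> nat) \<Rightarrow> nat" where
  "encode b e f = (\<Sum>k<e. f k * b ^ k)"

lemma digit_less: "b > 0 \<Longrightarrow> digit b i k < b"
  by (simp add: digit_def)

lemma encode_less:
  assumes "\<And>k. k < e \<Longrightarrow> f k < b"
  shows "encode b e f < b ^ e"
  using assms
proof (induction e)
  case (Suc e)
  have "encode b (Suc e) f = encode b e f + f e * b ^ e"
    by (simp add: encode_def)
  also have "\<dots> < b ^ e + f e * b ^ e"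
    using Suc by simp
  also have "\<dots> = (1 + f e) * b ^ e"
    by (simp add: algebra_simps)
  also have "\<dots> \<le> b * b ^ e"
    using Suc.prems[of e] by (intro mult_right_mono) auto
  finally show ?case
    by simp
qed (simp add: encode_def)

lemma digit_encode:
  assumes "\<And>k. k < e \<Longrightarrow> f k < b" "k < e"
  shows "digit b (encode b e f) k = f k"
  using assms
proof (induction e)
  case (Suc e)
  have b: "b > 0"
    using Suc.prems by (metis gr_zeroI less_zeroE)
  have lt: "encode b e f < b ^ e"
    using Suc.prems(1) by (intro encode_less) auto
  have eq: "encode b (Suc e) f = encode b e f + f e * b ^ e"
    by (simp add: encode_def)
  show ?case
  proof (cases "k = e")
    case True
    then show ?thesis
      using lt b Suc.prems(1)[of e] by (simp add: eq digit_def)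
  next
    case False
    then have k: "k < e" and "digit b (encode b e f) k = f k"
      using Suc by auto
    moreover have "b ^ e = b ^ k * (b * b ^ (e - k - 1))"
      using k by (simp flip: power_Suc power_add)
    then have "(encode b e f + f e * b ^ e) div b ^ k
        = encode b e f div b ^ k + b * (f e * b ^ (e - k - 1))"
      using b div_mult_self2[of "b ^ k" "encode b e f" "b * (f e * b ^ (e - k - 1))"]
      by (simp add: ac_simps)
    then have "digit b (encode b (Suc e) f) k = digit b (encode b e f) k"
      by (simp add: eq digit_def)
    ultimately show ?thesis
      by simp
  qed
qed simp

lemma encode_inj:
  assumes "\<And>k. k < e \<Longrightarrow> f k < b" "\<And>k. k < e \<Longrightarrow> g k < b"
  shows "encode b e f = encode b e g \<longleftrightarrow> (\<forall>k<e. f k = g k)"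
proof
  show "\<forall>k<e. f k = g k" if "encode b e f = encode b e g"
    using digit_encode[of e f b] digit_encode[of e g b] assms that by fastforce
qed (simp add: encode_def)

lemma encode_digit: "encode b e (digit b i) = i mod b ^ e"
proof (induction e)
  case (Suc e)
  have "encode b (Suc e) (digit b i) = i mod b ^ e + digit b i e * b ^ e"
    using Suc by (simp add: encode_def)
  also have "\<dots> = i mod b ^ Suc e"
    using mod_mult2_eq[of i "b ^ e" b] by (simp add: digit_def ac_simps)
  finally show ?case .
qed (simp add: encode_def)

lemma bij_betw_encode:
  "bij_betw (encode b e) ({..<e} \<rightarrow>\<^sub>E {..<b}) {..<b ^ e}"
\<comment> \<open>Digits lie below the base only if it is positive. Base 0 gives two empty sets when
  \<open>e > 0\<close>, and there are no digits when \<open>e = 0\<close>.\<close>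
proof (cases "b = 0 \<and> e > 0")
  case True
  then show ?thesis
    by (auto simp: bij_betw_def PiE_eq_empty_iff power_0_left)
next
  case False
  show ?thesis
  proof (rule bij_betw_byWitness[where f' = "\<lambda>i. restrict (digit b i) {..<e}"])
    show "\<forall>f\<in>{..<e} \<rightarrow>\<^sub>E {..<b}. restrict (digit b (encode b e f)) {..<e} = f"
    proof
      fix f assume f: "f \<in> {..<e} \<rightarrow>\<^sub>E {..<b}"
      show "restrict (digit b (encode b e f)) {..<e} = f"
      proof
        fix k
        show "restrict (digit b (encode b e f)) {..<e} k = f k"
          using f digit_encode[of e f b k] by (auto simp: PiE_iff extensional_def)
      qed
    qed
    have "encode b e (restrict (digit b i) {..<e}) = encode b e (digit b i)" for i
      by (simp add: encode_def)
    then show "\<forall>i\<in>{..<b ^ e}. encode b e (restrict (digit b i) {..<e}) = i"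
      by (simp add: encode_digit)
    show "encode b e ` ({..<e} \<rightarrow>\<^sub>E {..<b}) \<subseteq> {..<b ^ e}"
      by (auto intro!: encode_less)
    show "(\<lambda>i. restrict (digit b i) {..<e}) ` {..<b ^ e} \<subseteq> {..<e} \<rightarrow>\<^sub>E {..<b}"
    proof (intro image_subsetI)
      fix i assume "i \<in> {..<b ^ e}"
      show "restrict (digit b i) {..<e} \<in> {..<e} \<rightarrow>\<^sub>E {..<b}"
        using False by (cases "e = 0") (auto simp: digit_less)
    qed
  qed
qed

lemma sum_digits:
  fixes F :: "(nat \<Rightarrow> nat) \<Rightarrow> 'a :: comm_monoid_add"
  shows "(\<Sum>i<b ^ e. F (restrict (digit b i) {..<e})) = (\<Sum>f\<in>{..<e} \<rightarrow>\<^sub>E {..<b}. F f)"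
proof -
  have "(\<Sum>f\<in>{..<e} \<rightarrow>\<^sub>E {..<b}. F f)
      = (\<Sum>f\<in>{..<e} \<rightarrow>\<^sub>E {..<b}. F (restrict (digit b (encode b e f)) {..<e}))"
  proof (rule sum.cong)
    fix f assume f: "f \<in> {..<e} \<rightarrow>\<^sub>E {..<b}"
    have "restrict (digit b (encode b e f)) {..<e} k = f k" for k
      using f digit_encode[of e f b k] by (auto simp: PiE_iff extensional_def)
    then show "F f = F (restrict (digit b (encode b e f)) {..<e})"
      by presburger
  qed simp
  also have "\<dots> = (\<Sum>i<b ^ e. F (restrict (digit b i) {..<e}))"
    by (rule sum.reindex_bij_betw[OF bij_betw_encode])
  finally show ?thesis
    by simp
qed

text \<open>Distributivity, with choice functions coded as numbers. It is the reason why one loop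
  over \<open>b ^ e\<close> codes can act on \<open>e\<close> coordinates independently.\<close>

lemma sum_prod_digits:
  fixes g :: "nat \<Rightarrow> nat \<Rightarrow> 'a :: comm_semiring_1"
  shows "(\<Sum>i<b ^ e. \<Prod>k<e. g k (digit b i k)) = (\<Prod>k<e. \<Sum>t<b. g k t)"
proof -
  have "(\<Sum>i<b ^ e. \<Prod>k<e. g k (digit b i k))
      = (\<Sum>i<b ^ e. (\<lambda>f. \<Prod>k<e. g k (f k)) (restrict (digit b i) {..<e}))"
    by (intro sum.cong prod.cong) auto
  also have "\<dots> = (\<Prod>k<e. \<Sum>t<b. g k t)"
    by (subst sum_digits) (simp add: prod_sum_PiE)
  finally show ?thesis .
qed

text \<open>Read \<open>a\<close> and \<open>b\<close> as leaves of a complete binary tree. Then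
  \<open>a\<close> is to the left of \<open>b\<close> iff it lies below the left sibling of a node
  above \<open>b\<close> that is a right child, and this happens at one height only, just under the
  lowest common ancestor. Removing the last bit of both numbers gives the induction:
  \<open>a < b\<close> iff \<open>a div 2 < b div 2\<close>, or \<open>b\<close> is odd and
  \<open>a = b - 1\<close>.\<close>

lemma dyadic_less:
  fixes a b :: nat
  assumes "2 ^ L \<le> a" "a < 2 ^ Suc L" "2 ^ L \<le> b" "b < 2 ^ Suc L"
  shows "(\<Sum>t<L. of_bool (odd (b div 2 ^ t) \<and> a div 2 ^ t = b div 2 ^ t - 1)) = (of_bool (a < b) :: nat)"
  using assms
proof (induction L arbitrary: a b)
  case (Suc L)
  have "(\<Sum>t<Suc L. of_bool (odd (b div 2 ^ t) \<and> a div 2 ^ t = b div 2 ^ t - 1))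
      = of_bool (odd b \<and> a = b - 1)
      + (\<Sum>t<L. of_bool (odd (b div 2 div 2 ^ t) \<and> a div 2 div 2 ^ t = b div 2 div 2 ^ t - 1) :: nat)"
    by (subst sum.lessThan_Suc_shift) (simp add: div_mult2_eq)
  also have "\<dots> = of_bool (odd b \<and> a = b - 1) + of_bool (a div 2 < b div 2)"
    using Suc.prems by (subst Suc.IH) auto
  also have "\<dots> = of_bool (a < b)"
    by (cases "even a"; cases "even b") (auto elim!: evenE oddE)
  finally show ?case .
qed auto

text \<open>
  Nodes of a complete binary tree are numbered as in a heap, so that the leaves are
  \<open>2 ^ L, \<dots>, 2 ^ Suc L - 1\<close>. The nodes \<open>x div 2 ^ t - 1\<close> with \<open>x div 2 ^ t\<close> odd are the roots of
  the maximal subtrees to the left of the leaf \<open>x\<close>.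
\<close>

lemma dyadic_levels:
  fixes a x :: nat
  assumes "2 ^ L \<le> a" "a < 2 ^ Suc L" "2 ^ L \<le> x" "x < 2 ^ Suc L"
    "t < L" "t' < L" "odd (x div 2 ^ t)" "a div 2 ^ t' = x div 2 ^ t - 1"
  shows "t' = t"
proof -
  have level: "2 ^ (L - u) \<le> y div 2 ^ u" "y div 2 ^ u < 2 ^ Suc (L - u)"
    if "2 ^ L \<le> y" "y < 2 ^ Suc L" "u < L" for u y :: nat
  proof -
    have "(2::nat) ^ L = 2 ^ (L - u) * 2 ^ u" "(2::nat) ^ Suc L = 2 ^ Suc (L - u) * 2 ^ u"
      using that by (simp_all flip: power_add)
    then show "2 ^ (L - u) \<le> y div 2 ^ u" "y div 2 ^ u < 2 ^ Suc (L - u)"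
      using that by (simp_all add: less_eq_div_iff_mult_less_eq div_less_iff_less_mult)
  qed
  \<comment> \<open>The leftmost node of height \<open>t < L\<close> is even. An odd node therefore
    is not leftmost, its predecessor lies on the same level, and the level of a node can be read off
    from its size.\<close>
  have "even ((2::nat) ^ (L - t))"
    using assms(5) by simp
  then have "x div 2 ^ t \<noteq> 2 ^ (L - t)"
    using assms(7) by metis
  then have l: "2 ^ (L - t) \<le> x div 2 ^ t - 1"
    using level(1)[OF assms(3,4,5)] by linarith
  have u: "x div 2 ^ t - 1 < 2 ^ Suc (L - t)"
    using level(2)[OF assms(3,4,5)] by linarith
  have "(2::nat) ^ (L - t') < 2 ^ Suc (L - t)" "(2::nat) ^ (L - t) < 2 ^ Suc (L - t')"
    using level[OF assms(1,2,6)] l u unfolding assms(8) by linarith+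
  then have "L - t' < Suc (L - t)" "L - t < Suc (L - t')"
    by (meson one_less_numeral_iff power_less_imp_less_exp semiring_norm(76) rel_simps)+
  then show ?thesis
    using assms(5,6) by linarith
qed

text \<open>\<open>\<tau>\<close> packs one height per coordinate into digits to base
  \<open>L\<close>. The offset is 0 for insertions and 1 for queries: shifting the query leaf turns
  the weak comparison of ranks into the strict one of \<open>dyadic_less\<close>.\<close>

definition node :: "nat \<Rightarrow> nat \<Rightarrow> (nat \<Rightarrow> nat) \<Rightarrow> nat \<Rightarrow> nat \<Rightarrow> nat" where
  "node L off \<rho> \<tau> k = (2 ^ L + off + \<rho> k) div 2 ^ digit L \<tau> k"

definition upd_addr :: "nat \<Rightarrow> nat \<Rightarrow> (nat \<Rightarrow> nat) \<Rightarrow> nat \<Rightarrow> nat" where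
  "upd_addr L e \<rho> \<tau> = encode (2 ^ Suc L) e (node L 0 \<rho> \<tau>)"

text \<open>Subtracting 1 moves to the left sibling, provided that the node is a right child;
  \<open>qry_valid\<close> tests this for all coordinates at once, as a product of parities.\<close>

definition qry_addr :: "nat \<Rightarrow> nat \<Rightarrow> (nat \<Rightarrow> nat) \<Rightarrow> nat \<Rightarrow> nat" where
  "qry_addr L e \<rho> \<tau> = encode (2 ^ Suc L) e (\<lambda>k. node L 1 \<rho> \<tau> k - 1)"

definition qry_valid :: "nat \<Rightarrow> nat \<Rightarrow> (nat \<Rightarrow> nat) \<Rightarrow> nat \<Rightarrow> nat" where
  "qry_valid L e \<rho> \<tau> = (\<Prod>k<e. node L 1 \<rho> \<tau> k mod 2)"

lemma node_less: "off + \<rho> k < 2 ^ L \<Longrightarrow> node L off \<rho> \<tau> k < 2 ^ Suc L"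
  unfolding node_def by (rule le_less_trans[OF div_le_dividend]) simp

lemma upd_addr_eq_qry_addr:
  assumes "\<And>k. k < e \<Longrightarrow> \<rho> k < 2 ^ L" "\<And>k. k < e \<Longrightarrow> \<rho>' k + 1 < 2 ^ L"
  shows "upd_addr L e \<rho> \<tau> = qry_addr L e \<rho>' \<tau>' \<longleftrightarrow> (\<forall>k<e. node L 0 \<rho> \<tau> k = node L 1 \<rho>' \<tau>' k - 1)"
  unfolding upd_addr_def qry_addr_def
  using assms node_less[of 0 \<rho> _ L \<tau>] node_less[of 1 \<rho>' _ L \<tau>']
  by (subst encode_inj) (auto simp: less_imp_diff_less)

text \<open>Both sums range over codes of height vectors, so by \<open>sum_prod_digits\<close> the
  expression is a product over the coordinates. In each factor \<open>dyadic_levels\<close> leaves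
  only equal heights, and \<open>dyadic_less\<close> evaluates what remains. The room for
  \<open>\<rho>' k + 1\<close> keeps the shifted query on a leaf.\<close>

theorem dyadic_dominance:
  assumes "\<And>k. k < e \<Longrightarrow> \<rho> k < 2 ^ L" "\<And>k. k < e \<Longrightarrow> \<rho>' k + 1 < 2 ^ L"
  shows "(\<Sum>\<tau>'<L ^ e. qry_valid L e \<rho>' \<tau>' * (\<Sum>\<tau><L ^ e. of_bool (upd_addr L e \<rho> \<tau> = qry_addr L e \<rho>' \<tau>')))
    = (of_bool (\<forall>k<e. \<rho> k \<le> \<rho>' k) :: nat)"
proof -
  define x where "x = (\<lambda>k. 2 ^ L + 1 + \<rho>' k)"
  define a where "a = (\<lambda>k. 2 ^ L + \<rho> k)"
  define h :: "nat \<Rightarrow> nat \<Rightarrow> nat \<Rightarrow> nat" where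
    "h = (\<lambda>k t' t. of_bool (odd (x k div 2 ^ t') \<and> a k div 2 ^ t = x k div 2 ^ t' - 1))"
  have prod_bool: "(\<Prod>k<e. of_bool (P k)) = (of_bool (\<forall>k<e. P k) :: nat)" for P
    by (induction e) (auto simp: less_Suc_eq)
  have "qry_valid L e \<rho>' \<tau>' * (\<Sum>\<tau><L ^ e. of_bool (upd_addr L e \<rho> \<tau> = qry_addr L e \<rho>' \<tau>'))
      = (\<Prod>k<e. \<Sum>t<L. h k (digit L \<tau>' k) t)" for \<tau>'
  proof -
    have "qry_valid L e \<rho>' \<tau>' * (\<Sum>\<tau><L ^ e. of_bool (upd_addr L e \<rho> \<tau> = qry_addr L e \<rho>' \<tau>'))
      = (\<Sum>\<tau><L ^ e. (\<Prod>k<e. of_bool (odd (x k div 2 ^ digit L \<tau>' k))) *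
          (\<Prod>k<e. of_bool (a k div 2 ^ digit L \<tau> k = x k div 2 ^ digit L \<tau>' k - 1)))"
      using assms unfolding sum_distrib_left prod_bool
      by (intro sum.cong refl arg_cong2[of _ _ _ _ "(*)"])
         (simp_all add: upd_addr_eq_qry_addr qry_valid_def node_def x_def a_def mod_2_eq_odd prod_bool)
    also have "\<dots> = (\<Sum>\<tau><L ^ e. \<Prod>k<e. h k (digit L \<tau>' k) (digit L \<tau> k))"
      unfolding h_def prod.distrib[symmetric] of_bool_conj[symmetric] ..
    finally show ?thesis
      by (simp only: sum_prod_digits[of "\<lambda>k. h k (digit L \<tau>' k)"])
  qed
  then have "(\<Sum>\<tau>'<L ^ e. qry_valid L e \<rho>' \<tau>' * (\<Sum>\<tau><L ^ e. of_bool (upd_addr L e \<rho> \<tau> = qry_addr L e \<rho>' \<tau>')))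
      = (\<Prod>k<e. \<Sum>t'<L. \<Sum>t<L. h k t' t)"
    by (simp add: sum_prod_digits[of "\<lambda>k t'. \<Sum>t<L. h k t' t"])
  also have "\<dots> = (\<Prod>k<e. of_bool (\<rho> k \<le> \<rho>' k))"
  proof (rule prod.cong)
    fix k assume "k \<in> {..<e}"
    then have k: "\<rho> k < 2 ^ L" "\<rho>' k + 1 < 2 ^ L"
      using assms by auto
    have "(\<Sum>t<L. h k t' t) = of_bool (odd (x k div 2 ^ t') \<and> a k div 2 ^ t' = x k div 2 ^ t' - 1)"
      if "t' < L" for t'
    proof -
      have "h k t' t = (if t = t' then h k t' t' else 0)" if "t < L" for t
        using k dyadic_levels[of L "a k" "x k" t' t] that \<open>t' < L\<close> unfolding h_def a_def x_def by auto
      then have "(\<Sum>t<L. h k t' t) = (\<Sum>t<L. if t = t' then h k t' t' else 0)"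
        by (intro sum.cong) auto
      then show ?thesis
        using that by (simp add: h_def)
    qed
    then have "(\<Sum>t'<L. \<Sum>t<L. h k t' t) = of_bool (a k < x k)"
      using k by (subst dyadic_less[of L "a k" "x k", symmetric])
        (auto simp: a_def x_def intro!: sum.cong simp del: sum_of_bool_eq)
    then show "(\<Sum>t'<L. \<Sum>t<L. h k t' t) = of_bool (\<rho> k \<le> \<rho>' k)"
      by (simp add: a_def x_def less_Suc_eq_le)
  qed simp
  finally show ?thesis
    by (simp add: prod_bool)
qed

section \<open>Sorting\<close>

text \<open>
  Dominance counting owns the arrays from 20 on. The letters v and a mark integer scalars and integer
  arrays, r marks reals; the two numberings are independent.
\<close>

abbreviation (input) vN :: nat where "vN \<equiv> 20"
abbreviation (input) vW :: nat where "vW \<equiv> 21"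
abbreviation (input) vL :: nat where "vL \<equiv> 22"
abbreviation (input) aPow :: nat where "aPow \<equiv> 23"
abbreviation (input) vi :: nat where "vi \<equiv> 24"
abbreviation (input) vk :: nat where "vk \<equiv> 25"
abbreviation (input) aT :: nat where "aT \<equiv> 26"
abbreviation (input) vt :: nat where "vt \<equiv> 27"
abbreviation (input) vx :: nat where "vx \<equiv> 28"
abbreviation (input) aOrd :: nat where "aOrd \<equiv> 29"
abbreviation (input) aRank :: nat where "aRank \<equiv> 30"
abbreviation (input) vc :: nat where "vc \<equiv> 31"
abbreviation (input) rKey :: nat where "rKey \<equiv> 20"

text \<open>The bit length of \<open>N\<close>. The inequality is strict because, with ranks below
  \<open>N\<close>, the shifted leaf of a query can have number \<open>N\<close>.\<close>

definition levels :: "nat \<Rightarrow> nat" where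
  "levels N = (LEAST l. N < 2 ^ l)"

lemma less_pow_levels: "N < 2 ^ levels N"
  unfolding levels_def by (rule LeastI[of _ N]) (rule less_exp)

lemma pow_le_of_less_levels: "l < levels N \<Longrightarrow> 2 ^ l \<le> N"
  unfolding levels_def using not_less_Least not_le by blast

lemma levels_eqI: "N < 2 ^ l \<Longrightarrow> (\<And>l'. l' < l \<Longrightarrow> 2 ^ l' \<le> N) \<Longrightarrow> levels N = l"
  unfolding levels_def by (rule Least_equality) (auto simp: not_less[symmetric])

lemma levels_pos: "N > 0 \<Longrightarrow> levels N > 0"
  using less_pow_levels[of N] by (cases "levels N") auto

lemma pow_levels_le: "N > 0 \<Longrightarrow> 2 ^ levels N \<le> 2 * N"
  using pow_le_of_less_levels[of "levels N - 1" N] levels_pos[of N]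
  by (cases "levels N") auto

lemma levels_le: "N > 0 \<Longrightarrow> levels N \<le> N"
  using pow_le_of_less_levels[of "levels N - 1" N] levels_pos[of N]
    less_exp[of "levels N - 1"] by linarith

text \<open>Doubling stops by itself once the power exceeds \<open>N\<close>, so \<open>N\<close>
  rounds suffice, and they are cheap compared with sorting. With the table of powers, the ancestor
  of a leaf at a given height takes a single division.\<close>

definition init_levels :: prog where
  "init_levels = ISet vW (IConst 1) ;; ISet vL (IConst 0) ;; IAssign aPow (IConst 0) (IConst 1) ;;
     For vi vN (If (ILess (Var vN) (Var vW)) Skip
       (ISet vW (IMul (IConst 2) (Var vW)) ;; ISet vL (IAdd (Var vL) (IConst 1)) ;;
        IAssign aPow (Var vL) (Var vW)))"

lemma run_init_levels:
  assumes "imem S vN 0 = N" "N > 0" "4 * N \<le> B"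
  shows "run B init_levels S (N * 100 + 18) (\<lambda>S'. same {vW, vL, aPow, vi} {} S S' \<and>
    imem S' vW 0 = 2 ^ levels N \<and> imem S' vL 0 = levels N \<and>
    (\<forall>t\<le>levels N. imem S' aPow t = 2 ^ t))"
proof -
  define P where "P = (\<lambda>i S'. same {vW, vL, aPow, vi} {} S S' \<and>
     imem S' vW 0 = 2 ^ imem S' vL 0 \<and> imem S' vL 0 \<le> i \<and>
     (\<forall>t\<le>imem S' vL 0. imem S' aPow t = 2 ^ t) \<and>
     (\<forall>l<imem S' vL 0. 2 ^ l \<le> N) \<and> (imem S' vL 0 = i \<or> N < 2 ^ imem S' vL 0))"
  let ?init = "ISet vW (IConst 1) ;; ISet vL (IConst 0) ;; IAssign aPow (IConst 0) (IConst 1)"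
  let ?body = "If (ILess (Var vN) (Var vW)) Skip
       (ISet vW (IMul (IConst 2) (Var vW)) ;; ISet vL (IAdd (Var vL) (IConst 1)) ;;
        IAssign aPow (Var vL) (Var vW))"
  have init: "run B ?init S 9 (P 0)"
    by (rule run_straight) (use assms in \<open>auto simp: P_def\<close>)
  have N: "imem S' vN 0 = N" if "P i S'" for i S'
    using that assms by (auto simp: P_def same_def)
  have loop: "run B (For vi vN ?body) S1 (N * (pcost ?body + 12) + 9) (\<lambda>S'. P N S')"
    if "P 0 S1" for S1
  proof (rule run_For[where P = P])
    fix i S' assume i: "i < N" "P i S'" "imem S' vi 0 = i"
    show "run B ?body S' (pcost ?body) (\<lambda>S''. P (Suc i) S'' \<and> imem S'' vi 0 = i)"
    proof (rule run_straight)
      have "2 ^ imem S' vL 0 \<le> N \<Longrightarrow> 2 * 2 ^ imem S' vL 0 \<le> B \<and> Suc (imem S' vL 0) \<le> B"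
        using assms i by (auto simp: P_def)
      then show "psafe B ?body S'"
        using N[OF i(2)] i assms by (auto simp: P_def not_less)
      show "P (Suc i) (effect ?body S') \<and> imem (effect ?body S') vi 0 = i"
        using N[OF i(2)] i by (auto simp: P_def not_less le_Suc_eq less_Suc_eq)
    qed simp
  qed (use that assms N in \<open>auto simp: P_def\<close>)
  have "levels N = imem S' vL 0" if "P N S'" for S'
  proof (rule levels_eqI)
    \<comment> \<open>Either the doubling has stopped, or all \<open>N\<close> rounds have doubled
      and \<open>N < 2 ^ N\<close> applies.\<close>
    show "N < 2 ^ imem S' vL 0"
      using that less_exp[of N] by (auto simp: P_def)
  qed (use that in \<open>auto simp: P_def\<close>)
  then have fin: "run B (For vi vN ?body) S1 (N * (pcost ?body + 12) + 9) (\<lambda>S'. same {vW, vL, aPow, vi} {} S S' \<and>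
    imem S' vW 0 = 2 ^ levels N \<and> imem S' vL 0 = levels N \<and> (\<forall>t\<le>levels N. imem S' aPow t = 2 ^ t))"
    if "P 0 S1" for S1
    by (intro run_mono[OF loop[OF that]]) (auto simp: P_def)
  have "run B (?init ;; For vi vN ?body) S (9 + (N * (pcost ?body + 12) + 9)) (\<lambda>S'. same {vW, vL, aPow, vi} {} S S' \<and>
    imem S' vW 0 = 2 ^ levels N \<and> imem S' vL 0 = levels N \<and> (\<forall>t\<le>levels N. imem S' aPow t = 2 ^ t))"
    by (rule run_Seq[OF init fin])
  then show ?thesis
    unfolding init_levels_def by (rule run_mono) simp_all
qed

text \<open>
  In a tournament over leaves \<open>W + i\<close> a node holds 0 if no key below it remains, and otherwise \<open>Suc i\<close>
  for a minimal remaining key \<open>i\<close>.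
\<close>

definition below :: "nat \<Rightarrow> nat \<Rightarrow> nat \<Rightarrow> bool" where
  "below W v i \<longleftrightarrow> (\<exists>t. (W + i) div 2 ^ t = v)"

definition winner :: "(nat \<Rightarrow> real) \<Rightarrow> nat \<Rightarrow> nat set \<Rightarrow> nat \<Rightarrow> nat \<Rightarrow> bool" where
  "winner key W A v x \<longleftrightarrow> (x = 0 \<and> (\<forall>i\<in>A. \<not> below W v i)) \<or>
     (\<exists>i\<in>A. x = Suc i \<and> below W v i \<and> (\<forall>j\<in>A. below W v j \<longrightarrow> key i \<le> key j))"

lemma below_split:
  assumes "v < W"
  shows "below W v i \<longleftrightarrow> below W (2 * v) i \<or> below W (2 * v + 1) i"
proof
  assume "below W v i"
  then obtain t where t: "(W + i) div 2 ^ t = v"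
    by (auto simp: below_def)
  with assms obtain u where "t = Suc u"
    by (cases t) auto
  with t have "(W + i) div 2 ^ u div 2 = v"
    by (simp add: power_Suc2 div_mult2_eq del: power_Suc)
  then have "(W + i) div 2 ^ u = 2 * v \<or> (W + i) div 2 ^ u = 2 * v + 1"
    by linarith
  then show "below W (2 * v) i \<or> below W (2 * v + 1) i"
    by (auto simp: below_def)
next
  assume "below W (2 * v) i \<or> below W (2 * v + 1) i"
  then obtain t where "(W + i) div 2 ^ t = 2 * v \<or> (W + i) div 2 ^ t = 2 * v + 1"
    by (auto simp: below_def)
  then have "(W + i) div 2 ^ Suc t = v"
    by (auto simp: power_Suc2 div_mult2_eq simp del: power_Suc)
  then show "below W v i"
    unfolding below_def by blast
qed

lemma below_leaf:
  assumes "i < W" "j < W"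
  shows "below W (W + i) j \<longleftrightarrow> j = i"
proof
  assume "below W (W + i) j"
  then obtain t where t: "(W + j) div 2 ^ t = W + i"
    by (auto simp: below_def)
  show "j = i"
  proof (cases t)
    case (Suc u)
    have "(W + j) div 2 ^ t \<le> (W + j) div 2"
      unfolding Suc by (simp add: div_mult2_eq)
    then show ?thesis
      using t assms by linarith
  qed (use t in auto)
next
  assume "j = i"
  then show "below W (W + i) j"
    by (auto simp: below_def intro: exI[of _ 0])
qed

text \<open>The test has the form in which \<open>replay\<close> can express it, with negation and
  conjunction only: the right child wins iff it is nonempty and the left one is empty or has a
  larger key.\<close>

lemma winner_join:
  assumes "v < W" "winner key W A (2 * v) l" "winner key W A (2 * v + 1) r"
  shows "winner key W A v (if 0 < r \<and> \<not> (0 < l \<and> \<not> key (r - 1) < key (l - 1)) then r else l)"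
  using assms(2,3) unfolding winner_def below_split[OF assms(1)]
  by (auto simp: not_less) (meson order_trans linear)+

lemma winner_insert_other: "\<not> below W v i \<Longrightarrow> winner key W (insert i A) v x = winner key W A v x"
  by (auto simp: winner_def)

lemma winner_remove_other: "\<not> below W v i \<Longrightarrow> winner key W (A - {i}) v x = winner key W A v x"
  by (auto simp: winner_def)

lemma winner_less: "winner key W A v x \<Longrightarrow> A \<subseteq> {..<N} \<Longrightarrow> x \<le> N"
  by (auto simp: winner_def)

text \<open>After a change at leaf \<open>c\<close> only its ancestors have to be recomputed. All
  parts of a conjunction are evaluated, so keys are read even for an empty child; truncated
  subtraction then leads to item 0, a harmless address.\<close>

definition replay :: "nat \<Rightarrow> prog" where
  "replay D = (let
       l = IArr aT (IMul (IConst 2) (Var vx));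
       r = IArr aT (IAdd (IMul (IConst 2) (Var vx)) (IConst 1));
       key = (\<lambda>e. RArr rKey (IAdd (IMul (ISub e (IConst 1)) (IConst D)) (Var vk)))
     in ISet vx (IAdd (Var vW) (Var vc)) ;;
       For vt vL (ISet vx (IDiv (Var vx) (IConst 2)) ;;
         If (BAnd (ILess (IConst 0) r) (BNot (BAnd (ILess (IConst 0) l) (BNot (RLess (key r) (key l))))))
           (IAssign aT (Var vx) r) (IAssign aT (Var vx) l)))"

text \<open>Cells outside the tree have to be 0, so that an emptied tree is an array of zeros, as
  the next sort expects.\<close>

abbreviation tree_ok :: "(nat \<Rightarrow> real) \<Rightarrow> nat \<Rightarrow> nat set \<Rightarrow> (nat \<Rightarrow> nat) \<Rightarrow> bool" where
  "tree_ok key W A T \<equiv> (\<forall>v\<in>{1..<2 * W}. winner key W A v (T v)) \<and> (\<forall>v. v \<notin> {1..<2 * W} \<longrightarrow> T v = 0)"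

text \<open>The hypothesis on \<open>winner\<close> leaves out the proper ancestors of the leaf
  \<open>c\<close>: this is the situation right after an insertion or a removal at \<open>c\<close>.
  One specification thus serves both.\<close>

lemma run_replay:
  fixes S :: store and D :: nat
  defines "key \<equiv> (\<lambda>i. rmem S rKey (i * D + imem S vk 0))"
  assumes W: "imem S vW 0 = W" "W = 2 ^ L" "imem S vL 0 = L" "2 * W \<le> B"
    and A: "A \<subseteq> {..<N}" "N * D + D \<le> B" "imem S vk 0 < D"
    and c: "c < W" "imem S vc 0 = c"
    and ok: "\<And>v. v \<in> {1..<2 * W} \<Longrightarrow> v = W + c \<or> \<not> below W v c \<Longrightarrow> winner key W A v (imem S aT v)"
    and old: "\<And>v. imem S aT v \<le> N" "\<And>v. v \<notin> {1..<2 * W} \<Longrightarrow> imem S aT v = 0"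
  shows "run B (replay D) S (L * 100 + 40) (\<lambda>S'. same {vx, vt, aT} {} S S' \<and> tree_ok key W A (imem S' aT))"
proof -
  \<comment> \<open>After \<open>i\<close> rounds all entries are correct except possibly those of
    ancestors of the leaf at a height above \<open>i\<close>.\<close>
  define P where "P = (\<lambda>i S'. same {vx, vt, aT} {} S S' \<and> imem S' vx 0 = (W + c) div 2 ^ i \<and>
     (\<forall>v\<in>{1..<2 * W}. (\<forall>t>i. (W + c) div 2 ^ t \<noteq> v) \<longrightarrow> winner key W A v (imem S' aT v)) \<and>
     (\<forall>v. imem S' aT v \<le> N) \<and> (\<forall>v. v \<notin> {1..<2 * W} \<longrightarrow> imem S' aT v = 0))"
  let ?l = "IArr aT (IMul (IConst 2) (Var vx))"
  let ?r = "IArr aT (IAdd (IMul (IConst 2) (Var vx)) (IConst 1))"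
  let ?key = "(\<lambda>e. RArr rKey (IAdd (IMul (ISub e (IConst 1)) (IConst D)) (Var vk)))"
  let ?cond = "BAnd (ILess (IConst 0) ?r) (BNot (BAnd (ILess (IConst 0) ?l) (BNot (RLess (?key ?r) (?key ?l)))))"
  let ?body = "ISet vx (IDiv (Var vx) (IConst 2)) ;; If ?cond (IAssign aT (Var vx) ?r) (IAssign aT (Var vx) ?l)"
  let ?init = "ISet vx (IAdd (Var vW) (Var vc))"
  have P0: "P 0 (iupd vx 0 (W + c) S)"
  proof -
    have "v = W + c \<or> \<not> below W v c" if "\<forall>t>0. (W + c) div 2 ^ t \<noteq> v" for v
      using that unfolding below_def by (metis div_by_1 gr0I power_0)
    then show ?thesis
      using old ok by (auto simp: P_def)
  qed
  have init: "run B ?init S 7 (P 0)"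
    by (rule run_straight) (use W(1,4) c P0 in simp_all)
  have loop: "run B (For vt vL ?body) S1 (L * (pcost ?body + 12) + 9)
      (\<lambda>S'. same {vx, vt, aT} {} S S' \<and> tree_ok key W A (imem S' aT))"
    if "P 0 S1" for S1
  proof (rule run_For[where P = P])
    show "P 0 S1"
      by fact
    show "L < B"
      using less_exp[of L] W by linarith
    fix i S' assume i: "i < L" and P: "P i S'" and t: "imem S' vt 0 = i"
    define x where "x = (W + c) div 2 ^ Suc i"
    have "(W + c) div 2 ^ i div 2 = x"
      unfolding x_def power_Suc2 by (rule div_mult2_eq[symmetric])
    then have eqs: "imem S' vx 0 div 2 = x" "imem S' vk = imem S vk" "rmem S' = rmem S"
      using P by (auto simp: P_def same_def)
    have "W + c < 2 ^ Suc L"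
      using c W by simp
    also have "\<dots> \<le> W * 2 ^ Suc i"
      using W by simp
    finally have xW: "x < W"
      unfolding x_def by (rule less_mult_imp_div_less)
    have "2 ^ Suc i \<le> W"
      using i W(2) by (metis Suc_leI numeral_le_one_iff one_le_numeral power_increasing)
    then have x0: "x \<ge> 1"
      unfolding x_def by (simp add: Suc_le_eq div_greater_zero_iff trans_le_add1)
    have child: "winner key W A v (imem S' aT v)" if "v = 2 * x \<or> v = 2 * x + 1" for v
    proof -
      have "(W + c) div 2 ^ t \<noteq> v" if "t > i" for t
      proof -
        have "(W + c) div 2 ^ t \<le> x"
          unfolding x_def using that by (intro div_le_mono2 power_increasing) auto
        then show ?thesis
          using \<open>v = 2 * x \<or> v = 2 * x + 1\<close> x0 by linarith
      qed
      then show ?thesis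
        using P that xW x0 by (auto simp: P_def)
    qed
    have new: "winner key W A x (if 0 < imem S' aT (2 * x + 1) \<and> \<not> (0 < imem S' aT (2 * x) \<and>
        \<not> key (imem S' aT (2 * x + 1) - 1) < key (imem S' aT (2 * x) - 1))
      then imem S' aT (2 * x + 1) else imem S' aT (2 * x))"
      using xW child by (intro winner_join) auto
    have less: "imem S' aT v \<le> N" for v
      using P by (auto simp: P_def)
    have bnd: "(imem S' aT v - Suc 0) * D + imem S vk 0 \<le> B" for v
    proof -
      have "(imem S' aT v - Suc 0) * D \<le> N * D"
        using less[of v] by (intro mult_right_mono) auto
      then show ?thesis
        using A by linarith
    qed
    have bnd': "(imem S' aT v - Suc 0) * D \<le> B" for v
      using bnd[of v] by linarith
    have D: "D \<le> B"
      using A by linarith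
    show "run B ?body S' (pcost ?body) (\<lambda>S''. P (Suc i) S'' \<and> imem S'' vt 0 = i)"
    proof (rule run_straight)
      show "psafe B ?body S'"
        using xW W eqs x0 bnd bnd' D by auto
      have old_v: "winner key W A v (imem S' aT v)"
        if "v \<in> {1..<2 * W}" "\<forall>t>Suc i. (W + c) div 2 ^ t \<noteq> v" "v \<noteq> x" for v
      proof -
        have "(W + c) div 2 ^ t \<noteq> v" if "t > i" for t
          using that \<open>v \<noteq> x\<close> \<open>\<forall>t>Suc i. _\<close> unfolding x_def by (cases "t = Suc i") auto
        then show ?thesis
          using P that by (auto simp: P_def)
      qed
      define y where "y = (if 0 < imem S' aT (2 * x + 1) \<and> \<not> (0 < imem S' aT (2 * x) \<and>
          \<not> key (imem S' aT (2 * x + 1) - 1) < key (imem S' aT (2 * x) - 1))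
        then imem S' aT (2 * x + 1) else imem S' aT (2 * x))"
      have "effect ?body S' = iupd aT x y (iupd vx 0 x S')"
        by (simp add: eqs key_def y_def)
      moreover have "P (Suc i) (iupd aT x y (iupd vx 0 x S'))"
      proof -
        have "y \<le> N"
          using less by (simp add: y_def)
        moreover have "winner key W A v (if v = x then y else imem S' aT v)"
          if "v \<in> {1..<2 * W}" "\<forall>t>Suc i. (W + c) div 2 ^ t \<noteq> v" for v
          using that new old_v by (simp add: y_def)
        moreover have "x \<in> {1..<2 * W}"
          using xW x0 by simp
        ultimately show ?thesis
          using P less unfolding P_def x_def[symmetric] by auto
      qed
      ultimately show "P (Suc i) (effect ?body S') \<and> imem (effect ?body S') vt 0 = i"
        using t by simp
    qed simp
  next
    fix S' assume P: "P L S'"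
    have "(W + c) div 2 ^ t \<noteq> v" if "t > L" "v \<ge> 1" for t v
    proof -
      have "W + c < 2 ^ Suc L"
        using c W by simp
      also have "\<dots> \<le> 2 ^ t"
        using that by (intro power_increasing) auto
      finally show ?thesis
        using that by simp
    qed
    then show "same {vx, vt, aT} {} S S' \<and> tree_ok key W A (imem S' aT)"
      using P by (auto simp: P_def)
  qed (use W in \<open>auto simp: P_def same_def\<close>)
  have "run B (?init ;; For vt vL ?body) S (7 + (L * (pcost ?body + 12) + 9))
     (\<lambda>S'. same {vx, vt, aT} {} S S' \<and> tree_ok key W A (imem S' aT))"
    by (rule run_Seq[OF init loop])
  then show ?thesis
    unfolding replay_def Let_def by (rule run_mono) simp_all
qed

section \<open>Filling and emptying the tournament\<close>

definition set_up :: "nat \<Rightarrow> store \<Rightarrow> bool" where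
  "set_up N S \<longleftrightarrow> imem S vN 0 = N \<and> imem S vW 0 = 2 ^ levels N \<and> imem S vL 0 = levels N \<and>
     (\<forall>t\<le>levels N. imem S aPow t = 2 ^ t)"

lemma set_up_same: "set_up N S \<Longrightarrow> same X Y S S' \<Longrightarrow> X \<inter> {vN, vW, vL, aPow} = {} \<Longrightarrow> set_up N S'"
  by (auto simp: set_up_def same_def)

lemma winner_leaf:
  assumes "A \<subseteq> {..<W}" "i < W"
  shows "winner key W (insert i A) (W + i) (Suc i)" "winner key W (A - {i}) (W + i) 0"
  using assms below_leaf[OF assms(2)] by (auto simp: winner_def)

text \<open>A bottom-up construction would save a factor \<open>levels N\<close>, but the
  extractions cost as much as these insertions, and \<open>replay\<close> serves both.\<close>

definition insert_all :: "nat \<Rightarrow> prog" where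
  "insert_all D = For vi vN (ISet vc (Var vi) ;;
     IAssign aT (IAdd (Var vW) (Var vc)) (IAdd (Var vc) (IConst 1)) ;; replay D)"

lemma run_insert_all:
  fixes S :: store and D :: nat
  defines "key \<equiv> (\<lambda>i. rmem S rKey (i * D + imem S vk 0))"
  assumes S: "set_up N S" "imem S vk 0 < D" "\<And>v. imem S aT v = 0"
    and N: "N > 0" "4 * N * D + D \<le> B"
  shows "run B (insert_all D) S (N * (levels N * 100 + 80) + 9)
    (\<lambda>S'. same {vi, vc, vx, vt, aT} {} S S' \<and> tree_ok key (2 ^ levels N) {..<N} (imem S' aT))"
proof -
  define P where "P = (\<lambda>i S'. same {vi, vc, vx, vt, aT} {} S S' \<and>
    tree_ok key (2 ^ levels N) {..<i} (imem S' aT))"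
  define W where "W = (2::nat) ^ levels N"
  let ?pre = "ISet vc (Var vi) ;; IAssign aT (IAdd (Var vW) (Var vc)) (IAdd (Var vc) (IConst 1))"
  have D: "D > 0"
    using S by linarith
  have "4 * N \<le> 4 * N * D"
    using D by simp
  then have W: "N < W" "2 * W \<le> B" "N < B"
    unfolding W_def using N pow_levels_le[of N] less_pow_levels[of N] by linarith+
  show ?thesis
    unfolding insert_all_def
  proof (rule run_mono[OF run_For[where P = P and N = N and T = "14 + (levels N * 100 + 40)"]])
    show "P 0 S"
      using S by (simp add: P_def winner_def)
    show "imem S' vN 0 = N" if "P i S'" for i S'
      using that S(1) by (auto simp: P_def set_up_def same_def)
    fix i S' assume i: "i < N" and P: "P i S'" and ci: "imem S' vi 0 = i"
    have su: "set_up N S'"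
      using P by (intro set_up_same[OF S(1)]) (auto simp: P_def)
    have eqs: "imem S' vk = imem S vk" "rmem S' = rmem S"
      using P by (auto simp: P_def same_def)
    have ok: "tree_ok key W {..<i} (imem S' aT)"
      using P by (simp add: P_def W_def)
    let ?S1 = "iupd aT (W + i) (Suc i) (iupd vc 0 i S')"
    have le: "imem S' aT v \<le> i" for v
      using ok by (cases "v \<in> {1..<2 * W}") (auto dest!: winner_less[OF _ subset_refl])
    have pre: "run B ?pre S' 14 (\<lambda>S''. S'' = ?S1)"
      by (rule run_straight) (use su ci i W in \<open>auto simp: set_up_def W_def[symmetric]\<close>)
    have "run B (?pre ;; replay D) S' (14 + (levels N * 100 + 40)) (\<lambda>S''.
      same {vx, vt, aT} {} ?S1 S'' \<and> tree_ok key W {..<Suc i} (imem S'' aT))"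
    proof (rule run_Seq[OF pre], clarify)
      have key: "key = (\<lambda>i. rmem ?S1 rKey (i * D + imem ?S1 vk 0))"
        by (simp add: key_def eqs)
      show "run B (replay D) ?S1 (levels N * 100 + 40) (\<lambda>S''.
          same {vx, vt, aT} {} ?S1 S'' \<and> tree_ok key W {..<Suc i} (imem S'' aT))"
        unfolding key
      proof (rule run_replay[where N = N and c = i and L = "levels N"])
        fix v assume v: "v \<in> {1..<2 * W}" "v = W + i \<or> \<not> below W v i"
        show "winner (\<lambda>i. rmem ?S1 rKey (i * D + imem ?S1 vk 0)) W {..<Suc i} v (imem ?S1 aT v)"
          unfolding key[symmetric] lessThan_Suc
        proof (cases "v = W + i")
          case True
          then show "winner key W (insert i {..<i}) v (imem ?S1 aT v)"
            using winner_leaf(1)[of "{..<i}" W i] i W by auto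
        next
          case False
          then show "winner key W (insert i {..<i}) v (imem ?S1 aT v)"
            using v ok by (auto simp: winner_insert_other)
        qed
      next
        show "imem ?S1 aT v \<le> N" for v
          using le[of v] i by auto
      next
        fix v assume "v \<notin> {1..<2 * W}"
        then show "imem ?S1 aT v = 0"
          using ok W i by auto
      qed (use su i W N S eqs in \<open>auto simp: set_up_def W_def\<close>)
    qed
    then show "run B (?pre ;; replay D) S' (14 + (levels N * 100 + 40)) (\<lambda>S''. P (Suc i) S'' \<and> imem S'' vi 0 = i)"
    proof (rule run_mono)
      fix S'' assume *: "same {vx, vt, aT} {} ?S1 S'' \<and> tree_ok key W {..<Suc i} (imem S'' aT)"
      have "same {vi, vc, vx, vt, aT} {} S ?S1"
        using P by (simp add: P_def)
      then have "same {vi, vc, vx, vt, aT} {} S S''"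
        by (rule same_trans) (use * in auto)
      moreover have "imem S'' vi 0 = i"
        using * ci by (auto simp: same_def)
      ultimately show "P (Suc i) S'' \<and> imem S'' vi 0 = i"
        using * by (simp add: P_def W_def)
    qed simp
  qed (use W in \<open>auto simp: P_def\<close>)
qed

text \<open>The state of a selection sort after \<open>v\<close> extractions. Equal keys share the
  position of the first of them as their rank; thus ranks reproduce \<open>\<le>\<close> between
  keys, ties included, and stay below \<open>N\<close>.\<close>

definition ranked :: "(nat \<Rightarrow> real) \<Rightarrow> nat \<Rightarrow> nat \<Rightarrow> (nat \<Rightarrow> nat) \<Rightarrow> (nat \<Rightarrow> nat) \<Rightarrow> bool" where
  "ranked key N v ord rank \<longleftrightarrow> inj_on ord {..<v} \<and> ord ` {..<v} \<subseteq> {..<N} \<and>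
     (\<forall>u<v. \<forall>i\<in>{..<N} - ord ` {..<v}. key (ord u) \<le> key i) \<and>
     (\<forall>u<v. rank (ord u) \<le> u) \<and>
     (\<forall>u u'. u \<le> u' \<longrightarrow> u' < v \<longrightarrow> key (ord u) \<le> key (ord u')) \<and>
     (\<forall>u<v. \<forall>u'<v. rank (ord u) \<le> rank (ord u') \<longleftrightarrow> key (ord u) \<le> key (ord u'))"

text \<open>Keys are extracted in increasing order, so the previous key is the largest so far, and
  comparing with it alone decides whether the new key is tied with an earlier one. If it is not, its
  position \<open>v\<close> exceeds all ranks given before.\<close>

lemma ranked_Suc:
  assumes r: "ranked key N v ord rank" and c: "c \<in> {..<N} - ord ` {..<v}"
    and least: "\<And>i. i \<in> {..<N} - ord ` {..<v} \<Longrightarrow> key c \<le> key i"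
  shows "ranked key N (Suc v) (ord(v := c))
    (rank(c := if 0 < v \<and> \<not> key (ord (v - 1)) < key c then rank (ord (v - 1)) else v))"
proof -
  let ?x = "if 0 < v \<and> \<not> key (ord (v - 1)) < key c then rank (ord (v - 1)) else v"
  let ?o = "ord(v := c)" and ?r = "rank(c := ?x)"
  have o: "?o u = ord u" "?r (?o u) = rank (ord u)" "rank (ord u) \<le> u" "key (ord u) \<le> key c" if "u < v" for u
    using that c r by (auto simp: ranked_def)
  have img: "?o ` {..<Suc v} = insert c (ord ` {..<v})"
    by (auto simp: less_Suc_eq)
  have mono: "key (ord u) \<le> key (ord u')" if "u \<le> u'" "u' < v" for u u'
    using r that by (auto simp: ranked_def)
  have iff: "rank (ord u) \<le> rank (ord u') \<longleftrightarrow> key (ord u) \<le> key (ord u')" if "u < v" "u' < v" for u u'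
    using r that by (auto simp: ranked_def)
  have new1: "rank (ord u) \<le> ?x" if "u < v" for u
    using o[OF that] that iff[of u "v - 1"] mono[of u "v - 1"] by auto
  have new2: "?x \<le> rank (ord u) \<longleftrightarrow> key c \<le> key (ord u)" if "u < v" for u
  proof (cases "0 < v \<and> \<not> key (ord (v - 1)) < key c")
    case True
    then have "key (ord (v - 1)) = key c"
      using o(4)[of "v - 1"] by simp
    then show ?thesis
      using True that iff[of "v - 1" u] by simp
  next
    case False
    moreover have "key (ord u) \<le> key (ord (v - 1))"
      using that by (intro mono) auto
    ultimately show ?thesis
      using that o(3)[OF that] by auto
  qed
  show ?thesis
    unfolding ranked_def img
  proof (intro conjI)
    show "inj_on ?o {..<Suc v}"
      using r c by (auto simp: ranked_def inj_on_def less_Suc_eq)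
    show "insert c (ord ` {..<v}) \<subseteq> {..<N}"
      using r c by (auto simp: ranked_def)
    show "\<forall>u<Suc v. \<forall>i\<in>{..<N} - insert c (ord ` {..<v}). key (?o u) \<le> key i"
      using r c least by (auto simp: ranked_def less_Suc_eq)
    have "?x \<le> v"
      using o(3)[of "v - 1"] by auto
    then have "?r (?o u) \<le> u" if "u < Suc v" for u
      using that o(2,3)[of u] by (cases "u < v") (auto simp: less_Suc_eq)
    then show "\<forall>u<Suc v. ?r (?o u) \<le> u"
      by blast
    show "\<forall>u u'. u \<le> u' \<longrightarrow> u' < Suc v \<longrightarrow> key (?o u) \<le> key (?o u')"
      using o mono by (auto simp: less_Suc_eq le_less)
    show "\<forall>u<Suc v. \<forall>u'<Suc v. ?r (?o u) \<le> ?r (?o u') \<longleftrightarrow> key (?o u) \<le> key (?o u')"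
    proof (intro allI impI)
      fix u u' assume "u < Suc v" "u' < Suc v"
      then consider "u < v" "u' < v" | "u < v" "u' = v" | "u = v" "u' < v" | "u = v" "u' = v"
        by linarith
      then show "?r (?o u) \<le> ?r (?o u') \<longleftrightarrow> key (?o u) \<le> key (?o u')"
        using o iff new1 new2 by cases auto
    qed
  qed
qed

definition extract_all :: "nat \<Rightarrow> prog" where
  "extract_all D = (let
       cell = (\<lambda>e. IAdd (IMul e (IConst D)) (Var vk));
       prev = IArr aOrd (ISub (Var vi) (IConst 1))
     in For vi vN (ISet vc (ISub (IArr aT (IConst 1)) (IConst 1)) ;;
       IAssign aOrd (Var vi) (Var vc) ;;
       If (BAnd (ILess (IConst 0) (Var vi)) (BNot (RLess (RArr rKey (cell prev)) (RArr rKey (cell (Var vc))))))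
         (IAssign aRank (cell (Var vc)) (IArr aRank (cell prev)))
         (IAssign aRank (cell (Var vc)) (Var vi)) ;;
       IAssign aT (IAdd (Var vW) (Var vc)) (IConst 0) ;; replay D))"

text \<open>The emptied tree is ready for the next coordinate. The last conjunct protects the ranks
  of the other coordinates, which are interleaved in the same array with stride
  \<open>D\<close>.\<close>

lemma run_extract_all:
  fixes S :: store and D :: nat
  defines "key \<equiv> (\<lambda>i. rmem S rKey (i * D + imem S vk 0))"
  assumes S: "set_up N S" "imem S vk 0 < D" "tree_ok key (2 ^ levels N) {..<N} (imem S aT)"
    and N: "N > 0" "4 * N * D + D \<le> B"
  shows "run B (extract_all D) S (N * (levels N * 100 + 200) + 9)
    (\<lambda>S'. same {vi, vc, vx, vt, aT, aOrd, aRank} {} S S' \<and> (\<forall>v. imem S' aT v = 0) \<and>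
      ranked key N N (imem S' aOrd) (\<lambda>i. imem S' aRank (i * D + imem S vk 0)) \<and>
      (\<forall>a. (\<forall>i<N. a \<noteq> i * D + imem S vk 0) \<longrightarrow> imem S' aRank a = imem S aRank a))"
proof -
  define k where "k = imem S vk 0"
  define W where "W = (2::nat) ^ levels N"
  define X where "X = {vi, vc, vx, vt, aT, aOrd, aRank}"
  define P where "P = (\<lambda>v S'. same X {} S S' \<and>
    tree_ok key W ({..<N} - imem S' aOrd ` {..<v}) (imem S' aT) \<and>
    ranked key N v (imem S' aOrd) (\<lambda>i. imem S' aRank (i * D + k)) \<and>
    (\<forall>a. (\<forall>i<N. a \<noteq> i * D + k) \<longrightarrow> imem S' aRank a = imem S aRank a))"
  let ?cell = "(\<lambda>e. IAdd (IMul e (IConst D)) (Var vk))"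
  let ?prev = "IArr aOrd (ISub (Var vi) (IConst 1))"
  let ?pre = "ISet vc (ISub (IArr aT (IConst 1)) (IConst 1)) ;;
       IAssign aOrd (Var vi) (Var vc) ;;
       If (BAnd (ILess (IConst 0) (Var vi)) (BNot (RLess (RArr rKey (?cell ?prev)) (RArr rKey (?cell (Var vc))))))
         (IAssign aRank (?cell (Var vc)) (IArr aRank (?cell ?prev)))
         (IAssign aRank (?cell (Var vc)) (Var vi)) ;;
       IAssign aT (IAdd (Var vW) (Var vc)) (IConst 0)"
  have D: "D > 0" "k < D"
    using S by (auto simp: k_def)
  have "4 * N \<le> 4 * N * D"
    using D by simp
  then have W: "N < W" "2 * W \<le> B" "N < B" "W \<ge> 1"
    unfolding W_def using N pow_levels_le[of N] less_pow_levels[of N] by linarith+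
  have cell_le: "i * D + k \<le> B" "i * D \<le> B" if "i < N" for i
  proof -
    have "i * D \<le> N * D"
      using that by simp
    then show "i * D + k \<le> B" "i * D \<le> B"
      using N D by linarith+
  qed
  have mtpre: "pcost ?pre \<le> 100"
    by simp
  show ?thesis
    unfolding extract_all_def Let_def
  proof (rule run_mono[OF run_For[where P = P and N = N and T = "100 + (levels N * 100 + 40)"]])
    show "P 0 S"
      using S by (simp add: P_def W_def ranked_def)
    show "imem S' vN 0 = N" if "P i S'" for i S'
      using that S(1) by (auto simp: P_def X_def set_up_def same_def)
    show "P i (iupd vi 0 v S')" if "P i S'" for i v S'
      using that by (simp add: P_def X_def)
    fix v S' assume v: "v < N" and P: "P v S'" and cv: "imem S' vi 0 = v"
    have su: "set_up N S'"
      using P by (intro set_up_same[OF S(1)]) (auto simp: P_def X_def)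
    have eqs: "imem S' vk 0 = k" "rmem S' = rmem S"
      using P by (auto simp: P_def X_def same_def k_def)
    let ?o = "imem S' aOrd"
    let ?A = "{..<N} - ?o ` {..<v}"
    have ok: "tree_ok key W ?A (imem S' aT)" and r: "ranked key N v ?o (\<lambda>i. imem S' aRank (i * D + k))"
      using P by (simp_all add: P_def)
    \<comment> \<open>Every leaf lies below the root, so the root entry 0 would mean that no key
      remains.\<close>
    have "below W 1 i" if "i \<in> ?A" for i
    proof -
      have "W \<le> W + i" "W + i < 2 * W"
        using that W by auto
      then have "(W + i) div 2 ^ levels N = 1"
        unfolding W_def by (simp add: div_nat_eqI)
      then show ?thesis
        by (auto simp: below_def)
    qed
    moreover have "?A \<noteq> {}"
    proof
      assume "?A = {}"
      then have "card {..<N} \<le> card (?o ` {..<v})"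
        by (intro card_mono) auto
      also have "\<dots> \<le> v"
        using card_image_le[of "{..<v}" ?o] by simp
      finally show False
        using v by simp
    qed
    moreover have "winner key W ?A 1 (imem S' aT 1)"
      using ok W by auto
    ultimately obtain c where c: "c \<in> ?A" "imem S' aT 1 = Suc c" "\<And>i. i \<in> ?A \<Longrightarrow> key c \<le> key i"
      unfolding winner_def by blast
    define x where "x = (if 0 < v \<and> \<not> key (?o (v - 1)) < key c then imem S' aRank (?o (v - 1) * D + k) else v)"
    have r': "ranked key N (Suc v) (?o(v := c)) ((\<lambda>i. imem S' aRank (i * D + k))(c := x))"
      unfolding x_def using ranked_Suc[OF r c(1) c(3)] by auto
    let ?S1 = "iupd aT (W + c) 0 (iupd aRank (c * D + k) x (iupd aOrd v c (iupd vc 0 c S')))"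
    have prev: "?o (v - 1) < N" if "v > 0"
    proof -
      have "?o (v - 1) \<in> ?o ` {..<v}"
        using that by simp
      then show ?thesis
        using r by (auto simp: ranked_def)
    qed
    have pre: "run B ?pre S' 100 (\<lambda>S''. S'' = ?S1)"
    proof (rule run_straight[OF _ mtpre])
      show "psafe B ?pre S'"
        using su cv c eqs W v D N prev cell_le[of c] cell_le[of "?o (v - Suc 0)"]
        by (cases "v = 0") (auto simp: set_up_def W_def[symmetric])
      show "effect ?pre S' = ?S1"
        using su cv c eqs D by (auto simp: set_up_def W_def[symmetric] x_def key_def k_def[symmetric])
    qed
    have le: "imem S' aT w \<le> N" for w
      using ok by (cases "w \<in> {1..<2 * W}") (auto dest!: winner_less[where N = N])
    have img: "{..<N} - imem ?S1 aOrd ` {..<Suc v} = ?A - {c}"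
      by (auto simp: less_Suc_eq)
    have "run B (?pre ;; replay D) S' (100 + (levels N * 100 + 40)) (\<lambda>S''.
      same {vx, vt, aT} {} ?S1 S'' \<and> tree_ok key W (?A - {c}) (imem S'' aT))"
    proof (rule run_Seq[OF pre], clarify)
      have key: "key = (\<lambda>i. rmem ?S1 rKey (i * D + imem ?S1 vk 0))"
        by (simp add: key_def eqs k_def)
      show "run B (replay D) ?S1 (levels N * 100 + 40) (\<lambda>S''.
          same {vx, vt, aT} {} ?S1 S'' \<and> tree_ok key W (?A - {c}) (imem S'' aT))"
        unfolding key
      proof (rule run_replay[where N = N and c = c and L = "levels N"])
        fix w assume w: "w \<in> {1..<2 * W}" "w = W + c \<or> \<not> below W w c"
        show "winner (\<lambda>i. rmem ?S1 rKey (i * D + imem ?S1 vk 0)) W (?A - {c}) w (imem ?S1 aT w)"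
          unfolding key[symmetric]
        proof (cases "w = W + c")
          case True
          moreover have "?A \<subseteq> {..<W}"
            using W by auto
          ultimately show "winner key W (?A - {c}) w (imem ?S1 aT w)"
            using winner_leaf(2)[of ?A W c key] c W by auto
        next
          case False
          then show "winner key W (?A - {c}) w (imem ?S1 aT w)"
            using w ok by (auto simp: winner_remove_other)
        qed
      next
        show "imem ?S1 aT v \<le> N" for v
          using le[of v] by auto
      next
        fix v assume "v \<notin> {1..<2 * W}"
        then show "imem ?S1 aT v = 0"
          using ok W by auto
      qed (use su c W N D eqs in \<open>auto simp: set_up_def W_def\<close>)
    qed
    then show "run B (?pre ;; replay D) S' (100 + (levels N * 100 + 40)) (\<lambda>S''. P (Suc v) S'' \<and> imem S'' vi 0 = v)"
    proof (rule run_mono)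
      fix S'' assume *: "same {vx, vt, aT} {} ?S1 S'' \<and> tree_ok key W (?A - {c}) (imem S'' aT)"
      have "same X {} S ?S1"
        using P by (simp add: P_def X_def)
      then have "same X {} S S''"
        by (rule same_trans) (use * in \<open>auto simp: X_def\<close>)
      moreover have "imem S'' vi 0 = v" "imem S'' aOrd = ?o(v := c)"
        "imem S'' aRank = (imem S' aRank)(c * D + k := x)"
        using * cv by (auto simp: same_def)
      moreover have "(\<lambda>i. ((imem S' aRank)(c * D + k := x)) (i * D + k)) = (\<lambda>i. imem S' aRank (i * D + k))(c := x)"
        using D by auto
      ultimately show "P (Suc v) S'' \<and> imem S'' vi 0 = v"
        using * r' c P img by (auto simp: P_def)
    qed simp
  next
    fix S' assume P: "P N S'"
    let ?o = "imem S' aOrd"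
    \<comment> \<open>After \<open>N\<close> extractions the order is a permutation and no key
      remains, which forces all entries of the tree to 0.\<close>
    have "inj_on ?o {..<N}" "?o ` {..<N} \<subseteq> {..<N}"
      using P by (auto simp: P_def ranked_def)
    then have "?o ` {..<N} = {..<N}"
      by (meson endo_inj_surj finite_lessThan)
    then have "imem S' aT v = 0" for v
      using P by (cases "v \<in> {1..<2 * W}") (auto simp: P_def winner_def)
    then show "same {vi, vc, vx, vt, aT, aOrd, aRank} {} S S' \<and> (\<forall>v. imem S' aT v = 0) \<and>
      ranked key N N ?o (\<lambda>i. imem S' aRank (i * D + imem S vk 0)) \<and>
      (\<forall>a. (\<forall>i<N. a \<noteq> i * D + imem S vk 0) \<longrightarrow> imem S' aRank a = imem S aRank a)"
      using P by (simp add: P_def X_def k_def)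
  qed (use W in \<open>auto\<close>)
qed

section \<open>Dominance counting by a sweep\<close>

abbreviation (input) vLE :: nat where "vLE \<equiv> 32"
abbreviation (input) vtau :: nat where "vtau \<equiv> 33"
abbreviation (input) vj :: nat where "vj \<equiv> 34"
abbreviation (input) vv :: nat where "vv \<equiv> 35"
abbreviation (input) vD :: nat where "vD \<equiv> 36"
abbreviation (input) vNN :: nat where "vNN \<equiv> 37"
abbreviation (input) vs :: nat where "vs \<equiv> 38"
abbreviation (input) rWt :: nat where "rWt \<equiv> 21"
abbreviation (input) rC :: nat where "rC \<equiv> 22"
abbreviation (input) rT :: nat where "rT \<equiv> 23"
abbreviation (input) rw :: nat where "rw \<equiv> 24"

text \<open>\<open>D\<close> and \<open>k\<close> are fixed when the program is built. The power of
  the depth that selects a digit is therefore an unrolled product, of constant cost.\<close>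

definition node_exp :: "nat \<Rightarrow> nat \<Rightarrow> nat \<Rightarrow> iexp" where
  "node_exp D off k = IDiv
     (IAdd (IAdd (Var vW) (IConst off)) (IArr aRank (IAdd (IMul (Var vc) (IConst D)) (IConst k))))
     (IArr aPow (IMod (IDiv (Var vtau) (iprod (\<lambda>_. Var vL) k)) (Var vL)))"

definition upd_addr_exp :: "nat \<Rightarrow> iexp" where
  "upd_addr_exp e = isum (\<lambda>k. IMul (node_exp (Suc e) 0 k) (iprod (\<lambda>_. IMul (IConst 2) (Var vW)) k)) e"

definition qry_addr_exp :: "nat \<Rightarrow> iexp" where
  "qry_addr_exp e = isum (\<lambda>k. IMul (ISub (node_exp (Suc e) 1 k) (IConst 1))
     (iprod (\<lambda>_. IMul (IConst 2) (Var vW)) k)) e"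

definition qry_valid_exp :: "nat \<Rightarrow> iexp" where
  "qry_valid_exp e = iprod (\<lambda>k. IMod (node_exp (Suc e) 1 k) (IConst 2)) e"

definition ranks :: "store \<Rightarrow> nat \<Rightarrow> nat \<Rightarrow> nat \<Rightarrow> nat" where
  "ranks S D i k = imem S aRank (i * D + k)"

context
  fixes S :: store and B N e i \<tau> :: nat
  assumes su: "set_up N S" and N: "N > 0" and B: "4 * N * Suc e + Suc e \<le> B" "(4 * N) ^ e \<le> B"
    and i: "imem S vc 0 = i" "i < N" and tau: "imem S vtau 0 = \<tau>"
    and rk: "\<And>k. k < Suc e \<Longrightarrow> ranks S (Suc e) i k < N"
begin

lemma ival_node_exp: "ival S (node_exp (Suc e) off k) = node (levels N) off (ranks S (Suc e) i) \<tau> k"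
proof -
  have "digit (levels N) \<tau> k < levels N"
    using levels_pos[OF N] by (rule digit_less)
  then have "imem S aPow (digit (levels N) \<tau> k) = 2 ^ digit (levels N) \<tau> k"
    using su by (auto simp: set_up_def)
  then show ?thesis
    using su i tau by (simp add: node_exp_def node_def set_up_def digit_def ranks_def)
qed

lemma node_exp_less:
  assumes "off \<le> 1" "k < Suc e"
  shows "node (levels N) off (ranks S (Suc e) i) \<tau> k < 2 * 2 ^ levels N"
proof -
  have "off + ranks S (Suc e) i k < 2 ^ levels N"
    using rk[OF assms(2)] assms(1) less_pow_levels[of N] by linarith
  then show ?thesis
    using node_less[of off "ranks S (Suc e) i" k "levels N" \<tau>] by simp
qed

lemma base_le: "4 * N \<le> B"
proof -
  have "4 * N * 1 \<le> 4 * N * Suc e"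
    by (intro mult_left_mono) auto
  then show ?thesis
    using B by linarith
qed

lemma pow_le: "b \<le> 4 * N \<Longrightarrow> k \<le> e \<Longrightarrow> b ^ k \<le> B"
proof -
  assume "b \<le> 4 * N" "k \<le> e"
  then have "b ^ k \<le> (4 * N) ^ k"
    by (intro power_mono) auto
  also have "\<dots> \<le> (4 * N) ^ e"
    using N \<open>k \<le> e\<close> by (intro power_increasing) auto
  finally show "b ^ k \<le> B"
    using B by simp
qed

lemma isafe_node_exp:
  assumes "off \<le> 1" "k < Suc e"
  shows "isafe B S (node_exp (Suc e) off k)"
proof -
  have "isafe B S (iprod (\<lambda>_. Var vL) k)"
    using su levels_pos[OF N] levels_le[OF N] pow_le[of "levels N" k] assms N
    by (intro isafe_iprod_pow[where b = "levels N"]) (auto simp: set_up_def)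
  moreover have "2 ^ levels N + off + ranks S (Suc e) i k \<le> B" "2 ^ levels N + off \<le> B"
    using rk[OF assms(2)] assms(1) less_pow_levels[of N] pow_levels_le[OF N] base_le by linarith+
  moreover have "i * Suc e + k \<le> B" "i * Suc e \<le> B" "k \<le> B" "Suc e \<le> B"
  proof -
    have "i * Suc e \<le> N * Suc e"
      using i by (intro mult_right_mono) auto
    then show "i * Suc e + k \<le> B" "i * Suc e \<le> B" "k \<le> B" "Suc e \<le> B"
      using B assms by linarith+
  qed
  ultimately show ?thesis
    using su i assms base_le N unfolding node_exp_def by (auto simp: set_up_def ranks_def)
qed

text \<open>The origin of the bound \<open>(4 * N) ^ e\<close>: addresses in the tree have
  \<open>e\<close> digits to the base \<open>2 ^ Suc (levels N)\<close>.\<close>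

lemma W_le: "2 * 2 ^ levels N \<le> 4 * N"
  using pow_levels_le[OF N] by simp

lemma isafe_iprod_W: "k < Suc e \<Longrightarrow> isafe B S (iprod (\<lambda>_. IMul (IConst 2) (Var vW)) k)"
  using su pow_le[OF W_le] W_le base_le N
  by (intro isafe_iprod_pow[where b = "2 * 2 ^ levels N"]) (auto simp: set_up_def)

lemma isafe_address:
  assumes "\<And>k. k < e \<Longrightarrow> isafe B S (f k)" "\<And>k. k < e \<Longrightarrow> ival S (f k) < 2 * 2 ^ levels N"
  shows "isafe B S (isum (\<lambda>k. IMul (f k) (iprod (\<lambda>_. IMul (IConst 2) (Var vW)) k)) e)"
    (is ?thesis1)
    and "ival S (isum (\<lambda>k. IMul (f k) (iprod (\<lambda>_. IMul (IConst 2) (Var vW)) k)) e)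
      = encode (2 ^ Suc (levels N)) e (\<lambda>k. ival S (f k))"
proof -
  let ?Z = "2 * 2 ^ levels N :: nat"
  show val: "ival S (isum (\<lambda>k. IMul (f k) (iprod (\<lambda>_. IMul (IConst 2) (Var vW)) k)) e)
      = encode (2 ^ Suc (levels N)) e (\<lambda>k. ival S (f k))"
    using su by (simp add: encode_def set_up_def)
  have "encode (2 ^ Suc (levels N)) e (\<lambda>k. ival S (f k)) < (2 ^ Suc (levels N)) ^ e"
    using assms by (intro encode_less) auto
  then have "encode (2 ^ Suc (levels N)) e (\<lambda>k. ival S (f k)) \<le> B"
    using pow_le[OF W_le, of e] by simp
  moreover have "ival S (f k) * ?Z ^ k \<le> B" if "k < e" for k
  proof -
    have "ival S (f k) * ?Z ^ k \<le> ?Z * ?Z ^ k"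
      using assms(2)[OF that] by (intro mult_right_mono) auto
    also have "\<dots> = ?Z ^ Suc k"
      by simp
    also have "\<dots> \<le> B"
      using that by (intro pow_le[OF W_le]) auto
    finally show ?thesis .
  qed
  ultimately show ?thesis1
    using assms isafe_iprod_W su unfolding val[symmetric]
    by (intro isafe_isum) (auto simp: set_up_def)
qed

lemma upd_addr_exp_eval:
  "isafe B S (upd_addr_exp e)" "ival S (upd_addr_exp e) = upd_addr (levels N) e (ranks S (Suc e) i) \<tau>"
  unfolding upd_addr_exp_def using isafe_node_exp[of 0] node_exp_less[of 0]
  by (auto intro!: isafe_address(1) simp del: ival_isum simp: ival_node_exp isafe_address(2) upd_addr_def)

lemma qry_addr_exp_eval:
  "isafe B S (qry_addr_exp e)" "ival S (qry_addr_exp e) = qry_addr (levels N) e (ranks S (Suc e) i) \<tau>"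
  unfolding qry_addr_exp_def using isafe_node_exp[of 1] node_exp_less[of 1] base_le N
  by (auto intro!: isafe_address(1) simp del: ival_isum
      simp: ival_node_exp isafe_address(2) qry_addr_def less_imp_diff_less)

lemma qry_valid_exp_eval:
  "isafe B S (qry_valid_exp e)" "ival S (qry_valid_exp e) = qry_valid (levels N) e (ranks S (Suc e) i) \<tau>"
  unfolding qry_valid_exp_def using isafe_node_exp[of 1] base_le N
  by (auto intro!: isafe_iprod_pow[where b = 1] simp: ival_node_exp qry_valid_def)

end

section \<open>Insertions and queries\<close>

definition update_step :: "nat \<Rightarrow> prog" where
  "update_step e = RAssign rT (upd_addr_exp e) (RAdd (RArr rT (upd_addr_exp e)) (RVar rw))"

definition query_step :: "nat \<Rightarrow> prog" where
  "query_step e = RAssign rC (Var vc)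
     (RAdd (RArr rC (Var vc)) (RMul (ROfNat (qry_valid_exp e)) (RArr rT (qry_addr_exp e))))"

text \<open>How often the insertion of a point with ranks \<open>\<rho>\<close> touches the cell
  \<open>a\<close>. Since insertions are linear in the weight, the contents of the tree are
  described by sums of such functions.\<close>

definition cover :: "nat \<Rightarrow> nat \<Rightarrow> (nat \<Rightarrow> nat) \<Rightarrow> nat \<Rightarrow> nat" where
  "cover L e \<rho> a = (\<Sum>\<tau><L ^ e. of_bool (upd_addr L e \<rho> \<tau> = a))"

lemma ranks_same: "same X Y S S' \<Longrightarrow> aRank \<notin> X \<Longrightarrow> ranks S' = ranks S"
  by (auto simp: ranks_def same_def fun_eq_iff)

text \<open>The new contents are given at all addresses at once. Hence the order of insertions does
  not matter, and a negated weight undoes an insertion.\<close>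

lemma run_update:
  assumes su: "set_up N S" and N: "N > 0" and B: "4 * N * Suc e + Suc e \<le> B" "(4 * N) ^ e < B"
    and i: "imem S vc 0 = i" "i < N" and LE: "imem S vLE 0 = levels N ^ e"
    and rk: "\<And>k. k < Suc e \<Longrightarrow> ranks S (Suc e) i k < N"
  shows "run B (For vtau vLE (update_step e)) S (levels N ^ e * (pcost (update_step e) + 12) + 9)
    (\<lambda>S'. same {vtau} {rT} S S' \<and> rmem S' rT =
      (\<lambda>a. rmem S rT a + rmem S rw 0 * real (cover (levels N) e (ranks S (Suc e) i) a)))"
proof (rule run_For[where P = "\<lambda>m S'. same {vtau} {rT} S S' \<and> rmem S' rT =
      (\<lambda>a. rmem S rT a + rmem S rw 0 *
        (\<Sum>\<tau><m. of_bool (upd_addr (levels N) e (ranks S (Suc e) i) \<tau> = a)))"])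
  have "levels N ^ e \<le> (4 * N) ^ e"
    using levels_le[OF N] by (intro power_mono) auto
  then show "levels N ^ e < B"
    using B by simp
  fix \<tau> S'
  assume inv: "same {vtau} {rT} S S' \<and> rmem S' rT =
      (\<lambda>a. rmem S rT a + rmem S rw 0 *
        (\<Sum>\<tau><\<tau>. of_bool (upd_addr (levels N) e (ranks S (Suc e) i) \<tau> = a)))"
    and tau: "imem S' vtau 0 = \<tau>"
  then have sm: "same {vtau} {rT} S S'"
    by blast
  have pre: "set_up N S'" "imem S' vc 0 = i" "\<And>k. k < Suc e \<Longrightarrow> ranks S' (Suc e) i k < N"
    "ranks S' = ranks S" "rmem S' rw = rmem S rw"
    using set_up_same[OF su sm] ranks_same[OF sm] i rk same_imem[OF sm] same_rmem[OF sm] by auto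
  note ev = upd_addr_exp_eval[OF pre(1) N B(1) less_imp_le[OF B(2)] pre(2) i(2) tau pre(3)]
  show "run B (update_step e) S' (pcost (update_step e)) (\<lambda>S''. (same {vtau} {rT} S S'' \<and> rmem S'' rT =
      (\<lambda>a. rmem S rT a + rmem S rw 0 *
        (\<Sum>\<tau><Suc \<tau>. of_bool (upd_addr (levels N) e (ranks S (Suc e) i) \<tau> = a)))) \<and> imem S'' vtau 0 = \<tau>)"
  proof (rule run_straight)
    show "psafe B (update_step e) S'"
      using ev by (simp add: update_step_def)
    show "(same {vtau} {rT} S (effect (update_step e) S') \<and> rmem (effect (update_step e) S') rT =
      (\<lambda>a. rmem S rT a + rmem S rw 0 *
        (\<Sum>\<tau><Suc \<tau>. of_bool (upd_addr (levels N) e (ranks S (Suc e) i) \<tau> = a)))) \<and>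
        imem (effect (update_step e) S') vtau 0 = \<tau>"
      using inv tau ev pre by (auto simp: update_step_def fun_eq_iff algebra_simps simp del: sum_of_bool_eq)
  qed simp
qed (use LE in \<open>auto simp: same_def cover_def\<close>)

lemma run_query:
  assumes su: "set_up N S" and N: "N > 0" and B: "4 * N * Suc e + Suc e \<le> B" "(4 * N) ^ e < B"
    and i: "imem S vc 0 = i" "i < N" and LE: "imem S vLE 0 = levels N ^ e"
    and rk: "\<And>k. k < Suc e \<Longrightarrow> ranks S (Suc e) i k < N"
    and zero: "rmem S rC i = 0"
  shows "run B (For vtau vLE (query_step e)) S (levels N ^ e * (pcost (query_step e) + 12) + 9)
    (\<lambda>S'. same {vtau} {rC} S S' \<and> rmem S' rC = (rmem S rC)(i := (\<Sum>\<tau><levels N ^ e.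
        real (qry_valid (levels N) e (ranks S (Suc e) i) \<tau>) *
        rmem S rT (qry_addr (levels N) e (ranks S (Suc e) i) \<tau>))))"
proof (rule run_For[where P = "\<lambda>m S'. same {vtau} {rC} S S' \<and> rmem S' rC = (rmem S rC)(i := (\<Sum>\<tau><m.
        real (qry_valid (levels N) e (ranks S (Suc e) i) \<tau>) *
        rmem S rT (qry_addr (levels N) e (ranks S (Suc e) i) \<tau>)))"])
  have "levels N ^ e \<le> (4 * N) ^ e"
    using levels_le[OF N] by (intro power_mono) auto
  then show "levels N ^ e < B"
    using B by simp
  fix \<tau> S'
  assume inv: "same {vtau} {rC} S S' \<and> rmem S' rC = (rmem S rC)(i := (\<Sum>\<tau><\<tau>.
        real (qry_valid (levels N) e (ranks S (Suc e) i) \<tau>) *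
        rmem S rT (qry_addr (levels N) e (ranks S (Suc e) i) \<tau>)))"
    and tau: "imem S' vtau 0 = \<tau>"
  then have sm: "same {vtau} {rC} S S'"
    by blast
  have pre: "set_up N S'" "imem S' vc 0 = i" "\<And>k. k < Suc e \<Longrightarrow> ranks S' (Suc e) i k < N"
    "ranks S' = ranks S" "rmem S' rT = rmem S rT"
    using set_up_same[OF su sm] ranks_same[OF sm] i rk same_imem[OF sm] same_rmem[OF sm] by auto
  note ev = qry_addr_exp_eval[OF pre(1) N B(1) less_imp_le[OF B(2)] pre(2) i(2) tau pre(3)]
    qry_valid_exp_eval[OF pre(1) N B(1) less_imp_le[OF B(2)] pre(2) i(2) tau pre(3)]
  show "run B (query_step e) S' (pcost (query_step e)) (\<lambda>S''. (same {vtau} {rC} S S'' \<and>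
      rmem S'' rC = (rmem S rC)(i := (\<Sum>\<tau><Suc \<tau>.
        real (qry_valid (levels N) e (ranks S (Suc e) i) \<tau>) *
        rmem S rT (qry_addr (levels N) e (ranks S (Suc e) i) \<tau>)))) \<and> imem S'' vtau 0 = \<tau>)"
    by (rule run_straight) (use inv tau ev pre in \<open>auto simp: query_step_def fun_eq_iff\<close>)
qed (use LE zero in \<open>auto simp: same_def\<close>)

text \<open>Exchanging the sums leaves, for every stored point, the coefficient evaluated by
  \<open>dyadic_dominance\<close>.\<close>

lemma sum_query:
  fixes w :: "nat \<Rightarrow> real"
  assumes "finite J" "\<And>j k. j \<in> J \<Longrightarrow> k < e \<Longrightarrow> \<rho> j k < 2 ^ L" "\<And>k. k < e \<Longrightarrow> \<rho>' k + 1 < 2 ^ L"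
  shows "(\<Sum>\<tau><L ^ e. real (qry_valid L e \<rho>' \<tau>) *
      (\<Sum>j\<in>J. w j * real (cover L e (\<rho> j) (qry_addr L e \<rho>' \<tau>))))
    = (\<Sum>j\<in>J. w j * of_bool (\<forall>k<e. \<rho> j k \<le> \<rho>' k))"
proof -
  have "(\<Sum>\<tau><L ^ e. real (qry_valid L e \<rho>' \<tau>) *
      (\<Sum>j\<in>J. w j * real (cover L e (\<rho> j) (qry_addr L e \<rho>' \<tau>))))
    = (\<Sum>j\<in>J. w j * real (\<Sum>\<tau><L ^ e. qry_valid L e \<rho>' \<tau> * cover L e (\<rho> j) (qry_addr L e \<rho>' \<tau>)))"
    unfolding sum_distrib_left of_nat_sum by (subst sum.swap) (simp add: mult_ac)
  also have "\<dots> = (\<Sum>j\<in>J. w j * of_bool (\<forall>k<e. \<rho> j k \<le> \<rho>' k))"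
    unfolding cover_def using assms by (intro sum.cong refl) (simp add: dyadic_dominance del: sum_of_bool_eq)
  finally show ?thesis .
qed

text \<open>
  Insertions and queries are merged along the last coordinate; insertions go first on equal ranks, as
  dominance is not strict.
\<close>

definition sweep :: "nat \<Rightarrow> prog" where
  "sweep e = (let rank = (\<lambda>p. IArr aRank (IAdd (IMul (IArr aOrd (IMod (Var p) (Var vN))) (IConst (Suc e))) (IConst e)))
     in ISet vLE (iprod (\<lambda>_. Var vL) e) ;; ISet vj (IConst 0) ;; ISet vv (IConst 0) ;;
       ISet vNN (IMul (IConst 2) (Var vN)) ;;
       For vs vNN (If (BAnd (ILess (Var vj) (Var vN)) (BNot (ILess (rank vv) (rank vj))))
         (ISet vc (IArr aOrd (Var vj)) ;; RSet rw (RArr rWt (Var vc)) ;;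
          ISet vj (IAdd (Var vj) (IConst 1)) ;; For vtau vLE (update_step e))
         (ISet vc (IArr aOrd (Var vv)) ;; RAssign rC (Var vc) (ROfNat (IConst 0)) ;;
          ISet vv (IAdd (Var vv) (IConst 1)) ;; For vtau vLE (query_step e))))"

text \<open>
  Insertion with negated weights clears the tree in the time of the sweep, so that counting can be
  repeated without scanning the whole tree.
\<close>

definition cleanup :: "nat \<Rightarrow> prog" where
  "cleanup e = For vi vN (ISet vc (Var vi) ;;
     RSet rw (RSub (ROfNat (IConst 0)) (RArr rWt (Var vc))) ;; For vtau vLE (update_step e))"

definition tree_sum :: "nat \<Rightarrow> nat \<Rightarrow> (nat \<Rightarrow> nat \<Rightarrow> nat) \<Rightarrow> (nat \<Rightarrow> real) \<Rightarrow> nat set \<Rightarrow> nat \<Rightarrow> real" where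
  "tree_sum L e \<rho> w J a = (\<Sum>j\<in>J. w j * real (cover L e (\<rho> j) a))"

lemma run_cleanup:
  assumes su: "set_up N S" and N: "N > 0" and B: "4 * N * Suc e + Suc e < B" "(4 * N) ^ e < B"
    and LE: "imem S vLE 0 = levels N ^ e"
    and rk: "\<And>i k. i < N \<Longrightarrow> k < Suc e \<Longrightarrow> ranks S (Suc e) i k < N"
    and T: "rmem S rT = tree_sum (levels N) e (ranks S (Suc e)) (rmem S rWt) {..<N}"
  shows "run B (cleanup e) S (N * (levels N ^ e * (pcost (update_step e) + 12) + 50) + 9)
    (\<lambda>S'. same {vi, vc, vtau} {rw, rT} S S' \<and> (\<forall>a. rmem S' rT a = 0))"
  unfolding cleanup_def
proof (rule run_mono[OF run_For[where N = N and T = "20 + (levels N ^ e * (pcost (update_step e) + 12) + 9)" and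
      P = "\<lambda>i S'. same {vi, vc, vtau} {rw, rT} S S' \<and>
        rmem S' rT = tree_sum (levels N) e (ranks S (Suc e)) (rmem S rWt) {i..<N}"]])
  show "same {vi, vc, vtau} {rw, rT} S S \<and>
        rmem S rT = tree_sum (levels N) e (ranks S (Suc e)) (rmem S rWt) {0..<N}"
    using T by (simp add: lessThan_atLeast0)
  have "N \<le> 4 * N * Suc e"
    by simp
  then show "N < B"
    using B by linarith
  fix i S' assume i: "i < N" and inv: "same {vi, vc, vtau} {rw, rT} S S' \<and>
        rmem S' rT = tree_sum (levels N) e (ranks S (Suc e)) (rmem S rWt) {i..<N}"
    and ci: "imem S' vi 0 = i"
  then have sm: "same {vi, vc, vtau} {rw, rT} S S'"
    by blast
  let ?pre = "ISet vc (Var vi) ;; RSet rw (RSub (ROfNat (IConst 0)) (RArr rWt (Var vc)))"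
  let ?S1 = "rupd rw 0 (- rmem S rWt i) (iupd vc 0 i S')"
  have pre: "run B ?pre S' 20 (\<lambda>S''. S'' = ?S1)"
    by (rule run_straight) (use ci same_rmem[OF sm, of rWt] in auto)
  have sm1: "same {vi, vc, vtau} {rw, rT} S ?S1"
    using sm by simp
  have r1: "ranks ?S1 = ranks S"
    by (rule ranks_same[OF sm1]) simp
  have "run B (?pre ;; For vtau vLE (update_step e)) S' (20 + (levels N ^ e * (pcost (update_step e) + 12) + 9))
    (\<lambda>S''. same {vtau} {rT} ?S1 S'' \<and> rmem S'' rT =
      (\<lambda>a. rmem ?S1 rT a + rmem ?S1 rw 0 * real (cover (levels N) e (ranks ?S1 (Suc e) i) a)))"
  proof (rule run_Seq[OF pre], clarify)
    show "run B (For vtau vLE (update_step e)) ?S1 (levels N ^ e * (pcost (update_step e) + 12) + 9)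
      (\<lambda>S''. same {vtau} {rT} ?S1 S'' \<and> rmem S'' rT =
        (\<lambda>a. rmem ?S1 rT a + rmem ?S1 rw 0 * real (cover (levels N) e (ranks ?S1 (Suc e) i) a)))"
    proof (rule run_update)
      show "set_up N ?S1"
        by (rule set_up_same[OF su sm1]) simp
    qed (use r1 rk[OF i] N B i LE same_imem[OF sm, of vLE] in auto)
  qed
  then show "run B (?pre ;; For vtau vLE (update_step e)) S' (20 + (levels N ^ e * (pcost (update_step e) + 12) + 9))
    (\<lambda>S''. (same {vi, vc, vtau} {rw, rT} S S'' \<and>
        rmem S'' rT = tree_sum (levels N) e (ranks S (Suc e)) (rmem S rWt) {Suc i..<N}) \<and> imem S'' vi 0 = i)"
  proof (rule run_mono)
    fix S'' assume *: "same {vtau} {rT} ?S1 S'' \<and> rmem S'' rT =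
      (\<lambda>a. rmem ?S1 rT a + rmem ?S1 rw 0 * real (cover (levels N) e (ranks ?S1 (Suc e) i) a))"
    have "same {vi, vc, vtau} {rw, rT} S S''"
      by (rule same_trans[OF sm1]) (use * in auto)
    moreover have "imem S'' vi 0 = i"
      using * ci by (auto simp: same_def)
    moreover have "rmem S'' rT = tree_sum (levels N) e (ranks S (Suc e)) (rmem S rWt) {Suc i..<N}"
      using * inv i by (auto simp: fun_eq_iff r1 tree_sum_def sum.atLeast_Suc_lessThan)
    ultimately show "(same {vi, vc, vtau} {rw, rT} S S'' \<and>
        rmem S'' rT = tree_sum (levels N) e (ranks S (Suc e)) (rmem S rWt) {Suc i..<N}) \<and> imem S'' vi 0 = i"
      by blast
  qed simp
qed (use su in \<open>auto simp: same_def set_up_def tree_sum_def\<close>)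

lemma run_sweep:
  assumes su: "set_up N S" and N: "N > 0" and B: "4 * N * Suc e + Suc e < B" "(4 * N) ^ e < B"
    and rk: "\<And>i k. i < N \<Longrightarrow> k < Suc e \<Longrightarrow> ranks S (Suc e) i k < N"
    and ord: "inj_on (imem S aOrd) {..<N}" "imem S aOrd ` {..<N} = {..<N}"
    and sorted: "\<And>u u'. u \<le> u' \<Longrightarrow> u' < N \<Longrightarrow>
      ranks S (Suc e) (imem S aOrd u) e \<le> ranks S (Suc e) (imem S aOrd u') e"
    and T: "\<And>a. rmem S rT a = 0"
  shows "run B (sweep e) S (N * (2 * levels N ^ e * (pcost (update_step e) + pcost (query_step e) + 12) + 300) + icost (iprod (\<lambda>_. Var vL) e) + 50)
    (\<lambda>S'. same {vLE, vj, vv, vNN, vs, vc, vtau} {rw, rT, rC} S S' \<and> imem S' vLE 0 = levels N ^ e \<and>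
      rmem S' rT = tree_sum (levels N) e (ranks S (Suc e)) (rmem S rWt) {..<N} \<and>
      (\<forall>i<N. rmem S' rC i = (\<Sum>j<N. rmem S rWt j *
         of_bool (\<forall>k<Suc e. ranks S (Suc e) j k \<le> ranks S (Suc e) i k))))"
proof -
  define X where "X = {vLE, vj, vv, vNN, vs, vc, vtau}"
  define Y where "Y = {rw, rT, rC}"
  define L where "L = levels N"
  define w where "w = rmem S rWt"
  define \<rho> where "\<rho> = ranks S (Suc e)"
  define od where "od = imem S aOrd"
  define res where "res = (\<lambda>i. \<Sum>j<N. w j * of_bool (\<forall>k<Suc e. \<rho> j k \<le> \<rho> i k))"
  \<comment> \<open>\<open>vj\<close> counts the insertions and \<open>vv\<close> the queries made
    so far. No inserted point exceeds the next query in the last coordinate, and the queries cannot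
    be exhausted before the insertions are.\<close>
  define P where "P = (\<lambda>m S'. same X Y S S' \<and> imem S' vLE 0 = L ^ e \<and> imem S' vNN 0 = 2 * N \<and>
     imem S' vj 0 + imem S' vv 0 = m \<and> imem S' vj 0 \<le> N \<and> imem S' vv 0 \<le> N \<and>
     (imem S' vv 0 = N \<longrightarrow> imem S' vj 0 = N) \<and>
     (imem S' vv 0 < N \<longrightarrow> (\<forall>u<imem S' vj 0. \<rho> (od u) e \<le> \<rho> (od (imem S' vv 0)) e)) \<and>
     rmem S' rT = tree_sum L e \<rho> w (od ` {..<imem S' vj 0}) \<and>
     (\<forall>u<imem S' vv 0. rmem S' rC (od u) = res (od u)))"
  let ?rank = "\<lambda>p. IArr aRank (IAdd (IMul (IArr aOrd (IMod (Var p) (Var vN))) (IConst (Suc e))) (IConst e))"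
  let ?init = "ISet vLE (iprod (\<lambda>_. Var vL) e) ;; ISet vj (IConst 0) ;; ISet vv (IConst 0) ;;
       ISet vNN (IMul (IConst 2) (Var vN))"
  let ?ins = "ISet vc (IArr aOrd (Var vj)) ;; RSet rw (RArr rWt (Var vc)) ;; ISet vj (IAdd (Var vj) (IConst 1))"
  let ?qry = "ISet vc (IArr aOrd (Var vv)) ;; RAssign rC (Var vc) (ROfNat (IConst 0)) ;; ISet vv (IAdd (Var vv) (IConst 1))"
  let ?cond = "BAnd (ILess (Var vj) (Var vN)) (BNot (ILess (?rank vv) (?rank vj)))"
  let ?body = "If ?cond (?ins ;; For vtau vLE (update_step e)) (?qry ;; For vtau vLE (query_step e))"
  let ?T = "L ^ e * (pcost (update_step e) + pcost (query_step e) + 12) + 9"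
  have "4 * N * 1 \<le> 4 * N * Suc e"
    by (intro mult_left_mono) auto
  then have NB: "4 * N < B"
    using B by linarith
  have oN: "od u < N" if "u < N" for u
    using that ord(2) unfolding od_def by auto
  have init: "run B ?init S (icost (iprod (\<lambda>_. Var vL) e) + 20) (P 0)"
  proof (rule run_straight)
    have "levels N ^ e \<le> (4 * N) ^ e"
      using levels_le[OF N] by (intro power_mono) auto
    then have "isafe B S (iprod (\<lambda>_. Var vL) e)"
      using su levels_pos[OF N] B
      by (intro isafe_iprod_pow[where b = "levels N"]) (auto simp: set_up_def)
    then show "psafe B ?init S"
      using NB N su by (auto simp: set_up_def)
    show "P 0 (effect ?init S)"
      using su N T by (auto simp: P_def X_def Y_def set_up_def L_def tree_sum_def fun_eq_iff)
  qed simp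
  have loop: "run B (For vs vNN ?body) S1 (2 * N * (1 + bcost ?cond + (20 + ?T) + 12) + 9) (P (2 * N))"
    if "P 0 S1" for S1
  proof (rule run_For[where P = P])
    show "2 * N < B"
      using NB by simp
    show "P i (iupd vs 0 v S')" if "P i S'" for i v S'
      using that by (simp add: P_def X_def)
    fix m S' assume m: "m < 2 * N" and P: "P m S'" and cm: "imem S' vs 0 = m"
    define j where "j = imem S' vj 0"
    define v where "v = imem S' vv 0"
    have sm: "same X Y S S'"
      using P by (simp add: P_def)
    have jv: "j + v = m" "j \<le> N" "v \<le> N" "v = N \<longrightarrow> j = N" "v < N"
      using P m unfolding P_def j_def v_def by auto
    have su': "set_up N S'"
      by (rule set_up_same[OF su sm]) (simp add: X_def)
    have eqs: "imem S' aOrd = od" "imem S' vN 0 = N" "rmem S' rWt = w" "imem S' aRank = imem S aRank"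
      "imem S' vLE 0 = L ^ e" "ranks S' = ranks S"
      using sm su P ranks_same[OF sm] by (auto simp: same_def X_def Y_def od_def w_def set_up_def P_def)
    have cell: "od u * Suc e + e \<le> B" "od u * Suc e \<le> B" if "u < N" for u
    proof -
      have "od u * Suc e \<le> N * Suc e"
        using oN[OF that] by (intro mult_right_mono) auto
      moreover have "N * Suc e \<le> 4 * N * Suc e"
        by simp
      ultimately show "od u * Suc e + e \<le> B" "od u * Suc e \<le> B"
        using B by linarith+
    qed
    show "run B ?body S' (1 + bcost ?cond + (20 + ?T)) (\<lambda>S''. P (Suc m) S'' \<and> imem S'' vs 0 = m)"
    proof (rule run_If)
      \<comment> \<open>All parts of the test are evaluated, even when \<open>vj\<close> has reached
        \<open>N\<close>; the reduction modulo \<open>N\<close> keeps the address meaningful and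
        within the word bound.\<close>
      have "j mod N < N" "v mod N < N" "Suc e \<le> B"
        using N B by auto
      then show "bsafe B S' ?cond"
        using cell[of "j mod N"] cell[of "v mod N"] by (auto simp: eqs j_def v_def)
    next
      assume "bval S' ?cond"
      then have jN: "j < N" and le: "\<rho> (od j) e \<le> \<rho> (od v) e"
        using jv by (auto simp: eqs \<rho>_def ranks_def j_def v_def)
      let ?S1 = "iupd vj 0 (Suc j) (rupd rw 0 (w (od j)) (iupd vc 0 (od j) S'))"
      have pre: "run B ?ins S' 20 (\<lambda>S''. S'' = ?S1)"
        by (rule run_straight) (use eqs jN NB in \<open>auto simp: j_def\<close>)
      have sm1: "same X Y S ?S1"
        using sm by (simp add: X_def Y_def)
      have r1: "ranks ?S1 = ranks S"
        by (rule ranks_same[OF sm1]) (simp add: X_def)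
      have "run B (?ins ;; For vtau vLE (update_step e)) S' (20 + (levels N ^ e * (pcost (update_step e) + 12) + 9))
        (\<lambda>S''. same {vtau} {rT} ?S1 S'' \<and> rmem S'' rT =
          (\<lambda>a. rmem ?S1 rT a + rmem ?S1 rw 0 * real (cover (levels N) e (ranks ?S1 (Suc e) (od j)) a)))"
      proof (rule run_Seq[OF pre], clarify)
        show "run B (For vtau vLE (update_step e)) ?S1 (levels N ^ e * (pcost (update_step e) + 12) + 9)
          (\<lambda>S''. same {vtau} {rT} ?S1 S'' \<and> rmem S'' rT =
            (\<lambda>a. rmem ?S1 rT a + rmem ?S1 rw 0 * real (cover (levels N) e (ranks ?S1 (Suc e) (od j)) a)))"
        proof (rule run_update)
          show "set_up N ?S1"
            by (rule set_up_same[OF su sm1]) (simp add: X_def)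
        qed (use r1 rk[OF oN[OF jN]] N B oN[OF jN] eqs in \<open>auto simp: L_def\<close>)
      qed
      then show "run B (?ins ;; For vtau vLE (update_step e)) S' (20 + ?T) (\<lambda>S''. P (Suc m) S'' \<and> imem S'' vs 0 = m)"
      proof (rule run_mono)
        fix S'' assume *: "same {vtau} {rT} ?S1 S'' \<and> rmem S'' rT =
          (\<lambda>a. rmem ?S1 rT a + rmem ?S1 rw 0 * real (cover (levels N) e (ranks ?S1 (Suc e) (od j)) a))"
        have "same X Y S S''"
          by (rule same_trans[OF sm1]) (use * in \<open>auto simp: X_def Y_def\<close>)
        moreover have "imem S'' vs 0 = m" "imem S'' vj 0 = Suc j" "imem S'' vv 0 = v" "imem S'' vLE 0 = L ^ e"
          "imem S'' vNN 0 = 2 * N" "rmem S'' rC = rmem S' rC"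
          using * cm eqs P by (auto simp: same_def v_def P_def)
        moreover have "od j \<notin> od ` {..<j}"
          using inj_on_image_mem_iff[OF ord(1)[folded od_def], of j "{..<j}"] jN by auto
        then have "rmem S'' rT = tree_sum L e \<rho> w (od ` {..<Suc j})"
          using * P by (auto simp: fun_eq_iff r1 tree_sum_def lessThan_Suc P_def j_def[symmetric] \<rho>_def L_def)
        ultimately show "P (Suc m) S'' \<and> imem S'' vs 0 = m"
          using P jv jN le by (auto simp: P_def j_def[symmetric] v_def[symmetric] less_Suc_eq)
      qed (simp add: L_def algebra_simps)
    next
      assume "\<not> bval S' ?cond"
      then have stop: "j < N \<Longrightarrow> \<rho> (od v) e < \<rho> (od j) e"
        using jv by (auto simp: eqs \<rho>_def ranks_def j_def v_def)
      let ?i = "od v"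
      let ?S1 = "iupd vv 0 (Suc v) (rupd rC ?i 0 (iupd vc 0 ?i S'))"
      have pre: "run B ?qry S' 20 (\<lambda>S''. S'' = ?S1)"
        by (rule run_straight) (use eqs jv NB in \<open>auto simp: v_def\<close>)
      have sm1: "same X Y S ?S1"
        using sm by (simp add: X_def Y_def)
      have r1: "ranks ?S1 = ranks S"
        by (rule ranks_same[OF sm1]) (simp add: X_def)
      let ?q = "\<Sum>\<tau><levels N ^ e. real (qry_valid (levels N) e (ranks ?S1 (Suc e) ?i) \<tau>) *
            rmem ?S1 rT (qry_addr (levels N) e (ranks ?S1 (Suc e) ?i) \<tau>)"
      have "run B (?qry ;; For vtau vLE (query_step e)) S' (20 + (levels N ^ e * (pcost (query_step e) + 12) + 9))
        (\<lambda>S''. same {vtau} {rC} ?S1 S'' \<and> rmem S'' rC = (rmem ?S1 rC)(?i := ?q))"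
      proof (rule run_Seq[OF pre], clarify)
        show "run B (For vtau vLE (query_step e)) ?S1 (levels N ^ e * (pcost (query_step e) + 12) + 9)
          (\<lambda>S''. same {vtau} {rC} ?S1 S'' \<and> rmem S'' rC = (rmem ?S1 rC)(?i := ?q))"
        proof (rule run_query)
          show "set_up N ?S1"
            by (rule set_up_same[OF su sm1]) (simp add: X_def)
        qed (use r1 rk[OF oN[OF jv(5)]] N B oN[OF jv(5)] eqs in \<open>auto simp: L_def\<close>)
      qed
      then show "run B (?qry ;; For vtau vLE (query_step e)) S' (20 + ?T) (\<lambda>S''. P (Suc m) S'' \<and> imem S'' vs 0 = m)"
      proof (rule run_mono)
        fix S'' assume *: "same {vtau} {rC} ?S1 S'' \<and> rmem S'' rC = (rmem ?S1 rC)(?i := ?q)"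
        have "same X Y S S''"
          by (rule same_trans[OF sm1]) (use * in \<open>auto simp: X_def Y_def\<close>)
        moreover have "imem S'' vs 0 = m" "imem S'' vj 0 = j" "imem S'' vv 0 = Suc v" "imem S'' vLE 0 = L ^ e"
          "imem S'' vNN 0 = 2 * N" "rmem S'' rT = rmem S' rT"
          using * cm eqs P by (auto simp: same_def j_def P_def)
        moreover have "?q = res ?i"
        proof -
          \<comment> \<open>At a query, the tree holds exactly the points that are no larger in the
            last coordinate: the inserted ones are by the invariant, and the first one still waiting
            is too large by \<open>stop\<close>, hence so are those after it.\<close>
          have J: "od ` {..<j} = {i\<in>{..<N}. \<rho> i e \<le> \<rho> ?i e}"
          proof (intro equalityI subsetI)
            fix i assume "i \<in> od ` {..<j}"
            then show "i \<in> {i\<in>{..<N}. \<rho> i e \<le> \<rho> ?i e}"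
              using P jv oN by (auto simp: P_def j_def[symmetric] v_def[symmetric])
          next
            fix i assume i: "i \<in> {i\<in>{..<N}. \<rho> i e \<le> \<rho> ?i e}"
            then obtain u where u: "i = od u" "u < N"
              using ord(2) unfolding od_def[symmetric] by auto
            have "u < j"
            proof (rule ccontr)
              assume "\<not> u < j"
              then have "\<rho> (od j) e \<le> \<rho> i e" "j < N"
                using sorted[of j u] u unfolding \<rho>_def od_def by auto
              then show False
                using stop i by auto
            qed
            then show "i \<in> od ` {..<j}"
              using u by auto
          qed
          have "?q = (\<Sum>\<tau><L ^ e. real (qry_valid L e (\<rho> ?i) \<tau>) *
             (\<Sum>i\<in>od ` {..<j}. w i * real (cover L e (\<rho> i) (qry_addr L e (\<rho> ?i) \<tau>))))"
            using P by (simp add: r1 P_def j_def[symmetric] tree_sum_def \<rho>_def[symmetric] L_def)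
          also have "\<dots> = (\<Sum>i\<in>od ` {..<j}. w i * of_bool (\<forall>k<e. \<rho> i k \<le> \<rho> ?i k))"
          proof (rule sum_query)
            have "\<rho> i k < N" if "i < N" "k < e" for i k
              using rk[of i k] that by (simp add: \<rho>_def)
            then show "\<rho> i k < 2 ^ L" if "i \<in> od ` {..<j}" "k < e" for i k
              using that less_pow_levels[of N] unfolding J L_def by fastforce
            show "\<rho> ?i k + 1 < 2 ^ L" if "k < e" for k
              using \<open>\<And>i k. i < N \<Longrightarrow> k < e \<Longrightarrow> \<rho> i k < N\<close>[OF oN[OF jv(5)] that] less_pow_levels[of N] unfolding L_def
              by linarith
          qed simp
          also have "\<dots> = (\<Sum>i<N. if \<rho> i e \<le> \<rho> ?i e then w i * of_bool (\<forall>k<e. \<rho> i k \<le> \<rho> ?i k) else 0)"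
            unfolding J by (subst sum.inter_filter) auto
          also have "\<dots> = res ?i"
            unfolding res_def by (intro sum.cong) (auto simp: less_Suc_eq)
          finally show ?thesis .
        qed
        moreover have "\<rho> (od u) e \<le> \<rho> (od (Suc v)) e" if "u < j" "Suc v < N" for u
        proof -
          have "\<rho> (od u) e \<le> \<rho> (od v) e"
            using P jv that by (auto simp: P_def j_def[symmetric] v_def[symmetric])
          also have "\<dots> \<le> \<rho> (od (Suc v)) e"
            using sorted[of v "Suc v"] that unfolding \<rho>_def od_def by auto
          finally show ?thesis .
        qed
        \<comment> \<open>Nothing can be waiting at the last query: a waiting point with position
          \<open>j \<le> v\<close> would exceed the query, against the sorting.\<close>
        moreover have "j = N" if "Suc v = N"
        proof (rule ccontr)
          assume "j \<noteq> N"
          then have "j < N" "j \<le> v"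
            using jv that by auto
          then show False
            using stop sorted[of j v] jv unfolding \<rho>_def od_def by auto
        qed
        ultimately show "P (Suc m) S'' \<and> imem S'' vs 0 = m"
          using P jv * by (auto simp: P_def j_def[symmetric] v_def[symmetric] less_Suc_eq)
      qed (simp add: L_def algebra_simps)
    qed
  qed (use that in \<open>auto simp: P_def\<close>)
  have "run B (?init ;; For vs vNN ?body) S
      ((icost (iprod (\<lambda>_. Var vL) e) + 20) + (2 * N * (1 + bcost ?cond + (20 + ?T) + 12) + 9)) (P (2 * N))"
    by (rule run_Seq[OF init loop])
  then show ?thesis
    unfolding sweep_def Let_def
  proof (rule run_mono)
    fix S' assume P: "P (2 * N) S'"
    then have "imem S' vj 0 = N" "imem S' vv 0 = N"
      by (auto simp: P_def)
    moreover have "od ` {..<N} = {..<N}"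
      using ord(2) by (simp add: od_def)
    moreover have "\<forall>i<N. rmem S' rC i = res i"
    proof (intro allI impI)
      fix i assume "i < N"
      then obtain u where "i = od u" "u < N"
        using ord(2) unfolding od_def[symmetric] by auto
      then show "rmem S' rC i = res i"
        using P \<open>imem S' vv 0 = N\<close> by (auto simp: P_def)
    qed
    ultimately show "same {vLE, vj, vv, vNN, vs, vc, vtau} {rw, rT, rC} S S' \<and> imem S' vLE 0 = levels N ^ e \<and>
      rmem S' rT = tree_sum (levels N) e (ranks S (Suc e)) (rmem S rWt) {..<N} \<and>
      (\<forall>i<N. rmem S' rC i = (\<Sum>j<N. rmem S rWt j *
         of_bool (\<forall>k<Suc e. ranks S (Suc e) j k \<le> ranks S (Suc e) i k)))"
      using P by (simp add: P_def X_def Y_def L_def res_def \<rho>_def w_def)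
  qed (simp add: L_def algebra_simps)
qed

text \<open>The last sort is by coordinate \<open>D - 1\<close>. It leaves in \<open>aOrd\<close>
  the order along which the sweep moves.\<close>

definition sort_all :: "nat \<Rightarrow> prog" where
  "sort_all D = ISet vD (IConst D) ;; For vk vD (insert_all D ;; extract_all D)"

lemma run_sort_all:
  assumes S: "set_up N S" "\<And>v. imem S aT v = 0"
    and N: "N > 0" "D > 0" "4 * N * D + D < B"
  shows "run B (sort_all D) S (D * (N * (levels N * 200 + 300) + 30) + 12)
    (\<lambda>S'. same {vD, vk, vi, vc, vx, vt, aT, aOrd, aRank} {} S S' \<and> (\<forall>v. imem S' aT v = 0) \<and>
      (\<forall>i<N. \<forall>k<D. ranks S' D i k < N) \<and>
      (\<forall>i<N. \<forall>j<N. \<forall>k<D. ranks S' D i k \<le> ranks S' D j k \<longleftrightarrow>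
        rmem S rKey (i * D + k) \<le> rmem S rKey (j * D + k)) \<and>
      inj_on (imem S' aOrd) {..<N} \<and> imem S' aOrd ` {..<N} = {..<N} \<and>
      (\<forall>u u'. u \<le> u' \<longrightarrow> u' < N \<longrightarrow> ranks S' D (imem S' aOrd u) (D - 1) \<le> ranks S' D (imem S' aOrd u') (D - 1)))"
proof -
  define X where "X = {vD, vk, vi, vc, vx, vt, aT, aOrd, aRank}"
  define key where "key = (\<lambda>k i. rmem S rKey (i * D + k))"
  define P where "P = (\<lambda>k S'. same X {} S S' \<and> imem S' vD 0 = D \<and> (\<forall>v. imem S' aT v = 0) \<and>
    (\<forall>i<N. \<forall>k'<k. ranks S' D i k' < N) \<and>
    (\<forall>i<N. \<forall>j<N. \<forall>k'<k. ranks S' D i k' \<le> ranks S' D j k' \<longleftrightarrow> key k' i \<le> key k' j) \<and>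
    (k > 0 \<longrightarrow> ranked (key (k - 1)) N N (imem S' aOrd) (\<lambda>i. ranks S' D i (k - 1))))"
  let ?T = "(N * (levels N * 100 + 80) + 9) + (N * (levels N * 100 + 200) + 9)"
  have surj: "imem S' aOrd ` {..<N} = {..<N}" if "ranked ke N N (imem S' aOrd) R" for ke R S'
    using that endo_inj_surj[of "{..<N}" "imem S' aOrd"] by (auto simp: ranked_def)
  have loop: "run B (For vk vD (insert_all D ;; extract_all D)) S1 (D * (?T + 12) + 9) (P D)" if "P 0 S1" for S1
  proof (rule run_For[where P = P])
    show "D < B"
      using N by linarith
    fix k S' assume k: "k < D" and P: "P k S'" and ck: "imem S' vk 0 = k"
    have sm: "same X {} S S'"
      using P by (simp add: P_def)
    have su': "set_up N S'"
      by (rule set_up_same[OF S(1) sm]) (simp add: X_def)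
    have key': "(\<lambda>i. rmem S' rKey (i * D + imem S' vk 0)) = key k"
      using same_rmem[OF sm, of rKey] ck by (simp add: key_def)
    let ?R = "\<lambda>S2. same {vi, vc, vx, vt, aT} {} S' S2 \<and> tree_ok (key k) (2 ^ levels N) {..<N} (imem S2 aT)"
    have "run B (insert_all D) S' (N * (levels N * 100 + 80) + 9) ?R"
      using run_insert_all[OF su', of D B] ck k P N key' by (simp add: P_def)
    then have "run B (insert_all D ;; extract_all D) S' ?T
      (\<lambda>S''. \<exists>S2. ?R S2 \<and> (same {vi, vc, vx, vt, aT, aOrd, aRank} {} S2 S'' \<and> (\<forall>v. imem S'' aT v = 0) \<and>
      ranked (key k) N N (imem S'' aOrd) (\<lambda>i. ranks S'' D i k) \<and>
      (\<forall>a. (\<forall>i<N. a \<noteq> i * D + k) \<longrightarrow> imem S'' aRank a = imem S2 aRank a)))"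
    proof (rule run_Seq)
      fix S2 assume R: "?R S2"
      have su2: "set_up N S2"
        by (rule set_up_same[OF su']) (use R in auto)
      have ck2: "imem S2 vk 0 = k" and rm: "rmem S2 = rmem S'"
        using R ck by (auto simp: same_def fun_eq_iff)
      have "(\<lambda>i. rmem S2 rKey (i * D + imem S2 vk 0)) = key k"
        using key' ck2 ck rm by simp
      then have "run B (extract_all D) S2 (N * (levels N * 100 + 200) + 9)
        (\<lambda>S''. same {vi, vc, vx, vt, aT, aOrd, aRank} {} S2 S'' \<and> (\<forall>v. imem S'' aT v = 0) \<and>
        ranked (key k) N N (imem S'' aOrd) (\<lambda>i. imem S'' aRank (i * D + k)) \<and>
        (\<forall>a. (\<forall>i<N. a \<noteq> i * D + k) \<longrightarrow> imem S'' aRank a = imem S2 aRank a))"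
        using run_extract_all[OF su2, of D B] ck2 k R N by simp
      then show "run B (extract_all D) S2 (N * (levels N * 100 + 200) + 9)
        (\<lambda>S''. \<exists>S2. ?R S2 \<and> (same {vi, vc, vx, vt, aT, aOrd, aRank} {} S2 S'' \<and> (\<forall>v. imem S'' aT v = 0) \<and>
        ranked (key k) N N (imem S'' aOrd) (\<lambda>i. ranks S'' D i k) \<and>
        (\<forall>a. (\<forall>i<N. a \<noteq> i * D + k) \<longrightarrow> imem S'' aRank a = imem S2 aRank a)))"
        by (rule run_mono) (use R in \<open>auto simp: ranks_def\<close>)
    qed
    then show "run B (insert_all D ;; extract_all D) S' ?T (\<lambda>S''. P (Suc k) S'' \<and> imem S'' vk 0 = k)"
    proof (rule run_mono)
      fix S''
      assume "\<exists>S2. ?R S2 \<and> (same {vi, vc, vx, vt, aT, aOrd, aRank} {} S2 S'' \<and> (\<forall>v. imem S'' aT v = 0) \<and>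
        ranked (key k) N N (imem S'' aOrd) (\<lambda>i. ranks S'' D i k) \<and>
        (\<forall>a. (\<forall>i<N. a \<noteq> i * D + k) \<longrightarrow> imem S'' aRank a = imem S2 aRank a))"
      then obtain S2 where R: "?R S2" and sm2: "same {vi, vc, vx, vt, aT, aOrd, aRank} {} S2 S''"
        and z: "\<forall>v. imem S'' aT v = 0" and rkd: "ranked (key k) N N (imem S'' aOrd) (\<lambda>i. ranks S'' D i k)"
        and fr: "\<forall>a. (\<forall>i<N. a \<noteq> i * D + k) \<longrightarrow> imem S'' aRank a = imem S2 aRank a"
        by blast
      have "same X {} S' S2"
        by (rule same_mono[where X = "{vi, vc, vx, vt, aT}" and Y = "{}"]) (use R in \<open>auto simp: X_def\<close>)
      moreover have "same X {} S2 S''"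
        by (rule same_mono[OF sm2]) (auto simp: X_def)
      ultimately have "same X {} S' S''"
        by (rule same_trans) auto
      with sm have "same X {} S S''"
        by (rule same_trans) auto
      moreover have "imem S'' vk 0 = k" "imem S'' vD 0 = D" "imem S2 aRank = imem S' aRank"
        using R sm2 ck P by (auto simp: same_def P_def)
      \<comment> \<open>The cells of different coordinates differ modulo \<open>D\<close>, so the
        sort by coordinate \<open>k\<close> leaves earlier ranks alone.\<close>
      moreover have old: "ranks S'' D i k' = ranks S' D i k'" if "k' < k" "i < N" for i k'
      proof -
        have "i * D + k' \<noteq> i' * D + k" for i'
        proof
          assume "i * D + k' = i' * D + k"
          then have "(i * D + k') mod D = (i' * D + k) mod D"
            by simp
          then show False
            using that k by simp
        qed
        then show ?thesis
          using fr \<open>imem S2 aRank = imem S' aRank\<close> by (simp add: ranks_def)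
      qed
      moreover have new: "ranks S'' D i k < N \<and> (\<forall>j<N. ranks S'' D i k \<le> ranks S'' D j k \<longleftrightarrow> key k i \<le> key k j)"
        if "i < N" for i
      proof -
        have "i \<in> imem S'' aOrd ` {..<N}"
          using that surj[OF rkd] by simp
        then obtain u where u: "i = imem S'' aOrd u" "u < N"
          by blast
        have "ranks S'' D i k < N"
          using rkd u by (auto simp: ranked_def intro: le_less_trans)
        moreover have "ranks S'' D i k \<le> ranks S'' D j k \<longleftrightarrow> key k i \<le> key k j" if j: "j < N" for j
        proof -
          have "j \<in> imem S'' aOrd ` {..<N}"
            using j surj[OF rkd] by simp
          then obtain u' where "j = imem S'' aOrd u'" "u' < N"
            by blast
          then show ?thesis
            using rkd u by (auto simp: ranked_def)
        qed
        ultimately show ?thesis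
          by blast
      qed
      ultimately show "P (Suc k) S'' \<and> imem S'' vk 0 = k"
        using P z rkd by (auto simp: P_def less_Suc_eq)
    qed simp
  qed (use that in \<open>auto simp: P_def X_def ranks_def\<close>)
  have "run B (ISet vD (IConst D)) S 3 (P 0)"
    by (rule run_straight) (use S N in \<open>auto simp: P_def X_def\<close>)
  then have "run B (sort_all D) S (3 + (D * (?T + 12) + 9)) (P D)"
    unfolding sort_all_def by (rule run_Seq) (rule loop)
  then show ?thesis
  proof (rule run_mono)
    fix S' assume P: "P D S'"
    then have rkd: "ranked (key (D - 1)) N N (imem S' aOrd) (\<lambda>i. ranks S' D i (D - 1))"
      using N by (simp add: P_def)
    have "ranks S' D (imem S' aOrd u) (D - 1) \<le> ranks S' D (imem S' aOrd u') (D - 1)" if "u \<le> u'" "u' < N" for u u'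
    proof -
      have "u < N"
        using that by simp
      then show ?thesis
        using rkd that unfolding ranked_def by blast
    qed
    moreover have "inj_on (imem S' aOrd) {..<N}"
      using rkd by (simp add: ranked_def)
    ultimately show "same {vD, vk, vi, vc, vx, vt, aT, aOrd, aRank} {} S S' \<and> (\<forall>v. imem S' aT v = 0) \<and>
      (\<forall>i<N. \<forall>k<D. ranks S' D i k < N) \<and>
      (\<forall>i<N. \<forall>j<N. \<forall>k<D. ranks S' D i k \<le> ranks S' D j k \<longleftrightarrow>
        rmem S rKey (i * D + k) \<le> rmem S rKey (j * D + k)) \<and>
      inj_on (imem S' aOrd) {..<N} \<and> imem S' aOrd ` {..<N} = {..<N} \<and>
      (\<forall>u u'. u \<le> u' \<longrightarrow> u' < N \<longrightarrow> ranks S' D (imem S' aOrd u) (D - 1) \<le> ranks S' D (imem S' aOrd u') (D - 1))"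
      using P surj[OF rkd] by (simp add: P_def X_def key_def)
  qed (simp add: algebra_simps)
qed

definition dominance :: "nat \<Rightarrow> prog" where
  "dominance e = init_levels ;; sort_all (Suc e) ;; sweep e ;; cleanup e"

lemma run_dominance_explicit:
  assumes N: "imem S vN 0 = N" "N > 0" and B: "4 * N * Suc e + Suc e < B" "(4 * N) ^ e < B"
    and Z: "\<And>v. imem S aT v = 0" "\<And>a. rmem S rT a = 0"
  shows "run B (dominance e) S
    ((N * 100 + 18) + (Suc e * (N * (levels N * 200 + 300) + 30) + 12) +
      (N * (2 * levels N ^ e * (pcost (update_step e) + pcost (query_step e) + 12) + 300) + icost (iprod (\<lambda>_. Var vL) e) + 50) +
      (N * (levels N ^ e * (pcost (update_step e) + 12) + 50) + 9))
    (\<lambda>S'. same {21..38} {rC, rT, rw} S S' \<and> (\<forall>v. imem S' aT v = 0) \<and> (\<forall>a. rmem S' rT a = 0) \<and>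
      (\<forall>i<N. rmem S' rC i = (\<Sum>j<N. rmem S rWt j *
        of_bool (\<forall>k<Suc e. rmem S rKey (j * Suc e + k) \<le> rmem S rKey (i * Suc e + k)))))"
proof -
  let ?I = "\<lambda>S'. same {21..38} {rC, rT, rw} S S' \<and> set_up N S' \<and> (\<forall>v. imem S' aT v = 0)"
  let ?res = "\<lambda>i. \<Sum>j<N. rmem S rWt j *
        of_bool (\<forall>k<Suc e. rmem S rKey (j * Suc e + k) \<le> rmem S rKey (i * Suc e + k))"
  let ?sorted = "\<lambda>S'. (\<forall>i<N. \<forall>k<Suc e. ranks S' (Suc e) i k < N) \<and>
      (\<forall>i<N. \<forall>j<N. \<forall>k<Suc e. ranks S' (Suc e) i k \<le> ranks S' (Suc e) j k \<longleftrightarrow>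
        rmem S rKey (i * Suc e + k) \<le> rmem S rKey (j * Suc e + k)) \<and>
      inj_on (imem S' aOrd) {..<N} \<and> imem S' aOrd ` {..<N} = {..<N} \<and>
      (\<forall>u u'. u \<le> u' \<longrightarrow> u' < N \<longrightarrow> ranks S' (Suc e) (imem S' aOrd u) e \<le> ranks S' (Suc e) (imem S' aOrd u') e)"
  have B4: "4 * N \<le> B"
  proof -
    have "4 * N * 1 \<le> 4 * N * Suc e"
      by (intro mult_left_mono) auto
    then show ?thesis
      using B by linarith
  qed
  show ?thesis
    unfolding dominance_def
  proof (rule run_Seq, rule run_Seq, rule run_Seq)
    show "run B init_levels S (N * 100 + 18) (\<lambda>S'. ?I S' \<and> rmem S' = rmem S)"
    proof (rule run_mono[OF run_init_levels[OF N B4]])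
      fix S' assume *: "same {vW, vL, aPow, vi} {} S S' \<and> imem S' vW 0 = 2 ^ levels N \<and>
        imem S' vL 0 = levels N \<and> (\<forall>t\<le>levels N. imem S' aPow t = 2 ^ t)"
      have "same {21..38} {rC, rT, rw} S S'"
        by (rule same_mono[where X = "{vW, vL, aPow, vi}" and Y = "{}"]) (use * in auto)
      moreover have "rmem S' = rmem S" "imem S' vN = imem S vN" "imem S' aT = imem S aT"
        using * by (auto simp: same_def)
      ultimately show "?I S' \<and> rmem S' = rmem S"
        using * N Z by (auto simp: set_up_def)
    qed simp
    fix S1 assume I1: "?I S1 \<and> rmem S1 = rmem S"
    show "run B (sort_all (Suc e)) S1 (Suc e * (N * (levels N * 200 + 300) + 30) + 12)
       (\<lambda>S'. ?I S' \<and> rmem S' = rmem S \<and> ?sorted S')"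
    proof (rule run_mono[OF run_sort_all[where D = "Suc e" and N = N]])
      fix S' assume *: "same {vD, vk, vi, vc, vx, vt, aT, aOrd, aRank} {} S1 S' \<and> (\<forall>v. imem S' aT v = 0) \<and>
      (\<forall>i<N. \<forall>k<Suc e. ranks S' (Suc e) i k < N) \<and>
      (\<forall>i<N. \<forall>j<N. \<forall>k<Suc e. ranks S' (Suc e) i k \<le> ranks S' (Suc e) j k \<longleftrightarrow>
        rmem S1 rKey (i * Suc e + k) \<le> rmem S1 rKey (j * Suc e + k)) \<and>
      inj_on (imem S' aOrd) {..<N} \<and> imem S' aOrd ` {..<N} = {..<N} \<and>
      (\<forall>u u'. u \<le> u' \<longrightarrow> u' < N \<longrightarrow>
        ranks S' (Suc e) (imem S' aOrd u) (Suc e - 1) \<le> ranks S' (Suc e) (imem S' aOrd u') (Suc e - 1))"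
      then have sm: "same {vD, vk, vi, vc, vx, vt, aT, aOrd, aRank} {} S1 S'"
        by blast
      have "same {21..38} {rC, rT, rw} S S'"
        by (rule same_trans[OF _ sm]) (use I1 in auto)
      moreover have "set_up N S'"
        by (rule set_up_same[OF _ sm]) (use I1 in auto)
      moreover have "rmem S' = rmem S"
        using I1 sm by (auto simp: same_def)
      ultimately show "?I S' \<and> rmem S' = rmem S \<and> ?sorted S'"
        using * I1 by simp
    qed (use I1 N B in auto)
  next
    fix S2 assume I2: "?I S2 \<and> rmem S2 = rmem S \<and> ?sorted S2"
    show "run B (sweep e) S2 (N * (2 * levels N ^ e * (pcost (update_step e) + pcost (query_step e) + 12) + 300)
        + icost (iprod (\<lambda>_. Var vL) e) + 50)
      (\<lambda>S'. ?I S' \<and> rmem S' rWt = rmem S rWt \<and> (\<forall>i<N. \<forall>k<Suc e. ranks S' (Suc e) i k < N) \<and>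
        imem S' vLE 0 = levels N ^ e \<and>
        rmem S' rT = tree_sum (levels N) e (ranks S' (Suc e)) (rmem S' rWt) {..<N} \<and>
        (\<forall>i<N. rmem S' rC i = ?res i))"
    proof (rule run_mono[OF run_sweep[where N = N]])
      fix S' assume *: "same {vLE, vj, vv, vNN, vs, vc, vtau} {rw, rT, rC} S2 S' \<and> imem S' vLE 0 = levels N ^ e \<and>
      rmem S' rT = tree_sum (levels N) e (ranks S2 (Suc e)) (rmem S2 rWt) {..<N} \<and>
      (\<forall>i<N. rmem S' rC i = (\<Sum>j<N. rmem S2 rWt j *
         of_bool (\<forall>k<Suc e. ranks S2 (Suc e) j k \<le> ranks S2 (Suc e) i k)))"
      then have sm: "same {vLE, vj, vv, vNN, vs, vc, vtau} {rw, rT, rC} S2 S'"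
        by blast
      have "same {21..38} {rC, rT, rw} S S'"
        by (rule same_trans[OF _ sm]) (use I2 in auto)
      moreover have "set_up N S'"
        by (rule set_up_same[OF _ sm]) (use I2 in auto)
      moreover have "rmem S' rWt = rmem S rWt" "imem S' aT = imem S2 aT" "ranks S' = ranks S2"
        using I2 sm ranks_same[OF sm] by (auto simp: same_def)
      moreover
      have iff: "ranks S2 (Suc e) j k \<le> ranks S2 (Suc e) i k \<longleftrightarrow>
          rmem S rKey (j * Suc e + k) \<le> rmem S rKey (i * Suc e + k)" if "j < N" "i < N" "k < Suc e" for i j k
        using I2 that by simp
      have "rmem S' rC i = ?res i" if "i < N" for i
      proof -
        have "(\<forall>k<Suc e. ranks S2 (Suc e) j k \<le> ranks S2 (Suc e) i k) \<longleftrightarrow>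
            (\<forall>k<Suc e. rmem S rKey (j * Suc e + k) \<le> rmem S rKey (i * Suc e + k))" if "j < N" for j
          using iff[OF that \<open>i < N\<close>] by simp
        moreover have "rmem S' rC i = (\<Sum>j<N. rmem S2 rWt j *
         of_bool (\<forall>k<Suc e. ranks S2 (Suc e) j k \<le> ranks S2 (Suc e) i k))"
          using * that by blast
        ultimately show ?thesis
          using I2 by simp
      qed
      ultimately show "?I S' \<and> rmem S' rWt = rmem S rWt \<and> (\<forall>i<N. \<forall>k<Suc e. ranks S' (Suc e) i k < N) \<and>
        imem S' vLE 0 = levels N ^ e \<and>
        rmem S' rT = tree_sum (levels N) e (ranks S' (Suc e)) (rmem S' rWt) {..<N} \<and>
        (\<forall>i<N. rmem S' rC i = ?res i)"
        using * I2 by simp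
    qed (use I2 N B Z in auto)
  next
    fix S3 assume I3: "?I S3 \<and> rmem S3 rWt = rmem S rWt \<and> (\<forall>i<N. \<forall>k<Suc e. ranks S3 (Suc e) i k < N) \<and>
        imem S3 vLE 0 = levels N ^ e \<and>
        rmem S3 rT = tree_sum (levels N) e (ranks S3 (Suc e)) (rmem S3 rWt) {..<N} \<and>
        (\<forall>i<N. rmem S3 rC i = ?res i)"
    show "run B (cleanup e) S3 (N * (levels N ^ e * (pcost (update_step e) + 12) + 50) + 9)
      (\<lambda>S'. same {21..38} {rC, rT, rw} S S' \<and> (\<forall>v. imem S' aT v = 0) \<and> (\<forall>a. rmem S' rT a = 0) \<and>
        (\<forall>i<N. rmem S' rC i = ?res i))"
    proof (rule run_mono[OF run_cleanup[where N = N]])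
      fix S' assume *: "same {vi, vc, vtau} {rw, rT} S3 S' \<and> (\<forall>a. rmem S' rT a = 0)"
      then have sm: "same {vi, vc, vtau} {rw, rT} S3 S'"
        by blast
      have "same {21..38} {rC, rT, rw} S S'"
        by (rule same_trans[OF _ sm]) (use I3 in auto)
      moreover have "rmem S' rC = rmem S3 rC" "imem S' aT = imem S3 aT"
        using sm by (auto simp: same_def)
      ultimately show "same {21..38} {rC, rT, rw} S S' \<and> (\<forall>v. imem S' aT v = 0) \<and> (\<forall>a. rmem S' rT a = 0) \<and>
        (\<forall>i<N. rmem S' rC i = ?res i)"
        using * I3 by simp
    qed (use I3 N B in auto)
  qed
qed

text \<open>The exponent is \<open>max 1 e\<close> because sorting costs one logarithm even when no
  coordinate is left for the tree. The scratch arrays are handed back as zeros, so several counts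
  fit into one program.\<close>

theorem run_dominance:
  obtains K where "\<And>B N (S :: store). \<lbrakk>imem S vN 0 = N; N > 0; 4 * N * Suc e + Suc e < B; (4 * N) ^ e < B;
      \<And>v. imem S aT v = 0; \<And>a. rmem S rT a = 0\<rbrakk> \<Longrightarrow>
    run B (dominance e) S (K * (N * levels N ^ max 1 e))
    (\<lambda>S'. same {21..38} {rC, rT, rw} S S' \<and> (\<forall>v. imem S' aT v = 0) \<and> (\<forall>a. rmem S' rT a = 0) \<and>
      (\<forall>i<N. rmem S' rC i = (\<Sum>j<N. rmem S rWt j *
        of_bool (\<forall>k<Suc e. rmem S rKey (j * Suc e + k) \<le> rmem S rKey (i * Suc e + k)))))"
proof -
  define u where "u = pcost (update_step e)"
  define q where "q = pcost (query_step e)"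
  define c where "c = icost (iprod (\<lambda>_. Var vL) e)"
  define K where "K = 118 + (Suc e * 530 + 12) + (2 * (u + q + 12) + 300 + c + 50) + (u + 71)"
  show ?thesis
  proof (rule that[of K])
    fix B N :: nat and S :: store
    assume *: "imem S vN 0 = N" "N > 0" "4 * N * Suc e + Suc e < B" "(4 * N) ^ e < B"
      "\<And>v. imem S aT v = 0" "\<And>a. rmem S rT a = 0"
    define M where "M = N * levels N ^ max 1 e"
    have lv: "levels N \<ge> 1"
      using levels_pos[OF *(2)] by simp
    have "levels N ^ 1 \<le> levels N ^ max 1 e" "levels N ^ e \<le> levels N ^ max 1 e"
      using lv by (intro power_increasing; simp)+
    then have m1: "N * levels N \<le> M" and m2: "N * levels N ^ e \<le> M"
      unfolding M_def by (simp_all add: mult_left_mono)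
    have "N * 1 \<le> N * levels N"
      using lv by (intro mult_left_mono) auto
    then have m3: "N \<le> M" "1 \<le> M"
      using m1 *(2) by linarith+
    have e: "Suc e * (N * (levels N * 200 + 300) + 30) \<le> Suc e * (530 * M)"
      using m1 m3 by (intro mult_left_mono) (auto simp: algebra_simps)
    have uq: "N * levels N ^ e * (2 * (u + q + 12)) \<le> M * (2 * (u + q + 12))"
      "N * levels N ^ e * (u + 12) \<le> M * (u + 12)" "c * 1 \<le> c * M"
      using m2 m3 by (intro mult_mono; simp)+
    have "(N * 100 + 18) + (Suc e * (N * (levels N * 200 + 300) + 30) + 12) +
      (N * (2 * levels N ^ e * (u + q + 12) + 300) + c + 50) + (N * (levels N ^ e * (u + 12) + 50) + 9)
      = (N * 100 + 18) + (Suc e * (N * (levels N * 200 + 300) + 30) + 12) +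
      (N * levels N ^ e * (2 * (u + q + 12)) + N * 300 + c + 50) + (N * levels N ^ e * (u + 12) + N * 50 + 9)"
      by (simp add: algebra_simps)
    also have "\<dots> \<le> (M * 100 + 18 * M) + (Suc e * (530 * M) + 12 * M) +
      (M * (2 * (u + q + 12)) + M * 300 + c * M + 50 * M) + (M * (u + 12) + M * 50 + 9 * M)"
      using e uq m3 by linarith
    also have "\<dots> = K * M"
      by (simp add: K_def algebra_simps)
    finally have le: "(N * 100 + 18) + (Suc e * (N * (levels N * 200 + 300) + 30) + 12) +
      (N * (2 * levels N ^ e * (u + q + 12) + 300) + c + 50) + (N * (levels N ^ e * (u + 12) + 50) + 9) \<le> K * M" .
    show "run B (dominance e) S (K * (N * levels N ^ max 1 e))
      (\<lambda>S'. same {21..38} {rC, rT, rw} S S' \<and> (\<forall>v. imem S' aT v = 0) \<and> (\<forall>a. rmem S' rT a = 0) \<and>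
      (\<forall>i<N. rmem S' rC i = (\<Sum>j<N. rmem S rWt j *
        of_bool (\<forall>k<Suc e. rmem S rKey (j * Suc e + k) \<le> rmem S rKey (i * Suc e + k)))))"
      by (rule run_mono[OF run_dominance_explicit[OF *]])
        (use le in \<open>simp_all add: u_def q_def c_def M_def\<close>)
  qed
qed

section \<open>U-statistics as sums over injections\<close>

definition injections :: "'a set \<Rightarrow> 'b set \<Rightarrow> ('a \<Rightarrow> 'b) set" where
  "injections S T = {f \<in> S \<rightarrow>\<^sub>E T. inj_on f S}"

lemma finite_injections: "finite S \<Longrightarrow> finite T \<Longrightarrow> finite (injections S T)"
  unfolding injections_def by (rule finite_subset[OF _ finite_PiE[of S "\<lambda>_. T"]]) auto

lemma strict_mono_on_unique:
  fixes i i' :: "nat \<Rightarrow> nat"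
  assumes "strict_mono_on {1..m} i" "strict_mono_on {1..m} i'" "i ` {1..m} = i' ` {1..m}" "j \<in> {1..m}"
  shows "i j = i' j"
proof -
  have sorted: "sorted (map h [1..<Suc m])" "distinct (map h [1..<Suc m])" if "strict_mono_on {1..m} h" for h :: "nat \<Rightarrow> nat"
  proof -
    have "sorted_wrt (<) (map h [1..<Suc m])"
      using that unfolding sorted_wrt_map by (auto simp: sorted_wrt_iff_nth_less strict_mono_on_def simp del: upt_Suc)
    then show "sorted (map h [1..<Suc m])" "distinct (map h [1..<Suc m])"
      by (auto simp: strict_sorted_iff)
  qed
  have "map i [1..<Suc m] = map i' [1..<Suc m]"
    using assms(3) sorted[OF assms(1)] sorted[OF assms(2)]
    by (intro sorted_distinct_set_unique) (auto simp: atLeastLessThanSuc_atLeastAtMost simp del: upt_Suc)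
  then show ?thesis
    using assms(4) by (auto simp del: upt_Suc)
qed

lemma sorted_factorization:
  fixes f :: "nat \<Rightarrow> nat"
  assumes "f \<in> injections {1..m} {1..n}"
  shows "\<exists>i \<sigma>. i \<in> {1..m} \<rightarrow>\<^sub>E {1..n} \<and> strict_mono_on {1..m} i \<and> \<sigma> permutes {1..m} \<and> f = (\<lambda>j. i (inv_into UNIV \<sigma> j))"
proof -
  define A where "A = f ` {1..m}"
  define i where "i = (\<lambda>j\<in>{1..m}. sorted_list_of_set A ! (j - 1))"
  have f: "f \<in> {1..m} \<rightarrow>\<^sub>E {1..n}" "inj_on f {1..m}"
    using assms by (auto simp: injections_def)
  have A: "finite A" "card A = m" "A \<subseteq> {1..n}"
    using f by (auto simp: A_def card_image)
  have mono: "strict_mono_on {1..m} i"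
  proof (rule strict_mono_onI)
    fix a b assume "a \<in> {1..m}" "b \<in> {1..m}" "a < b"
    then show "i a < i b"
      using sorted_wrt_nth_less[OF strict_sorted_list_of_set[of A], of "a - 1" "b - 1"] A by (auto simp: i_def)
  qed
  then have inj: "inj_on i {1..m}"
    by (rule strict_mono_on_imp_inj_on)
  have sub: "i ` {1..m} \<subseteq> A"
  proof
    fix x assume "x \<in> i ` {1..m}"
    then obtain j where "j \<in> {1..m}" "x = sorted_list_of_set A ! (j - 1)"
      by (auto simp: i_def)
    moreover have "j - 1 < length (sorted_list_of_set A)"
      using A \<open>j \<in> {1..m}\<close> by auto
    ultimately have "x \<in> set (sorted_list_of_set A)"
      using nth_mem by blast
    then show "x \<in> A"
      using A by simp
  qed
  have "card (i ` {1..m}) = card A"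
    using inj A by (simp add: card_image)
  then have img: "i ` {1..m} = A"
    using sub A by (intro card_subset_eq) auto
  \<comment> \<open>The position of \<open>f j\<close> in the sorted image. As
    \<open>perm_tuple\<close> acts through the inverse, the permutation in the factorization is the
    inverse of \<open>\<tau>\<close>.\<close>
  define \<tau> where "\<tau> = (\<lambda>j. if j \<in> {1..m} then inv_into {1..m} i (f j) else j)"
  have "bij_betw f {1..m} A"
    using f by (auto simp: bij_betw_def A_def)
  moreover have "bij_betw (inv_into {1..m} i) A {1..m}"
    using inj img by (simp add: bij_betw_def bij_betw_inv_into[unfolded bij_betw_def] inj_on_inv_into)
  ultimately have "bij_betw (inv_into {1..m} i \<circ> f) {1..m} {1..m}"
    by (rule bij_betw_trans)
  then have "bij_betw \<tau> {1..m} {1..m}"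
    by (rule bij_betw_cong[THEN iffD1, rotated]) (simp add: \<tau>_def)
  then have \<tau>: "\<tau> permutes {1..m}"
    by (rule bij_imp_permutes) (auto simp: \<tau>_def)
  have "f j = i (\<tau> j)" for j
  proof (cases "j \<in> {1..m}")
    case True
    then have "f j \<in> i ` {1..m}"
      using img by (auto simp: A_def)
    then show ?thesis
      using True by (simp add: \<tau>_def f_inv_into_f)
  next
    case False
    then show ?thesis
      using f by (auto simp: \<tau>_def i_def PiE_iff extensional_def)
  qed
  moreover have "inv_into UNIV (inv_into UNIV \<tau>) = \<tau>"
    using \<tau> by (simp add: inv_inv_eq permutes_bij)
  moreover have "i \<in> {1..m} \<rightarrow>\<^sub>E {1..n}"
    using sub A by (auto simp: i_def)
  ultimately show ?thesis
    using mono permutes_inv[OF \<tau>] by (intro exI[of _ i] exI[of _ "inv_into UNIV \<tau>"]) auto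
qed

text \<open>An injection factors uniquely into the increasing enumeration of its image and a
  permutation. Averaging over increasing tuples and over permutations is therefore averaging over
  injections, and the symmetrization disappears.\<close>

theorem U_stat_symmetrize:
  "U_stat m (symmetrize m k) n z =
     1 / (real (n choose m) * fact m) * (\<Sum>f\<in>injections {1..m} {1..n}. k (\<lambda>j. z (f j)))"
proof -
  define I where "I = {i \<in> {1..m} \<rightarrow>\<^sub>E {1..n}. strict_mono_on {1..m} i}"
  define Pm where "Pm = {\<sigma> :: nat \<Rightarrow> nat. \<sigma> permutes {1..m}}"
  define \<Phi> :: "(nat \<Rightarrow> nat) \<times> (nat \<Rightarrow> nat) \<Rightarrow> nat \<Rightarrow> nat"
    where "\<Phi> = (\<lambda>(i, \<sigma>) j. i (inv_into UNIV \<sigma> j))"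
  have "bij_betw \<Phi> (I \<times> Pm) (injections {1..m} {1..n})"
    unfolding bij_betw_def
  proof
    show "inj_on \<Phi> (I \<times> Pm)"
    proof (rule inj_onI, clarify)
      fix i \<sigma> i' \<sigma>' assume *: "i \<in> I" "\<sigma> \<in> Pm" "i' \<in> I" "\<sigma>' \<in> Pm" "\<Phi> (i, \<sigma>) = \<Phi> (i', \<sigma>')"
      have p: "inv_into UNIV \<sigma> permutes {1..m}" "inv_into UNIV \<sigma>' permutes {1..m}"
        using * by (auto simp: Pm_def intro: permutes_inv)
      have eq: "i (inv_into UNIV \<sigma> j) = i' (inv_into UNIV \<sigma>' j)" for j
        using fun_cong[OF *(5), of j] by (simp add: \<Phi>_def)
      have "i ` {1..m} = (\<lambda>j. i (inv_into UNIV \<sigma> j)) ` {1..m}"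
        using permutes_image[OF p(1)] by (metis image_image)
      also have "\<dots> = i' ` {1..m}"
        unfolding eq using permutes_image[OF p(2)] by (metis image_image)
      finally have "i j = i' j" if "j \<in> {1..m}" for j
        using * that by (intro strict_mono_on_unique[of m]) (auto simp: I_def)
      then have ii: "i = i'"
        using * unfolding I_def by (blast intro: PiE_ext)
      have "inj_on i {1..m}"
        using * by (auto simp: I_def intro: strict_mono_on_imp_inj_on)
      then have "inv_into UNIV \<sigma> j = inv_into UNIV \<sigma>' j" for j
      proof (cases "j \<in> {1..m}")
        case True
        then have "inv_into UNIV \<sigma> j \<in> {1..m}" "inv_into UNIV \<sigma>' j \<in> {1..m}"
          using permutes_in_image[OF p(1)] permutes_in_image[OF p(2)] by blast+
        then show ?thesis
          using eq[of j] \<open>inj_on i {1..m}\<close> unfolding ii by (metis inj_onD)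
      next
        case False
        then show ?thesis
          using permutes_not_in[OF p(1)] permutes_not_in[OF p(2)] by simp
      qed
      then have "inv_into UNIV (inv_into UNIV \<sigma>) = inv_into UNIV (inv_into UNIV \<sigma>')"
        by presburger
      then have "\<sigma> = \<sigma>'"
        using * by (simp add: Pm_def inv_inv_eq permutes_bij)
      then show "i = i' \<and> \<sigma> = \<sigma>'"
        using ii by simp
    qed
    show "\<Phi> ` (I \<times> Pm) = injections {1..m} {1..n}"
    proof (intro equalityI subsetI)
      fix f assume "f \<in> \<Phi> ` (I \<times> Pm)"
      then obtain i \<sigma> where *: "i \<in> I" "\<sigma> \<in> Pm" "f = \<Phi> (i, \<sigma>)"
        by auto
      have p: "inv_into UNIV \<sigma> permutes {1..m}"
        using * by (auto simp: Pm_def intro: permutes_inv)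
      have "inj_on i {1..m}"
        using * by (auto simp: I_def intro: strict_mono_on_imp_inj_on)
      then have "inj_on (i \<circ> inv_into UNIV \<sigma>) {1..m}"
        using permutes_inj_on[OF p] permutes_image[OF p] by (intro comp_inj_on) auto
      moreover have "f = i \<circ> inv_into UNIV \<sigma>"
        using * by (auto simp: \<Phi>_def)
      moreover have "f j \<in> {1..n}" if "j \<in> {1..m}" for j
        using * permutes_in_image[OF p, of j] that by (auto simp: \<Phi>_def I_def)
      moreover have "f j = undefined" if "j \<notin> {1..m}" for j
        using * that permutes_not_in[OF p that] by (auto simp: \<Phi>_def I_def PiE_iff extensional_def)
      ultimately show "f \<in> injections {1..m} {1..n}"
        by (auto simp: injections_def)
    next
      fix f assume "f \<in> injections {1..m} {1..n}"
      from sorted_factorization[OF this] show "f \<in> \<Phi> ` (I \<times> Pm)"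
        by (force simp: I_def Pm_def \<Phi>_def image_iff)
    qed
  qed
  then have "(\<Sum>f\<in>injections {1..m} {1..n}. k (\<lambda>j. z (f j))) = (\<Sum>p\<in>I \<times> Pm. k (\<lambda>j. z (\<Phi> p j)))"
    by (simp add: sum.reindex_bij_betw[symmetric])
  also have "\<dots> = (\<Sum>i\<in>I. \<Sum>\<sigma>\<in>Pm. k (perm_tuple \<sigma> (\<lambda>j. z (i j))))"
    by (simp add: sum.cartesian_product perm_tuple_def \<Phi>_def case_prod_beta)
  finally show ?thesis
    by (simp add: U_stat_def symmetrize_def I_def Pm_def sum_distrib_left sum_divide_distrib mult_ac)
qed

lemma sum_injections_insert:
  fixes F :: "('a \<Rightarrow> 'b) \<Rightarrow> 'c :: comm_monoid_add"
  assumes "a \<notin> S" "finite S" "finite T"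
  shows "(\<Sum>f\<in>injections (insert a S) T. F f) = (\<Sum>g\<in>injections S T. \<Sum>y\<in>T - g ` S. F (g(a := y)))"
proof -
  define \<Phi> where "\<Phi> = (\<lambda>(g :: 'a \<Rightarrow> 'b, y). g(a := y))"
  have upd: "g(a := y) \<in> injections (insert a S) T" if "g \<in> injections S T" "y \<in> T - g ` S" for g y
    using that assms(1) by (auto simp: injections_def PiE_iff extensional_def inj_on_def)
  have "bij_betw \<Phi> (SIGMA g:injections S T. T - g ` S) (injections (insert a S) T)"
  proof (rule bij_betw_byWitness[where f' = "\<lambda>f. (f(a := undefined), f a)"])
    show "\<forall>p\<in>SIGMA g:injections S T. T - g ` S. ((\<Phi> p)(a := undefined), \<Phi> p a) = p"
      using assms(1) by (auto simp: \<Phi>_def injections_def PiE_iff extensional_def fun_eq_iff)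
    show "\<forall>f\<in>injections (insert a S) T. \<Phi> (f(a := undefined), f a) = f"
      by (auto simp: \<Phi>_def)
    show "\<Phi> ` (SIGMA g:injections S T. T - g ` S) \<subseteq> injections (insert a S) T"
      using upd by (auto simp: \<Phi>_def)
    show "(\<lambda>f. (f(a := undefined), f a)) ` injections (insert a S) T \<subseteq> (SIGMA g:injections S T. T - g ` S)"
    proof clarify
      fix f assume f: "f \<in> injections (insert a S) T"
      have 1: "f(a := undefined) \<in> injections S T"
        using f assms(1) by (auto simp: injections_def PiE_iff extensional_def inj_on_def)
      have "f(a := undefined) ` S = f ` S"
        using assms(1) by auto
      moreover have "f a \<in> T" "f a \<notin> f ` S"
        using f assms(1) by (auto simp: injections_def inj_on_def)
      ultimately show "f(a := undefined) \<in> injections S T \<and> f a \<in> T - f(a := undefined) ` S"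
        using 1 by simp
    qed
  qed
  then have "(\<Sum>f\<in>injections (insert a S) T. F f) = (\<Sum>p\<in>(SIGMA g:injections S T. T - g ` S). F (\<Phi> p))"
    by (simp add: sum.reindex_bij_betw[symmetric])
  also have "\<dots> = (\<Sum>g\<in>injections S T. \<Sum>y\<in>T - g ` S. F (g(a := y)))"
    using assms by (subst sum.Sigma) (auto simp: \<Phi>_def finite_injections case_prod_beta)
  finally show ?thesis .
qed

section \<open>Sums over four distinct columns\<close>

definition distinct4 :: "'a \<Rightarrow> 'a \<Rightarrow> 'a \<Rightarrow> 'a \<Rightarrow> bool" where
  "distinct4 i j k l \<longleftrightarrow> i \<noteq> j \<and> i \<noteq> k \<and> i \<noteq> l \<and> j \<noteq> k \<and> j \<noteq> l \<and> k \<noteq> l"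

lemma sum_reverse4:
  fixes f :: "'a \<Rightarrow> 'a \<Rightarrow> 'a \<Rightarrow> 'a \<Rightarrow> 'b :: comm_monoid_add"
  shows "(\<Sum>l\<in>M. \<Sum>k\<in>M. \<Sum>j\<in>M. \<Sum>i\<in>M. f i j k l) = (\<Sum>i\<in>M. \<Sum>j\<in>M. \<Sum>k\<in>M. \<Sum>l\<in>M. f i j k l)"
proof -
  have swap3: "(\<Sum>l\<in>M. \<Sum>k\<in>M. \<Sum>j\<in>M. g j k l) = (\<Sum>j\<in>M. \<Sum>k\<in>M. \<Sum>l\<in>M. g j k l)" for g :: "'a \<Rightarrow> 'a \<Rightarrow> 'a \<Rightarrow> 'b"
  proof -
    have "(\<Sum>l\<in>M. \<Sum>k\<in>M. \<Sum>j\<in>M. g j k l) = (\<Sum>l\<in>M. \<Sum>j\<in>M. \<Sum>k\<in>M. g j k l)"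
      by (intro sum.cong refl sum.swap)
    also have "\<dots> = (\<Sum>j\<in>M. \<Sum>l\<in>M. \<Sum>k\<in>M. g j k l)"
      by (rule sum.swap)
    also have "\<dots> = (\<Sum>j\<in>M. \<Sum>k\<in>M. \<Sum>l\<in>M. g j k l)"
      by (intro sum.cong refl sum.swap)
    finally show ?thesis .
  qed
  have "(\<Sum>l\<in>M. \<Sum>k\<in>M. \<Sum>j\<in>M. \<Sum>i\<in>M. f i j k l) = (\<Sum>l\<in>M. \<Sum>i\<in>M. \<Sum>j\<in>M. \<Sum>k\<in>M. f i j k l)"
    by (intro sum.cong refl swap3)
  also have "\<dots> = (\<Sum>i\<in>M. \<Sum>l\<in>M. \<Sum>j\<in>M. \<Sum>k\<in>M. f i j k l)"
    by (rule sum.swap)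
  also have "\<dots> = (\<Sum>i\<in>M. \<Sum>l\<in>M. \<Sum>k\<in>M. \<Sum>j\<in>M. f i j k l)"
    by (intro sum.cong refl sum.swap)
  also have "\<dots> = (\<Sum>i\<in>M. \<Sum>j\<in>M. \<Sum>k\<in>M. \<Sum>l\<in>M. f i j k l)"
    by (intro sum.cong refl swap3)
  finally show ?thesis .
qed

text \<open>The columns from 5 on, which carry the reference point, are fixed first. Distinctness of
  the other four becomes a factor, so that unrestricted sums over \<open>M\<close> can be
  used.\<close>

theorem sum_injections_4:
  fixes F :: "(nat \<Rightarrow> 'b) \<Rightarrow> real"
  assumes "finite T"
  shows "(\<Sum>f\<in>injections {1..4 + e} T. F f) =
    (\<Sum>g\<in>injections {5..4 + e} T. let M = T - g ` {5..4 + e} in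
      \<Sum>i\<in>M. \<Sum>j\<in>M. \<Sum>k\<in>M. \<Sum>l\<in>M. of_bool (distinct4 i j k l) * F (g(4 := l, 3 := k, 2 := j, 1 := i)))"
proof -
  let ?S = "{5..4 + e}"
  have set: "{1..4 + e} = insert 1 (insert 2 (insert 3 (insert 4 ?S)))"
    by auto
  have inner: "(\<Sum>l\<in>T - g ` ?S. \<Sum>k\<in>T - (g(4 := l)) ` insert 4 ?S.
        \<Sum>j\<in>T - (g(4 := l, 3 := k)) ` insert 3 (insert 4 ?S).
        \<Sum>i\<in>T - (g(4 := l, 3 := k, 2 := j)) ` insert 2 (insert 3 (insert 4 ?S)).
          F (g(4 := l, 3 := k, 2 := j, 1 := i)))
      = (let M = T - g ` ?S in \<Sum>i\<in>M. \<Sum>j\<in>M. \<Sum>k\<in>M. \<Sum>l\<in>M.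
          of_bool (distinct4 i j k l) * F (g(4 := l, 3 := k, 2 := j, 1 := i)))" for g :: "nat \<Rightarrow> 'b"
  proof -
    define M where "M = T - g ` ?S"
    have fin: "finite M"
      using assms by (simp add: M_def)
    have sets: "T - (g(4 := l)) ` insert 4 ?S = M - {l}"
      "T - (g(4 := l, 3 := k)) ` insert 3 (insert 4 ?S) = M - {k, l}"
      "T - (g(4 := l, 3 := k, 2 := j)) ` insert 2 (insert 3 (insert 4 ?S)) = M - {j, k, l}" for j k l
      by (auto simp: M_def)
    have guard: "(\<Sum>x\<in>M - A. f x) = (\<Sum>x\<in>M. of_bool (x \<notin> A) * f x)" for A and f :: "'b \<Rightarrow> real"
      using fin by (intro sum.mono_neutral_cong_left) auto
    have "(\<Sum>l\<in>M. \<Sum>k\<in>M - {l}. \<Sum>j\<in>M - {k, l}. \<Sum>i\<in>M - {j, k, l}. F (g(4 := l, 3 := k, 2 := j, 1 := i)))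
      = (\<Sum>l\<in>M. \<Sum>k\<in>M. \<Sum>j\<in>M. \<Sum>i\<in>M. of_bool (distinct4 i j k l) * F (g(4 := l, 3 := k, 2 := j, 1 := i)))"
      unfolding guard sum_distrib_left by (intro sum.cong refl) (auto simp: distinct4_def)
    also have "\<dots> = (\<Sum>i\<in>M. \<Sum>j\<in>M. \<Sum>k\<in>M. \<Sum>l\<in>M. of_bool (distinct4 i j k l) * F (g(4 := l, 3 := k, 2 := j, 1 := i)))"
      by (rule sum_reverse4)
    finally show ?thesis
      unfolding sets M_def[symmetric] Let_def .
  qed
  show ?thesis
    unfolding set using assms
    by (subst sum_injections_insert, simp, simp, simp)+ (rule sum.cong[OF refl inner])
qed

text \<open>Inclusion-exclusion over coinciding indices. Since \<open>h\<close> vanishes when its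
  first and fourth or its second and third arguments agree, only four coincidences of two indices
  count. Two of them with a common index would force one of the vanishing cases, so the second order
  consists of the two disjoint combinations, and there is no third order.\<close>

theorem sum_distinct4:
  fixes h :: "'a \<Rightarrow> 'a \<Rightarrow> 'a \<Rightarrow> 'a \<Rightarrow> real"
  assumes "finite M" "\<And>i j k. h i j k i = 0" "\<And>i j l. h i j j l = 0"
  shows "(\<Sum>i\<in>M. \<Sum>j\<in>M. \<Sum>k\<in>M. \<Sum>l\<in>M. of_bool (distinct4 i j k l) * h i j k l) =
    (\<Sum>i\<in>M. \<Sum>j\<in>M. \<Sum>k\<in>M. \<Sum>l\<in>M. h i j k l)
    - (\<Sum>i\<in>M. \<Sum>k\<in>M. \<Sum>l\<in>M. h i i k l) - (\<Sum>i\<in>M. \<Sum>j\<in>M. \<Sum>l\<in>M. h i j i l)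
    - (\<Sum>i\<in>M. \<Sum>j\<in>M. \<Sum>k\<in>M. h i j k j) - (\<Sum>i\<in>M. \<Sum>j\<in>M. \<Sum>k\<in>M. h i j k k)
    + (\<Sum>i\<in>M. \<Sum>k\<in>M. h i i k k) + (\<Sum>i\<in>M. \<Sum>j\<in>M. h i j i j)"
proof -
  have pt: "of_bool (distinct4 i j k l) * h i j k l = h i j k l
      - of_bool (j = i) * h i i k l - of_bool (k = i) * h i j i l
      - of_bool (l = j) * h i j k j - of_bool (l = k) * h i j k k
      + of_bool (j = i) * (of_bool (l = k) * h i i k k) + of_bool (k = i) * (of_bool (l = j) * h i j i j)" for i j k l
    using assms(2,3) by (auto simp: distinct4_def of_bool_def)
  have delta: "(\<Sum>x\<in>M. of_bool (x = a) * f x) = f a" if "a \<in> M" for a and f :: "'a \<Rightarrow> real"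
    using assms(1) that by (simp add: of_bool_def if_distrib[of "\<lambda>x. x * _"] cong: if_cong)
  have delta': "(\<Sum>x\<in>M. of_bool (x = a) * c) = c" if "a \<in> M" for a and c :: real
    using delta[OF that, of "\<lambda>_. c"] .
  show ?thesis
    unfolding pt sum.distrib sum_subtractf
    by (simp add: delta delta' sum_distrib_left[symmetric] cong: sum.cong)
qed

section \<open>The kernels\<close>

text \<open>The generators are commuting involutions and so generate a Klein four-group;
  \<open>m \<ge> 4\<close> places them in the symmetric group.\<close>

lemma H_tau_eq:
  assumes "m \<ge> 4"
  shows "H_tau m = {id, transpose 1 4, transpose 2 3, transpose 1 4 \<circ> transpose 2 3}"
proof -
  let ?a = "transpose 1 4 :: nat \<Rightarrow> nat" and ?b = "transpose 2 3 :: nat \<Rightarrow> nat"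
  have perm: "?a permutes {1..m}" "?b permutes {1..m}"
    using assms by (auto intro!: permutes_swap_id)
  interpret G: group "sym_group m"
    by (rule sym_group_is_group)
  have ab: "?a \<circ> ?b = ?b \<circ> ?a"
    by (auto simp: fun_eq_iff transpose_def)
  have aa: "?a \<circ> ?a = id" "?b \<circ> ?b = id"
    by (auto simp: fun_eq_iff transpose_def)
  have inv: "inv\<^bsub>sym_group m\<^esub> ?a = ?a" "inv\<^bsub>sym_group m\<^esub> ?b = ?b"
    using perm by (simp_all add: sym_group_inv_equality sym_group_carrier)
  have mult: "x \<otimes>\<^bsub>sym_group m\<^esub> y = x \<circ> y" for x y
    by (simp add: sym_group_def)
  have one: "\<one>\<^bsub>sym_group m\<^esub> = id"
    by (simp add: sym_group_def)
  have closed: "x \<circ> y \<in> {id, ?a, ?b, ?a \<circ> ?b}"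
    if "x \<in> {id, ?a, ?b, ?a \<circ> ?b}" "y \<in> {id, ?a, ?b, ?a \<circ> ?b}" for x y
  proof -
    have "?b \<circ> ?a = ?a \<circ> ?b" "?a \<circ> (?a \<circ> ?b) = ?b" "?b \<circ> (?a \<circ> ?b) = ?a" "?a \<circ> ?b \<circ> ?a = ?b"
      "?a \<circ> ?b \<circ> ?b = ?a" "?a \<circ> ?b \<circ> (?a \<circ> ?b) = id"
      by (auto simp: fun_eq_iff transpose_def)
    then show ?thesis
      using that aa by auto
  qed
  show ?thesis
  proof (intro equalityI subsetI)
    fix x assume "x \<in> H_tau m"
    then have "x \<in> generate (sym_group m) {?a, ?b}"
      by (simp add: H_tau_def)
    then show "x \<in> {id, ?a, ?b, ?a \<circ> ?b}"
    proof (induction rule: generate.induct)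
      case (eng h1 h2)
      then show ?case
        unfolding mult by (intro closed)
    qed (use inv in \<open>auto simp: one\<close>)
  next
    fix x assume "x \<in> {id, ?a, ?b, ?a \<circ> ?b}"
    moreover have "id \<in> generate (sym_group m) {?a, ?b}"
      using generate.one[of "sym_group m"] by (simp add: one)
    moreover have "?a \<in> generate (sym_group m) {?a, ?b}" "?b \<in> generate (sym_group m) {?a, ?b}"
      by (auto intro: generate.incl)
    moreover from this have "?a \<circ> ?b \<in> generate (sym_group m) {?a, ?b}"
      using generate.eng[of ?a "sym_group m" "{?a, ?b}" ?b] by (simp add: mult)
    ultimately show "x \<in> H_tau m"
      by (auto simp: H_tau_def)
  qed
qed

definition alternating :: "(tuple \<Rightarrow> real) \<Rightarrow> tuple \<Rightarrow> real" where
  "alternating I w = I w - I (w \<circ> transpose 1 4) - I (w \<circ> transpose 2 3) + I (w \<circ> transpose 1 4 \<circ> transpose 2 3)"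

lemma sum_H_tau:
  assumes "m \<ge> 4"
  shows "(\<Sum>\<sigma>\<in>H_tau m. of_int (sign \<sigma>) * I (perm_tuple \<sigma> w)) = alternating I w"
proof -
  let ?a = "transpose 1 4 :: nat \<Rightarrow> nat" and ?b = "transpose 2 3 :: nat \<Rightarrow> nat"
  have ab: "?a \<circ> ?b = ?b \<circ> ?a"
    by (auto simp: fun_eq_iff transpose_def)
  have "?a 1 = 4" "?b 1 = 1" "?a 2 = 2" "?b 2 = 3" "(?a \<circ> ?b) 1 = 4" "(?a \<circ> ?b) 2 = 3"
    by (auto simp: transpose_def)
  then have neq: "id \<noteq> ?a" "id \<noteq> ?b" "id \<noteq> ?a \<circ> ?b" "?a \<noteq> ?b" "?a \<noteq> ?a \<circ> ?b" "?b \<noteq> ?a \<circ> ?b"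
    by (metis id_apply numeral_eq_one_iff numeral_eq_iff semiring_norm(83,85,87,88,89))+
  have "inv_into UNIV (?a \<circ> ?b) = ?a \<circ> ?b"
    using ab by (simp add: o_inv_distrib)
  moreover have "perm_tuple \<sigma> w = w \<circ> inv_into UNIV \<sigma>" for \<sigma>
    by (simp add: perm_tuple_def o_def)
  ultimately have perm: "perm_tuple id w = w" "perm_tuple ?a w = w \<circ> ?a" "perm_tuple ?b w = w \<circ> ?b"
    "perm_tuple (?a \<circ> ?b) w = w \<circ> ?a \<circ> ?b"
    by (simp_all add: o_assoc)
  have sign: "sign ?a = -1" "sign ?b = -1" "sign (?a \<circ> ?b) = 1"
    by (simp_all add: sign_swap_id sign_compose permutation_swap_id)
  show ?thesis
    unfolding H_tau_eq[OF assms] alternating_def using neq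
    by (simp add: perm sign sign_id del: One_nat_def)
qed

lemma kernel_eq:
  "m \<ge> 4 \<Longrightarrow> kernel r s m c IX IY z = c * alternating (IX r) z * alternating (IY s) (y_part r z)"
  by (simp add: kernel_def x_part_def sum_H_tau)

section \<open>Kernels with a reference point\<close>

definition below_x :: "nat \<Rightarrow> tuple \<Rightarrow> (nat \<Rightarrow> real) \<Rightarrow> nat \<Rightarrow> bool" where
  "below_x r z u p \<longleftrightarrow> (\<forall>l\<in>{1..r}. z p l \<le> u l)"

definition below_y :: "nat \<Rightarrow> nat \<Rightarrow> tuple \<Rightarrow> (nat \<Rightarrow> real) \<Rightarrow> nat \<Rightarrow> bool" where
  "below_y r s z u p \<longleftrightarrow> (\<forall>l\<in>{1..s}. z p (r + l) \<le> u (r + l))"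

text \<open>1 for a concordant pair, -1 for a discordant one and 0 for a pair tied in
  \<open>A\<close> or in \<open>B\<close>, as in Kendall's coefficient.\<close>

definition concord :: "(nat \<Rightarrow> bool) \<Rightarrow> (nat \<Rightarrow> bool) \<Rightarrow> nat \<Rightarrow> nat \<Rightarrow> real" where
  "concord A B i j = (of_bool (A i) - of_bool (A j)) * (of_bool (B i) - of_bool (B j))"

text \<open>Antisymmetrizing \<open>A 1 * A 2 * (1 - A 3) * (1 - A 4)\<close> in 1, 4 and in 2, 3
  gives a product of two differences; for indicators the 16 truth assignments settle this. The
  hypothesis concerns maps fixing all columns above 4, because the reference point behind
  \<open>A\<close> is taken from these.\<close>

lemma alternating_product:
  fixes A :: "nat \<Rightarrow> bool"
  assumes "\<And>\<sigma>. (\<And>j. j > 4 \<Longrightarrow> \<sigma> j = j) \<Longrightarrow>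
    I (w \<circ> \<sigma>) = of_bool (A (\<sigma> 1) \<and> A (\<sigma> 2)) * of_bool (\<not> A (\<sigma> 3) \<and> \<not> A (\<sigma> 4))"
  shows "alternating I w = (of_bool (A 1) - of_bool (A 4)) * (of_bool (A 2) - of_bool (A 3))"
proof -
  have t: "transpose 1 4 j = j" "transpose 2 3 j = j" if "j > 4" for j :: nat
    using that by (simp_all add: transpose_def)
  have "I w = of_bool (A 1 \<and> A 2) * of_bool (\<not> A 3 \<and> \<not> A 4)"
    using assms[of id] by simp
  moreover have "I (w \<circ> transpose 1 4) = of_bool (A 4 \<and> A 2) * of_bool (\<not> A 3 \<and> \<not> A 1)"
    using assms[of "transpose 1 4", OF t(1)] by (simp add: transpose_def)
  moreover have "I (w \<circ> transpose 2 3) = of_bool (A 1 \<and> A 3) * of_bool (\<not> A 2 \<and> \<not> A 4)"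
    using assms[of "transpose 2 3", OF t(2)] by (simp add: transpose_def)
  moreover have "I (w \<circ> transpose 1 4 \<circ> transpose 2 3) = of_bool (A 4 \<and> A 3) * of_bool (\<not> A 2 \<and> \<not> A 1)"
    using assms[of "transpose 1 4 \<circ> transpose 2 3"] t by (simp add: o_assoc transpose_def)
  ultimately show ?thesis
    unfolding alternating_def by (cases "A 1"; cases "A 2"; cases "A 3"; cases "A 4") simp_all
qed

lemma alternating_I_D:
  "alternating (I_D r) z = (of_bool (below_x r z (z 5) 1) - of_bool (below_x r z (z 5) 4)) *
     (of_bool (below_x r z (z 5) 2) - of_bool (below_x r z (z 5) 3))"
  "alternating (I_D s) (y_part r z) = (of_bool (below_y r s z (z 5) 1) - of_bool (below_y r s z (z 5) 4)) *
     (of_bool (below_y r s z (z 5) 2) - of_bool (below_y r s z (z 5) 3))"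
  by (rule alternating_product[where A = "below_x r z (z 5)"];
      simp add: I_D_def preceq_def below_x_def)
    (rule alternating_product[where A = "below_y r s z (z 5)"];
      simp add: I_D_def preceq_def below_y_def y_part_def)

lemma alternating_I_R:
  fixes z :: tuple
  defines "u \<equiv> (\<lambda>l. z (4 + l) l)"
  shows "alternating (I_R 4 r) z = (of_bool (below_x r z u 1) - of_bool (below_x r z u 4)) *
     (of_bool (below_x r z u 2) - of_bool (below_x r z u 3))"
  "alternating (I_R (4 + r) s) (y_part r z) = (of_bool (below_y r s z u 1) - of_bool (below_y r s z u 4)) *
     (of_bool (below_y r s z u 2) - of_bool (below_y r s z u 3))"
  by (rule alternating_product[where A = "below_x r z u"];
      simp add: I_R_def preceq_def below_x_def u_def)
    (rule alternating_product[where A = "below_y r s z u"];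
      simp add: I_R_def preceq_def below_y_def y_part_def u_def add.assoc)

text \<open>
  The first summand of \<open>quad_poly\<close> is the sum over all columns; the other two are inclusion-exclusion
  corrections for coinciding columns.
\<close>

definition quad_poly :: "real \<Rightarrow> real \<Rightarrow> real \<Rightarrow> real \<Rightarrow> real" where
  "quad_poly N a b c = 4 * (N * c - a * b) * (N * c - a * b)
     - 4 * (c * N * N + a * b * b + a * a * b + 3 * N * c * c - 2 * N * b * c - 2 * N * a * c - 2 * a * b * c)
     + 4 * (N * c + a * b - 2 * b * c - 2 * a * c + 2 * c * c)"

text \<open>As \<open>concord\<close> is symmetric, the four simple coincidences all give the sum of
  the squared row sums, and the two double ones give the sum of the squared entries. A row sum
  depends on \<open>i\<close> only through \<open>A i\<close> and \<open>B i\<close>, which makes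
  everything a polynomial in the three counts and \<open>card M\<close>.\<close>

lemma sum_concord_quad:
  assumes "finite M"
  shows "(\<Sum>i\<in>M. \<Sum>j\<in>M. \<Sum>k\<in>M. \<Sum>l\<in>M. of_bool (distinct4 i j k l) * (concord A B i l * concord A B j k))
    = quad_poly (card M) (\<Sum>i\<in>M. of_bool (A i)) (\<Sum>i\<in>M. of_bool (B i)) (\<Sum>i\<in>M. of_bool (A i \<and> B i))"
proof -
  define N where "N = real (card M)"
  define a where "a = (\<Sum>i\<in>M. of_bool (A i) :: real)"
  define b where "b = (\<Sum>i\<in>M. of_bool (B i) :: real)"
  define c where "c = (\<Sum>i\<in>M. of_bool (A i \<and> B i) :: real)"
  let ?g = "concord A B"
  let ?h = "\<lambda>i j k l. ?g i l * ?g j k"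
  have comm: "?g i j = ?g j i" for i j
    by (simp add: concord_def algebra_simps)
  have h13: "?h i j i l = ?g i j * ?g i l" and h24: "?h i j k j = ?g j i * ?g j k"
    and h34: "?h i j k k = ?g k i * ?g k j" and h1324: "?h i j i j = ?g i j * ?g i j" for i j k l
    using comm[of j i] comm[of i k] comm[of j k] by simp_all
  define dv where "dv = (\<lambda>i. \<Sum>j\<in>M. ?g i j)"
  have row: "dv i = of_bool (A i \<and> B i) * N - of_bool (A i) * b - of_bool (B i) * a + c" for i
  proof -
    have "?g i j = of_bool (A i \<and> B i) - of_bool (A i) * of_bool (B j) - of_bool (B i) * of_bool (A j)
        + of_bool (A j \<and> B j)" for j
      by (auto simp: concord_def of_bool_def)
    then show ?thesis
      unfolding dv_def
      by (simp add: sum.distrib sum_subtractf sum_distrib_left[symmetric] a_def b_def c_def N_def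
          del: sum_of_bool_eq sum_of_bool_mult_eq sum_mult_of_bool_eq)
  qed
  have total: "(\<Sum>i\<in>M. dv i) = 2 * (N * c - a * b)"
    unfolding row
    by (simp add: sum.distrib sum_subtractf sum_distrib_right[symmetric] a_def[symmetric] b_def[symmetric] c_def[symmetric] N_def
          del: sum_of_bool_eq sum_of_bool_mult_eq sum_mult_of_bool_eq)
  have "(\<Sum>i\<in>M. \<Sum>j\<in>M. \<Sum>k\<in>M. \<Sum>l\<in>M. ?h i j k l) = (\<Sum>i\<in>M. dv i) * (\<Sum>i\<in>M. dv i)"
    by (simp add: sum_distrib_left[symmetric] sum_distrib_right[symmetric] dv_def)
  then have all: "(\<Sum>i\<in>M. \<Sum>j\<in>M. \<Sum>k\<in>M. \<Sum>l\<in>M. ?h i j k l)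
      = 2 * (N * c - a * b) * (2 * (N * c - a * b))"
    unfolding total .
  have "dv i * dv i = of_bool (A i \<and> B i) * (N * N - 2 * N * b - 2 * N * a + 2 * N * c + 2 * a * b)
      + of_bool (A i) * (b * b - 2 * b * c) + of_bool (B i) * (a * a - 2 * a * c) + c * c" for i
    unfolding row by (cases "A i"; cases "B i") (simp_all add: algebra_simps)
  then have "(\<Sum>i\<in>M. dv i * dv i) = c * (N * N - 2 * N * b - 2 * N * a + 2 * N * c + 2 * a * b)
      + a * (b * b - 2 * b * c) + b * (a * a - 2 * a * c) + N * (c * c)"
    by (simp add: sum.distrib sum_distrib_right[symmetric] a_def[symmetric] b_def[symmetric] c_def[symmetric] N_def
          del: sum_of_bool_eq sum_of_bool_mult_eq sum_mult_of_bool_eq)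
  then have sq: "(\<Sum>i\<in>M. dv i * dv i) = c * N * N + a * b * b + a * a * b + 3 * N * c * c - 2 * N * b * c - 2 * N * a * c - 2 * a * b * c"
    by (simp add: algebra_simps)
  have "?g i j * ?g i j = of_bool (A i \<and> B i) + of_bool (A i) * of_bool (B j) - 2 * of_bool (A i \<and> B i) * of_bool (B j)
     + of_bool (B i) * of_bool (A j) + of_bool (A j \<and> B j) - 2 * of_bool (B i) * of_bool (A j \<and> B j)
     - 2 * of_bool (A i \<and> B i) * of_bool (A j) - 2 * of_bool (A i) * of_bool (A j \<and> B j)
     + 4 * of_bool (A i \<and> B i) * of_bool (A j \<and> B j)" for i j
    by (cases "A i"; cases "B i"; cases "A j"; cases "B j") (simp_all add: concord_def)
  then have "(\<Sum>i\<in>M. \<Sum>j\<in>M. ?g i j * ?g i j) = c * N + a * b - 2 * c * b + b * a + N * c - 2 * b * c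
     - 2 * c * a - 2 * a * c + 4 * c * c"
    by (simp add: sum.distrib sum_subtractf sum_distrib_right[symmetric] sum_distrib_left[symmetric]
          a_def[symmetric] b_def[symmetric] c_def[symmetric] N_def
          del: sum_of_bool_eq sum_of_bool_mult_eq sum_mult_of_bool_eq)
  then have pairs: "(\<Sum>i\<in>M. \<Sum>j\<in>M. ?g i j * ?g i j) = 2 * (N * c + a * b - 2 * b * c - 2 * a * c + 2 * c * c)"
    by (simp add: algebra_simps)
  have "(\<Sum>i\<in>M. \<Sum>j\<in>M. \<Sum>k\<in>M. \<Sum>l\<in>M. of_bool (distinct4 i j k l) * ?h i j k l) =
    (\<Sum>i\<in>M. \<Sum>j\<in>M. \<Sum>k\<in>M. \<Sum>l\<in>M. ?h i j k l)
    - (\<Sum>i\<in>M. \<Sum>k\<in>M. \<Sum>l\<in>M. ?h i i k l) - (\<Sum>i\<in>M. \<Sum>j\<in>M. \<Sum>l\<in>M. ?h i j i l)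
    - (\<Sum>i\<in>M. \<Sum>j\<in>M. \<Sum>k\<in>M. ?h i j k j) - (\<Sum>i\<in>M. \<Sum>j\<in>M. \<Sum>k\<in>M. ?h i j k k)
    + (\<Sum>i\<in>M. \<Sum>k\<in>M. ?h i i k k) + (\<Sum>i\<in>M. \<Sum>j\<in>M. ?h i j i j)"
    using assms by (intro sum_distinct4) (auto simp: concord_def)
  moreover have "(\<Sum>i\<in>M. \<Sum>k\<in>M. \<Sum>l\<in>M. ?h i i k l) = (\<Sum>i\<in>M. dv i * dv i)"
    by (simp add: dv_def sum_product mult.commute)
  moreover have "(\<Sum>i\<in>M. \<Sum>j\<in>M. \<Sum>l\<in>M. ?h i j i l) = (\<Sum>i\<in>M. \<Sum>j\<in>M. \<Sum>l\<in>M. ?g i j * ?g i l)"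
    by (intro sum.cong refl h13)
  moreover have "(\<Sum>i\<in>M. \<Sum>j\<in>M. \<Sum>k\<in>M. ?h i j k j) = (\<Sum>i\<in>M. \<Sum>j\<in>M. \<Sum>k\<in>M. ?g i j * ?g i k)"
    by (subst sum.swap) (intro sum.cong refl h24)
  moreover have "(\<Sum>i\<in>M. \<Sum>j\<in>M. \<Sum>k\<in>M. ?h i j k k) = (\<Sum>k\<in>M. \<Sum>i\<in>M. \<Sum>j\<in>M. ?g k i * ?g k j)"
  proof -
    have "(\<Sum>i\<in>M. \<Sum>j\<in>M. \<Sum>k\<in>M. ?h i j k k) = (\<Sum>i\<in>M. \<Sum>k\<in>M. \<Sum>j\<in>M. ?h i j k k)"
      by (intro sum.cong refl sum.swap)
    also have "\<dots> = (\<Sum>k\<in>M. \<Sum>i\<in>M. \<Sum>j\<in>M. ?h i j k k)"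
      by (rule sum.swap)
    also have "\<dots> = (\<Sum>k\<in>M. \<Sum>i\<in>M. \<Sum>j\<in>M. ?g k i * ?g k j)"
      by (intro sum.cong refl h34)
    finally show ?thesis .
  qed
  moreover have "(\<Sum>i\<in>M. \<Sum>j\<in>M. ?h i j i j) = (\<Sum>i\<in>M. \<Sum>j\<in>M. ?g i j * ?g i j)"
    by (intro sum.cong refl h1324)
  moreover have "(\<Sum>i\<in>M. \<Sum>j\<in>M. \<Sum>k\<in>M. ?g i j * ?g i k) = (\<Sum>i\<in>M. dv i * dv i)"
    by (simp add: dv_def sum_product)
  ultimately show ?thesis
    unfolding all sq pairs quad_poly_def a_def[symmetric] b_def[symmetric] c_def[symmetric] N_def[symmetric]
    by (simp add: algebra_simps)
qed

section \<open>Kernels built from a binary relation\<close>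

definition rel4 :: "(nat \<Rightarrow> nat \<Rightarrow> bool) \<Rightarrow> nat \<Rightarrow> nat \<Rightarrow> nat \<Rightarrow> nat \<Rightarrow> real" where
  "rel4 R i j k l = of_bool (R i k \<and> R i l \<and> R j k \<and> R j l)"

definition alt4 :: "(nat \<Rightarrow> nat \<Rightarrow> bool) \<Rightarrow> nat \<Rightarrow> nat \<Rightarrow> nat \<Rightarrow> nat \<Rightarrow> real" where
  "alt4 R i j k l = rel4 R i j k l - rel4 R l j k i - rel4 R i k j l + rel4 R l k j i"

text \<open>
  \<open>correction\<close> is the contribution of the tuples with coinciding columns. Coincidences of the columns
  1, 4 or 2, 3 contribute nothing by antisymmetry.
\<close>

definition margin :: "nat set \<Rightarrow> (nat \<Rightarrow> nat \<Rightarrow> bool) \<Rightarrow> (nat \<Rightarrow> nat \<Rightarrow> bool) \<Rightarrow> nat \<Rightarrow> real" where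
  "margin M R R' v = (\<Sum>p\<in>M. of_bool (R v p \<and> R' v p))"

definition correction :: "nat set \<Rightarrow> (nat \<Rightarrow> nat \<Rightarrow> bool) \<Rightarrow> (nat \<Rightarrow> nat \<Rightarrow> bool) \<Rightarrow> real" where
  "correction M R R' = (\<Sum>v\<in>M. \<Sum>p\<leftarrow>[margin M R R' v, margin M R R'\<inverse>\<inverse> v, margin M R\<inverse>\<inverse> R' v, margin M R\<inverse>\<inverse> R'\<inverse>\<inverse> v].
     4 * p * p - 2 * p)"

lemma sum_swap_outer:
  "(\<Sum>i\<in>M. \<Sum>j\<in>M. \<Sum>k\<in>M. \<Sum>l\<in>M. F l j k i) = (\<Sum>i\<in>M. \<Sum>j\<in>M. \<Sum>k\<in>M. \<Sum>l\<in>M. F i j k (l :: nat) :: real)"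
  "(\<Sum>i\<in>M. \<Sum>j\<in>M. \<Sum>k\<in>M. \<Sum>l\<in>M. F i k j l) = (\<Sum>i\<in>M. \<Sum>j\<in>M. \<Sum>k\<in>M. \<Sum>l\<in>M. F i j k (l :: nat) :: real)"
proof -
  show inner: "(\<Sum>i\<in>M. \<Sum>j\<in>M. \<Sum>k\<in>M. \<Sum>l\<in>M. F i k j l) = (\<Sum>i\<in>M. \<Sum>j\<in>M. \<Sum>k\<in>M. \<Sum>l\<in>M. F i j k (l :: nat) :: real)" for F
    by (intro sum.cong refl sum.swap)
  have "(\<Sum>i\<in>M. \<Sum>j\<in>M. \<Sum>k\<in>M. \<Sum>l\<in>M. F l j k i) = (\<Sum>i\<in>M. \<Sum>k\<in>M. \<Sum>j\<in>M. \<Sum>l\<in>M. F l j k i)"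
    by (intro sum.cong refl sum.swap)
  also have "\<dots> = (\<Sum>i\<in>M. \<Sum>j\<in>M. \<Sum>k\<in>M. \<Sum>l\<in>M. F i j k l)"
    by (rule sum_reverse4)
  finally show "(\<Sum>i\<in>M. \<Sum>j\<in>M. \<Sum>k\<in>M. \<Sum>l\<in>M. F l j k i) = (\<Sum>i\<in>M. \<Sum>j\<in>M. \<Sum>k\<in>M. \<Sum>l\<in>M. F i j k l)" .
qed

text \<open>
  Since the alternating sum changes its sign under the transpositions of 1, 4 and of 2, 3, the four terms
  of the first factor contribute equally.
\<close>

lemma sum_alt4_alt4:
  "(\<Sum>i\<in>M. \<Sum>j\<in>M. \<Sum>k\<in>M. \<Sum>l\<in>M. alt4 R i j k l * alt4 R' i j k l)
    = 4 * (\<Sum>i\<in>M. \<Sum>j\<in>M. \<Sum>k\<in>M. \<Sum>l\<in>M. rel4 R i j k l * alt4 R' i j k l)"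
proof -
  have anti: "alt4 R' l j k i = - alt4 R' i j k l" "alt4 R' i k j l = - alt4 R' i j k l" for i j k l
    by (simp_all add: alt4_def)
  have e1: "rel4 R i j k l * alt4 R' l j k i = - (rel4 R i j k l * alt4 R' i j k l)"
    and e2: "rel4 R i j k l * alt4 R' i k j l = - (rel4 R i j k l * alt4 R' i j k l)" for i j k l
    by (simp_all only: anti(1)[of l j k i] anti(2)[of i k j l] mult_minus_right)
  let ?s = "\<lambda>F. \<Sum>i\<in>M. \<Sum>j\<in>M. \<Sum>k\<in>M. \<Sum>l\<in>M. F i j k l :: real"
  let ?I = "rel4 R" and ?J = "alt4 R'"
  have "?s (\<lambda>i j k l. alt4 R i j k l * ?J i j k l)
    = ?s (\<lambda>i j k l. ?I i j k l * ?J i j k l) - ?s (\<lambda>i j k l. ?I l j k i * ?J i j k l)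
      - ?s (\<lambda>i j k l. ?I i k j l * ?J i j k l) + ?s (\<lambda>i j k l. ?I l k j i * ?J i j k l)"
    by (simp add: alt4_def[of R] algebra_simps sum.distrib sum_subtractf)
  moreover have "?s (\<lambda>i j k l. ?I l j k i * ?J i j k l) = ?s (\<lambda>i j k l. ?I i j k l * ?J l j k i)"
    by (rule sum_swap_outer(1))
  moreover have "?s (\<lambda>i j k l. ?I i k j l * ?J i j k l) = ?s (\<lambda>i j k l. ?I i j k l * ?J i k j l)"
    by (rule sum_swap_outer(2))
  moreover have "?s (\<lambda>i j k l. ?I l k j i * ?J i j k l) = ?s (\<lambda>i j k l. ?I i k j l * ?J l j k i)"
    by (rule sum_swap_outer(1))
  moreover have "\<dots> = ?s (\<lambda>i j k l. ?I i j k l * ?J l k j i)"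
    by (rule sum_swap_outer(2))
  moreover have "?s (\<lambda>i j k l. ?I i j k l * ?J l j k i) = ?s (\<lambda>i j k l. - (?I i j k l * ?J i j k l))"
    by (intro sum.cong refl e1)
  moreover have "?s (\<lambda>i j k l. ?I i j k l * ?J i k j l) = ?s (\<lambda>i j k l. - (?I i j k l * ?J i j k l))"
    by (intro sum.cong refl e2)
  moreover have e3: "?I i j k l * ?J l k j i = ?I i j k l * ?J i j k l" for i j k l
    by (simp add: alt4_def)
  have "?s (\<lambda>i j k l. ?I i j k l * ?J l k j i) = ?s (\<lambda>i j k l. ?I i j k l * ?J i j k l)"
    by (intro sum.cong refl e3)
  ultimately show ?thesis
    by (simp add: sum_negf)
qed

text \<open>When two columns coincide, an alternating sum collapses, up to sign, to two terms, one
  for each direction of the relation. The sign is the same in both factors, so the product is a sum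
  of four terms, which belong to the four margins. Each of the four simple coincidences contributes
  \<open>p * p\<close>, and each of the two double ones gives back \<open>p\<close>; hence
  \<open>4 * p * p - 2 * p\<close>.\<close>

lemma sum_distinct_alt4:
  assumes "finite M" and R: "\<And>i. \<not> R i i" "\<And>i. \<not> R' i i"
  shows "(\<Sum>i\<in>M. \<Sum>j\<in>M. \<Sum>k\<in>M. \<Sum>l\<in>M. of_bool (distinct4 i j k l) * (alt4 R i j k l * alt4 R' i j k l))
    = 4 * (\<Sum>i\<in>M. \<Sum>j\<in>M. \<Sum>k\<in>M. \<Sum>l\<in>M. rel4 R i j k l * alt4 R' i j k l) - correction M R R'"
proof -
  let ?h = "\<lambda>i j k l. alt4 R i j k l * alt4 R' i j k l"
  define b where "b = (\<lambda>v p. [of_bool (R v p \<and> R' v p), of_bool (R v p \<and> R' p v),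
     of_bool (R p v \<and> R' v p), of_bool (R p v \<and> R' p v) :: real])"
  define f where "f = (\<lambda>v p q. \<Sum>t\<leftarrow>zip (b v p) (b v q). fst t * snd t)"
  have f: "f v p q = of_bool (R v p \<and> R' v p) * of_bool (R v q \<and> R' v q)
    + of_bool (R v p \<and> R' p v) * of_bool (R v q \<and> R' q v)
    + of_bool (R p v \<and> R' v p) * of_bool (R q v \<and> R' v q)
    + of_bool (R p v \<and> R' p v) * of_bool (R q v \<and> R' q v)" for v p q
    by (simp add: f_def b_def)
  have collapse: "alt4 Q i i k l = of_bool (Q i k) * of_bool (Q i l) + of_bool (Q k i) * of_bool (Q l i)"
    "alt4 Q i j i l = - (of_bool (Q i j) * of_bool (Q i l) + of_bool (Q j i) * of_bool (Q l i))"
    "alt4 Q i j k j = - (of_bool (Q j i) * of_bool (Q j k) + of_bool (Q i j) * of_bool (Q k j))"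
    "alt4 Q i j k k = of_bool (Q k i) * of_bool (Q k j) + of_bool (Q i k) * of_bool (Q j k)"
    if "\<And>i. \<not> Q i i" for Q i j k l
    using that by (auto simp: alt4_def rel4_def)
  have h12: "?h i i k l = f i k l" and h13: "?h i j i l = f i j l"
    and h24: "?h i j k j = f j i k" and h34: "?h i j k k = f k i j" for i j k l
    unfolding f collapse[OF R(1)] collapse[OF R(2)] of_bool_conj by (simp_all add: algebra_simps)
  let ?m = "\<lambda>v. [margin M R R' v, margin M R R'\<inverse>\<inverse> v, margin M R\<inverse>\<inverse> R' v, margin M R\<inverse>\<inverse> R'\<inverse>\<inverse> v]"
  have sq: "(\<Sum>p\<in>M. \<Sum>q\<in>M. f v p q) = (\<Sum>p\<leftarrow>?m v. p * p)" for v
    unfolding f sum.distrib by (simp add: margin_def sum_product del: sum_of_bool_eq sum_of_bool_mult_eq sum_mult_of_bool_eq)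
  have dg: "(\<Sum>p\<in>M. f v p p) = (\<Sum>p\<leftarrow>?m v. p)" for v
    unfolding f sum.distrib by (simp add: margin_def of_bool_conj[symmetric] del: sum_of_bool_eq sum_of_bool_mult_eq sum_mult_of_bool_eq)
  have "(\<Sum>i\<in>M. \<Sum>j\<in>M. \<Sum>k\<in>M. \<Sum>l\<in>M. of_bool (distinct4 i j k l) * ?h i j k l) =
    (\<Sum>i\<in>M. \<Sum>j\<in>M. \<Sum>k\<in>M. \<Sum>l\<in>M. ?h i j k l)
    - (\<Sum>i\<in>M. \<Sum>k\<in>M. \<Sum>l\<in>M. ?h i i k l) - (\<Sum>i\<in>M. \<Sum>j\<in>M. \<Sum>l\<in>M. ?h i j i l)
    - (\<Sum>i\<in>M. \<Sum>j\<in>M. \<Sum>k\<in>M. ?h i j k j) - (\<Sum>i\<in>M. \<Sum>j\<in>M. \<Sum>k\<in>M. ?h i j k k)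
    + (\<Sum>i\<in>M. \<Sum>k\<in>M. ?h i i k k) + (\<Sum>i\<in>M. \<Sum>j\<in>M. ?h i j i j)"
    using assms by (intro sum_distinct4) (auto simp: alt4_def rel4_def)
  also have "(\<Sum>i\<in>M. \<Sum>j\<in>M. \<Sum>k\<in>M. ?h i j k j) = (\<Sum>v\<in>M. \<Sum>p\<in>M. \<Sum>q\<in>M. f v p q)"
    unfolding h24 by (rule sum.swap)
  also have "(\<Sum>i\<in>M. \<Sum>j\<in>M. \<Sum>k\<in>M. ?h i j k k) = (\<Sum>v\<in>M. \<Sum>p\<in>M. \<Sum>q\<in>M. f v p q)"
  proof -
    have "(\<Sum>i\<in>M. \<Sum>j\<in>M. \<Sum>k\<in>M. f k i j) = (\<Sum>i\<in>M. \<Sum>k\<in>M. \<Sum>j\<in>M. f k i j)"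
      by (intro sum.cong refl sum.swap)
    also have "\<dots> = (\<Sum>k\<in>M. \<Sum>i\<in>M. \<Sum>j\<in>M. f k i j)"
      by (rule sum.swap)
    finally show ?thesis
      unfolding h34 .
  qed
  finally show ?thesis
    unfolding h12 h13 sum_alt4_alt4 correction_def sq dg
    by (simp add: sum.distrib sum_subtractf sum_distrib_left algebra_simps)
qed

lemma alternating_rel4:
  assumes "\<And>\<sigma>. I (w \<circ> \<sigma>) = rel4 R (\<sigma> 1) (\<sigma> 2) (\<sigma> 3) (\<sigma> 4)"
  shows "alternating I w = alt4 R 1 2 3 4"
  using assms[of id] assms[of "transpose 1 4"] assms[of "transpose 2 3"] assms[of "transpose 1 4 \<circ> transpose 2 3"]
  by (simp add: alternating_def alt4_def o_assoc transpose_def)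

lemma alternating_I_J:
  "alternating (I_J r) z = alt4 (\<lambda>i j. prec r (z i) (z j)) 1 2 3 4"
  by (rule alternating_rel4[where R = "\<lambda>i j. prec r (z i) (z j)"]) (simp add: I_J_def rel4_def)

lemma alternating_I_P:
  "alternating (I_P r) z = alt4 (\<lambda>i j. \<not> preceq r (z j) (z i)) 1 2 3 4"
  by (rule alternating_rel4[where R = "\<lambda>i j. \<not> preceq r (z j) (z i)"]) (simp add: I_P_def rel4_def conj_ac)

section \<open>Closed formulas for the statistics\<close>

definition rest_count :: "nat \<Rightarrow> nat \<Rightarrow> (nat \<Rightarrow> nat) \<Rightarrow> (nat \<Rightarrow> bool) \<Rightarrow> real" where
  "rest_count n e g P = (\<Sum>i\<in>{1..n}. of_bool (P i)) - (\<Sum>k\<in>{5..4 + e}. of_bool (P (g k)))"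

text \<open>The reference point is determined by the columns above 4. It stays constant while the
  first four columns range over the \<open>n - e\<close> indices that are left, and
  \<open>sum_concord_quad\<close> evaluates that sum.\<close>

lemma sum_quad_injections:
  fixes ref :: "(nat \<Rightarrow> nat) \<Rightarrow> nat \<Rightarrow> real" and r s :: nat and z :: tuple
  assumes ref: "\<And>g h. (\<And>k. k > 4 \<Longrightarrow> g k = h k) \<Longrightarrow> ref g = ref h"
  defines "A \<equiv> \<lambda>g. below_x r z (ref g)" and "B \<equiv> \<lambda>g. below_y r s z (ref g)"
  shows "(\<Sum>f\<in>injections {1..4 + e} {1..n}. 1 / 4 *
      ((of_bool (A f (f 1)) - of_bool (A f (f 4))) * (of_bool (A f (f 2)) - of_bool (A f (f 3)))) *
      ((of_bool (B f (f 1)) - of_bool (B f (f 4))) * (of_bool (B f (f 2)) - of_bool (B f (f 3)))))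
    = 1 / 4 * (\<Sum>g\<in>injections {5..4 + e} {1..n}. quad_poly (real n - real e)
        (rest_count n e g (A g)) (rest_count n e g (B g)) (rest_count n e g (\<lambda>p. A g p \<and> B g p)))"
proof -
  define F :: "(nat \<Rightarrow> nat) \<Rightarrow> real" where "F = (\<lambda>f. 1 / 4 * (concord (A f) (B f) (f 1) (f 4) * concord (A f) (B f) (f 2) (f 3)))"
  have "(\<Sum>f\<in>injections {1..4 + e} {1..n}. 1 / 4 *
      ((of_bool (A f (f 1)) - of_bool (A f (f 4))) * (of_bool (A f (f 2)) - of_bool (A f (f 3)))) *
      ((of_bool (B f (f 1)) - of_bool (B f (f 4))) * (of_bool (B f (f 2)) - of_bool (B f (f 3)))))
    = (\<Sum>f\<in>injections {1..4 + e} {1..n}. F f)"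
    unfolding F_def concord_def by (intro sum.cong refl) (simp only: mult_ac)
  also have "\<dots> = (\<Sum>g\<in>injections {5..4 + e} {1..n}. 1 / 4 * quad_poly (real n - real e)
        (rest_count n e g (A g)) (rest_count n e g (B g)) (rest_count n e g (\<lambda>p. A g p \<and> B g p)))"
    unfolding sum_injections_4[OF finite_atLeastAtMost] Let_def
  proof (rule sum.cong)
    fix g assume g: "g \<in> injections {5..4 + e} {1..n}"
    define M where "M = {1..n} - g ` {5..4 + e}"
    have fin: "finite M"
      by (simp add: M_def)
    have gsub: "g ` {5..4 + e} \<subseteq> {1..n}" and ginj: "inj_on g {5..4 + e}"
      using g by (auto simp: injections_def)
    have card: "card (g ` {5..4 + e}) = e"
      using ginj by (simp add: card_image)
    have "card M = n - e"
      unfolding M_def using gsub card by (subst card_Diff_subset) auto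
    moreover have "e \<le> n"
      using card_mono[OF _ gsub] card by simp
    ultimately have cM: "real (card M) = real n - real e"
      by simp
    have rest: "(\<Sum>i\<in>M. of_bool (P i)) = rest_count n e g P" for P
    proof -
      have "(\<Sum>i\<in>M. of_bool (P i) :: real) = (\<Sum>i\<in>{1..n}. of_bool (P i)) - (\<Sum>i\<in>g ` {5..4 + e}. of_bool (P i))"
        unfolding M_def using gsub by (intro sum_diff) auto
      also have "(\<Sum>i\<in>g ` {5..4 + e}. of_bool (P i) :: real) = (\<Sum>k\<in>{5..4 + e}. of_bool (P (g k)))"
        using sum.reindex[OF ginj, of "\<lambda>i. of_bool (P i) :: real"] by (simp del: sum_of_bool_eq)
      finally show ?thesis
        by (simp add: rest_count_def)
    qed
    have F: "F (g(4 := l, 3 := k, 2 := j, 1 := i)) = 1 / 4 * (concord (A g) (B g) i l * concord (A g) (B g) j k)" for i j k l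
    proof -
      have "ref (g(4 := l, 3 := k, 2 := j, 1 := i)) = ref g"
        by (rule ref) simp
      then show ?thesis
        by (simp add: F_def A_def B_def)
    qed
    have "(\<Sum>i\<in>M. \<Sum>j\<in>M. \<Sum>k\<in>M. \<Sum>l\<in>M. of_bool (distinct4 i j k l) * F (g(4 := l, 3 := k, 2 := j, 1 := i)))
      = 1 / 4 * (\<Sum>i\<in>M. \<Sum>j\<in>M. \<Sum>k\<in>M. \<Sum>l\<in>M. of_bool (distinct4 i j k l) *
          (concord (A g) (B g) i l * concord (A g) (B g) j k))"
      unfolding F sum_distrib_left by (intro sum.cong refl) simp
    also have "\<dots> = 1 / 4 * quad_poly (real n - real e)
        (rest_count n e g (A g)) (rest_count n e g (B g)) (rest_count n e g (\<lambda>p. A g p \<and> B g p))"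
      unfolding sum_concord_quad[OF fin] rest cM ..
    finally show "(\<Sum>i\<in>{1..n} - g ` {5..4 + e}. \<Sum>j\<in>{1..n} - g ` {5..4 + e}. \<Sum>k\<in>{1..n} - g ` {5..4 + e}.
        \<Sum>l\<in>{1..n} - g ` {5..4 + e}. of_bool (distinct4 i j k l) * F (g(4 := l, 3 := k, 2 := j, 1 := i)))
      = 1 / 4 * quad_poly (real n - real e)
        (rest_count n e g (A g)) (rest_count n e g (B g)) (rest_count n e g (\<lambda>p. A g p \<and> B g p))"
      unfolding M_def .
  qed simp
  finally show ?thesis
    by (simp add: sum_distrib_left)
qed

text \<open>The falling factorial. For \<open>m > n\<close> truncated subtraction produces a factor
  0, in agreement with the binomial coefficient.\<close>

definition falling :: "nat \<Rightarrow> nat \<Rightarrow> real" where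
  "falling n m = (\<Prod>k<m. real (n - k))"

lemma falling_eq: "real (n choose m) * fact m = falling n m"
proof (induction m)
  case (Suc m)
  have "real (n choose Suc m) * fact (Suc m) = real (Suc m * (n choose Suc m)) * fact m"
    by (simp add: algebra_simps)
  also have "Suc m * (n choose Suc m) = (n - m) * (n choose m)"
    using binomial_absorb_comp[of n m] binomial_absorption[of m n] by simp
  finally show ?case
    using Suc by (simp add: falling_def mult_ac)
qed (simp add: falling_def)

theorem U_R_formula:
  fixes z :: tuple
  defines "u \<equiv> \<lambda>g l. z (g (4 + l)) l"
  shows "U_R r s n z = 1 / falling n (4 + (r + s)) * (1 / 4 * (\<Sum>g\<in>injections {5..4 + (r + s)} {1..n}.
    quad_poly (real n - real (r + s)) (rest_count n (r + s) g (below_x r z (u g))) (rest_count n (r + s) g (below_y r s z (u g)))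
      (rest_count n (r + s) g (\<lambda>p. below_x r z (u g) p \<and> below_y r s z (u g) p))))"
proof -
  have "kernel r s (4 + (r + s)) (1 / 4) (I_R 4) (I_R (4 + r)) (\<lambda>j. z (f j)) =
    1 / 4 * ((of_bool (below_x r z (u f) (f 1)) - of_bool (below_x r z (u f) (f 4))) *
        (of_bool (below_x r z (u f) (f 2)) - of_bool (below_x r z (u f) (f 3)))) *
      ((of_bool (below_y r s z (u f) (f 1)) - of_bool (below_y r s z (u f) (f 4))) *
        (of_bool (below_y r s z (u f) (f 2)) - of_bool (below_y r s z (u f) (f 3))))" for f
    by (simp add: kernel_eq alternating_I_R below_x_def below_y_def u_def)
  then have "U_R r s n z = 1 / falling n (4 + (r + s)) * (\<Sum>f\<in>injections {1..4 + (r + s)} {1..n}.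
    1 / 4 * ((of_bool (below_x r z (u f) (f 1)) - of_bool (below_x r z (u f) (f 4))) *
        (of_bool (below_x r z (u f) (f 2)) - of_bool (below_x r z (u f) (f 3)))) *
      ((of_bool (below_y r s z (u f) (f 1)) - of_bool (below_y r s z (u f) (f 4))) *
        (of_bool (below_y r s z (u f) (f 2)) - of_bool (below_y r s z (u f) (f 3)))))"
    by (simp only: U_R_def Let_def U_stat_symmetrize falling_eq)
  \<comment> \<open>At coordinate 0 the point \<open>u\<close> would refer to column 4, one of the
    columns that vary. Blanking it makes the point depend on the columns above 4 only.\<close>
  moreover define u' where "u' = (\<lambda>g l. if l = 0 then 0 else u g l)"
  have "u' g = u' h" if "\<And>k. k > 4 \<Longrightarrow> g k = h k" for g h
    using that by (auto simp: u'_def u_def)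
  note sum_quad_injections[where ref = u' and r = r and s = s and z = z and n = n and e = "r + s", OF this]
  moreover have "below_x r z (u g) = below_x r z (u' g)" "below_y r s z (u g) = below_y r s z (u' g)" for g
    by (auto simp: below_x_def below_y_def u'_def fun_eq_iff)
  ultimately show ?thesis
    by (simp only:)
qed

text \<open>The only reference column is 5, and its point is below itself in all coordinates, so
  excluding it lowers each of the three counts by 1.\<close>

theorem U_D_formula:
  fixes z :: tuple and n :: nat
  defines "cnt \<equiv> \<lambda>P. (\<Sum>i\<in>{1..n}. of_bool (P i)) - 1 :: real"
  shows "U_D r s n z = 1 / falling n 5 * (1 / 4 * (\<Sum>p\<in>{1..n}.
    quad_poly (real n - 1) (cnt (below_x r z (z p))) (cnt (below_y r s z (z p)))
      (cnt (\<lambda>i. below_x r z (z p) i \<and> below_y r s z (z p) i))))"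
proof -
  define u where "u = (\<lambda>g :: nat \<Rightarrow> nat. z (g 5))"
  have "kernel r s 5 (1 / 4) I_D I_D (\<lambda>j. z (f j)) =
    1 / 4 * ((of_bool (below_x r z (u f) (f 1)) - of_bool (below_x r z (u f) (f 4))) *
        (of_bool (below_x r z (u f) (f 2)) - of_bool (below_x r z (u f) (f 3)))) *
      ((of_bool (below_y r s z (u f) (f 1)) - of_bool (below_y r s z (u f) (f 4))) *
        (of_bool (below_y r s z (u f) (f 2)) - of_bool (below_y r s z (u f) (f 3))))" for f
    by (simp add: kernel_eq alternating_I_D(1)[of r "\<lambda>j. z (f j)"] alternating_I_D(2)[of s r "\<lambda>j. z (f j)"]
        below_x_def below_y_def u_def)
  then have "U_D r s n z = 1 / falling n 5 * (\<Sum>f\<in>injections {1..4 + 1} {1..n}.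
    1 / 4 * ((of_bool (below_x r z (u f) (f 1)) - of_bool (below_x r z (u f) (f 4))) *
        (of_bool (below_x r z (u f) (f 2)) - of_bool (below_x r z (u f) (f 3)))) *
      ((of_bool (below_y r s z (u f) (f 1)) - of_bool (below_y r s z (u f) (f 4))) *
        (of_bool (below_y r s z (u f) (f 2)) - of_bool (below_y r s z (u f) (f 3)))))"
    by (simp only: U_D_def U_stat_symmetrize falling_eq) simp
  also have "\<dots> = 1 / falling n 5 * (1 / 4 * (\<Sum>g\<in>injections {5..4 + 1} {1..n}. quad_poly (real n - real 1)
        ((\<Sum>i\<in>{1..n}. of_bool (below_x r z (u g) i)) - (\<Sum>k\<in>{5..4 + 1}. of_bool (below_x r z (u g) (g k))))
        ((\<Sum>i\<in>{1..n}. of_bool (below_y r s z (u g) i)) - (\<Sum>k\<in>{5..4 + 1}. of_bool (below_y r s z (u g) (g k))))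
        ((\<Sum>i\<in>{1..n}. of_bool (below_x r z (u g) i \<and> below_y r s z (u g) i))
          - (\<Sum>k\<in>{5..4 + 1}. of_bool (below_x r z (u g) (g k) \<and> below_y r s z (u g) (g k))))))"
    by (subst sum_quad_injections) (simp_all add: u_def rest_count_def)
  also have "\<dots> = 1 / falling n 5 * (1 / 4 * (\<Sum>g\<in>injections (insert (5 :: nat) {}) {1..n}. quad_poly (real n - 1)
      (cnt (below_x r z (z (g 5)))) (cnt (below_y r s z (z (g 5))))
      (cnt (\<lambda>i. below_x r z (z (g 5)) i \<and> below_y r s z (z (g 5)) i))))"
    by (simp add: u_def cnt_def below_x_def below_y_def del: sum_of_bool_eq)
  also have "\<dots> = 1 / falling n 5 * (1 / 4 * (\<Sum>p\<in>{1..n}.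
    quad_poly (real n - 1) (cnt (below_x r z (z p))) (cnt (below_y r s z (z p)))
      (cnt (\<lambda>i. below_x r z (z p) i \<and> below_y r s z (z p) i))))"
    by (subst sum_injections_insert) (simp_all add: injections_def)
  finally show ?thesis .
qed

theorem U_tau_formula:
  fixes r :: nat and z :: tuple and Rx Ry :: "(nat \<Rightarrow> real) \<Rightarrow> (nat \<Rightarrow> real) \<Rightarrow> bool"
  assumes "\<And>z. alternating (IX r) z = alt4 (\<lambda>i j. Rx (z i) (z j)) 1 2 3 4"
    "\<And>z. alternating (IY s) z = alt4 (\<lambda>i j. Ry (z i) (z j)) 1 2 3 4"
    "\<And>a. \<not> Rx a a" "\<And>a. \<not> Ry a a"
  defines "R \<equiv> \<lambda>i j. Rx (z i) (z j)" and "R' \<equiv> \<lambda>i j. Ry (y_part r z i) (y_part r z j)"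
  shows "U_stat 4 (symmetrize 4 (kernel r s 4 1 IX IY)) n z = 1 / falling n 4 *
    (4 * (\<Sum>i\<in>{1..n}. \<Sum>j\<in>{1..n}. \<Sum>k\<in>{1..n}. \<Sum>l\<in>{1..n}. rel4 R i j k l * alt4 R' i j k l)
      - correction {1..n} R R')"
proof -
  have alt4_comp: "alt4 (\<lambda>i j. Q (f i) (f j)) i j k l = alt4 Q (f i) (f j) (f k) (f l)" for Q and f :: "nat \<Rightarrow> nat" and i j k l
    by (simp add: alt4_def rel4_def)
  have "kernel r s 4 1 IX IY (\<lambda>j. z (f j)) = alt4 R (f 1) (f 2) (f 3) (f 4) * alt4 R' (f 1) (f 2) (f 3) (f 4)" for f
    by (simp add: kernel_eq assms(1,2) R_def R'_def y_part_def flip: alt4_comp)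
  then have "U_stat 4 (symmetrize 4 (kernel r s 4 1 IX IY)) n z = 1 / falling n 4 *
    (\<Sum>f\<in>injections {1..4 + 0 :: nat} {1..n}. alt4 R (f 1) (f 2) (f 3) (f 4) * alt4 R' (f 1) (f 2) (f 3) (f 4))"
    by (simp only: U_stat_symmetrize falling_eq add_0_right)
  also have "(\<Sum>f\<in>injections {1..4 + 0 :: nat} {1..n}. alt4 R (f 1) (f 2) (f 3) (f 4) * alt4 R' (f 1) (f 2) (f 3) (f 4))
    = (\<Sum>i\<in>{1..n}. \<Sum>j\<in>{1..n}. \<Sum>k\<in>{1..n}. \<Sum>l\<in>{1..n}.
        of_bool (distinct4 i j k l) * (alt4 R i j k l * alt4 R' i j k l))"
    by (subst sum_injections_4) (simp_all add: Let_def injections_def del: sum_of_bool_mult_eq sum_mult_of_bool_eq)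
  also have "\<dots> = 4 * (\<Sum>i\<in>{1..n}. \<Sum>j\<in>{1..n}. \<Sum>k\<in>{1..n}. \<Sum>l\<in>{1..n}. rel4 R i j k l * alt4 R' i j k l)
      - correction {1..n} R R'"
    by (rule sum_distinct_alt4) (simp_all add: R_def R'_def assms)
  finally show ?thesis .
qed

section \<open>Program schemes\<close>

lemma computable_in_timeI:
  fixes T :: "nat \<Rightarrow> nat"
  assumes "\<And>n z. n \<ge> m \<Longrightarrow> run (n ^ w) p (input_store d n z) (T n) (\<lambda>S. output_of S = U n z)"
    and "(\<lambda>n. real (T n)) \<in> O(g)"
  shows "computable_in_time d m U g"
  unfolding computable_in_time_def
proof (rule exI[of _ p], rule exI[of _ w], rule exI[of _ "\<lambda>n. real (T n)"], intro conjI allI impI)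
  fix n z assume "m \<le> n"
  from assms(1)[OF this, of z] show "\<exists>t S. exec (n ^ w) p (input_store d n z) t S \<and> output_of S = U n z \<and> real t \<le> real (T n)"
    unfolding run_def by auto
qed (fact assms(2))

text \<open>The step hypothesis admits stores in which the target array has been changed
  arbitrarily; thus the values written cannot depend on earlier writes.\<close>

lemma run_fill:
  assumes "imem S m 0 = N" "N < B" "c \<noteq> m"
    and step: "\<And>i S'. i < N \<Longrightarrow> same {c} {a} S S' \<Longrightarrow> imem S' c 0 = i \<Longrightarrow>
      isafe B S' e \<and> rsafe B S' f \<and> ival S' e = g i \<and> rval S' f = F i"
    and inj: "inj_on g {..<N}"
  shows "run B (For c m (RAssign a e f)) S (N * (pcost (RAssign a e f) + 12) + 9)
    (\<lambda>S'. same {c} {a} S S' \<and> (\<forall>i<N. rmem S' a (g i) = F i) \<and>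
      (\<forall>x. x \<notin> g ` {..<N} \<longrightarrow> rmem S' a x = rmem S a x))"
proof (rule run_For[where P = "\<lambda>k S'. same {c} {a} S S' \<and> (\<forall>i<k. rmem S' a (g i) = F i) \<and>
      (\<forall>x. x \<notin> g ` {..<k} \<longrightarrow> rmem S' a x = rmem S a x)"])
  fix i S' assume i: "i < N" and P: "same {c} {a} S S' \<and> (\<forall>i'<i. rmem S' a (g i') = F i') \<and>
      (\<forall>x. x \<notin> g ` {..<i} \<longrightarrow> rmem S' a x = rmem S a x)" and ci: "imem S' c 0 = i"
  have ev: "isafe B S' e" "rsafe B S' f" "ival S' e = g i" "rval S' f = F i"
    using step[OF i _ ci] P by auto
  have "g i' \<noteq> g i" if "i' < i" for i'
    using inj_on_eq_iff[OF inj, of i i'] i that by auto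
  then show "run B (RAssign a e f) S' (pcost (RAssign a e f)) (\<lambda>S''. (same {c} {a} S S'' \<and> (\<forall>i'<Suc i. rmem S'' a (g i') = F i') \<and>
      (\<forall>x. x \<notin> g ` {..<Suc i} \<longrightarrow> rmem S'' a x = rmem S a x)) \<and> imem S'' c 0 = i)"
    by (intro run_straight) (use ev P ci in \<open>auto simp: less_Suc_eq lessThan_Suc\<close>)
qed (use assms in \<open>auto simp: same_def\<close>)

lemma run_accumulate:
  assumes "imem S m 0 = N" "N < B" "c \<noteq> m"
    and step: "\<And>i S'. i < N \<Longrightarrow> same {c} {a} S S' \<Longrightarrow> imem S' c 0 = i \<Longrightarrow>
      isafe B S' e \<and> rsafe B S' f \<and> ival S' e = x \<and> rval S' f = F i"
  shows "run B (For c m (RAssign a e (RAdd (RArr a e) f))) S (N * (pcost (RAssign a e (RAdd (RArr a e) f)) + 12) + 9)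
    (\<lambda>S'. same {c} {a} S S' \<and> rmem S' a = (rmem S a)(x := rmem S a x + (\<Sum>i<N. F i)))"
proof (rule run_For[where P = "\<lambda>k S'. same {c} {a} S S' \<and> rmem S' a = (rmem S a)(x := rmem S a x + (\<Sum>i<k. F i))"])
  fix i S' assume i: "i < N" and P: "same {c} {a} S S' \<and> rmem S' a = (rmem S a)(x := rmem S a x + (\<Sum>i<i. F i))"
    and ci: "imem S' c 0 = i"
  have ev: "isafe B S' e" "rsafe B S' f" "ival S' e = x" "rval S' f = F i"
    using step[OF i _ ci] P by auto
  show "run B (RAssign a e (RAdd (RArr a e) f)) S' (pcost (RAssign a e (RAdd (RArr a e) f)))
    (\<lambda>S''. (same {c} {a} S S'' \<and> rmem S'' a = (rmem S a)(x := rmem S a x + (\<Sum>i<Suc i. F i))) \<and> imem S'' c 0 = i)"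
    by (intro run_straight) (use ev P ci in \<open>auto simp: add.assoc\<close>)
qed (use assms in \<open>auto simp: same_def\<close>)

definition quad_exp :: "rexp \<Rightarrow> rexp \<Rightarrow> rexp \<Rightarrow> rexp \<Rightarrow> rexp" where
  "quad_exp N a b c = (let k = (\<lambda>i. ROfNat (IConst i)); nc = RMul N c; ab = RMul a b; w = RSub nc ab in
     RAdd (RSub (RMul (RMul (k 4) w) w)
       (RMul (k 4) (RSub (RSub (RSub (RAdd (RAdd (RAdd (RMul nc N) (RMul ab b)) (RMul a ab)) (RMul (RMul (k 3) nc) c))
         (RMul (RMul (k 2) nc) b)) (RMul (RMul (k 2) nc) a)) (RMul (RMul (k 2) ab) c))))
     (RMul (k 4) (RAdd (RSub (RSub (RAdd nc ab) (RMul (RMul (k 2) b) c)) (RMul (RMul (k 2) a) c)) (RMul (RMul (k 2) c) c))))"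

lemma rval_quad_exp [simp]:
  "rval S (quad_exp N a b c) = quad_poly (rval S N) (rval S a) (rval S b) (rval S c)"
  by (simp add: quad_exp_def quad_poly_def Let_def algebra_simps)

lemma rsafe_quad_exp [simp]:
  "rsafe B S (quad_exp N a b c) \<longleftrightarrow> rsafe B S N \<and> rsafe B S a \<and> rsafe B S b \<and> rsafe B S c \<and> 4 \<le> B"
  by (auto simp: quad_exp_def Let_def)

primrec falling_exp :: "iexp \<Rightarrow> nat \<Rightarrow> rexp" where
  "falling_exp e 0 = ROfNat (IConst 1)"
| "falling_exp e (Suc m) = RMul (falling_exp e m) (ROfNat (ISub e (IConst m)))"

lemma rval_falling_exp [simp]: "rval S (falling_exp e m) = falling (ival S e) m"
  by (induction m) (simp_all add: falling_def)

lemma rsafe_falling_exp: "isafe B S e \<Longrightarrow> m \<le> B \<Longrightarrow> 1 \<le> B \<Longrightarrow> rsafe B S (falling_exp e m)"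
  by (induction m) simp_all

text \<open>Allows constants that depend on \<open>d\<close> to be absorbed by the exponent of the
  word bound.\<close>

lemma const_le_power: "n \<ge> 2 \<Longrightarrow> c \<le> (n :: nat) ^ c"
  using less_exp[of c] power_mono[of 2 n c] by linarith

lemma levels_le_log:
  assumes "N \<ge> 1"
  shows "real (levels N) \<le> 1 + log 2 (real N)"
proof -
  have "2 ^ (levels N - 1) \<le> N"
    using levels_pos[of N] assms by (intro pow_le_of_less_levels) auto
  then have "2 ^ (levels N - 1) \<le> real N"
    by (metis of_nat_le_iff of_nat_numeral of_nat_power)
  then have "real (levels N - 1) \<le> log 2 (real N)"
    using assms by (simp add: le_log_iff powr_realpow)
  then show ?thesis
    by linarith
qed

section \<open>The statistic of Hoeffding type\<close>

text \<open>The \<open>q\<close> coordinates from \<open>off\<close> on are repacked with stride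
  \<open>q\<close>, the layout that \<open>dominance\<close> expects. Unit weights turn its sums
  into counts.\<close>

definition count_prog :: "nat \<Rightarrow> nat \<Rightarrow> nat \<Rightarrow> nat \<Rightarrow> prog" where
  "count_prog d q off dst =
     ISet 2 (IMul (Var 0) (IConst q)) ;; ISet vN (Var 0) ;;
     For 3 2 (RAssign rKey (Var 3) (RArr 0 (IAdd (IMul (IDiv (Var 3) (IConst q)) (IConst d))
       (IAdd (IConst off) (IMod (Var 3) (IConst q)))))) ;;
     For 3 0 (RAssign rWt (Var 3) (ROfNat (IConst 1))) ;;
     dominance (q - 1) ;;
     For 3 0 (RAssign dst (Var 3) (RArr rC (Var 3)))"

lemma run_count_prog:
  assumes q: "1 \<le> q" "off + q \<le> d" "d \<ge> 2" and dst: "dst \<in> {2, 3, 4}"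
  obtains K where "\<And>B n (S :: store). \<lbrakk>imem S 0 0 = n; n > 0; 5 * n * d < B; (4 * n) ^ (q - 1) < B;
      \<And>v. imem S aT v = 0; \<And>a. rmem S rT a = 0\<rbrakk> \<Longrightarrow>
    run B (count_prog d q off dst) S (K * (n * levels n ^ (d - 1)))
    (\<lambda>S'. same ({2, 3} \<union> {20..38}) {dst, rKey, rWt, rC, rT, rw} S S' \<and>
      (\<forall>v. imem S' aT v = 0) \<and> (\<forall>a. rmem S' rT a = 0) \<and>
      (\<forall>i<n. rmem S' dst i = (\<Sum>j<n. of_bool (\<forall>k<q. rmem S 0 (j * d + (off + k)) \<le> rmem S 0 (i * d + (off + k))))))"
proof -
  obtain e where e: "q = Suc e"
    using q by (cases q) auto
  obtain K where K: "\<And>B N (S :: store). \<lbrakk>imem S vN 0 = N; N > 0; 4 * N * Suc e + Suc e < B; (4 * N) ^ e < B;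
      \<And>v. imem S aT v = 0; \<And>a. rmem S rT a = 0\<rbrakk> \<Longrightarrow>
    run B (dominance e) S (K * (N * levels N ^ max 1 e))
    (\<lambda>S'. same {21..38} {rC, rT, rw} S S' \<and> (\<forall>v. imem S' aT v = 0) \<and> (\<forall>a. rmem S' rT a = 0) \<and>
      (\<forall>i<N. rmem S' rC i = (\<Sum>j<N. rmem S rWt j *
        of_bool (\<forall>k<Suc e. rmem S rKey (j * Suc e + k) \<le> rmem S rKey (i * Suc e + k)))))"
    using run_dominance[of e] by blast
  let ?init = "ISet 2 (IMul (Var 0) (IConst q)) ;; ISet vN (Var 0)"
  let ?src = "RArr 0 (IAdd (IMul (IDiv (Var 3) (IConst q)) (IConst d)) (IAdd (IConst off) (IMod (Var 3) (IConst q))))"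
  let ?fill = "RAssign rKey (Var 3) ?src"
  show ?thesis
  proof (rule that[of "K + 100 * (q + 1)"])
    fix B n and S :: store
    assume n: "imem S 0 0 = n" "n > 0" and B: "5 * n * d < B" "(4 * n) ^ (q - 1) < B"
      and z: "\<And>v. imem S aT v = 0" "\<And>a. rmem S rT a = 0"
    have "n * q \<le> n * d" "n * 1 \<le> n * d" "1 * d \<le> n * d"
      using q n by (intro mult_mono; simp)+
    moreover have "4 * n * q = 4 * (n * q)" "5 * n * d = 5 * (n * d)"
      by simp_all
    ultimately have le: "n * q \<le> n * d" "n \<le> n * d" "d \<le> n * d" "n * d < B" "4 * n * q + q < B"
      using B(1) q by linarith+
    then have nB: "n < B"
      by linarith
    let ?zero = "\<lambda>S'. (\<forall>v. imem S' aT v = 0) \<and> (\<forall>a. rmem S' rT a = 0) \<and> imem S' 0 0 = n"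
    let ?F1 = "\<lambda>S'. same {2, 3, vN} {rKey, rWt} S S' \<and> imem S' vN 0 = n \<and> ?zero S'"
    have 1: "run B ?init S 20 (\<lambda>S'. ?F1 S' \<and> imem S' 2 0 = n * q)"
      by (rule run_straight) (use n le z q in auto)
    have 2: "run B (For 3 2 ?fill) S1 (n * q * (pcost ?fill + 12) + 9)
      (\<lambda>S'. ?F1 S' \<and> (\<forall>i<n * q. rmem S' rKey i = rmem S 0 (i div q * d + (off + i mod q))))"
      if S1: "?F1 S1 \<and> imem S1 2 0 = n * q" for S1
    proof (rule run_mono[OF run_fill[where N = "n * q" and g = "\<lambda>i. i" and
            F = "\<lambda>i. rmem S 0 (i div q * d + (off + i mod q))"]])
      fix i S' assume i: "i < n * q" "same {3} {rKey} S1 S'" "imem S' 3 0 = i"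
      have "rmem S' 0 = rmem S 0"
        using i(2) S1 by (auto simp: same_def)
      moreover have "i div q < n"
        using i(1) by (simp add: less_mult_imp_div_less)
      then have "i div q * d + d \<le> n * d"
        using mult_right_mono[of "Suc (i div q)" n d] by simp
      moreover have "i mod q < q"
        using q by simp
      ultimately have "off + i mod q \<le> B" "i div q * d + (off + i mod q) \<le> B" "i div q * d \<le> B"
        "d \<le> B" "q \<le> B" "off \<le> B" "rmem S' 0 = rmem S 0"
        using q le by linarith+
      then show "isafe B S' (Var 3) \<and> rsafe B S' ?src \<and> ival S' (Var 3) = i \<and>
          rval S' ?src = rmem S 0 (i div q * d + (off + i mod q))"
        using i(3) by simp
    next
      fix S' assume *: "same {3} {rKey} S1 S' \<and> (\<forall>i<n * q. rmem S' rKey i = rmem S 0 (i div q * d + (off + i mod q))) \<and>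
        (\<forall>x. x \<notin> (\<lambda>i. i) ` {..<n * q} \<longrightarrow> rmem S' rKey x = rmem S1 rKey x)"
      have "same {2, 3, vN} {rKey, rWt} S S'"
        by (rule same_trans[of "{2, 3, vN}" "{rKey, rWt}" S S1]) (use * S1 in auto)
      then show "?F1 S' \<and> (\<forall>i<n * q. rmem S' rKey i = rmem S 0 (i div q * d + (off + i mod q)))"
        using * S1 by (auto simp: same_def)
    qed (use S1 le in auto)
    have 3: "run B (For 3 0 (RAssign rWt (Var 3) (ROfNat (IConst 1)))) S1 (n * 17 + 9)
      (\<lambda>S'. ?F1 S' \<and> (\<forall>i<n * q. rmem S' rKey i = rmem S 0 (i div q * d + (off + i mod q))) \<and>
        (\<forall>i<n. rmem S' rWt i = 1))"
      if S1: "?F1 S1 \<and> (\<forall>i<n * q. rmem S1 rKey i = rmem S 0 (i div q * d + (off + i mod q)))" for S1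
    proof (rule run_mono[OF run_fill[where N = n and g = "\<lambda>i. i" and F = "\<lambda>i. 1"]])
      fix S' assume *: "same {3} {rWt} S1 S' \<and> (\<forall>i<n. rmem S' rWt i = 1) \<and>
        (\<forall>x. x \<notin> (\<lambda>i. i) ` {..<n} \<longrightarrow> rmem S' rWt x = rmem S1 rWt x)"
      have "same {2, 3, vN} {rKey, rWt} S S'"
        by (rule same_trans[of "{2, 3, vN}" "{rKey, rWt}" S S1]) (use * S1 in auto)
      then show "?F1 S' \<and> (\<forall>i<n * q. rmem S' rKey i = rmem S 0 (i div q * d + (off + i mod q))) \<and>
        (\<forall>i<n. rmem S' rWt i = 1)"
        using * S1 by (auto simp: same_def)
    qed (use S1 nB in auto)
    let ?res = "\<lambda>i. \<Sum>j<n. of_bool (\<forall>k<q. rmem S 0 (j * d + (off + k)) \<le> rmem S 0 (i * d + (off + k)))"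
    let ?F2 = "\<lambda>S'. same ({2, 3} \<union> {20..38}) {dst, rKey, rWt, rC, rT, rw} S S' \<and> ?zero S'"
    have 4: "run B (dominance e) S1 (K * (n * levels n ^ max 1 e)) (\<lambda>S'. ?F2 S' \<and> (\<forall>i<n. rmem S' rC i = ?res i))"
      if S1: "?F1 S1 \<and> (\<forall>i<n * q. rmem S1 rKey i = rmem S 0 (i div q * d + (off + i mod q))) \<and>
        (\<forall>i<n. rmem S1 rWt i = 1)" for S1
    proof (rule run_mono[OF K[where N = n]])
      fix S' assume *: "same {21..38} {rC, rT, rw} S1 S' \<and> (\<forall>v. imem S' aT v = 0) \<and> (\<forall>a. rmem S' rT a = 0) \<and>
      (\<forall>i<n. rmem S' rC i = (\<Sum>j<n. rmem S1 rWt j *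
        of_bool (\<forall>k<Suc e. rmem S1 rKey (j * Suc e + k) \<le> rmem S1 rKey (i * Suc e + k))))"
      have "same ({2, 3} \<union> {20..38}) {dst, rKey, rWt, rC, rT, rw} S S1"
        by (rule same_mono[of "{2, 3, vN}" "{rKey, rWt}"]) (use S1 in auto)
      then have "same ({2, 3} \<union> {20..38}) {dst, rKey, rWt, rC, rT, rw} S S'"
        by (rule same_trans) (use * in auto)
      moreover have key: "rmem S1 rKey (i * Suc e + k) = rmem S 0 (i * d + (off + k))" if "i < n" "k < q" for i k
      proof -
        have "i * q + k < n * q"
          using that mult_right_mono[of "Suc i" n q] by simp
        then have "rmem S1 rKey (i * q + k) = rmem S 0 ((i * q + k) div q * d + (off + (i * q + k) mod q))"
          using S1 by blast
        moreover have "(i * q + k) div q = i" "(i * q + k) mod q = k"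
          using that by simp_all
        ultimately show ?thesis
          unfolding e[symmetric] by simp
      qed
      have "rmem S' rC i = ?res i" if i: "i < n" for i
      proof -
        have "rmem S' rC i = (\<Sum>j<n. rmem S1 rWt j *
          of_bool (\<forall>k<Suc e. rmem S1 rKey (j * Suc e + k) \<le> rmem S1 rKey (i * Suc e + k)))"
          using * i by blast
        also have "\<dots> = ?res i"
          using S1 key i by (intro sum.cong refl) (auto simp: e)
        finally show ?thesis .
      qed
      moreover have "imem S' 0 0 = n"
        using * S1 by (auto simp: same_def)
      ultimately show "?F2 S' \<and> (\<forall>i<n. rmem S' rC i = ?res i)"
        using * by blast
    qed (use S1 le n B e in auto)
    have 5: "run B (For 3 0 (RAssign dst (Var 3) (RArr rC (Var 3)))) S1 (n * 18 + 9) (\<lambda>S'. ?F2 S' \<and> (\<forall>i<n. rmem S' dst i = ?res i))"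
      if S1: "?F2 S1 \<and> (\<forall>i<n. rmem S1 rC i = ?res i)" for S1
    proof (rule run_mono[OF run_fill[where N = n and g = "\<lambda>i. i" and F = ?res]])
      fix i S' assume "i < n" "same {3} {dst} S1 S'" "imem S' 3 0 = i"
      then show "isafe B S' (Var 3) \<and> rsafe B S' (RArr rC (Var 3)) \<and> ival S' (Var 3) = i \<and> rval S' (RArr rC (Var 3)) = ?res i"
        using S1 dst same_rmem[of "{3}" "{dst}" S1 S' rC] by (auto simp del: sum_of_bool_eq)
    next
      fix S' assume *: "same {3} {dst} S1 S' \<and> (\<forall>i<n. rmem S' dst i = ?res i) \<and>
        (\<forall>x. x \<notin> (\<lambda>i. i) ` {..<n} \<longrightarrow> rmem S' dst x = rmem S1 dst x)"
      have "same ({2, 3} \<union> {20..38}) {dst, rKey, rWt, rC, rT, rw} S S'"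
        by (rule same_trans[of _ _ S S1 "{3}" "{dst}"]) (use * S1 in auto)
      moreover have "imem S' aT = imem S1 aT" "rmem S' rT = rmem S1 rT" "imem S' 0 = imem S1 0"
        using * dst by (auto simp: same_def)
      ultimately show "?F2 S' \<and> (\<forall>i<n. rmem S' dst i = ?res i)"
        using * S1 by (simp del: sum_of_bool_eq)
    qed (use S1 nB in auto)
    have "run B (?init ;; For 3 2 ?fill ;; For 3 0 (RAssign rWt (Var 3) (ROfNat (IConst 1))) ;; dominance e ;;
         For 3 0 (RAssign dst (Var 3) (RArr rC (Var 3)))) S
      (20 + (n * q * (pcost ?fill + 12) + 9) + (n * 17 + 9) + K * (n * levels n ^ max 1 e) + (n * 18 + 9))
      (\<lambda>S'. ?F2 S' \<and> (\<forall>i<n. rmem S' dst i = ?res i))"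
      by (intro run_Seq[OF run_Seq[OF run_Seq[OF run_Seq[OF 1 2] 3] 4] 5])
    then show "run B (count_prog d q off dst) S ((K + 100 * (q + 1)) * (n * levels n ^ (d - 1)))
      (\<lambda>S'. same ({2, 3} \<union> {20..38}) {dst, rKey, rWt, rC, rT, rw} S S' \<and>
      (\<forall>v. imem S' aT v = 0) \<and> (\<forall>a. rmem S' rT a = 0) \<and> (\<forall>i<n. rmem S' dst i = ?res i))"
      unfolding count_prog_def e diff_Suc_1
    proof (rule run_mono)
      have lv: "levels n \<ge> 1"
        using levels_pos[OF n(2)] by simp
      define M where "M = n * levels n ^ (d - 1)"
      \<comment> \<open>With a single coordinate the sort still costs one logarithm; the bound has
        room for it as \<open>d \<ge> 2\<close>.\<close>
      have "levels n ^ max 1 e \<le> levels n ^ (d - 1)"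
        using lv q e by (intro power_increasing) auto
      then have m1: "K * (n * levels n ^ max 1 e) \<le> K * M"
        unfolding M_def by (intro mult_left_mono) auto
      have "n * 1 \<le> M"
        unfolding M_def using lv by (intro mult_left_mono) auto
      then have m2: "n \<le> M" "1 \<le> M"
        using n by auto
      have m3: "n * q * (pcost ?fill + 12) \<le> M * q * 60"
        using m2 by (intro mult_mono) auto
      have "20 + (n * q * (pcost ?fill + 12) + 9) + (n * 17 + 9) + K * (n * levels n ^ max 1 e) + (n * 18 + 9)
        \<le> 20 * M + (M * q * 60 + 9 * M) + (M * 17 + 9 * M) + K * M + (M * 18 + 9 * M)"
        using m1 m2 m3 by linarith
      also have "\<dots> \<le> (K + 100 * (q + 1)) * M"
        by (simp add: algebra_simps)
      finally show "20 + (n * Suc e * (pcost (RAssign rKey (Var 3) (RArr 0 (IAdd (IMul (IDiv (Var 3) (IConst (Suc e))) (IConst d))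
          (IAdd (IConst off) (IMod (Var 3) (IConst (Suc e))))))) + 12) + 9) + (n * 17 + 9) +
          K * (n * levels n ^ max 1 e) + (n * 18 + 9) \<le> (K + 100 * (Suc e + 1)) * (n * levels n ^ (d - 1))"
        unfolding M_def e .
    qed auto
  qed
qed

definition prog_D :: "nat \<Rightarrow> nat \<Rightarrow> prog" where
  "prog_D r s = (let x = (\<lambda>a. RSub (RArr a (Var 3)) (ROfNat (IConst 1))) in
     count_prog (r + s) r 0 2 ;; count_prog (r + s) s r 3 ;; count_prog (r + s) (r + s) 0 4 ;;
     For 3 0 (RAssign 1 (IConst 0) (RAdd (RArr 1 (IConst 0))
       (quad_exp (ROfNat (ISub (Var 0) (IConst 1))) (x 2) (x 3) (x 4)))) ;;
     RSet 1 (RDiv (RVar 1) (RMul (ROfNat (IConst 4)) (falling_exp (Var 0) 5))))"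

lemma input_store_coord:
  assumes "i < n" "l < d"
  shows "rmem (input_store d n z) 0 (i * d + l) = z (Suc i) (Suc l)"
proof -
  have "i * d + l < n * d"
    using assms mult_right_mono[of "Suc i" n d] by simp
  then show ?thesis
    using assms by (simp add: input_store_def)
qed

lemma ball_Suc_atLeastAtMost: "(\<forall>l\<in>{1..q}. P l) \<longleftrightarrow> (\<forall>k<q. P (Suc k))"
  by (metis Suc_le_eq Suc_le_mono Suc_pred atLeastAtMost_iff le0 less_eq_Suc_le One_nat_def gr0_conv_Suc)

lemma sum_Suc_atLeastAtMost: "(\<Sum>i\<in>{1..n}. f i) = (\<Sum>i<n. f (Suc i) :: real)"
  by (simp add: lessThan_atLeast0 sum.shift_bounds_Suc_ivl[symmetric] atLeastLessThanSuc_atLeastAtMost)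

text \<open>For \<open>n \<ge> 2\<close> the logarithm is at least 1 and absorbs the additive
  constant of the bit length. The factor \<open>c\<close> is 1 for \<open>n\<close> points and 2 for
  \<open>2 * (n * n)\<close> points.\<close>

lemma bigo_log:
  assumes "\<And>n. n \<ge> 2 \<Longrightarrow> L n \<le> c * (1 + log 2 (real n))" "\<And>n. L n \<ge> 0" "c \<ge> 0"
  shows "(\<lambda>n. real K * (real n ^ a * L n ^ b)) \<in> O(\<lambda>n. real n ^ a * log 2 (real n) ^ b)"
proof (rule bigoI[where c = "real K * (2 * c) ^ b"])
  show "\<forall>\<^sub>F n in sequentially. norm (real K * (real n ^ a * L n ^ b))
    \<le> real K * (2 * c) ^ b * norm (real n ^ a * log 2 (real n) ^ b)"
    using eventually_ge_at_top[of 2]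
  proof eventually_elim
    case (elim n)
    then have "1 \<le> log 2 (real n)"
      by simp
    have "L n \<le> c * (1 + log 2 (real n))"
      using assms(1) elim by blast
    also have "\<dots> \<le> c * (2 * log 2 (real n))"
      using \<open>1 \<le> log 2 (real n)\<close> assms(3) by (intro mult_left_mono) auto
    finally have "L n ^ b \<le> (2 * c * log 2 (real n)) ^ b"
      using assms(2) by (intro power_mono) (auto simp: mult_ac)
    also have "\<dots> = (2 * c) ^ b * log 2 (real n) ^ b"
      by (rule power_mult_distrib)
    finally have "real K * real n ^ a * L n ^ b \<le> real K * real n ^ a * ((2 * c) ^ b * log 2 (real n) ^ b)"
      by (intro mult_left_mono) auto
    then show ?case
      using assms(2) \<open>1 \<le> log 2 (real n)\<close> by (simp add: abs_mult mult_ac)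
  qed
qed

theorem computable_U_D:
  assumes r: "r \<ge> 1" and s: "s \<ge> 1" and d: "d = r + s"
  shows "computable_in_time d 5 (U_D r s) (\<lambda>n. real n * log 2 (real n) ^ (d - 1))"
proof -
  define X where "X = {2, 3} \<union> {20..38::nat}"
  define Y where "Y = {2, 3, 4, rKey, rWt, rC, rT, rw :: nat}"
  let ?spec = "\<lambda>K q off dst. \<forall>B n (S :: store). imem S 0 0 = n \<longrightarrow> n > 0 \<longrightarrow> 5 * n * d < B \<longrightarrow> (4 * n) ^ d < B \<longrightarrow>
      (\<forall>v. imem S aT v = 0) \<longrightarrow> (\<forall>a. rmem S rT a = 0) \<longrightarrow>
    run B (count_prog d q off dst) S (K * (n * levels n ^ (d - 1)))
    (\<lambda>S'. same X {dst, rKey, rWt, rC, rT, rw} S S' \<and>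
      (\<forall>v. imem S' aT v = 0) \<and> (\<forall>a. rmem S' rT a = 0) \<and>
      (\<forall>i<n. rmem S' dst i = (\<Sum>j<n. of_bool (\<forall>k<q. rmem S 0 (j * d + (off + k)) \<le> rmem S 0 (i * d + (off + k))))))"
  have cp: "\<exists>K. ?spec K q off dst"
    if "1 \<le> q" "off + q \<le> d" "dst \<in> {2, 3, 4}" for q off dst
  proof -
    have "d \<ge> 2"
      using r s d by simp
    from run_count_prog[OF that(1,2) this that(3)] obtain K where
      K: "\<And>B n (S :: store). \<lbrakk>imem S 0 0 = n; n > 0; 5 * n * d < B; (4 * n) ^ (q - 1) < B;
      \<And>v. imem S aT v = 0; \<And>a. rmem S rT a = 0\<rbrakk> \<Longrightarrow>
    run B (count_prog d q off dst) S (K * (n * levels n ^ (d - 1)))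
    (\<lambda>S'. same ({2, 3} \<union> {20..38}) {dst, rKey, rWt, rC, rT, rw} S S' \<and>
      (\<forall>v. imem S' aT v = 0) \<and> (\<forall>a. rmem S' rT a = 0) \<and>
      (\<forall>i<n. rmem S' dst i = (\<Sum>j<n. of_bool (\<forall>k<q. rmem S 0 (j * d + (off + k)) \<le> rmem S 0 (i * d + (off + k))))))"
      by blast
    show ?thesis
      unfolding X_def
    proof (intro exI[of _ K] allI impI)
      fix B n and S :: store
      assume *: "imem S 0 0 = n" "n > 0" "5 * n * d < B" "(4 * n) ^ d < B" "\<forall>v. imem S aT v = 0" "\<forall>a. rmem S rT a = 0"
      have "(4 * n) ^ (q - 1) \<le> (4 * n) ^ d"
        using *(2) that by (intro power_increasing) auto
      then show "run B (count_prog d q off dst) S (K * (n * levels n ^ (d - 1)))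
    (\<lambda>S'. same ({2, 3} \<union> {20..38}) {dst, rKey, rWt, rC, rT, rw} S S' \<and>
      (\<forall>v. imem S' aT v = 0) \<and> (\<forall>a. rmem S' rT a = 0) \<and>
      (\<forall>i<n. rmem S' dst i = (\<Sum>j<n. of_bool (\<forall>k<q. rmem S 0 (j * d + (off + k)) \<le> rmem S 0 (i * d + (off + k))))))"
        using * by (intro K) auto
    qed
  qed
  obtain K1 where K1: "?spec K1 r 0 2"
  proof -
    have "\<exists>K. ?spec K r 0 2"
      by (rule cp) (use r s d in auto)
    then show thesis
      using that by (elim exE)
  qed
  obtain K2 where K2: "?spec K2 s r 3"
  proof -
    have "\<exists>K. ?spec K s r 3"
      by (rule cp) (use r s d in auto)
    then show thesis
      using that by (elim exE)
  qed
  obtain K3 where K3: "?spec K3 (r + s) 0 4"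
  proof -
    have "\<exists>K. ?spec K (r + s) 0 4"
      by (rule cp) (use r s d in auto)
    then show thesis
      using that by (elim exE)
  qed
  define x where "x = (\<lambda>a. RSub (RArr a (Var 3)) (ROfNat (IConst 1)))"
  let ?q = "quad_exp (ROfNat (ISub (Var 0) (IConst 1))) (x 2) (x 3) (x 4)"
  let ?step = "RAssign 1 (IConst 0) (RAdd (RArr 1 (IConst 0)) ?q)"
  let ?last = "RSet 1 (RDiv (RVar 1) (RMul (ROfNat (IConst 4)) (falling_exp (Var 0) 5)))"
  define K where "K = K1 + K2 + K3 + (pcost ?step + 12 + 9) + pcost ?last"
  show ?thesis
  proof (rule computable_in_timeI)
    fix n :: nat and z assume n: "5 \<le> n"
    \<comment> \<open>Large enough, since \<open>n \<ge> 5\<close> gives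
      \<open>4 * n \<le> n * n\<close>, and \<open>d \<le> n ^ d\<close>.\<close>
    define B where "B = n ^ (2 * d + 10)"
    define S where "S = input_store d n z"
    have B1: "5 * n * d < B"
    proof -
      have "5 * n * d \<le> n * n * n ^ d"
        using n const_le_power[of n d] by (intro mult_mono) auto
      also have "\<dots> = n ^ (d + 2)"
        by (simp add: power_add power2_eq_square)
      also have "\<dots> < B"
        unfolding B_def using n by (intro power_strict_increasing) auto
      finally show ?thesis .
    qed
    have B2: "(4 * n) ^ d < B"
    proof -
      have "(4 * n) ^ d \<le> (n * n) ^ d"
        using n by (intro power_mono mult_right_mono) auto
      also have "\<dots> = n ^ (2 * d)"
        by (simp add: power_mult power2_eq_square)
      also have "\<dots> < B"
        unfolding B_def using n by (intro power_strict_increasing) auto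
      finally show ?thesis .
    qed
    have nB: "n < B" "5 \<le> B"
    proof -
      have "n * 1 \<le> 5 * n * d"
        using r d by simp
      then show "n < B" "5 \<le> B"
        using B1 n by linarith+
    qed
    have coord: "rmem S 0 (i * d + l) = z (Suc i) (Suc l)" if "i < n" "l < d" for i l
      unfolding S_def by (rule input_store_coord[OF that])
    have lt: "k < r \<Longrightarrow> k < d" "k < s \<Longrightarrow> r + k < d" for k
      by (simp_all add: d)
    define ca where "ca = (\<lambda>p. \<Sum>i\<in>{1..n}. of_bool (below_x r z (z p) i) :: real)"
    define cb where "cb = (\<lambda>p. \<Sum>i\<in>{1..n}. of_bool (below_y r s z (z p) i) :: real)"
    define cc where "cc = (\<lambda>p. \<Sum>i\<in>{1..n}. of_bool (below_x r z (z p) i \<and> below_y r s z (z p) i) :: real)"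
    have ca: "ca (Suc i) = (\<Sum>j<n. of_bool (\<forall>k<r. rmem S 0 (j * d + (0 + k)) \<le> rmem S 0 (i * d + (0 + k))))"
      if "i < n" for i
      unfolding ca_def sum_Suc_atLeastAtMost below_x_def ball_Suc_atLeastAtMost
      using that by (intro sum.cong refl) (simp add: coord lt)
    have cb: "cb (Suc i) = (\<Sum>j<n. of_bool (\<forall>k<s. rmem S 0 (j * d + (r + k)) \<le> rmem S 0 (i * d + (r + k))))"
      if "i < n" for i
      unfolding cb_def sum_Suc_atLeastAtMost below_y_def ball_Suc_atLeastAtMost
      using that by (intro sum.cong refl) (simp add: coord lt)
    have split: "(\<forall>k<r + s. P k) \<longleftrightarrow> (\<forall>k<r. P k) \<and> (\<forall>k<s. P (r + k))" for P :: "nat \<Rightarrow> bool"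
      by (metis add_less_cancel_left le_add_diff_inverse not_less trans_less_add1)
    have cc: "cc (Suc i) = (\<Sum>j<n. of_bool (\<forall>k<r + s. rmem S 0 (j * d + (0 + k)) \<le> rmem S 0 (i * d + (0 + k))))"
      if "i < n" for i
      unfolding cc_def sum_Suc_atLeastAtMost below_x_def below_y_def ball_Suc_atLeastAtMost split
      using that by (intro sum.cong refl) (simp add: coord lt)
    let ?I = "\<lambda>S'. same X Y S S' \<and> (\<forall>v. imem S' aT v = 0) \<and> (\<forall>a. rmem S' rT a = 0)"
    have S: "imem S 0 0 = n" "imem S aT v = 0" "rmem S rT a = 0" "rmem S 1 0 = 0" for v a
      by (simp_all add: S_def input_store_def)
    have I: "imem S' 0 0 = n" "rmem S' 0 = rmem S 0" "rmem S' 1 = rmem S 1" if "same X Y S S'" for S'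
      using that S by (auto simp: same_def X_def Y_def)
    define M where "M = n * levels n ^ (d - 1)"
    have 1: "run B (count_prog d r 0 2) S (K1 * M) (\<lambda>S'. ?I S' \<and> (\<forall>i<n. rmem S' 2 i = ca (Suc i)))"
      unfolding M_def
    proof (rule run_mono[OF K1[rule_format]])
      fix S' assume *: "same X {2, rKey, rWt, rC, rT, rw} S S' \<and> (\<forall>v. imem S' aT v = 0) \<and> (\<forall>a. rmem S' rT a = 0) \<and>
        (\<forall>i<n. rmem S' 2 i = (\<Sum>j<n. of_bool (\<forall>k<r. rmem S 0 (j * d + (0 + k)) \<le> rmem S 0 (i * d + (0 + k)))))"
      have "same X Y S S'"
        by (rule same_mono[of X "{2, rKey, rWt, rC, rT, rw}"]) (use * in \<open>auto simp: Y_def\<close>)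
      then show "?I S' \<and> (\<forall>i<n. rmem S' 2 i = ca (Suc i))"
        using * ca by auto
    qed (use S n B1 B2 in auto)
    have 2: "run B (count_prog d s r 3) S1 (K2 * M) (\<lambda>S'. ?I S' \<and> (\<forall>i<n. rmem S' 2 i = ca (Suc i)) \<and> (\<forall>i<n. rmem S' 3 i = cb (Suc i)))"
      if S1: "?I S1 \<and> (\<forall>i<n. rmem S1 2 i = ca (Suc i))" for S1
      unfolding M_def
    proof (rule run_mono[OF K2[rule_format]])
      fix S' assume *: "same X {3, rKey, rWt, rC, rT, rw} S1 S' \<and> (\<forall>v. imem S' aT v = 0) \<and> (\<forall>a. rmem S' rT a = 0) \<and>
        (\<forall>i<n. rmem S' 3 i = (\<Sum>j<n. of_bool (\<forall>k<s. rmem S1 0 (j * d + (r + k)) \<le> rmem S1 0 (i * d + (r + k)))))"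
      have "same X Y S S'"
        by (rule same_trans[of _ _ S S1 X "{3, rKey, rWt, rC, rT, rw}"]) (use * S1 in \<open>auto simp: Y_def\<close>)
      moreover have "rmem S' 2 = rmem S1 2"
        using * by (auto simp: same_def)
      ultimately show "?I S' \<and> (\<forall>i<n. rmem S' 2 i = ca (Suc i)) \<and> (\<forall>i<n. rmem S' 3 i = cb (Suc i))"
        using * S1 I(2)[of S1] cb by auto
    qed (use S1 I(1)[of S1] n B1 B2 in auto)
    have 3: "run B (count_prog d (r + s) 0 4) S1 (K3 * M) (\<lambda>S'. ?I S' \<and> (\<forall>i<n. rmem S' 2 i = ca (Suc i)) \<and> (\<forall>i<n. rmem S' 3 i = cb (Suc i))
        \<and> (\<forall>i<n. rmem S' 4 i = cc (Suc i)))"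
      if S1: "?I S1 \<and> (\<forall>i<n. rmem S1 2 i = ca (Suc i)) \<and> (\<forall>i<n. rmem S1 3 i = cb (Suc i))" for S1
      unfolding M_def
    proof (rule run_mono[OF K3[rule_format]])
      fix S' assume *: "same X {4, rKey, rWt, rC, rT, rw} S1 S' \<and> (\<forall>v. imem S' aT v = 0) \<and> (\<forall>a. rmem S' rT a = 0) \<and>
        (\<forall>i<n. rmem S' 4 i = (\<Sum>j<n. of_bool (\<forall>k<r + s. rmem S1 0 (j * d + (0 + k)) \<le> rmem S1 0 (i * d + (0 + k)))))"
      have "same X Y S S'"
        by (rule same_trans[of _ _ S S1 X "{4, rKey, rWt, rC, rT, rw}"]) (use * S1 in \<open>auto simp: Y_def\<close>)
      moreover have "rmem S' 2 = rmem S1 2" "rmem S' 3 = rmem S1 3"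
        using * by (auto simp: same_def)
      ultimately show "?I S' \<and> (\<forall>i<n. rmem S' 2 i = ca (Suc i)) \<and> (\<forall>i<n. rmem S' 3 i = cb (Suc i))
        \<and> (\<forall>i<n. rmem S' 4 i = cc (Suc i))"
        using * S1 I(2)[of S1] cc by auto
    qed (use S1 I(1)[of S1] n B1 B2 in auto)
    let ?F = "\<lambda>p. quad_poly (real n - 1) (ca p - 1) (cb p - 1) (cc p - 1)"
    have 4: "run B (For 3 0 ?step) S1 (n * (pcost ?step + 12) + 9) (\<lambda>S'. imem S' 0 0 = n \<and> rmem S' 1 0 = (\<Sum>p\<in>{1..n}. ?F p))"
      if S1: "?I S1 \<and> (\<forall>i<n. rmem S1 2 i = ca (Suc i)) \<and> (\<forall>i<n. rmem S1 3 i = cb (Suc i)) \<and> (\<forall>i<n. rmem S1 4 i = cc (Suc i))" for S1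
    proof (rule run_mono[OF run_accumulate[where N = n and x = 0 and F = "\<lambda>i. ?F (Suc i)"]])
      fix i S' assume i: "i < n" "same {3} {1} S1 S'" "imem S' 3 0 = i"
      have "rmem S' 2 = rmem S1 2" "rmem S' 3 = rmem S1 3" "rmem S' 4 = rmem S1 4" "imem S' 0 0 = n"
        using i(2) S1 I(1)[of S1] by (auto simp: same_def)
      then show "isafe B S' (IConst 0) \<and> rsafe B S' ?q \<and> ival S' (IConst 0) = 0 \<and> rval S' ?q = ?F (Suc i)"
        using i(1,3) S1 n nB by (simp add: x_def of_nat_diff)
    next
      fix S' assume *: "same {3} {1} S1 S' \<and> rmem S' 1 = (rmem S1 1)(0 := rmem S1 1 0 + (\<Sum>i<n. ?F (Suc i)))"
      then show "imem S' 0 0 = n \<and> rmem S' 1 0 = (\<Sum>p\<in>{1..n}. ?F p)"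
        using S1 I[of S1] S(4) same_imem[of "{3}" "{1}" S1 S' 0] unfolding sum_Suc_atLeastAtMost by simp
    qed (use S1 I(1)[of S1] nB in auto)
    have 5: "run B ?last S1 (pcost ?last) (\<lambda>S'. output_of S' = U_D r s n z)"
      if S1: "imem S1 0 0 = n \<and> rmem S1 1 0 = (\<Sum>p\<in>{1..n}. ?F p)" for S1
    proof (rule run_straight)
      show "psafe B ?last S1"
        using nB by (simp add: rsafe_falling_exp del: falling_exp.simps)
      have "U_D r s n z = 1 / falling n 5 * (1 / 4 * (\<Sum>p\<in>{1..n}. ?F p))"
        by (simp only: U_D_formula ca_def cb_def cc_def)
      then show "output_of (effect ?last S1) = U_D r s n z"
        using S1 by (simp add: output_of_def del: falling_exp.simps)
    qed simp
    have "run B (count_prog d r 0 2 ;; count_prog d s r 3 ;; count_prog d (r + s) 0 4 ;; For 3 0 ?step ;; ?last) S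
      (K1 * M + K2 * M + K3 * M + (n * (pcost ?step + 12) + 9) + pcost ?last) (\<lambda>S'. output_of S' = U_D r s n z)"
      by (intro run_Seq[OF run_Seq[OF run_Seq[OF run_Seq[OF 1 2] 3] 4] 5])
    moreover have "K1 * M + K2 * M + K3 * M + (n * (pcost ?step + 12) + 9) + pcost ?last \<le> K * M"
    proof -
      have "levels n \<ge> 1"
        using levels_pos[of n] n by simp
      then have "n * 1 \<le> M"
        unfolding M_def by (intro mult_left_mono) auto
      then have M: "n \<le> M" "1 \<le> M"
        using n by auto
      have "n * (pcost ?step + 12) \<le> M * (pcost ?step + 12)" "pcost ?last * 1 \<le> pcost ?last * M"
        by (rule mult_le_mono1 mult_le_mono2, fact)+
      then have "K1 * M + K2 * M + K3 * M + (n * (pcost ?step + 12) + 9) + pcost ?last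
        \<le> K1 * M + K2 * M + K3 * M + (M * (pcost ?step + 12) + 9 * M) + pcost ?last * M"
        using M(2) by linarith
      also have "\<dots> = K * M"
        unfolding K_def by (simp only: distrib_right mult.commute[of M])
      finally show ?thesis .
    qed
    ultimately show "run (n ^ (2 * d + 10)) (prog_D r s) (input_store d n z) (K * (n * levels n ^ (d - 1)))
      (\<lambda>S'. output_of S' = U_D r s n z)"
      unfolding prog_D_def Let_def x_def[symmetric] d[symmetric] B_def[symmetric] S_def[symmetric] M_def[symmetric]
      by (rule run_mono)
  next
    have "(\<lambda>n. real K * (real n ^ 1 * real (levels n) ^ (d - 1))) \<in> O(\<lambda>n. real n ^ 1 * log 2 (real n) ^ (d - 1))"
      using levels_le_log by (intro bigo_log[where c = 1]) auto
    then show "(\<lambda>n. real (K * (n * levels n ^ (d - 1)))) \<in> O(\<lambda>n. real n * log 2 (real n) ^ (d - 1))"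
      by simp
  qed
qed

lemma ival_rupd [simp]: "ival (rupd a j v S) e = ival S e"
  by (induction e) simp_all

lemma isafe_rupd [simp]: "isafe B (rupd a j v S) e = isafe B S e"
  by (induction e) simp_all

section \<open>Ranks\<close>

definition rank :: "nat \<Rightarrow> tuple \<Rightarrow> nat \<Rightarrow> nat \<Rightarrow> nat" where
  "rank n z i k = (\<Sum>j<n. of_bool (z (Suc j) (Suc k) < z (Suc i) (Suc k)))"

lemma rank_eq_card: "rank n z i k = card {j. j < n \<and> z (Suc j) (Suc k) < z (Suc i) (Suc k)}"
  unfolding rank_def by (simp add: Int_def)

lemma rank_less: "i < n \<Longrightarrow> rank n z i k < n"
proof -
  assume "i < n"
  then have "{j. j < n \<and> z (Suc j) (Suc k) < z (Suc i) (Suc k)} \<subset> {..<n}"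
    by auto
  from psubset_card_mono[OF _ this] show "rank n z i k < n"
    by (simp add: rank_eq_card)
qed

lemma rank_less_iff:
  assumes "i < n" "j < n"
  shows "rank n z i k < rank n z j k \<longleftrightarrow> z (Suc i) (Suc k) < z (Suc j) (Suc k)"
proof
  assume *: "z (Suc i) (Suc k) < z (Suc j) (Suc k)"
  have "{l. l < n \<and> z (Suc l) (Suc k) < z (Suc i) (Suc k)} \<subset> {l. l < n \<and> z (Suc l) (Suc k) < z (Suc j) (Suc k)}"
    using * assms by (intro psubsetI) (auto dest: less_trans simp: set_eq_iff)
  from psubset_card_mono[OF _ this] show "rank n z i k < rank n z j k"
    by (simp add: rank_eq_card)
next
  assume "rank n z i k < rank n z j k"
  show "z (Suc i) (Suc k) < z (Suc j) (Suc k)"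
  proof (rule ccontr)
    assume "\<not> z (Suc i) (Suc k) < z (Suc j) (Suc k)"
    then have "rank n z j k \<le> rank n z i k"
      unfolding rank_eq_card by (intro card_mono) auto
    then show False
      using \<open>rank n z i k < rank n z j k\<close> by simp
  qed
qed

lemma rank_le_iff: "i < n \<Longrightarrow> j < n \<Longrightarrow> rank n z i k \<le> rank n z j k \<longleftrightarrow> z (Suc i) (Suc k) \<le> z (Suc j) (Suc k)"
  using rank_less_iff[of j n i z k] by (simp flip: not_less)

text \<open>All pairs of points are compared. Quadratic time is affordable, because the statistics
  computed from these ranks have bounds that are at least quadratic.\<close>

definition rank_prog :: "nat \<Rightarrow> prog" where
  "rank_prog d = ISet 2 (IMul (Var 0) (IConst d)) ;;
     For 3 2 (For 4 0 (If (RLess (RArr 0 (IAdd (IMul (Var 4) (IConst d)) (IMod (Var 3) (IConst d)))) (RArr 0 (Var 3)))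
       (IAssign 5 (Var 3) (IAdd (IArr 5 (Var 3)) (IConst 1))) Skip))"

lemma run_rank_prog:
  assumes n: "imem S 0 0 = n" "n > 0" "d > 0" and B: "n * d < B"
    and inp: "\<And>i l. i < n \<Longrightarrow> l < d \<Longrightarrow> rmem S 0 (i * d + l) = z (Suc i) (Suc l)"
    and zero: "\<And>a. imem S 5 a = 0"
  shows "run B (rank_prog d) S (n * n * (d * 100) + 100)
    (\<lambda>S'. same {2, 3, 4, 5} {} S S' \<and> (\<forall>i<n. \<forall>k<d. imem S' 5 (i * d + k) = rank n z i k))"
proof -
  have "n * 1 \<le> n * d" "1 * d \<le> n * d"
    using n by (intro mult_mono; simp)+
  then have nB: "n < B" "d < B"
    using B by linarith+
  let ?cond = "RLess (RArr 0 (IAdd (IMul (Var 4) (IConst d)) (IMod (Var 3) (IConst d)))) (RArr 0 (Var 3))"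
  let ?step = "If ?cond (IAssign 5 (Var 3) (IAdd (IArr 5 (Var 3)) (IConst 1))) Skip"
  define v where "v = (\<lambda>m x. \<Sum>j<m. of_bool (z (Suc j) (Suc (x mod d)) < z (Suc (x div d)) (Suc (x mod d))) :: nat)"
  let ?I = "\<lambda>S'. same {2, 3, 4, 5} {} S S' \<and> imem S' 2 0 = n * d"
  have v0: "v 0 x = 0" for x
    by (simp add: v_def)
  have v_le: "v m x \<le> m" for m x
  proof -
    have "v m x \<le> (\<Sum>j<m. 1)"
      unfolding v_def by (intro sum_mono) simp
    then show ?thesis
      by simp
  qed
  have 1: "run B (ISet 2 (IMul (Var 0) (IConst d))) S 6 (\<lambda>S'. ?I S' \<and> (\<forall>a. imem S' 5 a = 0))"
    by (rule run_straight) (use n zero B nB in auto)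
  have 2: "run B (For 3 2 (For 4 0 ?step)) S1 (n * d * (n * (pcost ?step + 12) + 9 + 12) + 9)
      (\<lambda>S'. ?I S' \<and> (\<forall>x<n * d. imem S' 5 x = v n x))" if S1: "?I S1 \<and> (\<forall>a. imem S1 5 a = 0)" for S1
  proof (rule run_For[where P = "\<lambda>x S'. ?I S' \<and> (\<forall>y. imem S' 5 y = (if y < x then v n y else 0))"])
    fix x S2 assume x: "x < n * d" and P: "?I S2 \<and> (\<forall>y. imem S2 5 y = (if y < x then v n y else 0))"
      and cx: "imem S2 3 0 = x"
    have xd: "x div d < n" "x mod d < d"
      using x n(3) by (simp_all add: less_mult_imp_div_less)
    show "run B (For 4 0 ?step) S2 (n * (pcost ?step + 12) + 9)
      (\<lambda>S'. (?I S' \<and> (\<forall>y. imem S' 5 y = (if y < Suc x then v n y else 0))) \<and> imem S' 3 0 = x)"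
    proof (rule run_For[where P = "\<lambda>m S'. ?I S' \<and> imem S' 3 0 = x \<and>
        (\<forall>y. imem S' 5 y = (if y < x then v n y else if y = x then v m x else 0))"])
      fix j S3 assume j: "j < n" and P3: "?I S3 \<and> imem S3 3 0 = x \<and>
        (\<forall>y. imem S3 5 y = (if y < x then v n y else if y = x then v j x else 0))" and cj: "imem S3 4 0 = j"
      have r0: "rmem S3 0 = rmem S 0"
        using P3 by (auto simp: same_def)
      have "rmem S 0 x = z (Suc (x div d)) (Suc (x mod d))"
        using inp[OF xd] by simp
      moreover have "rmem S 0 (j * d + x mod d) = z (Suc j) (Suc (x mod d))"
        using inp[OF j xd(2)] .
      ultimately have cond: "bval S3 ?cond \<longleftrightarrow> z (Suc j) (Suc (x mod d)) < z (Suc (x div d)) (Suc (x mod d))"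
        using P3 cj r0 by simp
      have "Suc j * d \<le> n * d"
        using j by (intro mult_right_mono) auto
      then have jd: "j * d + x mod d \<le> B" "j * d \<le> B"
        using B xd(2) by auto
      have vj: "Suc (v j x) \<le> B"
        using v_le[of j x] j nB by linarith
      have vS: "v (Suc j) x = v j x + of_bool (z (Suc j) (Suc (x mod d)) < z (Suc (x div d)) (Suc (x mod d)))"
        by (simp add: v_def del: sum_of_bool_eq)
      show "run B ?step S3 (pcost ?step) (\<lambda>S'. (?I S' \<and> imem S' 3 0 = x \<and>
        (\<forall>y. imem S' 5 y = (if y < x then v n y else if y = x then v (Suc j) x else 0))) \<and> imem S' 4 0 = j)"
      proof (rule run_straight)
        show "psafe B ?step S3"
          using P3 cj jd vj nB by auto
        show "(?I (effect ?step S3) \<and> imem (effect ?step S3) 3 0 = x \<and>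
          (\<forall>y. imem (effect ?step S3) 5 y = (if y < x then v n y else if y = x then v (Suc j) x else 0))) \<and>
          imem (effect ?step S3) 4 0 = j"
          using P3 cj vS cond by (simp del: bval.simps)
      qed simp
    qed (use P cx nB n in \<open>auto simp: v0 same_def less_Suc_eq\<close>)
  qed (use S1 B nB in auto)
  have "run B (rank_prog d) S (6 + (n * d * (n * (pcost ?step + 12) + 9 + 12) + 9))
    (\<lambda>S'. ?I S' \<and> (\<forall>x<n * d. imem S' 5 x = v n x))"
    unfolding rank_prog_def by (rule run_Seq[OF 1 2])
  then show ?thesis
  proof (rule run_mono)
    have "n * d * 1 \<le> n * d * n"
      using n by (intro mult_left_mono) auto
    moreover have "6 + (n * d * (n * (pcost ?step + 12) + 9 + 12) + 9) = 36 * (n * d * n) + 21 * (n * d * 1) + 15"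
      by (simp add: algebra_simps)
    moreover have "n * n * (d * 100) = 100 * (n * d * n)"
      by simp
    ultimately show "6 + (n * d * (n * (pcost ?step + 12) + 9 + 12) + 9) \<le> n * n * (d * 100) + 100"
      by linarith
    fix S' assume *: "?I S' \<and> (\<forall>x<n * d. imem S' 5 x = v n x)"
    have "imem S' 5 (i * d + k) = rank n z i k" if "i < n" "k < d" for i k
    proof -
      have "Suc i * d \<le> n * d"
        using that by (intro mult_right_mono) auto
      then have "i * d + k < n * d"
        using that by simp
      then show ?thesis
        using * that by (simp add: v_def rank_def del: sum_of_bool_eq)
    qed
    then show "same {2, 3, 4, 5} {} S S' \<and> (\<forall>i<n. \<forall>k<d. imem S' 5 (i * d + k) = rank n z i k)"
      using * by blast
  qed
qed

section \<open>The refined statistic\<close>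

text \<open>Prefix sums in place, one dimension after the other: a cell receives its predecessor in
  dimension \<open>l\<close>, at distance \<open>n ^ l\<close>, unless its digit there is 0. The
  nested truncated subtractions compute this condition as a factor 0 or 1, so the body has no
  branch.\<close>

definition prefix_prog :: "nat \<Rightarrow> prog" where
  "prefix_prog d = ISet 9 (IConst d) ;; ISet 7 (IConst 1) ;;
     For 8 9 (For 3 6 (RAssign 2 (Var 3) (RAdd (RArr 2 (Var 3))
         (RMul (ROfNat (ISub (IConst 1) (ISub (IConst 1) (IMod (IDiv (Var 3) (Var 7)) (Var 0)))))
           (RArr 2 (ISub (Var 3) (Var 7)))))) ;;
       ISet 7 (IMul (Var 7) (Var 0)))"

text \<open>
  \<open>mixed\<close> is the invariant of the prefix sums when the dimensions below \<open>l\<close> have been accumulated.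
\<close>

definition mixed :: "nat \<Rightarrow> nat \<Rightarrow> nat \<Rightarrow> (nat \<Rightarrow> nat) \<Rightarrow> nat \<Rightarrow> bool" where
  "mixed n d l f a \<longleftrightarrow> (\<forall>k<d. if k < l then f k \<le> digit n a k else f k = digit n a k)"

text \<open>A positive digit is lowered without a borrow, so the other digits stay as they
  are.\<close>

lemma digit_decrease:
  assumes "a < n ^ d" "l < d" "0 < digit n a l" "k < d"
  shows "digit n (a - n ^ l) k = (if k = l then digit n a l - 1 else digit n a k)"
proof -
  define f where "f = (digit n a)(l := digit n a l - 1)"
  have n: "n > 0"
    using assms by (metis digit_def gr0I mod_0 div_0 less_nat_zero_code zero_less_power_eq power_eq_0_iff)
  have fl: "f k < n" if "k < d" for k
    using digit_less[OF n, of a k] by (auto simp: f_def less_imp_diff_less)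
  have "encode n d f + n ^ l = encode n d (digit n a)"
  proof -
    have "encode n d h = h l * n ^ l + (\<Sum>k\<in>{..<d} - {l}. h k * n ^ k)" for h
      unfolding encode_def using assms(2) by (subst sum.remove[of _ l]) auto
    moreover have "(\<Sum>k\<in>{..<d} - {l}. f k * n ^ k) = (\<Sum>k\<in>{..<d} - {l}. digit n a k * n ^ k)"
      by (intro sum.cong) (auto simp: f_def)
    moreover have "f l * n ^ l + n ^ l = digit n a l * n ^ l"
      using assms(3) by (cases "digit n a l") (auto simp: f_def)
    ultimately show ?thesis
      by simp
  qed
  then have "a - n ^ l = encode n d f"
    using assms(1) by (simp add: encode_digit)
  then show ?thesis
    using digit_encode[of d f n k, OF fl assms(4)] by (auto simp: f_def)
qed

text \<open>\<open>f l \<le> digit n a l\<close> means either equality or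
  \<open>f l \<le> digit n a l - 1\<close>, the latter being the condition at the predecessor of
  \<open>a\<close> in dimension \<open>l\<close>; the two cases exclude each other.\<close>

lemma mixed_Suc:
  assumes "a < n ^ d" "l < d"
  shows "(of_bool (mixed n d (Suc l) f a) :: real) = of_bool (mixed n d l f a)
    + of_bool (0 < digit n a l) * of_bool (mixed n d (Suc l) f (a - n ^ l))"
proof -
  define rest where "rest \<longleftrightarrow> (\<forall>k<d. k \<noteq> l \<longrightarrow> (if k < l then f k \<le> digit n a k else f k = digit n a k))"
  have 1: "mixed n d l f a \<longleftrightarrow> rest \<and> f l = digit n a l"
    unfolding mixed_def rest_def using assms(2) by (metis less_irrefl)
  have 2: "mixed n d (Suc l) f a \<longleftrightarrow> rest \<and> f l \<le> digit n a l"
    unfolding mixed_def rest_def using assms(2) by (metis less_Suc_eq)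
  have 3: "mixed n d (Suc l) f (a - n ^ l) \<longleftrightarrow> rest \<and> f l \<le> digit n a l - 1" if "0 < digit n a l"
  proof -
    have "(if k < Suc l then f k \<le> digit n (a - n ^ l) k else f k = digit n (a - n ^ l) k) \<longleftrightarrow>
      (if k = l then f l \<le> digit n a l - 1 else if k < l then f k \<le> digit n a k else f k = digit n a k)"
      if "k < d" for k
      using digit_decrease[OF assms \<open>0 < digit n a l\<close> that] by auto
    then show ?thesis
      unfolding mixed_def rest_def using assms(2) by metis
  qed
  show ?thesis
    using 1 2 3 by (cases "0 < digit n a l") (auto simp: of_bool_def)
qed

lemma run_prefix_prog:
  fixes f :: "nat \<Rightarrow> nat \<Rightarrow> nat"
  assumes n: "imem S 0 0 = n" "n > 0" and P: "imem S 6 0 = n ^ d" and B: "n ^ d < B" "d < B" "1 < B"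
    and T: "\<And>a. a < n ^ d \<Longrightarrow> rmem S 2 a = (\<Sum>i<n. of_bool (mixed n d 0 (f i) a))"
  shows "run B (prefix_prog d) S (n ^ d * (d * 200) + d * 100 + 100)
    (\<lambda>S'. same {3, 7, 8, 9} {2} S S' \<and> (\<forall>a<n ^ d. rmem S' 2 a = (\<Sum>i<n. of_bool (mixed n d d (f i) a))))"
proof -
  let ?I = "\<lambda>S'. same {3, 7, 8, 9} {2} S S' \<and> imem S' 9 0 = d"
  let ?V = "\<lambda>l a. \<Sum>i<n. of_bool (mixed n d l (f i) a) :: real"
  let ?up = "RAssign 2 (Var 3) (RAdd (RArr 2 (Var 3))
         (RMul (ROfNat (ISub (IConst 1) (ISub (IConst 1) (IMod (IDiv (Var 3) (Var 7)) (Var 0)))))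
           (RArr 2 (ISub (Var 3) (Var 7)))))"
  have 1: "run B (ISet 9 (IConst d) ;; ISet 7 (IConst 1)) S 6
    (\<lambda>S'. ?I S' \<and> imem S' 7 0 = n ^ 0 \<and> (\<forall>a<n ^ d. rmem S' 2 a = ?V 0 a))"
    by (rule run_straight) (use B T in auto)
  have 2: "run B (For 8 9 (For 3 6 ?up ;; ISet 7 (IMul (Var 7) (Var 0)))) S1
      (d * ((n ^ d * (pcost ?up + 12) + 9) + 7 + 12) + 9) (\<lambda>S'. ?I S' \<and> (\<forall>a<n ^ d. rmem S' 2 a = ?V d a))"
    if S1: "?I S1 \<and> imem S1 7 0 = n ^ 0 \<and> (\<forall>a<n ^ d. rmem S1 2 a = ?V 0 a)" for S1
  proof (rule run_For[where P = "\<lambda>l S'. ?I S' \<and> imem S' 7 0 = n ^ l \<and> (\<forall>a<n ^ d. rmem S' 2 a = ?V l a)"])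
    fix l S2 assume l: "l < d" and P2: "?I S2 \<and> imem S2 7 0 = n ^ l \<and> (\<forall>a<n ^ d. rmem S2 2 a = ?V l a)"
      and cl: "imem S2 8 0 = l"
    let ?J = "\<lambda>S'. ?I S' \<and> imem S' 7 0 = n ^ l \<and> imem S' 8 0 = l"
    have inner: "run B (For 3 6 ?up) S2 (n ^ d * (pcost ?up + 12) + 9) (\<lambda>S'. ?J S' \<and> (\<forall>a<n ^ d. rmem S' 2 a = ?V (Suc l) a))"
    proof (rule run_For[where P = "\<lambda>m S'. ?J S' \<and> (\<forall>a<n ^ d. rmem S' 2 a = ?V (if a < m then Suc l else l) a)"])
      fix m S3 assume m: "m < n ^ d" and P3: "?J S3 \<and> (\<forall>a<n ^ d. rmem S3 2 a = ?V (if a < m then Suc l else l) a)"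
        and cm: "imem S3 3 0 = m"
      have i0: "imem S3 0 0 = n"
        using P3 n by (auto simp: same_def)
      have ind: "ival S3 (ISub (IConst 1) (ISub (IConst 1) (IMod (IDiv (Var 3) (Var 7)) (Var 0)))) = of_bool (0 < digit n m l)"
        using P3 cm i0 by (auto simp: digit_def)
      have "?V (Suc l) m = ?V l m + of_bool (0 < digit n m l) * ?V (Suc l) (m - n ^ l)"
        unfolding mixed_Suc[OF m l] sum.distrib sum_distrib_left ..
      \<comment> \<open>The cell that is read has a smaller index than the one that is written, so
        the current pass has already updated it, as a running sum requires.\<close>
      moreover have "m - n ^ l < m" if "0 < digit n m l"
      proof -
        have "m \<noteq> 0"
          using that by (cases "m = 0") (simp_all add: digit_def)
        then show ?thesis
          using n by simp
      qed
      then have "of_bool (0 < digit n m l) * rmem S3 2 (m - n ^ l) = of_bool (0 < digit n m l) * ?V (Suc l) (m - n ^ l)"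
        using P3 m by (auto simp: of_bool_def less_trans)
      ultimately have new: "rmem S3 2 m + of_bool (0 < digit n m l) * rmem S3 2 (m - n ^ l) = ?V (Suc l) m"
        using P3 m by simp
      show "run B ?up S3 (pcost ?up) (\<lambda>S'. (?J S' \<and> (\<forall>a<n ^ d. rmem S' 2 a = ?V (if a < Suc m then Suc l else l) a)) \<and> imem S' 3 0 = m)"
      proof (rule run_straight)
        show "psafe B ?up S3"
          using B by simp
        have "effect ?up S3 = rupd 2 m (rmem S3 2 m + of_bool (0 < digit n m l) * rmem S3 2 (m - n ^ l)) S3"
          using ind P3 cm by (simp del: ival.simps(4)) simp
        then have "effect ?up S3 = rupd 2 m (?V (Suc l) m) S3"
          unfolding new .
        then show "(?J (effect ?up S3) \<and> (\<forall>a<n ^ d. rmem (effect ?up S3) 2 a = ?V (if a < Suc m then Suc l else l) a)) \<and> imem (effect ?up S3) 3 0 = m"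
          using P3 cm by (simp add: less_Suc_eq del: effect.simps sum_of_bool_eq)
      qed simp
    qed (use P2 cl B P in \<open>auto simp: same_def simp del: sum_of_bool_eq\<close>)
    have "n ^ Suc l \<le> n ^ d"
      using l n by (intro power_increasing) auto
    then have lB: "n ^ l * n \<le> B"
      using B by (simp add: mult.commute)
    have last: "run B (ISet 7 (IMul (Var 7) (Var 0))) S3 7
      (\<lambda>S'. (?I S' \<and> imem S' 7 0 = n ^ Suc l \<and> (\<forall>a<n ^ d. rmem S' 2 a = ?V (Suc l) a)) \<and> imem S' 8 0 = l)"
      if S3: "?J S3 \<and> (\<forall>a<n ^ d. rmem S3 2 a = ?V (Suc l) a)" for S3
    proof (rule run_straight)
      have "imem S3 0 0 = n"
        using S3 n by (auto simp: same_def)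
      then show "psafe B (ISet 7 (IMul (Var 7) (Var 0))) S3"
        using S3 lB by simp
      show "(?I (effect (ISet 7 (IMul (Var 7) (Var 0))) S3) \<and> imem (effect (ISet 7 (IMul (Var 7) (Var 0))) S3) 7 0 = n ^ Suc l \<and>
          (\<forall>a<n ^ d. rmem (effect (ISet 7 (IMul (Var 7) (Var 0))) S3) 2 a = ?V (Suc l) a)) \<and>
          imem (effect (ISet 7 (IMul (Var 7) (Var 0))) S3) 8 0 = l"
        using S3 \<open>imem S3 0 0 = n\<close> by (simp add: mult.commute del: sum_of_bool_eq)
    qed simp
    show "run B (For 3 6 ?up ;; ISet 7 (IMul (Var 7) (Var 0))) S2 ((n ^ d * (pcost ?up + 12) + 9) + 7)
      (\<lambda>S'. (?I S' \<and> imem S' 7 0 = n ^ Suc l \<and> (\<forall>a<n ^ d. rmem S' 2 a = ?V (Suc l) a)) \<and> imem S' 8 0 = l)"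
      by (rule run_Seq[OF inner last])
  qed (use S1 B in \<open>auto simp del: sum_of_bool_eq\<close>)
  have "run B (prefix_prog d) S (6 + (d * ((n ^ d * (pcost ?up + 12) + 9) + 7 + 12) + 9))
    (\<lambda>S'. ?I S' \<and> (\<forall>a<n ^ d. rmem S' 2 a = ?V d a))"
    unfolding prefix_prog_def by (rule run_Seq[OF 1 2])
  then show ?thesis
    by (rule run_mono) (simp add: algebra_simps, blast)
qed

section \<open>Evaluation of one choice of reference columns\<close>

definition pow_exp :: "nat \<Rightarrow> iexp" where
  "pow_exp k = iprod (\<lambda>_. Var 0) k"

text \<open>Truncated subtraction expresses comparisons as numbers 0 and 1. Products then act as
  conjunctions, and the loop body is free of branches.\<close>

definition leq_exp :: "iexp \<Rightarrow> iexp \<Rightarrow> iexp" where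
  "leq_exp a b = ISub (IConst 1) (ISub a b)"

definition neq_exp :: "iexp \<Rightarrow> iexp \<Rightarrow> iexp" where
  "neq_exp a b = ISub (IConst 1) (ISub (IConst 1) (IAdd (ISub a b) (ISub b a)))"

lemma ival_neq_exp [simp]: "ival S (neq_exp a b) = of_bool (ival S a \<noteq> ival S b)"
  by (auto simp: neq_exp_def)

lemma prod_of_bool: "(\<Prod>j<(k :: nat). of_bool (P j)) = (of_bool (\<forall>j<k. P j) :: nat)"
  by (induction k) (auto simp: less_Suc_eq)

lemma isafe_iprod_bool:
  "(\<And>j. j < k \<Longrightarrow> isafe B S (f j)) \<Longrightarrow> (\<And>j. j < k \<Longrightarrow> ival S (f j) = of_bool (P j)) \<Longrightarrow> 1 \<le> B \<Longrightarrow>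
    isafe B S (iprod f k)"
  by (rule isafe_iprod_pow[where b = 1]) auto

lemma ival_pow_exp [simp]: "ival S (pow_exp k) = imem S 0 0 ^ k"
  by (simp add: pow_exp_def)

text \<open>The loop counter codes a choice of one column per coordinate: its digit \<open>k\<close>
  is the column that supplies coordinate \<open>k\<close> of the reference point.\<close>

definition pick_exp :: "nat \<Rightarrow> iexp" where
  "pick_exp k = IMod (IDiv (Var 3) (pow_exp k)) (Var 0)"

definition rank_exp :: "nat \<Rightarrow> iexp \<Rightarrow> nat \<Rightarrow> iexp" where
  "rank_exp d i k = IArr 5 (IAdd (IMul i (IConst d)) (IConst k))"

definition address_exp :: "nat \<Rightarrow> (nat \<Rightarrow> iexp) \<Rightarrow> iexp" where
  "address_exp d f = isum (\<lambda>l. IMul (f l) (pow_exp l)) d"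

definition ref_exp :: "nat \<Rightarrow> nat \<Rightarrow> iexp" where
  "ref_exp d l = rank_exp d (pick_exp l) l"

text \<open>
  The digit \<open>n - 1\<close> in an unselected dimension removes the constraint there.
\<close>

definition rest_exp :: "nat \<Rightarrow> (nat \<Rightarrow> bool) \<Rightarrow> rexp" where
  "rest_exp d sel = RSub
     (RArr 2 (address_exp d (\<lambda>l. if sel l then ref_exp d l else ISub (Var 0) (IConst 1))))
     (ROfNat (isum (\<lambda>k. iprod (\<lambda>l. if sel l then leq_exp (rank_exp d (pick_exp k) l) (ref_exp d l) else IConst 1) d) d))"

text \<open>The loop also visits choices with a repeated column; these receive the factor 0.\<close>

definition distinct_exp :: "nat \<Rightarrow> iexp" where
  "distinct_exp d = iprod (\<lambda>k. iprod (\<lambda>k'. neq_exp (pick_exp k) (pick_exp k')) k) d"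

definition prog_R :: "nat \<Rightarrow> nat \<Rightarrow> prog" where
  "prog_R r s = (let d = r + s; a = address_exp d (rank_exp d (Var 3)) in
     rank_prog d ;; ISet 6 (pow_exp d) ;;
     For 3 0 (RAssign 2 a (RAdd (RArr 2 a) (ROfNat (IConst 1)))) ;;
     prefix_prog d ;;
     For 3 6 (RSet 3 (rest_exp d (\<lambda>l. l < r)) ;; RSet 4 (rest_exp d (\<lambda>l. r \<le> l)) ;; RSet 5 (rest_exp d (\<lambda>l. True)) ;;
       RSet 1 (RAdd (RVar 1) (RMul (ROfNat (distinct_exp d))
         (quad_exp (RSub (ROfNat (Var 0)) (ROfNat (IConst d))) (RVar 3) (RVar 4) (RVar 5))))) ;;
     RSet 1 (RDiv (RVar 1) (RMul (ROfNat (IConst 4)) (falling_exp (Var 0) (4 + d)))))"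

text \<open>The counterpart of \<open>rest_count\<close> with ranks instead of coordinates and with
  columns numbered from 0.\<close>

definition rest_rank :: "nat \<Rightarrow> nat \<Rightarrow> (nat \<Rightarrow> nat \<Rightarrow> nat) \<Rightarrow> (nat \<Rightarrow> bool) \<Rightarrow> (nat \<Rightarrow> nat) \<Rightarrow> real" where
  "rest_rank n d rk sel f = (\<Sum>i<n. of_bool (\<forall>l<d. sel l \<longrightarrow> rk i l \<le> rk (f l) l))
     - (\<Sum>k<d. of_bool (\<forall>l<d. sel l \<longrightarrow> rk (f k) l \<le> rk (f l) l))"

context
  fixes S :: store and B n d :: nat and rk :: "nat \<Rightarrow> nat \<Rightarrow> nat"
  assumes n: "imem S 0 0 = n" "n \<ge> 2" and d: "d \<ge> 1" and B: "n * d * n ^ d \<le> B"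
    and rk: "\<And>i k. i < n \<Longrightarrow> k < d \<Longrightarrow> imem S 5 (i * d + k) = rk i k" "\<And>i k. i < n \<Longrightarrow> k < d \<Longrightarrow> rk i k < n"
begin

lemma bound_R: "n ^ d \<le> B" "n * d \<le> B" "2 * n \<le> B" "d \<le> B"
proof -
  have "1 * n ^ d \<le> n * d * n ^ d" "n * d * 1 \<le> n * d * n ^ d" "1 * d * 1 \<le> n * d * n ^ d"
    using n d by (intro mult_mono; simp)+
  moreover have "n ^ 1 \<le> n ^ d"
    using n d by (intro power_increasing) auto
  then have "n * 1 * n \<le> n * d * n ^ d"
    using d by (intro mult_mono) auto
  moreover have "2 * n \<le> n * n"
    using n by simp
  ultimately show "n ^ d \<le> B" "n * d \<le> B" "2 * n \<le> B" "d \<le> B"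
    using B by linarith+
qed

lemma pow_le_R: "k \<le> d \<Longrightarrow> n ^ k \<le> B"
proof -
  assume "k \<le> d"
  then have "n ^ k \<le> n ^ d"
    using n by (intro power_increasing) auto
  then show ?thesis
    using bound_R by simp
qed

lemma isafe_pow_exp: "k \<le> d \<Longrightarrow> isafe B S (pow_exp k)"
  unfolding pow_exp_def using n pow_le_R bound_R by (intro isafe_iprod_pow[where b = n]) auto

lemma isafe_rank_exp: "isafe B S i \<Longrightarrow> ival S i < n \<Longrightarrow> k < d \<Longrightarrow> isafe B S (rank_exp d i k)"
proof -
  assume *: "isafe B S i" "ival S i < n" "k < d"
  have "Suc (ival S i) * d \<le> n * d"
    using * by (intro mult_right_mono) auto
  then have "ival S i * d + k \<le> B" "ival S i * d \<le> B"
    using * bound_R by auto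
  then show ?thesis
    using * bound_R by (simp add: rank_exp_def)
qed

lemma ival_rank_exp: "ival S i < n \<Longrightarrow> k < d \<Longrightarrow> ival S (rank_exp d i k) = rk (ival S i) k"
  by (simp add: rank_exp_def rk)

lemma address_exp_eval:
  assumes "\<And>l. l < d \<Longrightarrow> isafe B S (f l)" "\<And>l. l < d \<Longrightarrow> ival S (f l) < n"
  shows "isafe B S (address_exp d f)" "ival S (address_exp d f) = encode n d (\<lambda>l. ival S (f l))"
proof -
  show val: "ival S (address_exp d f) = encode n d (\<lambda>l. ival S (f l))"
    by (simp add: address_exp_def encode_def n)
  have "encode n d (\<lambda>l. ival S (f l)) < n ^ d"
    using assms(2) by (rule encode_less)
  moreover have "ival S (f l) * n ^ l \<le> B" if "l < d" for l
  proof -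
    have "ival S (f l) * n ^ l \<le> n * n ^ l"
      using assms(2)[OF that] by (intro mult_right_mono) auto
    also have "\<dots> \<le> B"
      using pow_le_R[of "Suc l"] that by simp
    finally show ?thesis .
  qed
  ultimately show "isafe B S (address_exp d f)"
    unfolding address_exp_def using assms(1) isafe_pow_exp bound_R val
    by (intro isafe_isum) (auto simp: n address_exp_def)
qed

context
  fixes x assumes x: "imem S 3 0 = x"
begin

lemma pick_exp_eval: "k < d \<Longrightarrow> isafe B S (pick_exp k)" "ival S (pick_exp k) = digit n x k"
  using isafe_pow_exp by (auto simp: pick_exp_def digit_def n x)

lemma digit_less_R: "digit n x k < n"
  using n by (intro digit_less) auto

lemma ref_exp_eval:
  assumes "l < d"
  shows "isafe B S (ref_exp d l)" "ival S (ref_exp d l) = rk (digit n x l) l"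
  unfolding ref_exp_def using assms pick_exp_eval digit_less_R
  by (auto intro!: isafe_rank_exp simp: ival_rank_exp)

lemma rest_exp_eval:
  assumes F: "\<And>a. a < n ^ d \<Longrightarrow> rmem S 2 a = (\<Sum>i<n. of_bool (mixed n d d (rk i) a))"
  shows "rsafe B S (rest_exp d sel)" "rval S (rest_exp d sel) = rest_rank n d rk sel (digit n x)"
proof -
  let ?f = "\<lambda>l. if sel l then ref_exp d l else ISub (Var 0) (IConst 1)"
  let ?g = "\<lambda>l. if sel l then rk (digit n x l) l else n - 1"
  let ?leq = "\<lambda>k l. if sel l then leq_exp (rank_exp d (pick_exp k) l) (ref_exp d l) else IConst 1"
  have f: "isafe B S (?f l)" "ival S (?f l) = ?g l" "?g l < n" if "l < d" for l
    using ref_exp_eval[OF that] bound_R n rk(2)[OF digit_less_R that] by auto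
  have addr: "isafe B S (address_exp d ?f)" "ival S (address_exp d ?f) = encode n d (\<lambda>l. ival S (?f l))"
    using address_exp_eval[of ?f] f by auto
  have addr2: "ival S (address_exp d ?f) = encode n d ?g"
    unfolding addr(2) encode_def using f(2) by (intro sum.cong refl) simp
  have "mixed n d d (rk i) (encode n d ?g) \<longleftrightarrow> (\<forall>l<d. sel l \<longrightarrow> rk i l \<le> rk (digit n x l) l)" if "i < n" for i
  proof -
    have "rk i l \<le> n - 1" if "l < d" for l
      using rk(2)[OF \<open>i < n\<close> that] by simp
    then show ?thesis
      unfolding mixed_def using digit_encode[of d ?g n, OF f(3)] by auto
  qed
  moreover have "encode n d ?g < n ^ d"
    using f(3) by (rule encode_less)
  ultimately have all: "rmem S 2 (encode n d ?g) = (\<Sum>i<n. of_bool (\<forall>l<d. sel l \<longrightarrow> rk i l \<le> rk (digit n x l) l))"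
    unfolding F[OF \<open>encode n d ?g < n ^ d\<close>] by (intro sum.cong refl) auto
  have leq: "isafe B S (?leq k l)" "ival S (?leq k l) = of_bool (sel l \<longrightarrow> rk (digit n x k) l \<le> rk (digit n x l) l)"
    if "k < d" "l < d" for k l
    using ref_exp_eval[OF that(2)] pick_exp_eval[of k] digit_less_R that bound_R n
    by (auto simp: leq_exp_def intro!: isafe_rank_exp) (auto simp: ival_rank_exp)
  have inner: "isafe B S (iprod (?leq k) d)"
    "ival S (iprod (?leq k) d) = of_bool (\<forall>l<d. sel l \<longrightarrow> rk (digit n x k) l \<le> rk (digit n x l) l)" if "k < d" for k
    using leq[OF that] bound_R n by (auto intro!: isafe_iprod_bool simp: prod_of_bool)
  have "(\<Sum>k<d. ival S (iprod (?leq k) d)) \<le> (\<Sum>k<d. 1)"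
    using inner(2) by (intro sum_mono) auto
  then have sum: "isafe B S (isum (\<lambda>k. iprod (?leq k) d) d)"
    using inner(1) bound_R by (intro isafe_isum) auto
  show "rsafe B S (rest_exp d sel)"
    using addr(1) sum by (simp add: rest_exp_def)
  have "real (ival S (isum (\<lambda>k. iprod (?leq k) d) d)) = (\<Sum>k<d. of_bool (\<forall>l<d. sel l \<longrightarrow> rk (digit n x k) l \<le> rk (digit n x l) l))"
    unfolding ival_isum of_nat_sum using inner(2) by (intro sum.cong refl) auto
  then show "rval S (rest_exp d sel) = rest_rank n d rk sel (digit n x)"
    by (simp add: rest_exp_def rest_rank_def addr2 all del: ival_isum sum_of_bool_eq)
qed

lemma distinct_exp_eval:
  "isafe B S (distinct_exp d)" "ival S (distinct_exp d) = of_bool (inj_on (digit n x) {..<d})"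
proof -
  have neq: "isafe B S (neq_exp (pick_exp k) (pick_exp k'))" "ival S (neq_exp (pick_exp k) (pick_exp k')) = of_bool (digit n x k \<noteq> digit n x k')"
    if "k < d" "k' < d" for k k'
    using pick_exp_eval that digit_less_R[of k] digit_less_R[of k'] bound_R n by (auto simp: neq_exp_def)
  have inner: "isafe B S (iprod (\<lambda>k'. neq_exp (pick_exp k) (pick_exp k')) k)"
    "ival S (iprod (\<lambda>k'. neq_exp (pick_exp k) (pick_exp k')) k) = of_bool (\<forall>k'<k. digit n x k \<noteq> digit n x k')"
    if "k < d" for k
    using neq[OF that] that bound_R n by (auto intro!: isafe_iprod_bool simp: prod_of_bool)
  show "isafe B S (distinct_exp d)"
    unfolding distinct_exp_def using bound_R n by (intro isafe_iprod_bool[OF inner]) auto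
  have "(\<forall>k<d. \<forall>k'<k. digit n x k \<noteq> digit n x k') \<longleftrightarrow> inj_on (digit n x) {..<d}"
  proof
    assume *: "\<forall>k<d. \<forall>k'<k. digit n x k \<noteq> digit n x k'"
    show "inj_on (digit n x) {..<d}"
    proof (rule inj_onI, rule ccontr)
      fix k k' assume k: "k \<in> {..<d}" "k' \<in> {..<d}" "digit n x k = digit n x k'" "k \<noteq> k'"
      then show False
        using *[rule_format, of k k'] *[rule_format, of k' k] by (cases "k < k'") auto
    qed
  qed (auto dest: inj_onD)
  moreover have "ival S (distinct_exp d) = (\<Prod>k<d. of_bool (\<forall>k'<k. digit n x k \<noteq> digit n x k'))"
    unfolding distinct_exp_def ival_iprod[of S _ d] by (intro prod.cong refl inner(2)) simp
  ultimately show "ival S (distinct_exp d) = of_bool (inj_on (digit n x) {..<d})"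
    by (simp only: prod_of_bool)
qed

end

end

text \<open>Columns numbered from 5 with values from 1 correspond to digits numbered from 0 with
  values from 0. The restriction makes digit functions extensional, as the product sets
  require.\<close>

lemma sum_injections_digits:
  fixes G :: "(nat \<Rightarrow> nat) \<Rightarrow> real"
  shows "(\<Sum>x<n ^ d. of_bool (inj_on (digit n x) {..<d}) * G (restrict (digit n x) {..<d}))
    = (\<Sum>g\<in>injections {5..4 + d} {1..n}. G (\<lambda>k\<in>{..<d}. g (5 + k) - 1))"
proof -
  let ?A = "injections {5..4 + d} {1..n}" and ?C = "injections {..<d} {..<n}"
  have inj_restrict: "inj_on (restrict f {..<d}) {..<d} \<longleftrightarrow> inj_on f {..<d}" for f :: "nat \<Rightarrow> nat"
    by (simp add: inj_on_def)
  have "(\<Sum>x<n ^ d. of_bool (inj_on (digit n x) {..<d}) * G (restrict (digit n x) {..<d}))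
    = (\<Sum>f\<in>{..<d} \<rightarrow>\<^sub>E {..<n}. of_bool (inj_on f {..<d}) * G f)"
    using sum_digits[where F = "\<lambda>f. of_bool (inj_on f {..<d}) * G f" and b = n and e = d] by (simp add: inj_restrict)
  also have "\<dots> = (\<Sum>f\<in>?C. G f)"
    unfolding injections_def
    by (rule sum.mono_neutral_cong_right) (auto intro!: finite_PiE)
  also have "\<dots> = (\<Sum>g\<in>?A. G (\<lambda>k\<in>{..<d}. g (5 + k) - 1))"
  proof (rule sum.reindex_bij_betw[symmetric], rule bij_betw_byWitness[where f' = "\<lambda>f. \<lambda>m\<in>{5..4 + d}. Suc (f (m - 5))"])
    have ge: "g m \<ge> 1" if "g \<in> ?A" "m \<in> {5..4 + d}" for g m
      using that by (auto simp: injections_def PiE_iff)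
    show "\<forall>g\<in>?A. (\<lambda>m\<in>{5..4 + d}. Suc ((\<lambda>k\<in>{..<d}. g (5 + k) - 1) (m - 5))) = g"
    proof
      fix g assume g: "g \<in> ?A"
      show "(\<lambda>m\<in>{5..4 + d}. Suc ((\<lambda>k\<in>{..<d}. g (5 + k) - 1) (m - 5))) = g"
      proof
        fix m
        show "(\<lambda>m\<in>{5..4 + d}. Suc ((\<lambda>k\<in>{..<d}. g (5 + k) - 1) (m - 5))) m = g m"
        proof (cases "m \<in> {5..4 + d}")
          case True
          then show ?thesis
            using ge[OF g True] by auto
        next
          case False
          then show ?thesis
            using g by (auto simp: injections_def PiE_iff extensional_def)
        qed
      qed
    qed
    show "\<forall>f\<in>?C. (\<lambda>k\<in>{..<d}. (\<lambda>m\<in>{5..4 + d}. Suc (f (m - 5))) (5 + k) - 1) = f"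
      by (auto simp: injections_def PiE_iff extensional_def fun_eq_iff)
    show "(\<lambda>g. \<lambda>k\<in>{..<d}. g (5 + k) - 1) ` ?A \<subseteq> ?C"
    proof
      fix f assume "f \<in> (\<lambda>g. \<lambda>k\<in>{..<d}. g (5 + k) - 1) ` ?A"
      then obtain g where g: "g \<in> ?A" "f = (\<lambda>k\<in>{..<d}. g (5 + k) - 1)"
        by blast
      have g1: "1 \<le> g (5 + k)" "g (5 + k) \<le> n" if "k < d" for k
        using g(1) that by (auto simp: injections_def PiE_iff)
      have "inj_on f {..<d}"
      proof (rule inj_onI)
        fix k k' assume k: "k \<in> {..<d}" "k' \<in> {..<d}" "f k = f k'"
        then have "g (5 + k) = g (5 + k')"
          using g1[of k] g1[of k'] g(2) by auto
        then show "k = k'"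
          using g(1) k inj_onD[of g "{5..4 + d}" "5 + k" "5 + k'"] by (auto simp: injections_def)
      qed
      moreover have "f k < n" if "k < d" for k
        using g1[OF that] g(2) that by auto
      ultimately show "f \<in> ?C"
        using g(2) by (auto simp: injections_def)
    qed
    show "(\<lambda>f. \<lambda>m\<in>{5..4 + d}. Suc (f (m - 5))) ` ?C \<subseteq> ?A"
    proof
      fix g assume "g \<in> (\<lambda>f. \<lambda>m\<in>{5..4 + d}. Suc (f (m - 5))) ` ?C"
      then obtain f where f: "f \<in> ?C" "g = (\<lambda>m\<in>{5..4 + d}. Suc (f (m - 5)))"
        by blast
      have "inj_on g {5..4 + d}"
      proof (rule inj_onI)
        fix m m' assume m: "m \<in> {5..4 + d}" "m' \<in> {5..4 + d}" "g m = g m'"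
        have "g m = Suc (f (m - 5))" "g m' = Suc (f (m' - 5))"
          unfolding f(2) using m(1,2) by (simp_all only: restrict_apply if_True)
        then have "f (m - 5) = f (m' - 5)"
          using m(3) by simp
        moreover have "inj_on f {..<d}"
          using f(1) by (simp add: injections_def)
        moreover have "m - 5 < d" "m' - 5 < d"
          using m(1,2) by auto
        ultimately have "m - 5 = m' - 5"
          by (auto dest: inj_onD)
        then show "m = m'"
          using m by auto
      qed
      moreover have "Suc (f (m - 5)) \<in> {1..n}" if "m \<in> {5..4 + d}" for m
      proof -
        have "f (m - 5) < n"
          using f(1) that by (auto simp: injections_def PiE_iff)
        then show ?thesis
          by auto
      qed
      ultimately show "g \<in> ?A"
        using f(2) by (auto simp: injections_def)
    qed
  qed
  finally show ?thesis .
qed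

lemma sum_shift_5:
  fixes d :: nat
  shows "(\<Sum>k\<in>{5..4 + d}. f k) = (\<Sum>k<d. f (5 + k) :: real)"
proof -
  have "{5..4 + d} = {0 + 5..<d + 5}"
    by auto
  then have "(\<Sum>k\<in>{5..4 + d}. f k) = (\<Sum>k\<in>{0..<d}. f (k + 5))"
    by (simp only: sum.shift_bounds_nat_ivl)
  then show ?thesis
    by (simp add: lessThan_atLeast0 add.commute)
qed

text \<open>Every coordinate of the reference point is that coordinate of some sample point, so
  comparing with it amounts to comparing ranks. For this reason a grid with \<open>n ^ d\<close>
  cells is enough.\<close>

lemma rest_count_rank:
  fixes z :: tuple
  assumes g: "g \<in> injections {5..4 + d} {1..n}" and d: "d = r + s"
  defines "u \<equiv> \<lambda>l. z (g (4 + l)) l" and "f \<equiv> \<lambda>k\<in>{..<d}. g (5 + k) - 1"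
  shows "rest_count n d g (below_x r z u) = rest_rank n d (rank n z) (\<lambda>l. l < r) f"
    "rest_count n d g (below_y r s z u) = rest_rank n d (rank n z) (\<lambda>l. r \<le> l) f"
    "rest_count n d g (\<lambda>p. below_x r z u p \<and> below_y r s z u p) = rest_rank n d (rank n z) (\<lambda>l. True) f"
proof -
  have gf: "g (5 + k) = Suc (f k)" "f k < n" if "k < d" for k
  proof -
    have "1 \<le> g (5 + k)" "g (5 + k) \<le> n"
      using g that by (auto simp: injections_def PiE_iff)
    then show "g (5 + k) = Suc (f k)" "f k < n"
      using that by (auto simp: f_def)
  qed
  have u: "u (Suc k) = z (Suc (f k)) (Suc k)" if "k < d" for k
    using gf[OF that] by (simp add: u_def)
  have bx: "below_x r z u (Suc i) \<longleftrightarrow> (\<forall>l<d. l < r \<longrightarrow> rank n z i l \<le> rank n z (f l) l)" if "i < n" for i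
  proof -
    have "below_x r z u (Suc i) \<longleftrightarrow> (\<forall>l<r. z (Suc i) (Suc l) \<le> u (Suc l))"
      by (simp only: below_x_def ball_Suc_atLeastAtMost)
    also have "\<dots> \<longleftrightarrow> (\<forall>l<r. rank n z i l \<le> rank n z (f l) l)"
      using u gf(2) that by (simp add: d rank_le_iff)
    finally show ?thesis
      by (auto simp: d)
  qed
  have "below_y r s z u (Suc i) \<longleftrightarrow> (\<forall>l<s. rank n z i (r + l) \<le> rank n z (f (r + l)) (r + l))" if "i < n" for i
  proof -
    have "below_y r s z u (Suc i) \<longleftrightarrow> (\<forall>l<s. z (Suc i) (Suc (r + l)) \<le> u (Suc (r + l)))"
      by (simp only: below_y_def ball_Suc_atLeastAtMost add_Suc_right)
    also have "\<dots> \<longleftrightarrow> (\<forall>l<s. rank n z i (r + l) \<le> rank n z (f (r + l)) (r + l))"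
      using u gf(2) that by (simp add: d rank_le_iff)
    finally show ?thesis .
  qed
  moreover have "(\<forall>l<s. P (r + l)) \<longleftrightarrow> (\<forall>l<d. r \<le> l \<longrightarrow> P l)" for P
    unfolding d by (metis add_less_cancel_left le_Suc_ex le_add1)
  ultimately have by': "below_y r s z u (Suc i) \<longleftrightarrow> (\<forall>l<d. r \<le> l \<longrightarrow> rank n z i l \<le> rank n z (f l) l)" if "i < n" for i
    using that by simp
  have bxy: "below_x r z u (Suc i) \<and> below_y r s z u (Suc i) \<longleftrightarrow> (\<forall>l<d. True \<longrightarrow> rank n z i l \<le> rank n z (f l) l)"
    if "i < n" for i
    unfolding bx[OF that] by'[OF that] by (meson not_le)
  have main: "rest_count n d g P = rest_rank n d (rank n z) sel f"
    if "\<And>i. i < n \<Longrightarrow> P (Suc i) \<longleftrightarrow> (\<forall>l<d. sel l \<longrightarrow> rank n z i l \<le> rank n z (f l) l)" for P sel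
    unfolding rest_count_def rest_rank_def sum_Suc_atLeastAtMost sum_shift_5
    using that gf by (intro arg_cong2[where f = "(-)"] sum.cong refl) simp_all
  show "rest_count n d g (below_x r z u) = rest_rank n d (rank n z) (\<lambda>l. l < r) f"
    "rest_count n d g (below_y r s z u) = rest_rank n d (rank n z) (\<lambda>l. r \<le> l) f"
    "rest_count n d g (\<lambda>p. below_x r z u p \<and> below_y r s z u p) = rest_rank n d (rank n z) (\<lambda>l. True) f"
    by (rule main, erule bx by' bxy)+
qed

lemma rest_rank_restrict: "rest_rank n d rk sel (restrict f {..<d}) = rest_rank n d rk sel f"
  unfolding rest_rank_def by (intro arg_cong2[where f = "(-)"] sum.cong refl) auto

theorem U_R_digits:
  fixes z :: tuple and r s n :: nat
  defines "d \<equiv> r + s"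
  defines "c \<equiv> \<lambda>sel x. rest_rank n d (rank n z) sel (digit n x)"
  shows "U_R r s n z = 1 / falling n (4 + d) * (1 / 4 * (\<Sum>x<n ^ d. of_bool (inj_on (digit n x) {..<d}) *
    quad_poly (real n - real d) (c (\<lambda>l. l < r) x) (c (\<lambda>l. r \<le> l) x) (c (\<lambda>l. True) x)))"
proof -
  let ?G = "\<lambda>f. quad_poly (real n - real d) (rest_rank n d (rank n z) (\<lambda>l. l < r) f)
      (rest_rank n d (rank n z) (\<lambda>l. r \<le> l) f) (rest_rank n d (rank n z) (\<lambda>l. True) f)"
  have "(\<Sum>x<n ^ d. of_bool (inj_on (digit n x) {..<d}) *
    quad_poly (real n - real d) (c (\<lambda>l. l < r) x) (c (\<lambda>l. r \<le> l) x) (c (\<lambda>l. True) x))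
    = (\<Sum>x<n ^ d. of_bool (inj_on (digit n x) {..<d}) * ?G (restrict (digit n x) {..<d}))"
    by (simp only: c_def rest_rank_restrict)
  also have "\<dots> = (\<Sum>g\<in>injections {5..4 + d} {1..n}. ?G (\<lambda>k\<in>{..<d}. g (5 + k) - 1))"
    by (rule sum_injections_digits)
  also have "\<dots> = (\<Sum>g\<in>injections {5..4 + d} {1..n}. quad_poly (real n - real d)
      (rest_count n d g (below_x r z (\<lambda>l. z (g (4 + l)) l)))
      (rest_count n d g (below_y r s z (\<lambda>l. z (g (4 + l)) l)))
      (rest_count n d g (\<lambda>p. below_x r z (\<lambda>l. z (g (4 + l)) l) p \<and> below_y r s z (\<lambda>l. z (g (4 + l)) l) p)))"
    by (intro sum.cong refl) (simp only: rest_count_rank[of _ d n r s z, OF _ d_def[THEN meta_eq_to_obj_eq]])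
  finally show ?thesis
    unfolding U_R_formula d_def by simp
qed

text \<open>When no dimension has been accumulated, \<open>mixed\<close> is equality of all digits.
  The histogram of the rank vectors is therefore the correct starting point of the prefix
  sums.\<close>

lemma sum_encode: "(\<Sum>i<n. of_bool (encode n d (f i) = a)) = (\<Sum>i<n. of_bool (mixed n d 0 (f i) a) :: real)"
  if "a < n ^ d" "\<And>i k. i < n \<Longrightarrow> k < d \<Longrightarrow> f i k < n"
proof (intro sum.cong refl)
  fix i assume "i \<in> {..<n}"
  then have f: "f i k < n" if "k < d" for k
    using that \<open>\<And>i k. i < n \<Longrightarrow> k < d \<Longrightarrow> f i k < n\<close> by simp
  have "encode n d (digit n a) = a"
    using that(1) by (simp add: encode_digit)
  moreover have "digit n a k < n" if "k < d" for k
    using f[OF that] by (intro digit_less) simp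
  ultimately have "encode n d (f i) = a \<longleftrightarrow> mixed n d 0 (f i) a"
    using encode_inj[of d "f i" n "digit n a"] f by (auto simp: mixed_def)
  then show "of_bool (encode n d (f i) = a) = (of_bool (mixed n d 0 (f i) a) :: real)"
    by simp
qed

text \<open>Points with equal rank vectors share a cell, so the targets are not injective as in
  \<open>run_fill\<close>, and the cells have to accumulate.\<close>

lemma run_scatter:
  fixes e :: iexp
  assumes S: "imem S 0 0 = n" and n: "n < B"
    and step: "\<And>i S'. i < n \<Longrightarrow> same {3} {2} S S' \<Longrightarrow> imem S' 3 0 = i \<Longrightarrow> isafe B S' e \<and> ival S' e = g i"
    and B: "1 \<le> B" and zero: "\<And>a. rmem S 2 a = 0"
  shows "run B (For 3 0 (RAssign 2 e (RAdd (RArr 2 e) (ROfNat (IConst 1))))) S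
    (n * (pcost (RAssign 2 e (RAdd (RArr 2 e) (ROfNat (IConst 1)))) + 12) + 9)
    (\<lambda>S'. same {3} {2} S S' \<and> (\<forall>a. rmem S' 2 a = (\<Sum>i<n. of_bool (g i = a))))"
proof (rule run_For[where P = "\<lambda>m S'. same {3} {2} S S' \<and> (\<forall>a. rmem S' 2 a = (\<Sum>i<m. of_bool (g i = a)))"])
  fix i S' assume i: "i < n" and P: "same {3} {2} S S' \<and> (\<forall>a. rmem S' 2 a = (\<Sum>i<i. of_bool (g i = a)))" and ci: "imem S' 3 0 = i"
  have ev: "isafe B S' e" "ival S' e = g i"
    using step[OF i _ ci] P by auto
  show "run B (RAssign 2 e (RAdd (RArr 2 e) (ROfNat (IConst 1)))) S' (pcost (RAssign 2 e (RAdd (RArr 2 e) (ROfNat (IConst 1)))))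
    (\<lambda>S''. (same {3} {2} S S'' \<and> (\<forall>a. rmem S'' 2 a = (\<Sum>i<Suc i. of_bool (g i = a)))) \<and> imem S'' 3 0 = i)"
    by (rule run_straight) (use ev P ci B in \<open>simp_all del: sum_of_bool_eq\<close>)
qed (use assms in \<open>auto simp: same_def\<close>)

theorem computable_U_R:
  assumes r: "r \<ge> 1" and s: "s \<ge> 1" and d: "d = r + s"
  shows "computable_in_time d (4 + d) (U_R r s) (\<lambda>n. real n ^ d)"
proof -
  let ?adr = "address_exp d (rank_exp d (Var 3))"
  let ?scat = "RAssign 2 ?adr (RAdd (RArr 2 ?adr) (ROfNat (IConst 1)))"
  let ?acc = "RMul (ROfNat (distinct_exp d)) (quad_exp (RSub (ROfNat (Var 0)) (ROfNat (IConst d))) (RVar 3) (RVar 4) (RVar 5))"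
  let ?body = "RSet 3 (rest_exp d (\<lambda>l. l < r)) ;; RSet 4 (rest_exp d (\<lambda>l. r \<le> l)) ;; RSet 5 (rest_exp d (\<lambda>l. True)) ;;
       RSet 1 (RAdd (RVar 1) ?acc)"
  let ?last = "RSet 1 (RDiv (RVar 1) (RMul (ROfNat (IConst 4)) (falling_exp (Var 0) (4 + d))))"
  let ?pow = "ISet 6 (pow_exp d)"
  define K where "K = d * 100 + 100 + pcost ?pow + (pcost ?scat + 12 + 9) + (d * 200 + d * 100 + 100) + (pcost ?body + 12 + 9) + pcost ?last"
  show ?thesis
  proof (rule computable_in_timeI)
    fix n :: nat and z assume n4: "4 + d \<le> n"
    define B where "B = n ^ (2 * d + 10)"
    define S where "S = input_store d n z"
    define M where "M = n ^ d"
    have n: "2 \<le> n" "4 + d \<le> n" "n > 0" and d2: "2 \<le> d" "d \<ge> 1" "d > 0"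
      using n4 r s d by simp_all
    have B: "n * d * n ^ d < B"
    proof -
      have "n * d * n ^ d \<le> n * n ^ d * n ^ d"
        using const_le_power[of n d] n by (intro mult_mono) auto
      also have "\<dots> = n ^ (2 * d + 1)"
        by (simp add: power_add mult_2)
      also have "\<dots> < B"
        unfolding B_def using n by (intro power_strict_increasing) auto
      finally show ?thesis .
    qed
    have "1 * n ^ d \<le> n * d * n ^ d" "n * d * 1 \<le> n * d * n ^ d"
      using n d2 by (intro mult_mono; simp)+
    then have Bs: "n ^ d < B" "n * d < B"
      using B by linarith+
    have "n * 1 \<le> n * d"
      using d2 by (intro mult_left_mono) auto
    then have nB: "n < B" "d < B" "4 + d \<le> B" "1 < B" "4 \<le> B" "1 \<le> B"
      using Bs(2) n by linarith+
    have S: "imem S 0 0 = n" "imem S 5 a = 0" "rmem S 2 a = 0" "rmem S 1 a = 0" for a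
      by (simp_all add: S_def input_store_def)
    define rk where "rk = rank n z"
    have rk_less: "rk i k < n" if "i < n" for i k
      unfolding rk_def using that by (rule rank_less)
    let ?I = "\<lambda>X Y S'. same X Y S S' \<and> (\<forall>i<n. \<forall>k<d. imem S' 5 (i * d + k) = rk i k)"
    let ?X = "{2, 3, 4, 5, 6, 7, 8, 9}"
    have 1: "run B (rank_prog d) S (n * n * (d * 100) + 100) (?I ?X {})"
    proof (rule run_mono[OF run_rank_prog[where n = n and z = z]])
      fix S' assume *: "same {2, 3, 4, 5} {} S S' \<and> (\<forall>i<n. \<forall>k<d. imem S' 5 (i * d + k) = rank n z i k)"
      have "same ?X {} S S'"
        by (rule same_mono[of "{2, 3, 4, 5}" "{}"]) (use * in auto)
      then show "?I ?X {} S'"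
        using * by (simp add: rk_def)
    qed (use S n d2 Bs in \<open>auto simp: S_def input_store_coord\<close>)
    have 2: "run B ?pow S1 (pcost ?pow) (\<lambda>S'. ?I ?X {} S' \<and> imem S' 6 0 = M)" if S1: "?I ?X {} S1" for S1
    proof (rule run_straight)
      have i0: "imem S1 0 0 = n"
        using S1 S by (auto simp: same_def)
      have "isafe B S1 (pow_exp d)"
        by (rule isafe_pow_exp[where n = n and d = d and rk = rk]) (use i0 n d2 B S1 rk_less in auto)
      then show "psafe B ?pow S1"
        by simp
      show "?I ?X {} (effect ?pow S1) \<and> imem (effect ?pow S1) 6 0 = M"
        using S1 i0 by (simp add: M_def)
    qed simp
    have 3: "run B (For 3 0 ?scat) S1 (n * (pcost ?scat + 12) + 9)
      (\<lambda>S'. ?I ?X {2} S' \<and> imem S' 6 0 = M \<and> (\<forall>a<n ^ d. rmem S' 2 a = (\<Sum>i<n. of_bool (mixed n d 0 (rk i) a))))"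
      if S1: "?I ?X {} S1 \<and> imem S1 6 0 = M" for S1
    proof (rule run_mono[OF run_scatter[where g = "\<lambda>i. encode n d (rk i)"]])
      show "imem S1 0 0 = n"
        using S1 S by (auto simp: same_def)
      show "rmem S1 2 a = 0" for a
        using S1 S by (auto simp: same_def)
      fix i S' assume i: "i < n" and sm: "same {3} {2} S1 S'" and ci: "imem S' 3 0 = i"
      have i0: "imem S' 0 0 = n"
        using S1 S sm by (auto simp: same_def)
      have i5: "\<And>i k. i < n \<Longrightarrow> k < d \<Longrightarrow> imem S' 5 (i * d + k) = rk i k"
        using S1 sm by (auto simp: same_def)
      note R = i0 n(1) d2(2) less_imp_le[OF B] i5 rk_less
      have v3: "isafe B S' (Var 3)" "ival S' (Var 3) = i"
        using ci by simp_all
      have re: "isafe B S' (rank_exp d (Var 3) l)" "ival S' (rank_exp d (Var 3) l) = rk i l" if "l < d" for l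
        using isafe_rank_exp[of S' n d B rk "Var 3" l, OF R] ival_rank_exp[of S' n d B rk "Var 3" l, OF R] v3 i that
        by auto
      have ad: "isafe B S' ?adr" "ival S' ?adr = encode n d (\<lambda>l. ival S' (rank_exp d (Var 3) l))"
        using address_exp_eval[of S' n d B rk "rank_exp d (Var 3)", OF R] re rk_less[OF i] by auto
      moreover have "encode n d (\<lambda>l. ival S' (rank_exp d (Var 3) l)) = encode n d (rk i)"
        unfolding encode_def using re by (intro sum.cong refl) simp
      ultimately show "isafe B S' ?adr \<and> ival S' ?adr = encode n d (rk i)"
        by simp
    next
      fix S' assume *: "same {3} {2} S1 S' \<and> (\<forall>a. rmem S' 2 a = (\<Sum>i<n. of_bool (encode n d (rk i) = a)))"
      have "same ?X {2} S S1"
        by (rule same_mono[of ?X "{}"]) (use S1 in auto)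
      then have "same ?X {2} S S'"
        by (rule same_trans[of _ _ _ _ "{3}" "{2}"]) (use * in auto)
      moreover have "imem S' 6 = imem S1 6" "imem S' 5 = imem S1 5"
        using * by (auto simp: same_def)
      moreover have "rmem S' 2 a = (\<Sum>i<n. of_bool (mixed n d 0 (rk i) a))" if "a < n ^ d" for a
        using * sum_encode[of a n d rk, OF that rk_less] by (simp del: sum_of_bool_eq)
      ultimately show "?I ?X {2} S' \<and> imem S' 6 0 = M \<and> (\<forall>a<n ^ d. rmem S' 2 a = (\<Sum>i<n. of_bool (mixed n d 0 (rk i) a)))"
        using S1 by (simp del: sum_of_bool_eq)
    qed (use nB in auto)
    let ?J = "\<lambda>S'. ?I ?X {2} S' \<and> imem S' 6 0 = M \<and> (\<forall>a<n ^ d. rmem S' 2 a = (\<Sum>i<n. of_bool (mixed n d d (rk i) a)))"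
    have 4: "run B (prefix_prog d) S1 (M * (d * 200) + d * 100 + 100) ?J"
      if S1: "?I ?X {2} S1 \<and> imem S1 6 0 = M \<and> (\<forall>a<n ^ d. rmem S1 2 a = (\<Sum>i<n. of_bool (mixed n d 0 (rk i) a)))" for S1
      unfolding M_def
    proof (rule run_mono[OF run_prefix_prog[where f = rk]])
      show "imem S1 0 0 = n"
        using S1 S by (auto simp: same_def)
      fix S' assume *: "same {3, 7, 8, 9} {2} S1 S' \<and> (\<forall>a<n ^ d. rmem S' 2 a = (\<Sum>i<n. of_bool (mixed n d d (rk i) a)))"
      have "same ?X {2} S S'"
        by (rule same_trans[of ?X "{2}" S S1 "{3, 7, 8, 9}" "{2}"]) (use * S1 in auto)
      moreover have "imem S' 6 = imem S1 6" "imem S' 5 = imem S1 5"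
        using * by (auto simp: same_def)
      ultimately show "?I ?X {2} S' \<and> imem S' 6 0 = n ^ d \<and> (\<forall>a<n ^ d. rmem S' 2 a = (\<Sum>i<n. of_bool (mixed n d d (rk i) a)))"
        using * S1 by (simp add: M_def del: sum_of_bool_eq)
    qed (use S1 n Bs nB M_def in \<open>simp_all del: sum_of_bool_eq\<close>)
    let ?c = "\<lambda>sel x. rest_rank n d rk sel (digit n x)"
    let ?F = "\<lambda>x. of_bool (inj_on (digit n x) {..<d}) *
      quad_poly (real n - real d) (?c (\<lambda>l. l < r) x) (?c (\<lambda>l. r \<le> l) x) (?c (\<lambda>l. True) x)"
    have 5: "run B (For 3 6 ?body) S1 (M * (pcost ?body + 12) + 9) (\<lambda>S'. imem S' 0 0 = n \<and> rmem S' 1 0 = (\<Sum>x<M. ?F x))"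
      if S1: "?J S1" for S1
    proof (rule run_For[where P = "\<lambda>m S'. same {3} {1, 3, 4, 5} S1 S' \<and> rmem S' 1 0 = (\<Sum>x<m. ?F x)"])
      show "M < B"
        using Bs by (simp add: M_def)
      show "same {3} {1, 3, 4, 5} S1 S1 \<and> rmem S1 1 0 = (\<Sum>x<0. ?F x)"
        using S1 S by (auto simp: same_def)
      show "imem S' 6 0 = M" if "same {3} {1, 3, 4, 5} S1 S' \<and> rmem S' 1 0 = (\<Sum>x<m. ?F x)" for m S'
        using that S1 by (auto simp: same_def)
      show "imem S' 0 0 = n \<and> rmem S' 1 0 = (\<Sum>x<M. ?F x)"
        if "same {3} {1, 3, 4, 5} S1 S' \<and> rmem S' 1 0 = (\<Sum>x<M. ?F x)" for S'
        using that S1 S by (auto simp: same_def)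
      fix x S' assume x: "x < M" and P: "same {3} {1, 3, 4, 5} S1 S' \<and> rmem S' 1 0 = (\<Sum>x<x. ?F x)" and cx: "imem S' 3 0 = x"
      have sm: "same {3} {1, 3, 4, 5} S1 S'"
        using P by blast
      have i0: "imem S' 0 0 = n"
        using S1 S sm by (auto simp: same_def)
      have i5: "\<And>i k. i < n \<Longrightarrow> k < d \<Longrightarrow> imem S' 5 (i * d + k) = rk i k"
        using S1 sm by (auto simp: same_def)
      have F: "rmem S' 2 a = (\<Sum>i<n. of_bool (mixed n d d (rk i) a))" if "a < n ^ d" for a
        using S1 sm that by (simp add: same_def del: sum_of_bool_eq)
      let ?S1 = "rupd 3 0 (?c (\<lambda>l. l < r) x) S'"
      let ?S2 = "rupd 4 0 (?c (\<lambda>l. r \<le> l) x) ?S1"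
      let ?S3 = "rupd 5 0 (?c (\<lambda>l. True) x) ?S2"
      have ev: "rsafe B Sx (rest_exp d sel)" "rval Sx (rest_exp d sel) = ?c sel x"
        if "imem Sx = imem S'" "rmem Sx 2 = rmem S' 2" for sel Sx
      proof -
        have R: "imem Sx 0 0 = n" "2 \<le> n" "1 \<le> d" "n * d * n ^ d \<le> B"
          "\<And>i k. i < n \<Longrightarrow> k < d \<Longrightarrow> imem Sx 5 (i * d + k) = rk i k" "\<And>i k. i < n \<Longrightarrow> k < d \<Longrightarrow> rk i k < n"
          "imem Sx 3 0 = x"
          using i0 n d2 B i5 rk_less cx by (simp_all add: that)
        have Fx: "rmem Sx 2 a = (\<Sum>i<n. of_bool (mixed n d d (rk i) a))" if "a < n ^ d" for a
          using F[OF that] \<open>rmem Sx 2 = rmem S' 2\<close> by simp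
        show "rsafe B Sx (rest_exp d sel)"
          by (rule rest_exp_eval(1)[where n = n and d = d and rk = rk and x = x]; fact R Fx)
        show "rval Sx (rest_exp d sel) = ?c sel x"
          by (rule rest_exp_eval(2)[where B = B and n = n and d = d and rk = rk and x = x]; fact R Fx)
      qed
      have R: "imem ?S3 0 0 = n" "2 \<le> n" "1 \<le> d" "n * d * n ^ d \<le> B"
          "\<And>i k. i < n \<Longrightarrow> k < d \<Longrightarrow> imem ?S3 5 (i * d + k) = rk i k" "\<And>i k. i < n \<Longrightarrow> k < d \<Longrightarrow> rk i k < n"
          "imem ?S3 3 0 = x"
        using i0 n d2 B i5 rk_less cx by simp_all
      have de: "isafe B ?S3 (distinct_exp d)" "ival ?S3 (distinct_exp d) = of_bool (inj_on (digit n x) {..<d})"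
        by (rule distinct_exp_eval(1)[where n = n and d = d and rk = rk and x = x]; fact R)
          (rule distinct_exp_eval(2)[where B = B and n = n and d = d and rk = rk and x = x]; fact R)
      show "run B ?body S' (pcost ?body)
        (\<lambda>S''. (same {3} {1, 3, 4, 5} S1 S'' \<and> rmem S'' 1 0 = (\<Sum>x<Suc x. ?F x)) \<and> imem S'' 3 0 = x)"
      proof (rule run_straight)
        have e1: "effect (RSet 3 (rest_exp d (\<lambda>l. l < r))) S' = ?S1"
          using ev[of S'] by simp
        have e2: "effect (RSet 4 (rest_exp d (\<lambda>l. r \<le> l))) ?S1 = ?S2"
          using ev[of ?S1] by simp
        have e3: "effect (RSet 5 (rest_exp d (\<lambda>l. True))) ?S2 = ?S3"
          using ev[of ?S2] by simp
        have ac: "rsafe B ?S3 ?acc" "rval ?S3 ?acc = ?F x"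
          using de nB i0 by simp_all
        show "psafe B ?body S'"
          using ev[of S'] ev[of ?S1] ev[of ?S2] ac(1)
          unfolding psafe.simps effect.simps(4) e1 e2 e3 by simp
        have "effect ?body S' = rupd 1 0 (rmem S' 1 0 + ?F x) ?S3"
          unfolding effect.simps(4) e1 e2 e3 using ac(2) by simp
        then show "(same {3} {1, 3, 4, 5} S1 (effect ?body S') \<and> rmem (effect ?body S') 1 0 = (\<Sum>x<Suc x. ?F x)) \<and> imem (effect ?body S') 3 0 = x"
          using P cx by (simp del: effect.simps)
      qed simp
    qed auto
    have 6: "run B ?last S1 (pcost ?last) (\<lambda>S'. output_of S' = U_R r s n z)"
      if S1: "imem S1 0 0 = n \<and> rmem S1 1 0 = (\<Sum>x<M. ?F x)" for S1
    proof (rule run_straight)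
      show "psafe B ?last S1"
        using nB by (simp add: rsafe_falling_exp del: falling_exp.simps)
      have "U_R r s n z = 1 / falling n (4 + d) * (1 / 4 * (\<Sum>x<M. ?F x))"
        unfolding U_R_digits d M_def rk_def ..
      then show "output_of (effect ?last S1) = U_R r s n z"
        using S1 by (simp add: output_of_def del: falling_exp.simps)
    qed simp
    have "run B (rank_prog d ;; ?pow ;; For 3 0 ?scat ;; prefix_prog d ;; For 3 6 ?body ;; ?last) S
      ((n * n * (d * 100) + 100) + pcost ?pow + (n * (pcost ?scat + 12) + 9) + (M * (d * 200) + d * 100 + 100)
        + (M * (pcost ?body + 12) + 9) + pcost ?last) (\<lambda>S'. output_of S' = U_R r s n z)"
      by (intro run_Seq[OF run_Seq[OF run_Seq[OF run_Seq[OF run_Seq[OF 1 2] 3] 4] 5] 6])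
    moreover have "(n * n * (d * 100) + 100) + pcost ?pow + (n * (pcost ?scat + 12) + 9) + (M * (d * 200) + d * 100 + 100)
        + (M * (pcost ?body + 12) + 9) + pcost ?last \<le> K * M"
    proof -
      \<comment> \<open>Because \<open>d \<ge> 2\<close>, the quadratic computation of the ranks
        fits into \<open>n ^ d\<close>.\<close>
      have "n ^ 2 \<le> M" "n ^ 1 \<le> M"
        unfolding M_def using n d2 by (intro power_increasing; simp)+
      then have M: "n * n \<le> M" "n \<le> M" "1 \<le> M"
        using n by (simp_all add: power2_eq_square)
      have "n * n * (d * 100) \<le> M * (d * 100)" "n * (pcost ?scat + 12) \<le> M * (pcost ?scat + 12)"
        "pcost ?pow * 1 \<le> pcost ?pow * M" "pcost ?last * 1 \<le> pcost ?last * M" "d * 100 * 1 \<le> d * 100 * M"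
        by (rule mult_le_mono1 mult_le_mono2, fact)+
      then have "(n * n * (d * 100) + 100) + pcost ?pow + (n * (pcost ?scat + 12) + 9) + (M * (d * 200) + d * 100 + 100)
          + (M * (pcost ?body + 12) + 9) + pcost ?last
        \<le> (M * (d * 100) + 100 * M) + pcost ?pow * M + (M * (pcost ?scat + 12) + 9 * M) + (M * (d * 200) + d * 100 * M + 100 * M)
          + (M * (pcost ?body + 12) + 9 * M) + pcost ?last * M"
        using M(3) by linarith
      also have "\<dots> = K * M"
        unfolding K_def by (simp only: distrib_right distrib_left mult_ac add_ac)
      finally show ?thesis .
    qed
    ultimately show "run (n ^ (2 * d + 10)) (prog_R r s) (input_store d n z) (K * n ^ d)
      (\<lambda>S'. output_of S' = U_R r s n z)"
      unfolding prog_R_def Let_def d[symmetric] B_def[symmetric] S_def[symmetric] M_def[symmetric]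
      by (rule run_mono)
  next
    show "(\<lambda>n. real (K * n ^ d)) \<in> O(\<lambda>n. real n ^ d)"
      by simp
  qed
qed

section \<open>The sign covariances\<close>

text \<open>The variant of \<open>run_fill\<close> for bodies with branches whose net effect is a
  single write.\<close>

lemma run_fill_prog:
  assumes "imem S m 0 = N" "N < B" "c \<noteq> m"
    and step: "\<And>i S'. i < N \<Longrightarrow> same {c} {a} S S' \<Longrightarrow> imem S' c 0 = i \<Longrightarrow>
      psafe B p S' \<and> effect p S' = rupd a i (F i) S'"
  shows "run B (For c m p) S (N * (pcost p + 12) + 9)
    (\<lambda>S'. same {c} {a} S S' \<and> (\<forall>i<N. rmem S' a i = F i))"
proof (rule run_For[where P = "\<lambda>k S'. same {c} {a} S S' \<and> (\<forall>i<k. rmem S' a i = F i)"])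
  fix i S' assume i: "i < N" and P: "same {c} {a} S S' \<and> (\<forall>i'<i. rmem S' a i' = F i')" and ci: "imem S' c 0 = i"
  have ev: "psafe B p S'" "effect p S' = rupd a i (F i) S'"
    using step[OF i _ ci] P by auto
  show "run B p S' (pcost p) (\<lambda>S''. (same {c} {a} S S'' \<and> (\<forall>i'<Suc i. rmem S'' a i' = F i')) \<and> imem S'' c 0 = i)"
    by (rule run_straight) (use ev P ci in \<open>auto simp: less_Suc_eq\<close>)
qed (use assms in \<open>auto simp: same_def\<close>)

text \<open>The programs in the list differ from each other, so they cannot be rounds of one loop.
  The accumulated value is therefore passed through the invariant.\<close>

lemma run_seqs:
  fixes val :: "'a \<Rightarrow> real"
  assumes "\<And>x acc S. x \<in> set xs \<Longrightarrow> Inv acc S \<Longrightarrow> run B (f x) S (T x) (Inv (acc + val x))" "Inv acc S"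
  shows "run B (seqs (map f xs)) S (sum_list (map T xs) + 1) (Inv (acc + sum_list (map val xs)))"
  using assms
proof (induction xs arbitrary: acc S)
  case Nil
  then show ?case
    by (auto intro!: run_straight)
next
  case (Cons x xs)
  have "run B (Seq (f x) (seqs (map f xs))) S (T x + (sum_list (map T xs) + 1)) (Inv (acc + val x + sum_list (map val xs)))"
  proof (rule run_Seq[OF Cons.prems(1)[of x]])
    fix S' assume "Inv (acc + val x) S'"
    then show "run B (seqs (map f xs)) S' (sum_list (map T xs) + 1) (Inv (acc + val x + sum_list (map val xs)))"
      by (rule Cons.IH[rotated]) (use Cons.prems(1) in simp)
  qed (use Cons.prems(2) in simp_all)
  then show ?case
    by (simp add: add.assoc)
qed

text \<open>\<open>lo\<close> and \<open>hi\<close> are separate tables so that one scheme covers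
  both covariances: a strict comparison of ranks is a weak one between different tables.\<close>

record problem =
  n_of :: nat
  lo :: "nat \<Rightarrow> nat \<Rightarrow> real"
  hi :: "nat \<Rightarrow> nat \<Rightarrow> real"

text \<open>
  The relations are encoded by tables \<open>lo\<close>, \<open>hi\<close> and a polarity: \<open>i\<close> and \<open>j\<close> are related iff
  the truth value of \<open>lo i \<le> hi j\<close>, taken over a block of coordinates, is the polarity.
\<close>

definition rel_block :: "bool \<Rightarrow> nat \<Rightarrow> nat \<Rightarrow> problem \<Rightarrow> nat \<Rightarrow> nat \<Rightarrow> bool" where
  "rel_block pol off q P i j \<longleftrightarrow> (\<forall>l<q. lo P i (off + l) \<le> hi P j (off + l)) = pol"

definition ready :: "bool \<Rightarrow> nat \<Rightarrow> nat \<Rightarrow> problem \<Rightarrow> store \<Rightarrow> bool" where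
  "ready pol r s P S \<longleftrightarrow> imem S 0 0 = n_of P \<and> imem S 10 0 = n_of P * n_of P \<and>
     (\<forall>i<n_of P. \<forall>l<r + s. rmem S 2 (i * (r + s) + l) = lo P i l \<and> rmem S 3 (i * (r + s) + l) = hi P i l) \<and>
     (\<forall>i<n_of P. \<forall>j<n_of P. rmem S 4 (i * n_of P + j) = of_bool (rel_block pol 0 r P i j) \<and>
        rmem S 5 (i * n_of P + j) = of_bool (rel_block pol r s P i j)) \<and>
     (\<forall>v. imem S aT v = 0) \<and> (\<forall>a. rmem S rT a = 0)"

lemma ready_same:
  "ready pol r s P S \<Longrightarrow> same X Y S S' \<Longrightarrow> X \<inter> {0, 10, aT} = {} \<Longrightarrow> Y \<inter> {2, 3, 4, 5, rT} = {} \<Longrightarrow> ready pol r s P S'"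
  by (auto simp: ready_def same_def)

text \<open>Cell \<open>it * (2 * d) + k\<close> of the key array belongs to item \<open>it\<close>
  and coordinate \<open>k\<close>. Items below \<open>n * n\<close> are the data pairs, the next
  \<open>n * n\<close> items the query pairs, and the pair of \<open>a\<close> and \<open>b\<close>
  has the number \<open>a * n + b\<close>.\<close>

definition key_item :: "nat \<Rightarrow> iexp" where
  "key_item D = IDiv (Var 11) (IConst D)"

definition key_coord :: "nat \<Rightarrow> iexp" where
  "key_coord D = IMod (Var 11) (IConst D)"

definition key_fst :: "nat \<Rightarrow> iexp" where
  "key_fst D = IDiv (IMod (key_item D) (Var 10)) (Var 0)"

definition key_snd :: "nat \<Rightarrow> iexp" where
  "key_snd D = IMod (IMod (key_item D) (Var 10)) (Var 0)"

definition key_low :: "nat \<Rightarrow> iexp" where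
  "key_low d = IMod (key_coord (2 * d)) (IConst d)"

definition cell_exp :: "nat \<Rightarrow> nat \<Rightarrow> iexp \<Rightarrow> rexp" where
  "cell_exp d a i = RArr a (IAdd (IMul i (IConst d)) (key_low d))"

text \<open>
  The terms are indexed by booleans \<open>u\<close>, \<open>v\<close> (swap the columns 1 and 4, or 2 and 3, in the second
  factor) and \<open>t1\<close>, \<open>t2\<close>, \<open>t3\<close>, \<open>t4\<close> (the expansion of the four relations between \<open>{2, 3}\<close> and
  \<open>{1, 4}\<close>). The data points are the pairs of columns (2, 3), the query points the pairs (1, 4).
  Zero keys make an unwanted comparison trivial.
\<close>

type_synonym term_index = "bool \<times> bool \<times> bool \<times> bool \<times> bool \<times> bool"

text \<open>Four blocks of coordinates carry the four relations: \<open>t1\<close> and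
  \<open>t3\<close> those leading from the data pair to the query pair, \<open>t2\<close> and
  \<open>t4\<close> those leading back. Dominance compares data with query in one direction only, so
  for the latter both tables are negated and change sides.\<close>

definition key_value :: "nat \<Rightarrow> nat \<Rightarrow> problem \<Rightarrow> term_index \<Rightarrow> nat \<Rightarrow> nat \<Rightarrow> real" where
  "key_value r d P = (\<lambda>(u, v, t1, t2, t3, t4) it k.
     let n = n_of P; p = it mod (n * n); a = p div n; b = p mod n; l = k mod d in
     if it < n * n
     then (if k < d
       then (if l < r then of_bool t1 * lo P a l else of_bool t3 * lo P (if v then b else a) l)
       else (if l < r then of_bool t2 * (- hi P b l) else of_bool t4 * (- hi P (if v then a else b) l)))
     else (if k < d
       then (if l < r then of_bool t1 * hi P b l else of_bool t3 * hi P (if u then a else b) l)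
       else (if l < r then of_bool t2 * (- lo P a l) else of_bool t4 * (- lo P (if u then b else a) l))))"

text \<open>The term index is known when the program is built; at run time only the position within
  the layout has to be tested.\<close>

definition key_prog :: "nat \<Rightarrow> nat \<Rightarrow> term_index \<Rightarrow> prog" where
  "key_prog r d = (\<lambda>(u, v, t1, t2, t3, t4).
     let a = key_fst (2 * d); b = key_snd (2 * d); zero = ROfNat (IConst 0);
       set = (\<lambda>t x. RAssign rKey (Var 11) (if t then x else zero)); neg = (\<lambda>x. RSub zero x)
     in If (ILess (key_item (2 * d)) (Var 10))
       (If (ILess (key_coord (2 * d)) (IConst d))
         (If (ILess (key_low d) (IConst r)) (set t1 (cell_exp d 2 a)) (set t3 (cell_exp d 2 (if v then b else a))))
         (If (ILess (key_low d) (IConst r)) (set t2 (neg (cell_exp d 3 b))) (set t4 (neg (cell_exp d 3 (if v then a else b))))))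
       (If (ILess (key_coord (2 * d)) (IConst d))
         (If (ILess (key_low d) (IConst r)) (set t1 (cell_exp d 3 b)) (set t3 (cell_exp d 3 (if u then a else b))))
         (If (ILess (key_low d) (IConst r)) (set t2 (neg (cell_exp d 2 a))) (set t4 (neg (cell_exp d 2 (if u then b else a)))))))"

lemma key_prog_eval:
  fixes S :: store
  assumes rd: "ready pol r s P S" and n: "n_of P = n" "n > 0" and d: "d = r + s" "r \<ge> 1" "s \<ge> 1"
    and B: "20 * (n * n * d) < B" and i: "imem S 11 0 = i"
  shows "psafe B (key_prog r d x) S"
    "effect (key_prog r d x) S = rupd rKey i (key_value r d P x (i div (2 * d)) (i mod (2 * d))) S"
proof -
  have "1 * d \<le> n * n * d" "n * d * 1 \<le> n * d * n"
    using n by (intro mult_mono; simp)+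
  moreover have "n * d * n = n * n * d"
    by simp
  ultimately have le: "2 * d \<le> B" "d \<le> B" "r \<le> B" "n * d \<le> B"
    using B d by linarith+
  have S: "imem S 0 0 = n" "imem S 10 0 = n * n"
    using rd n by (auto simp: ready_def)
  let ?p = "i div (2 * d) mod (n * n)"
  let ?a = "?p div n" and ?b = "?p mod n" and ?l = "i mod (2 * d) mod d"
  have ab: "?a < n" "?b < n" "?l < d"
    using n d by (simp_all add: less_mult_imp_div_less)
  have ev: "isafe B S (key_item (2 * d))" "ival S (key_item (2 * d)) = i div (2 * d)"
    "isafe B S (key_coord (2 * d))" "ival S (key_coord (2 * d)) = i mod (2 * d)"
    "isafe B S (key_fst (2 * d))" "ival S (key_fst (2 * d)) = ?a"
    "isafe B S (key_snd (2 * d))" "ival S (key_snd (2 * d)) = ?b"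
    "isafe B S (key_low d)" "ival S (key_low d) = ?l"
    using le S i by (simp_all add: key_item_def key_coord_def key_fst_def key_snd_def key_low_def)
  have cell: "rsafe B S (cell_exp d a e)"
    "rval S (cell_exp d 2 e) = lo P (ival S e) ?l" "rval S (cell_exp d 3 e) = hi P (ival S e) ?l"
    if "isafe B S e" "ival S e < n" for e a
  proof -
    have "Suc (ival S e) * d \<le> n * d"
      using that by (intro mult_right_mono) auto
    then have "ival S e * d + ?l \<le> B" "ival S e * d \<le> B"
      using ab(3) le unfolding mult_Suc by linarith+
    then show "rsafe B S (cell_exp d a e)"
      using that ev le by (simp add: cell_exp_def)
    show "rval S (cell_exp d 2 e) = lo P (ival S e) ?l" "rval S (cell_exp d 3 e) = hi P (ival S e) ?l"
      using rd that ab(3) d n ev(10) by (simp_all add: cell_exp_def ready_def)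
  qed
  have cf: "rsafe B S (cell_exp d a (key_fst (2 * d)))" "rsafe B S (cell_exp d a (key_snd (2 * d)))"
    "rval S (cell_exp d 2 (key_fst (2 * d))) = lo P ?a ?l" "rval S (cell_exp d 2 (key_snd (2 * d))) = lo P ?b ?l"
    "rval S (cell_exp d 3 (key_fst (2 * d))) = hi P ?a ?l" "rval S (cell_exp d 3 (key_snd (2 * d))) = hi P ?b ?l" for a
    using cell[of "key_fst (2 * d)"] cell[of "key_snd (2 * d)"] ev ab by simp_all
  obtain u v t1 t2 t3 t4 where x: "x = (u, v, t1, t2, t3, t4)"
    by (cases x) auto
  show "psafe B (key_prog r d x) S"
    unfolding x key_prog_def Let_def using ev cf le by simp
  show "effect (key_prog r d x) S = rupd rKey i (key_value r d P x (i div (2 * d)) (i mod (2 * d))) S"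
    unfolding x key_prog_def key_value_def Let_def using ev cf S i n by simp
qed

definition swap_pair :: "bool \<Rightarrow> nat \<Rightarrow> nat \<Rightarrow> nat" where
  "swap_pair w n p = (if w then p mod n * n + p div n else p)"

definition swap_exp :: "bool \<Rightarrow> iexp \<Rightarrow> iexp" where
  "swap_exp w e = (if w then IAdd (IMul (IMod e (Var 0)) (Var 0)) (IDiv e (Var 0)) else e)"

text \<open>Of the four relations in \<open>rel4\<close>, the one between columns 2 and 3 and the
  one between columns 1 and 4 concern a single pair. They stay outside the dominance count and act
  as the weight of a data point or as a factor of a query. The flag \<open>w\<close> reverses the
  pair in the second block only.\<close>

definition pair_rel :: "bool \<Rightarrow> nat \<Rightarrow> nat \<Rightarrow> problem \<Rightarrow> bool \<Rightarrow> nat \<Rightarrow> bool" where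
  "pair_rel pol r s P w p \<longleftrightarrow> (let n = n_of P; p' = swap_pair w n p in
     rel_block pol 0 r P (p div n) (p mod n) \<and> rel_block pol r s P (p' div n) (p' mod n))"

definition pair_exp :: "bool \<Rightarrow> iexp \<Rightarrow> rexp" where
  "pair_exp w e = RMul (RArr 4 e) (RArr 5 (swap_exp w e))"

lemma swap_pair_less: "n > 0 \<Longrightarrow> p < n * n \<Longrightarrow> swap_pair w n p < n * n"
proof -
  assume *: "n > 0" "p < n * n"
  have "Suc (p mod n) * n \<le> n * n"
    using * by (intro mult_right_mono) (auto simp: Suc_le_eq)
  moreover have "p div n < n"
    using * by (simp add: less_mult_imp_div_less)
  ultimately show ?thesis
    using * by (auto simp: swap_pair_def)
qed

lemma pair_exp_eval:
  assumes rd: "ready pol r s P S" and n: "n_of P = n" "n > 0" and B: "n * n \<le> B"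
    and e: "isafe B S e" "ival S e = p" "p < n * n"
  shows "rsafe B S (pair_exp w e)" "rval S (pair_exp w e) = of_bool (pair_rel pol r s P w p)"
proof -
  have S: "imem S 0 0 = n"
    using rd n by (auto simp: ready_def)
  have table: "rmem S 4 q = of_bool (rel_block pol 0 r P (q div n) (q mod n))"
    "rmem S 5 q = of_bool (rel_block pol r s P (q div n) (q mod n))" if "q < n * n" for q
  proof -
    have "q div n < n" "q mod n < n" "q div n * n + q mod n = q"
      using that n by (auto simp: less_mult_imp_div_less)
    then show "rmem S 4 q = of_bool (rel_block pol 0 r P (q div n) (q mod n))"
      "rmem S 5 q = of_bool (rel_block pol r s P (q div n) (q mod n))"
      using rd n unfolding ready_def by metis+
  qed
  have sw: "swap_pair w n p < n * n" "ival S (swap_exp w e) = swap_pair w n p"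
    using swap_pair_less[OF n(2) e(3)] e S by (auto simp: swap_exp_def swap_pair_def)
  moreover have "p mod n * n \<le> n * n"
    using n by (intro mult_right_mono) auto
  ultimately show "rsafe B S (pair_exp w e)"
    using e S B by (auto simp: pair_exp_def swap_exp_def swap_pair_def)
  show "rval S (pair_exp w e) = of_bool (pair_rel pol r s P w p)"
    using sw table[OF e(3)] table[OF sw(1)] e n by (auto simp: pair_exp_def pair_rel_def Let_def)
qed

text \<open>Data and queries form one point set; weight 0 prevents queries from being
  counted.\<close>

definition weight_prog :: "bool \<Rightarrow> prog" where
  "weight_prog v = If (ILess (Var 11) (Var 10)) (RAssign rWt (Var 11) (pair_exp v (Var 11)))
     (RAssign rWt (Var 11) (ROfNat (IConst 0)))"

text \<open>The signs of the swaps times the coefficients from expanding the relations. For positive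
  polarity a relation is a comparison, so the coefficient vanishes unless all four \<open>t\<close>
  are true; for negative polarity it is 1 minus a comparison, hence 1 or -1 for each
  \<open>t\<close>. The 4 comes from \<open>sum_alt4_alt4\<close>.\<close>

definition coeff :: "bool \<Rightarrow> term_index \<Rightarrow> int" where
  "coeff pol = (\<lambda>(u, v, t1, t2, t3, t4).
     4 * (if u = v then 1 else -1) * (\<Prod>t\<leftarrow>[t1, t2, t3, t4]. if t then (if pol then 1 else -1) else of_bool (\<not> pol)))"

text \<open>Constants of the language are natural numbers, so a signed constant is written as a
  difference.\<close>

definition coeff_exp :: "int \<Rightarrow> rexp" where
  "coeff_exp k = RSub (ROfNat (IConst (nat k))) (ROfNat (IConst (nat (- k))))"

definition term_prog :: "bool \<Rightarrow> nat \<Rightarrow> nat \<Rightarrow> term_index \<Rightarrow> prog" where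
  "term_prog pol r s x = (let d = r + s; u = fst x; v = fst (snd x) in
     ISet vN (IMul (IConst 2) (Var 10)) ;; ISet 13 (IMul (Var vN) (IConst (2 * d))) ;;
     For 11 13 (key_prog r d x) ;;
     For 11 vN (weight_prog v) ;;
     dominance (2 * d - 1) ;;
     For 11 10 (RAssign 1 (IConst 0) (RAdd (RArr 1 (IConst 0))
       (RMul (RMul (coeff_exp (coeff pol x)) (pair_exp u (Var 11))) (RArr rC (IAdd (Var 10) (Var 11)))))))"

definition term_value :: "bool \<Rightarrow> nat \<Rightarrow> nat \<Rightarrow> problem \<Rightarrow> term_index \<Rightarrow> real" where
  "term_value pol r s P x = (let n = n_of P; d = r + s; u = fst x; v = fst (snd x) in
     \<Sum>q<n * n. of_int (coeff pol x) * of_bool (pair_rel pol r s P u q) *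
       (\<Sum>p<n * n. of_bool (pair_rel pol r s P v p) *
         of_bool (\<forall>k<2 * d. key_value r d P x p k \<le> key_value r d P x (n * n + q) k)))"

lemma abs_coeff_le: "\<bar>coeff pol x\<bar> \<le> 4"
  by (cases x) (auto simp: coeff_def abs_mult)

lemma coeff_exp_eval:
  "B \<ge> 4 \<Longrightarrow> rsafe B S (coeff_exp (coeff pol x))" "rval S (coeff_exp k) = of_int k"
  using abs_coeff_le[of pol x] by (auto simp: coeff_exp_def)

lemma run_term_prog:
  assumes d: "d = r + s" "r \<ge> 1" "s \<ge> 1"
  obtains K where "\<And>B n P acc (S :: store). \<lbrakk>n_of P = n; n > 0; 20 * (n * n * d) < B; (8 * (n * n)) ^ (2 * d - 1) < B;
      ready pol r s P S \<and> rmem S 1 0 = acc\<rbrakk> \<Longrightarrow>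
    run B (term_prog pol r s x) S (K * (n * n * levels (2 * (n * n)) ^ (2 * d - 1)))
      (\<lambda>S'. ready pol r s P S' \<and> rmem S' 1 0 = acc + term_value pol r s P x)"
proof -
  define e where "e = 2 * d - 1"
  have e: "Suc e = 2 * d" "max 1 e = e" "e \<ge> 1"
    using d by (auto simp: e_def)
  obtain K where K: "\<And>B N (S :: store). \<lbrakk>imem S vN 0 = N; N > 0; 4 * N * Suc e + Suc e < B; (4 * N) ^ e < B;
      \<And>v. imem S aT v = 0; \<And>a. rmem S rT a = 0\<rbrakk> \<Longrightarrow>
    run B (dominance e) S (K * (N * levels N ^ max 1 e))
    (\<lambda>S'. same {21..38} {rC, rT, rw} S S' \<and> (\<forall>v. imem S' aT v = 0) \<and> (\<forall>a. rmem S' rT a = 0) \<and>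
      (\<forall>i<N. rmem S' rC i = (\<Sum>j<N. rmem S rWt j *
        of_bool (\<forall>k<Suc e. rmem S rKey (j * Suc e + k) \<le> rmem S rKey (i * Suc e + k)))))"
    using run_dominance[of e] by blast
  let ?u = "fst x" and ?v = "fst (snd x)"
  let ?init = "ISet vN (IMul (IConst 2) (Var 10)) ;; ISet 13 (IMul (Var vN) (IConst (2 * d)))"
  let ?term = "RMul (RMul (coeff_exp (coeff pol x)) (pair_exp ?u (Var 11))) (RArr rC (IAdd (Var 10) (Var 11)))"
  let ?acc = "RAssign 1 (IConst 0) (RAdd (RArr 1 (IConst 0)) ?term)"
  define K' where "K' = 20 + (4 * d * (pcost (key_prog r d x) + 12) + 9) + (2 * (pcost (weight_prog ?v) + 12) + 9) + K * 2 + (pcost ?acc + 12 + 9)"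
  show ?thesis
  proof (rule that[of K'])
    fix B n P acc and S :: store
    assume n: "n_of P = n" "n > 0" and B: "20 * (n * n * d) < B" "(8 * (n * n)) ^ (2 * d - 1) < B"
      and S: "ready pol r s P S \<and> rmem S 1 0 = acc"
    define N where "N = n * n"
    have N: "N > 0"
      using n by (simp add: N_def)
    have "N * 1 \<le> N * d" "1 * d \<le> N * d"
      using N d by (intro mult_mono; simp)+
    then have le: "20 * (N * d) < B" "N \<le> N * d" "d \<le> N * d" "N * d \<ge> 1"
      using B N by (simp_all add: N_def)
    moreover have "2 * N * (2 * d) = 4 * (N * d)" "4 * (2 * N) * (2 * d) = 16 * (N * d)"
      by simp_all
    ultimately have NB: "N < B" "2 * N < B" "2 * N * (2 * d) < B" "2 * d \<le> B" "4 * (2 * N) * (2 * d) + 2 * d < B" "4 \<le> B" "2 \<le> B"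
      by linarith+
    let ?I = "\<lambda>S'. same {11, 13, vN} {rKey, rWt} S S' \<and> imem S' vN 0 = 2 * N"
    have rdI: "ready pol r s P S'" "rmem S' 1 0 = acc" "imem S' 0 0 = n" "imem S' 10 0 = N"
      if "same {11, 13, vN} {rKey, rWt} S S'" for S'
    proof -
      show "ready pol r s P S'"
        by (rule ready_same[OF _ that]) (use S in auto)
      then show "imem S' 0 0 = n" "imem S' 10 0 = N"
        using n by (simp_all add: ready_def N_def)
      show "rmem S' 1 0 = acc"
        using S that by (auto simp: same_def)
    qed
    have S0: "imem S 10 0 = N"
      using rdI[of S] by simp
    have 1: "run B ?init S 20 (\<lambda>S'. ?I S' \<and> imem S' 13 0 = 2 * N * (2 * d))"
      by (rule run_straight) (use S0 NB in auto)
    let ?key = "key_value r d P x"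
    let ?keys = "\<lambda>S'. \<forall>i<2 * N * (2 * d). rmem S' rKey i = ?key (i div (2 * d)) (i mod (2 * d))"
    have 2: "run B (For 11 13 (key_prog r d x)) S1 (2 * N * (2 * d) * (pcost (key_prog r d x) + 12) + 9) (\<lambda>S'. ?I S' \<and> ?keys S')"
      if S1: "?I S1 \<and> imem S1 13 0 = 2 * N * (2 * d)" for S1
    proof (rule run_mono[OF run_fill_prog[where N = "2 * N * (2 * d)" and F = "\<lambda>i. ?key (i div (2 * d)) (i mod (2 * d))" and a = rKey]])
      fix i S' assume i: "same {11} {rKey} S1 S'" "imem S' 11 0 = i"
      have "same {11, 13, vN} {rKey, rWt} S S'"
        by (rule same_trans[of _ _ S S1 "{11}" "{rKey}"]) (use S1 i in auto)
      then show "psafe B (key_prog r d x) S' \<and> effect (key_prog r d x) S' = rupd rKey i (?key (i div (2 * d)) (i mod (2 * d))) S'"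
        using key_prog_eval[OF rdI(1) n d B(1) i(2)] by blast
    next
      fix S' assume *: "same {11} {rKey} S1 S' \<and> ?keys S'"
      have "same {11, 13, vN} {rKey, rWt} S S'"
        by (rule same_trans[of _ _ S S1 "{11}" "{rKey}"]) (use S1 * in auto)
      moreover have "imem S' vN = imem S1 vN"
        using * by (auto simp: same_def)
      ultimately show "?I S' \<and> ?keys S'"
        using * S1 by simp
    qed (use S1 NB in simp_all)
    let ?W = "\<lambda>it. if it < N then of_bool (pair_rel pol r s P ?v it) else 0 :: real"
    have 3: "run B (For 11 vN (weight_prog ?v)) S1 (2 * N * (pcost (weight_prog ?v) + 12) + 9)
      (\<lambda>S'. ?I S' \<and> ?keys S' \<and> (\<forall>i<2 * N. rmem S' rWt i = ?W i))"
      if S1: "?I S1 \<and> ?keys S1" for S1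
    proof (rule run_mono[OF run_fill_prog[where N = "2 * N" and F = ?W and a = rWt]])
      fix i S' assume i: "i < 2 * N" "same {11} {rWt} S1 S'" "imem S' 11 0 = i"
      have sm: "same {11, 13, vN} {rKey, rWt} S S'"
        by (rule same_trans[of _ _ S S1 "{11}" "{rWt}"]) (use S1 i in auto)
      have "rsafe B S' (pair_exp ?v (Var 11))" "rval S' (pair_exp ?v (Var 11)) = of_bool (pair_rel pol r s P ?v i)" if "i < N"
        using pair_exp_eval[OF rdI(1)[OF sm] n, of B "Var 11" i ?v] i(3) that NB by (simp_all add: N_def)
      then show "psafe B (weight_prog ?v) S' \<and> effect (weight_prog ?v) S' = rupd rWt i (?W i) S'"
        using i(3) rdI(4)[OF sm] by (cases "i < N") (simp_all add: weight_prog_def)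
    next
      fix S' assume *: "same {11} {rWt} S1 S' \<and> (\<forall>i<2 * N. rmem S' rWt i = ?W i)"
      have "same {11, 13, vN} {rKey, rWt} S S'"
        by (rule same_trans[of _ _ S S1 "{11}" "{rWt}"]) (use S1 * in auto)
      moreover have "imem S' vN = imem S1 vN" "rmem S' rKey = rmem S1 rKey"
        using * by (auto simp: same_def)
      ultimately show "?I S' \<and> ?keys S' \<and> (\<forall>i<2 * N. rmem S' rWt i = ?W i)"
        using * S1 by simp
    qed (use S1 NB in simp_all)
    let ?res = "\<lambda>q. \<Sum>p<N. of_bool (pair_rel pol r s P ?v p) * of_bool (\<forall>k<2 * d. ?key p k \<le> ?key (N + q) k)"
    let ?J = "\<lambda>S'. ready pol r s P S' \<and> rmem S' 1 0 = acc \<and> imem S' 10 0 = N \<and> (\<forall>q<N. rmem S' rC (N + q) = ?res q)"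
    have 4: "run B (dominance e) S1 (K * (2 * N * levels (2 * N) ^ e)) ?J"
      if S1: "?I S1 \<and> ?keys S1 \<and> (\<forall>i<2 * N. rmem S1 rWt i = ?W i)" for S1
    proof (rule run_mono[OF K[where N = "2 * N"]])
      have rd: "ready pol r s P S1"
        using rdI S1 by blast
      then show "imem S1 aT v = 0" "rmem S1 rT a = 0" for v a
        by (simp_all add: ready_def)
      \<comment> \<open>The constant 8 in the hypothesis is 4 times the 2 from putting data and
        queries together.\<close>
      show "(4 * (2 * N)) ^ e < B"
        using B by (simp add: N_def e_def)
      fix S' assume *: "same {21..38} {rC, rT, rw} S1 S' \<and> (\<forall>v. imem S' aT v = 0) \<and> (\<forall>a. rmem S' rT a = 0) \<and>
      (\<forall>i<2 * N. rmem S' rC i = (\<Sum>j<2 * N. rmem S1 rWt j *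
        of_bool (\<forall>k<Suc e. rmem S1 rKey (j * Suc e + k) \<le> rmem S1 rKey (i * Suc e + k))))"
      have "ready pol r s P S'"
        using rd * by (auto simp: ready_def same_def)
      moreover have "rmem S' 1 0 = acc" "imem S' 10 0 = N"
        using * rdI(2,4)[of S1] S1 by (auto simp: same_def)
      moreover have "rmem S' rC (N + q) = ?res q" if q: "q < N" for q
      proof -
        have key: "rmem S1 rKey (i * Suc e + k) = ?key i k" if "i < 2 * N" "k < Suc e" for i k
        proof -
          have "Suc i * (2 * d) \<le> 2 * N * (2 * d)"
            using that by (intro mult_right_mono) auto
          then have "i * (2 * d) + k < 2 * N * (2 * d)"
            using that e by simp
          moreover have "(i * (2 * d) + k) div (2 * d) = i" "(i * (2 * d) + k) mod (2 * d) = k"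
            using that e by simp_all
          ultimately show ?thesis
            unfolding e(1) using S1 by metis
        qed
        have "N + q < 2 * N"
          using q by simp
        then have "rmem S' rC (N + q) = (\<Sum>j<2 * N. rmem S1 rWt j *
          of_bool (\<forall>k<Suc e. rmem S1 rKey (j * Suc e + k) \<le> rmem S1 rKey ((N + q) * Suc e + k)))"
          using * by blast
        also have "\<dots> = (\<Sum>j<2 * N. ?W j * of_bool (\<forall>k<2 * d. ?key j k \<le> ?key (N + q) k))"
        proof (intro sum.cong refl)
          fix j assume "j \<in> {..<2 * N}"
          then have j: "j < 2 * N"
            by simp
          have "(\<forall>k<Suc e. rmem S1 rKey (j * Suc e + k) \<le> rmem S1 rKey ((N + q) * Suc e + k)) \<longleftrightarrow>
              (\<forall>k<2 * d. ?key j k \<le> ?key (N + q) k)"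
            using key[OF j] key[OF \<open>N + q < 2 * N\<close>] unfolding e(1) by auto
          moreover have "rmem S1 rWt j = ?W j"
            using S1 j by blast
          ultimately show "rmem S1 rWt j * of_bool (\<forall>k<Suc e. rmem S1 rKey (j * Suc e + k) \<le> rmem S1 rKey ((N + q) * Suc e + k))
            = ?W j * of_bool (\<forall>k<2 * d. ?key j k \<le> ?key (N + q) k)"
            by simp
        qed
        also have "\<dots> = ?res q"
          by (rule sum.mono_neutral_cong_right) auto
        finally show ?thesis .
      qed
      ultimately show "?J S'"
        by blast
    qed (use S1 NB N e in simp_all)
    have 5: "run B (For 11 10 ?acc) S1 (N * (pcost ?acc + 12) + 9)
      (\<lambda>S'. ready pol r s P S' \<and> rmem S' 1 0 = acc + term_value pol r s P x)" if S1: "?J S1" for S1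
    proof (rule run_mono[OF run_accumulate[where N = N and x = 0 and
            F = "\<lambda>q. of_int (coeff pol x) * of_bool (pair_rel pol r s P ?u q) * ?res q"]])
      fix q S' assume i: "q < N" "same {11} {1} S1 S'" "imem S' 11 0 = q"
      have rd: "ready pol r s P S'"
        by (rule ready_same[OF _ i(2)]) (use S1 in auto)
      have i10: "imem S' 10 0 = N" "rmem S' rC = rmem S1 rC"
        using i(2) S1 by (auto simp: same_def)
      have pe: "rsafe B S' (pair_exp ?u (Var 11))" "rval S' (pair_exp ?u (Var 11)) = of_bool (pair_rel pol r s P ?u q)"
        using pair_exp_eval[OF rd n, of B "Var 11" q ?u] i NB by (simp_all add: N_def)
      show "isafe B S' (IConst 0) \<and> rsafe B S' ?term \<and> ival S' (IConst 0) = 0 \<and>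
          rval S' ?term = of_int (coeff pol x) * of_bool (pair_rel pol r s P ?u q) * ?res q"
        using pe i10 i S1 NB by (simp add: coeff_exp_eval del: sum_of_bool_eq sum_of_bool_mult_eq sum_mult_of_bool_eq)
    next
      fix S' assume *: "same {11} {1} S1 S' \<and> rmem S' 1 = (rmem S1 1)(0 := rmem S1 1 0 +
        (\<Sum>q<N. of_int (coeff pol x) * of_bool (pair_rel pol r s P ?u q) * ?res q))"
      have "ready pol r s P S'"
        by (rule ready_same[of _ _ _ _ S1 "{11}" "{1}"]) (use S1 * in auto)
      then show "ready pol r s P S' \<and> rmem S' 1 0 = acc + term_value pol r s P x"
        using * S1 by (simp add: term_value_def Let_def n N_def d)
    qed (use S1 NB in simp_all)
    have "run B (?init ;; For 11 13 (key_prog r d x) ;; For 11 vN (weight_prog ?v) ;; dominance e ;; For 11 10 ?acc) S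
      (20 + (2 * N * (2 * d) * (pcost (key_prog r d x) + 12) + 9) + (2 * N * (pcost (weight_prog ?v) + 12) + 9) +
        K * (2 * N * levels (2 * N) ^ e) + (N * (pcost ?acc + 12) + 9))
      (\<lambda>S'. ready pol r s P S' \<and> rmem S' 1 0 = acc + term_value pol r s P x)"
      by (intro run_Seq[OF run_Seq[OF run_Seq[OF run_Seq[OF 1 2] 3] 4] 5])
    moreover have "20 + (2 * N * (2 * d) * (pcost (key_prog r d x) + 12) + 9) + (2 * N * (pcost (weight_prog ?v) + 12) + 9) +
        K * (2 * N * levels (2 * N) ^ e) + (N * (pcost ?acc + 12) + 9) \<le> K' * (N * levels (2 * N) ^ e)"
    proof -
      define M where "M = N * levels (2 * N) ^ e"
      have "levels (2 * N) \<ge> 1"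
        using levels_pos[of "2 * N"] N by simp
      then have "N * 1 \<le> M"
        unfolding M_def by (intro mult_left_mono) auto
      then have M: "N \<le> M" "1 \<le> M"
        using N by linarith+
      have "N * (4 * d * (pcost (key_prog r d x) + 12)) \<le> M * (4 * d * (pcost (key_prog r d x) + 12))"
        "N * (2 * (pcost (weight_prog ?v) + 12)) \<le> M * (2 * (pcost (weight_prog ?v) + 12))"
        "N * (pcost ?acc + 12) \<le> M * (pcost ?acc + 12)"
        by (rule mult_le_mono1, fact)+
      moreover have "2 * N * (2 * d) * (pcost (key_prog r d x) + 12) = N * (4 * d * (pcost (key_prog r d x) + 12))"
        "2 * N * (pcost (weight_prog ?v) + 12) = N * (2 * (pcost (weight_prog ?v) + 12))"
        "K * (2 * N * levels (2 * N) ^ e) = K * 2 * M"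
        by (simp_all only: M_def mult_ac)
      ultimately have "20 + (2 * N * (2 * d) * (pcost (key_prog r d x) + 12) + 9) + (2 * N * (pcost (weight_prog ?v) + 12) + 9) +
          K * (2 * N * levels (2 * N) ^ e) + (N * (pcost ?acc + 12) + 9)
        \<le> 20 * M + (M * (4 * d * (pcost (key_prog r d x) + 12)) + 9 * M) + (M * (2 * (pcost (weight_prog ?v) + 12)) + 9 * M) +
          K * 2 * M + (M * (pcost ?acc + 12) + 9 * M)"
        using M(2) by linarith
      also have "\<dots> = K' * M"
        unfolding K'_def by (simp only: distrib_right mult.commute[of M])
      finally show ?thesis
        unfolding M_def .
    qed
    ultimately show "run B (term_prog pol r s x) S (K' * (n * n * levels (2 * (n * n)) ^ (2 * d - 1)))
      (\<lambda>S'. ready pol r s P S' \<and> rmem S' 1 0 = acc + term_value pol r s P x)"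
      unfolding term_prog_def Let_def d(1)[symmetric] e_def[symmetric] N_def[symmetric]
      by (rule run_mono)
  qed
qed

section \<open>Expansion of the kernel into dominance counts\<close>

lemma sum_pairs:
  fixes f :: "nat \<Rightarrow> nat \<Rightarrow> real"
  shows "(\<Sum>p<n * n. f (p div n) (p mod n)) = (\<Sum>a<n. \<Sum>b<n. f a b)"
proof -
  have less: "a * n + b < n * n" if "a < n" "b < n" for a b
  proof -
    have "Suc a * n \<le> n * n"
      using that by (intro mult_right_mono) auto
    then show ?thesis
      using that by simp
  qed
  have "(\<Sum>p<n * n. f (p div n) (p mod n)) = (\<Sum>(a, b)\<in>{..<n} \<times> {..<n}. f a b)"
    by (rule sum.reindex_bij_witness[where i = "\<lambda>(a, b). a * n + b" and j = "\<lambda>p. (p div n, p mod n)"])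
      (auto simp: less less_mult_imp_div_less intro!: mod_less_divisor gr0I)
  then show ?thesis
    by (simp add: sum.cartesian_product)
qed

lemma key_value_le_iff:
  assumes n: "n_of P = n" and p: "p < n * n" and q: "q < n * n" and d: "d = r + s" "r \<ge> 1" "s \<ge> 1"
  shows "(\<forall>k<2 * d. key_value r d P (u, v, t1, t2, t3, t4) p k \<le> key_value r d P (u, v, t1, t2, t3, t4) (n * n + q) k) \<longleftrightarrow>
     (t1 \<longrightarrow> rel_block True 0 r P (p div n) (q mod n)) \<and>
     (t2 \<longrightarrow> rel_block True 0 r P (q div n) (p mod n)) \<and>
     (t3 \<longrightarrow> rel_block True r s P (if v then p mod n else p div n) (if u then q div n else q mod n)) \<and>
     (t4 \<longrightarrow> rel_block True r s P (if u then q mod n else q div n) (if v then p div n else p mod n))"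
proof -
  \<comment> \<open>The \<open>2 * d\<close> coordinates consist of an x and a y block for one
    direction, followed by an x and a y block for the other.\<close>
  have split: "(\<forall>k<2 * d. Q k) \<longleftrightarrow> (\<forall>l<r. Q l) \<and> (\<forall>l<s. Q (r + l)) \<and> (\<forall>l<r. Q (d + l)) \<and> (\<forall>l<s. Q (d + (r + l)))" for Q
  proof (intro iffI conjI allI impI)
    fix k assume *: "(\<forall>l<r. Q l) \<and> (\<forall>l<s. Q (r + l)) \<and> (\<forall>l<r. Q (d + l)) \<and> (\<forall>l<s. Q (d + (r + l)))" "k < 2 * d"
    consider "k < r" | "r \<le> k" "k < d" | "d \<le> k" "k < d + r" | "d + r \<le> k"
      by linarith
    then show "Q k"
    proof cases
      case 2
      then have "Q (r + (k - r))"
        using * d by (metis add_less_cancel_left le_add_diff_inverse)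
      then show ?thesis
        using 2 by simp
    next
      case 3
      then have "Q (d + (k - d))"
        using * by (metis add_less_cancel_left le_add_diff_inverse)
      then show ?thesis
        using 3 by simp
    next
      case 4
      have "k - d - r < s"
        using *(2) 4 d by linarith
      then have "Q (d + (r + (k - d - r)))"
        using * by blast
      then show ?thesis
        using 4 by simp
    qed (use * in blast)
  qed (use d in auto)
  have qn: "\<not> n * n + q < n * n" "(n * n + q) mod (n * n) = q" "p mod (n * n) = p"
    using p q by simp_all
  have low: "l mod d = l" "(r + l') mod d = r + l'" "(d + l) mod d = l" "(d + (r + l')) mod d = r + l'"
    "l < d" "r + l' < d" if "l < r" "l' < s" for l l'
    using that d by simp_all
  have s0: "0 < s" "0 < r"
    using d by simp_all
  let ?K = "key_value r d P (u, v, t1, t2, t3, t4)"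
  have 1: "(\<forall>l<r. ?K p l \<le> ?K (n * n + q) l) \<longleftrightarrow> (t1 \<longrightarrow> rel_block True 0 r P (p div n) (q mod n))"
    using p qn low(1,5)[OF _ s0(1)] by (auto simp: key_value_def Let_def n rel_block_def)
  have 2: "(\<forall>l<s. ?K p (r + l) \<le> ?K (n * n + q) (r + l)) \<longleftrightarrow>
      (t3 \<longrightarrow> rel_block True r s P (if v then p mod n else p div n) (if u then q div n else q mod n))"
    using p qn low(2,6)[OF s0(2)] by (auto simp: key_value_def Let_def n rel_block_def)
  have 3: "(\<forall>l<r. ?K p (d + l) \<le> ?K (n * n + q) (d + l)) \<longleftrightarrow> (t2 \<longrightarrow> rel_block True 0 r P (q div n) (p mod n))"
    using p qn low(3)[OF _ s0(1)] by (auto simp: key_value_def Let_def n rel_block_def)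
  have 4: "(\<forall>l<s. ?K p (d + (r + l)) \<le> ?K (n * n + q) (d + (r + l))) \<longleftrightarrow>
      (t4 \<longrightarrow> rel_block True r s P (if u then q mod n else q div n) (if v then p div n else p mod n))"
    using p qn low(4)[OF s0(2)] by (auto simp: key_value_def Let_def n rel_block_def)
  show ?thesis
    unfolding split 1 2 3 4 by blast
qed

text \<open>There are 64 choices; their number does not depend on \<open>n\<close>, so they cost a
  constant factor.\<close>

definition terms :: "term_index list" where
  "terms = (let b = [False, True] in List.product b (List.product b (List.product b (List.product b (List.product b b)))))"

lemma sum_list_product:
  fixes f :: "'a \<times> 'b \<Rightarrow> real"
  shows "sum_list (map f (List.product xs ys)) = (\<Sum>x\<leftarrow>xs. \<Sum>y\<leftarrow>ys. f (x, y))"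
  by (induction xs) (simp_all add: o_def)

lemma sum_list_swap:
  fixes f :: "'a \<Rightarrow> 'b \<Rightarrow> real"
  shows "(\<Sum>x\<leftarrow>xs. \<Sum>a\<in>A. f x a) = (\<Sum>a\<in>A. \<Sum>x\<leftarrow>xs. f x a)"
  by (induction xs) (simp_all add: sum.distrib)

text \<open>For negative polarity the left side is the product of four factors
  \<open>1 - of_bool D\<close> multiplied out; for positive polarity a single summand has a nonzero
  coefficient.\<close>

lemma edge_expansion:
  fixes D1 D2 D3 D4 pol :: bool
  defines "c \<equiv> \<lambda>t. if t then (if pol then 1 else -1) else of_bool (\<not> pol) :: real"
  shows "(\<Sum>t1\<leftarrow>[False, True]. \<Sum>t2\<leftarrow>[False, True]. \<Sum>t3\<leftarrow>[False, True]. \<Sum>t4\<leftarrow>[False, True].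
      c t1 * c t2 * c t3 * c t4 * of_bool ((t1 \<longrightarrow> D1) \<and> (t2 \<longrightarrow> D2) \<and> (t3 \<longrightarrow> D3) \<and> (t4 \<longrightarrow> D4)))
    = of_bool (D1 = pol \<and> D2 = pol \<and> D3 = pol \<and> D4 = pol)"
  by (cases pol; cases D1; cases D2; cases D3; cases D4) (simp_all add: c_def)

lemma rel_block_pol: "rel_block pol off q P i j \<longleftrightarrow> rel_block True off q P i j = pol"
  by (simp add: rel_block_def)

text \<open>The query pair \<open>c0\<close>, \<open>e\<close> holds columns 1 and 4, the data pair
  \<open>a\<close>, \<open>b\<close> columns 2 and 3. Summing over the four \<open>t\<close>
  restores the relations between the pairs, and the signed sum over \<open>u\<close> and
  \<open>v\<close> is the alternating sum of the second factor.\<close>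

theorem sum_term_value:
  assumes n: "n_of P = n" and d: "r \<ge> 1" "s \<ge> 1"
  shows "sum_list (map (term_value pol r s P) terms) = 4 * (\<Sum>i<n. \<Sum>j<n. \<Sum>k<n. \<Sum>l<n.
     rel4 (rel_block pol 0 r P) i j k l * alt4 (rel_block pol r s P) i j k l)"
proof -
  let ?R = "rel_block pol 0 r P" and ?R' = "rel_block pol r s P"
  let ?D = "rel_block True 0 r P" and ?D' = "rel_block True r s P"
  define c where "c = (\<lambda>t. if t then (if pol then 1 else -1) else of_bool (\<not> pol) :: real)"
  define g where "g = (\<lambda>(u, v, t1, t2, t3, t4) c0 e a b.
     4 * (if u = v then 1 else -1) * (c t1 * c t2 * c t3 * c t4) *
     (of_bool (?R c0 e \<and> ?R' (if u then e else c0) (if u then c0 else e)) *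
      (of_bool (?R a b \<and> ?R' (if v then b else a) (if v then a else b)) *
       of_bool ((t1 \<longrightarrow> ?D a e) \<and> (t2 \<longrightarrow> ?D c0 b) \<and> (t3 \<longrightarrow> ?D' (if v then b else a) (if u then c0 else e)) \<and>
         (t4 \<longrightarrow> ?D' (if u then e else c0) (if v then a else b))))) :: real)"
  have pr: "pair_rel pol r s P w p \<longleftrightarrow> ?R (p div n) (p mod n) \<and>
      ?R' (if w then p mod n else p div n) (if w then p div n else p mod n)" if "p < n * n" for w p
  proof -
    have "p div n < n"
      using that by (simp add: less_mult_imp_div_less)
    then show ?thesis
      by (auto simp: pair_rel_def Let_def n swap_pair_def)
  qed
  have tv: "term_value pol r s P x = (\<Sum>c0<n. \<Sum>e<n. \<Sum>a<n. \<Sum>b<n. g x c0 e a b)" for x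
  proof -
    obtain u v t1 t2 t3 t4 where x: "x = (u, v, t1, t2, t3, t4)"
      by (cases x) auto
    have "real_of_int (coeff pol x) = 4 * (if u = v then 1 else -1) * (c t1 * c t2 * c t3 * c t4)"
      by (auto simp: x coeff_def c_def)
    then have "term_value pol r s P x = (\<Sum>q<n * n. \<Sum>p<n * n. g x (q div n) (q mod n) (p div n) (p mod n))"
      unfolding term_value_def Let_def n sum_distrib_left
      using key_value_le_iff[OF n, of _ _ "r + s" r s u v t1 t2 t3 t4] d
      by (intro sum.cong refl) (simp add: x g_def pr mult_ac)
    also have "\<dots> = (\<Sum>c0<n. \<Sum>e<n. \<Sum>a<n. \<Sum>b<n. g x c0 e a b)"
      by (simp only: sum_pairs[where f = "\<lambda>a b. g x _ _ a b"]
          sum_pairs[where f = "\<lambda>c0 e. \<Sum>a<n. \<Sum>b<n. g x c0 e a b"])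
    finally show ?thesis .
  qed
  have four: "(\<Sum>t1\<leftarrow>[False, True]. \<Sum>t2\<leftarrow>[False, True]. \<Sum>t3\<leftarrow>[False, True]. \<Sum>t4\<leftarrow>[False, True].
      g (u, v, t1, t2, t3, t4) c0 e a b) = 4 * (if u = v then 1 else -1) *
      (rel4 ?R c0 a b e * rel4 ?R' (if u then e else c0) (if v then b else a) (if v then a else b) (if u then c0 else e))"
    for u v c0 e a b
  proof -
    let ?k = "4 * (if u = v then 1 else -1) * (of_bool (?R c0 e \<and> ?R' (if u then e else c0) (if u then c0 else e)) *
      of_bool (?R a b \<and> ?R' (if v then b else a) (if v then a else b))) :: real"
    let ?D1 = "?D a e" and ?D2 = "?D c0 b" and ?D3 = "?D' (if v then b else a) (if u then c0 else e)"
      and ?D4 = "?D' (if u then e else c0) (if v then a else b)"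
    have gk: "g (u, v, t1, t2, t3, t4) c0 e a b = ?k * (c t1 * c t2 * c t3 * c t4 *
        of_bool ((t1 \<longrightarrow> ?D1) \<and> (t2 \<longrightarrow> ?D2) \<and> (t3 \<longrightarrow> ?D3) \<and> (t4 \<longrightarrow> ?D4)))" for t1 t2 t3 t4
      unfolding g_def by (simp only: prod.case mult_ac)
    have "(\<Sum>t1\<leftarrow>[False, True]. \<Sum>t2\<leftarrow>[False, True]. \<Sum>t3\<leftarrow>[False, True]. \<Sum>t4\<leftarrow>[False, True].
      g (u, v, t1, t2, t3, t4) c0 e a b) = ?k * of_bool (?D1 = pol \<and> ?D2 = pol \<and> ?D3 = pol \<and> ?D4 = pol)"
      unfolding gk sum_list_const_mult c_def edge_expansion ..
    also have "\<dots> = 4 * (if u = v then 1 else -1) *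
      (rel4 ?R c0 a b e * rel4 ?R' (if u then e else c0) (if v then b else a) (if v then a else b) (if u then c0 else e))"
      unfolding rel4_def rel_block_pol[of pol] by (auto simp: of_bool_def)
    finally show ?thesis .
  qed
  have "(\<Sum>x\<leftarrow>terms. g x c0 e a b) = 4 * (rel4 ?R c0 a b e * alt4 ?R' c0 a b e)" for c0 e a b
    unfolding terms_def Let_def sum_list_product four
    by (simp add: alt4_def algebra_simps)
  moreover have "sum_list (map (term_value pol r s P) terms) = (\<Sum>c0<n. \<Sum>e<n. \<Sum>a<n. \<Sum>b<n. \<Sum>x\<leftarrow>terms. g x c0 e a b)"
    unfolding tv sum_list_swap ..
  ultimately have "sum_list (map (term_value pol r s P) terms)
      = 4 * (\<Sum>c0<n. \<Sum>e<n. \<Sum>a<n. \<Sum>b<n. rel4 ?R c0 a b e * alt4 ?R' c0 a b e)"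
    by (simp only: sum_distrib_left)
  also have "(\<Sum>c0<n. \<Sum>e<n. \<Sum>a<n. \<Sum>b<n. rel4 ?R c0 a b e * alt4 ?R' c0 a b e)
      = (\<Sum>c0<n. \<Sum>a<n. \<Sum>e<n. \<Sum>b<n. rel4 ?R c0 a b e * alt4 ?R' c0 a b e)"
    by (intro sum.cong refl sum.swap)
  also have "\<dots> = (\<Sum>c0<n. \<Sum>a<n. \<Sum>b<n. \<Sum>e<n. rel4 ?R c0 a b e * alt4 ?R' c0 a b e)"
    by (intro sum.cong refl sum.swap)
  finally show ?thesis .
qed

text \<open>There are no Boolean constants, so the empty conjunction is the negation of a false
  comparison.\<close>

primrec ball_exp :: "(nat \<Rightarrow> bexp) \<Rightarrow> nat \<Rightarrow> bexp" where
  "ball_exp f 0 = BNot (ILess (IConst 0) (IConst 0))"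
| "ball_exp f (Suc k) = BAnd (ball_exp f k) (f k)"

lemma bval_ball_exp [simp]: "bval S (ball_exp f k) \<longleftrightarrow> (\<forall>l<k. bval S (f l))"
  by (induction k) (auto simp: less_Suc_eq)

lemma bsafe_ball_exp: "(\<And>l. l < k \<Longrightarrow> bsafe B S (f l)) \<Longrightarrow> bsafe B S (ball_exp f k)"
  by (induction k) auto

text \<open>Each relation is evaluated once per pair of columns; all terms and the correction then
  look it up in constant time.\<close>

definition table_prog :: "bool \<Rightarrow> nat \<Rightarrow> nat \<Rightarrow> nat \<Rightarrow> nat \<Rightarrow> prog" where
  "table_prog pol d off q dst = If (ball_exp (\<lambda>l. BNot (RLess
       (RArr 3 (IAdd (IMul (IMod (Var 11) (Var 0)) (IConst d)) (IConst (off + l))))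
       (RArr 2 (IAdd (IMul (IDiv (Var 11) (Var 0)) (IConst d)) (IConst (off + l)))))) q)
     (RAssign dst (Var 11) (ROfNat (IConst (of_bool pol)))) (RAssign dst (Var 11) (ROfNat (IConst (of_bool (\<not> pol)))))"

lemma run_table_prog:
  assumes n: "imem S 0 0 = n" "n_of P = n" "n > 0" "imem S 10 0 = n * n" and B: "n * n < B" "n * d < B" "1 \<le> B"
    and tab: "\<And>i l. i < n \<Longrightarrow> l < d \<Longrightarrow> rmem S 2 (i * d + l) = lo P i l \<and> rmem S 3 (i * d + l) = hi P i l"
    and q: "off + q \<le> d" and dst: "dst \<noteq> 2" "dst \<noteq> 3"
  shows "run B (For 11 10 (table_prog pol d off q dst)) S (n * n * (pcost (table_prog pol d off q dst) + 12) + 9)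
    (\<lambda>S'. same {11} {dst} S S' \<and> (\<forall>i<n. \<forall>j<n. rmem S' dst (i * n + j) = of_bool (rel_block pol off q P i j)))"
proof (rule run_mono[OF run_fill_prog[where N = "n * n" and F = "\<lambda>p. of_bool (rel_block pol off q P (p div n) (p mod n))" and a = dst]])
  fix p S' assume p: "p < n * n" "same {11} {dst} S S'" "imem S' 11 0 = p"
  have S': "imem S' 0 0 = n" "rmem S' 2 = rmem S 2" "rmem S' 3 = rmem S 3"
    using p(2) n dst by (auto simp: same_def)
  have ij: "p div n < n" "p mod n < n"
    using p(1) n by (simp_all add: less_mult_imp_div_less)
  have cell: "i * d + (off + l) \<le> B" "i * d \<le> B" "off + l \<le> B" "d \<le> B" "off + l < d" if "i < n" "l < q" for i l
  proof -
    have "Suc i * d \<le> n * d"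
      using that by (intro mult_right_mono) auto
    then show "i * d + (off + l) \<le> B" "i * d \<le> B" "off + l \<le> B" "d \<le> B" "off + l < d"
      using that q B unfolding mult_Suc by linarith+
  qed
  let ?f = "\<lambda>l. BNot (RLess
       (RArr 3 (IAdd (IMul (IMod (Var 11) (Var 0)) (IConst d)) (IConst (off + l))))
       (RArr 2 (IAdd (IMul (IDiv (Var 11) (Var 0)) (IConst d)) (IConst (off + l)))))"
  have f: "bsafe B S' (?f l)" "bval S' (?f l) \<longleftrightarrow> lo P (p div n) (off + l) \<le> hi P (p mod n) (off + l)" if "l < q" for l
    using cell[OF ij(1) that] cell[OF ij(2) that] tab[OF ij(1)] tab[OF ij(2)] p(3) S' by auto
  have safe: "bsafe B S' (ball_exp ?f q)"
    using f by (intro bsafe_ball_exp) auto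
  have "bval S' (ball_exp ?f q) \<longleftrightarrow> (\<forall>l<q. lo P (p div n) (off + l) \<le> hi P (p mod n) (off + l))"
    unfolding bval_ball_exp using f(2) by blast
  then have "rel_block pol off q P (p div n) (p mod n) \<longleftrightarrow> bval S' (ball_exp ?f q) = pol"
    unfolding rel_block_def by (rule arg_cong[symmetric])
  then show "psafe B (table_prog pol d off q dst) S' \<and>
      effect (table_prog pol d off q dst) S' = rupd dst p (of_bool (rel_block pol off q P (p div n) (p mod n))) S'"
    using p(3) B safe unfolding table_prog_def
    by (cases pol; cases "bval S' (ball_exp ?f q)") (simp_all del: bval_ball_exp bval.simps)
next
  fix S' assume *: "same {11} {dst} S S' \<and> (\<forall>p<n * n. rmem S' dst p = of_bool (rel_block pol off q P (p div n) (p mod n)))"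
  have "rmem S' dst (i * n + j) = of_bool (rel_block pol off q P i j)" if "i < n" "j < n" for i j
  proof -
    have "Suc i * n \<le> n * n"
      using that by (intro mult_right_mono) auto
    then have "i * n + j < n * n"
      using that by simp
    then show ?thesis
      using * that by simp
  qed
  then show "same {11} {dst} S S' \<and> (\<forall>i<n. \<forall>j<n. rmem S' dst (i * n + j) = of_bool (rel_block pol off q P i j))"
    using * by blast
qed (use n B in auto)

text \<open>\<open>f\<close> and \<open>b\<close> address the pair in forward and in backward order;
  their four combinations belong to the relations and their converses.\<close>

definition margin_step :: prog where
  "margin_step = (let f = IAdd (IMul (Var 11) (Var 0)) (Var 12); b = IAdd (IMul (Var 12) (Var 0)) (Var 11);
       add = (\<lambda>a i j. RSet a (RAdd (RVar a) (RMul (RArr 4 i) (RArr 5 j))))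
     in add 6 f f ;; add 7 f b ;; add 8 b f ;; add 9 b b)"

definition correction_step :: prog where
  "correction_step = (let z = (\<lambda>a. RSet a (ROfNat (IConst 0)));
       g = (\<lambda>a. RSub (RMul (RMul (ROfNat (IConst 4)) (RVar a)) (RVar a)) (RMul (ROfNat (IConst 2)) (RVar a)))
     in z 6 ;; z 7 ;; z 8 ;; z 9 ;; For 12 0 margin_step ;;
       RSet 1 (RSub (RVar 1) (RAdd (RAdd (RAdd (g 6) (g 7)) (g 8)) (g 9))))"

lemma run_correction:
  fixes R R' :: "nat \<Rightarrow> nat \<Rightarrow> bool"
  assumes n: "imem S 0 0 = n" "n > 0" and B: "n * n < B" "4 \<le> B"
    and tab: "\<And>i j. i < n \<Longrightarrow> j < n \<Longrightarrow> rmem S 4 (i * n + j) = of_bool (R i j) \<and> rmem S 5 (i * n + j) = of_bool (R' i j)"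
    and zero: "rmem S 1 0 = 0"
  shows "run B (For 11 0 correction_step) S (n * ((16 + (n * (pcost margin_step + 12) + 9) + 100) + 12) + 9)
    (\<lambda>S'. same {11, 12} {1, 6, 7, 8, 9} S S' \<and> rmem S' 1 0 = - correction {..<n} R R')"
proof -
  have nB: "n < B"
  proof -
    have "n * 1 \<le> n * n"
      using n by (intro mult_left_mono) auto
    then show ?thesis
      using B by linarith
  qed
  let ?Y = "{1, 6, 7, 8, 9}"
  define m where "m = (\<lambda>k i. [\<Sum>j<k. of_bool (R i j \<and> R' i j), \<Sum>j<k. of_bool (R i j \<and> R' j i),
    \<Sum>j<k. of_bool (R j i \<and> R' i j), \<Sum>j<k. of_bool (R j i \<and> R' j i) :: real])"
  define cor where "cor = (\<lambda>i. \<Sum>p\<leftarrow>m n i. 4 * p * p - 2 * p)"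
  have cor: "correction {..<n} R R' = (\<Sum>i<n. cor i)"
    unfolding correction_def cor_def m_def margin_def by (simp del: sum_of_bool_eq)
  let ?z = "\<lambda>a. RSet a (ROfNat (IConst 0))"
  let ?g = "\<lambda>a. RSub (RMul (RMul (ROfNat (IConst 4)) (RVar a)) (RVar a)) (RMul (ROfNat (IConst 2)) (RVar a))"
  let ?fin = "RSet 1 (RSub (RVar 1) (RAdd (RAdd (RAdd (?g 6) (?g 7)) (?g 8)) (?g 9)))"
  let ?init = "?z 6 ;; ?z 7 ;; ?z 8 ;; ?z 9"
  let ?acc = "\<lambda>k i S'. rmem S' 6 0 = m k i ! 0 \<and> rmem S' 7 0 = m k i ! 1 \<and> rmem S' 8 0 = m k i ! 2 \<and> rmem S' 9 0 = m k i ! 3"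
  show ?thesis
  proof (rule run_For[where P = "\<lambda>i S'. same {11, 12} ?Y S S' \<and> rmem S' 1 0 = - (\<Sum>i<i. cor i)"])
    fix i S1 assume i: "i < n" and P: "same {11, 12} ?Y S S1 \<and> rmem S1 1 0 = - (\<Sum>i<i. cor i)" and ci: "imem S1 11 0 = i"
    let ?I = "\<lambda>S'. same {11, 12} ?Y S S' \<and> rmem S' 1 0 = - (\<Sum>i<i. cor i) \<and> imem S' 11 0 = i"
    have 1: "run B ?init S1 16 (\<lambda>S'. ?I S' \<and> ?acc 0 i S')"
      by (rule run_straight) (use P ci in \<open>auto simp: m_def\<close>)
    have 2: "run B (For 12 0 margin_step) S2 (n * (pcost margin_step + 12) + 9) (\<lambda>S'. ?I S' \<and> ?acc n i S')"
      if S2: "?I S2 \<and> ?acc 0 i S2" for S2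
    proof (rule run_For[where P = "\<lambda>k S'. ?I S' \<and> ?acc k i S'"])
      fix j S3 assume j: "j < n" and P3: "?I S3 \<and> ?acc j i S3" and cj: "imem S3 12 0 = j"
      have S3: "imem S3 0 0 = n" "rmem S3 4 = rmem S 4" "rmem S3 5 = rmem S 5"
        using P3 n by (auto simp: same_def)
      have "Suc i * n \<le> n * n" "Suc j * n \<le> n * n"
        using i j by (intro mult_right_mono; simp)+
      then have bd: "i * n + j \<le> B" "j * n + i \<le> B" "i * n \<le> B" "j * n \<le> B"
        using i j B unfolding mult_Suc by linarith+
      note t = tab[OF i j] tab[OF j i]
      show "run B margin_step S3 (pcost margin_step) (\<lambda>S'. (?I S' \<and> ?acc (Suc j) i S') \<and> imem S' 12 0 = j)"
      proof (rule run_straight)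
        show "psafe B margin_step S3"
          using P3 cj S3 bd by (simp add: margin_step_def Let_def)
        show "(?I (effect margin_step S3) \<and> ?acc (Suc j) i (effect margin_step S3)) \<and> imem (effect margin_step S3) 12 0 = j"
          using P3 cj S3 t by (simp add: margin_step_def Let_def m_def of_bool_conj del: sum_of_bool_eq sum_of_bool_mult_eq sum_mult_of_bool_eq)
      qed simp
    qed (use S2 nB n in \<open>auto simp: same_def\<close>)
    have 3: "run B ?fin S2 100 (\<lambda>S'. (same {11, 12} ?Y S S' \<and> rmem S' 1 0 = - (\<Sum>i<Suc i. cor i)) \<and> imem S' 11 0 = i)"
      if S2: "?I S2 \<and> ?acc n i S2" for S2
    proof (rule run_straight)
      show "psafe B ?fin S2"
        using B by simp
      have "cor i = (\<Sum>p\<leftarrow>[m n i ! 0, m n i ! 1, m n i ! 2, m n i ! 3]. 4 * p * p - 2 * p)"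
        by (simp add: cor_def m_def del: sum_of_bool_eq)
      then show "(same {11, 12} ?Y S (effect ?fin S2) \<and> rmem (effect ?fin S2) 1 0 = - (\<Sum>i<Suc i. cor i)) \<and> imem (effect ?fin S2) 11 0 = i"
        using S2 by simp
    qed simp
    show "run B correction_step S1 (16 + (n * (pcost margin_step + 12) + 9) + 100)
      (\<lambda>S'. (same {11, 12} ?Y S S' \<and> rmem S' 1 0 = - (\<Sum>i<Suc i. cor i)) \<and> imem S' 11 0 = i)"
      unfolding correction_step_def Let_def by (rule run_Seq[OF run_Seq[OF 1 2] 3])
  qed (use zero nB n cor in \<open>auto simp: same_def\<close>)
qed

lemma correction_Suc:
  assumes "\<And>i j. i < n \<Longrightarrow> j < n \<Longrightarrow> Q i j = R (Suc i) (Suc j)" "\<And>i j. i < n \<Longrightarrow> j < n \<Longrightarrow> Q' i j = R' (Suc i) (Suc j)"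
  shows "correction {1..n} R R' = correction {..<n} Q Q'"
proof -
  have m: "margin {1..n} A A' (Suc v) = margin {..<n} C C' v"
    if "\<And>j. j < n \<Longrightarrow> A (Suc v) (Suc j) = C v j \<and> A' (Suc v) (Suc j) = C' v j" for A A' C C' v
    unfolding margin_def sum_Suc_atLeastAtMost by (intro sum.cong refl) (simp add: that)
  have "margin {1..n} R R' (Suc v) = margin {..<n} Q Q' v" "margin {1..n} R R'\<inverse>\<inverse> (Suc v) = margin {..<n} Q Q'\<inverse>\<inverse> v"
    "margin {1..n} R\<inverse>\<inverse> R' (Suc v) = margin {..<n} Q\<inverse>\<inverse> Q' v" "margin {1..n} R\<inverse>\<inverse> R'\<inverse>\<inverse> (Suc v) = margin {..<n} Q\<inverse>\<inverse> Q'\<inverse>\<inverse> v"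
    if "v < n" for v
    by (rule m, simp add: assms that)+
  then show ?thesis
    unfolding correction_def sum_Suc_atLeastAtMost by (intro sum.cong refl) simp
qed

lemma sum_rel4_alt4_Suc:
  assumes "\<And>i j. i < n \<Longrightarrow> j < n \<Longrightarrow> Q i j = R (Suc i) (Suc j)" "\<And>i j. i < n \<Longrightarrow> j < n \<Longrightarrow> Q' i j = R' (Suc i) (Suc j)"
  shows "(\<Sum>i\<in>{1..n}. \<Sum>j\<in>{1..n}. \<Sum>k\<in>{1..n}. \<Sum>l\<in>{1..n}. rel4 R i j k l * alt4 R' i j k l)
    = (\<Sum>i<n. \<Sum>j<n. \<Sum>k<n. \<Sum>l<n. rel4 Q i j k l * alt4 Q' i j k l)"
  unfolding sum_Suc_atLeastAtMost
proof (intro sum.cong refl)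
  fix i j k l assume "i \<in> {..<n}" "j \<in> {..<n}" "k \<in> {..<n}" "l \<in> {..<n}"
  then show "rel4 R (Suc i) (Suc j) (Suc k) (Suc l) * alt4 R' (Suc i) (Suc j) (Suc k) (Suc l) = rel4 Q i j k l * alt4 Q' i j k l"
    unfolding rel4_def alt4_def by (simp add: assms)
qed

section \<open>The complete program for a sign covariance\<close>

definition covariance_prog :: "bool \<Rightarrow> nat \<Rightarrow> nat \<Rightarrow> prog" where
  "covariance_prog pol r s = (let d = r + s in
     ISet 10 (IMul (Var 0) (Var 0)) ;; For 11 10 (table_prog pol d 0 r 4) ;; For 11 10 (table_prog pol d r s 5) ;;
     For 11 0 correction_step ;; seqs (map (term_prog pol r s) terms) ;;
     RSet 1 (RDiv (RVar 1) (falling_exp (Var 0) 4)))"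

lemma run_covariance_prog:
  assumes d: "d = r + s" "r \<ge> 1" "s \<ge> 1"
  obtains K where "\<And>B n (P :: problem) (S :: store). \<lbrakk>n_of P = n; n \<ge> 4; 20 * (n * n * d) < B; (8 * (n * n)) ^ (2 * d - 1) < B;
      imem S 0 0 = n; rmem S 1 0 = 0; \<And>v. imem S aT v = 0; \<And>a. rmem S rT a = 0;
      \<And>i l. i < n \<Longrightarrow> l < d \<Longrightarrow> rmem S 2 (i * d + l) = lo P i l \<and> rmem S 3 (i * d + l) = hi P i l\<rbrakk> \<Longrightarrow>
    run B (covariance_prog pol r s) S (K * (n * n * levels (2 * (n * n)) ^ (2 * d - 1)))
      (\<lambda>S'. rmem S' 1 0 = 1 / falling n 4 * (4 * (\<Sum>i<n. \<Sum>j<n. \<Sum>k<n. \<Sum>l<n.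
         rel4 (rel_block pol 0 r P) i j k l * alt4 (rel_block pol r s P) i j k l)
         - correction {..<n} (rel_block pol 0 r P) (rel_block pol r s P)))"
proof -
  \<comment> \<open>Each term program comes with its own cost constant. Choice collects them into
    one function, whose sum over \<open>terms\<close> enters the total.\<close>
  have "\<forall>x. \<exists>K. \<forall>B n P acc S. n_of P = n \<longrightarrow> n > 0 \<longrightarrow> 20 * (n * n * d) < B \<longrightarrow> (8 * (n * n)) ^ (2 * d - 1) < B \<longrightarrow>
      ready pol r s P S \<and> rmem S 1 0 = acc \<longrightarrow>
    run B (term_prog pol r s x) S (K * (n * n * levels (2 * (n * n)) ^ (2 * d - 1)))
      (\<lambda>S'. ready pol r s P S' \<and> rmem S' 1 0 = acc + term_value pol r s P x)" (is "\<forall>x. \<exists>K. ?Q x K")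
  proof
    fix x
    show "\<exists>K. ?Q x K"
    proof (rule run_term_prog[OF d, of pol x])
      fix k
      assume k: "\<And>B n P acc (S :: store). \<lbrakk>n_of P = n; n > 0; 20 * (n * n * d) < B; (8 * (n * n)) ^ (2 * d - 1) < B;
      ready pol r s P S \<and> rmem S 1 0 = acc\<rbrakk> \<Longrightarrow>
    run B (term_prog pol r s x) S (k * (n * n * levels (2 * (n * n)) ^ (2 * d - 1)))
      (\<lambda>S'. ready pol r s P S' \<and> rmem S' 1 0 = acc + term_value pol r s P x)"
      show ?thesis
        by (rule exI[of _ k], intro allI impI, rule k)
    qed
  qed
  from choice[OF this] obtain K where "\<forall>x. ?Q x (K x)" ..
  note K = this[rule_format]
  let ?tx = "table_prog pol d 0 r 4" and ?ty = "table_prog pol d r s 5"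
  let ?last = "RSet 1 (RDiv (RVar 1) (falling_exp (Var 0) 4))"
  define K' where "K' = 10 + (pcost ?tx + 12 + 9) + (pcost ?ty + 12 + 9) + (16 + (pcost margin_step + 12 + 9) + 100 + 12 + 9) +
    (sum_list (map K terms) + 1) + pcost ?last"
  show ?thesis
  proof (rule that[of K'])
    fix B n and P :: problem and S :: store
    assume n4: "n_of P = n" "n \<ge> 4" and B: "20 * (n * n * d) < B" "(8 * (n * n)) ^ (2 * d - 1) < B"
      and S: "imem S 0 0 = n" "rmem S 1 0 = 0" "\<And>v. imem S aT v = 0" "\<And>a. rmem S rT a = 0"
      and tab: "\<And>i l. i < n \<Longrightarrow> l < d \<Longrightarrow> rmem S 2 (i * d + l) = lo P i l \<and> rmem S 3 (i * d + l) = hi P i l"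
    have n: "n_of P = n" "n > 0"
      using n4 by simp_all
    have "n * 1 \<le> n * n" "n * n * 1 \<le> n * n * d" "n * d * 1 \<le> n * d * n"
      using n d by (intro mult_left_mono; simp)+
    moreover have "n * d * n = n * n * d"
      by simp
    ultimately have NB: "n * n < B" "n * d < B" "1 \<le> B" "4 \<le> B" "n < B"
      using B n4 by linarith+
    let ?R = "rel_block pol 0 r P" and ?R' = "rel_block pol r s P"
    let ?I = "\<lambda>Y S'. same {10, 11, 12} Y S S' \<and> imem S' 10 0 = n * n"
    let ?T = "\<lambda>a Q S'. \<forall>i<n. \<forall>j<n. rmem S' a (i * n + j) = of_bool (Q i j)"
    have I: "imem S' 0 0 = n" "rmem S' 2 = rmem S 2" "rmem S' 3 = rmem S 3" "rmem S' 1 0 = 0" if "?I {4, 5} S'" for S'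
      using that S by (auto simp: same_def)
    have 1: "run B (ISet 10 (IMul (Var 0) (Var 0))) S 10 (?I {4, 5})"
      by (rule run_straight) (use S NB in auto)
    have 2: "run B (For 11 10 ?tx) S1 (n * n * (pcost ?tx + 12) + 9) (\<lambda>S'. ?I {4, 5} S' \<and> ?T 4 ?R S')" if S1: "?I {4, 5} S1" for S1
    proof (rule run_mono[OF run_table_prog[where P = P and n = n]])
      fix S' assume *: "same {11} {4} S1 S' \<and> ?T 4 ?R S'"
      have "same {10, 11, 12} {4, 5} S S'"
        by (rule same_trans[of _ _ S S1 "{11}" "{4}"]) (use S1 * in auto)
      then show "?I {4, 5} S' \<and> ?T 4 ?R S'"
        using * S1 same_imem[of "{11}" "{4}" S1 S' 10] by simp
    qed (use I[OF S1] S1 n NB tab d(1) in simp_all)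
    have 3: "run B (For 11 10 ?ty) S1 (n * n * (pcost ?ty + 12) + 9) (\<lambda>S'. ?I {4, 5} S' \<and> ?T 4 ?R S' \<and> ?T 5 ?R' S')"
      if S1: "?I {4, 5} S1 \<and> ?T 4 ?R S1" for S1
    proof (rule run_mono[OF run_table_prog[where P = P and n = n]])
      have "?I {4, 5} S1"
        using S1 by blast
      note I = I[OF this]
      show "imem S1 0 0 = n" "\<And>i l. i < n \<Longrightarrow> l < d \<Longrightarrow> rmem S1 2 (i * d + l) = lo P i l \<and> rmem S1 3 (i * d + l) = hi P i l"
        using I tab by simp_all
      fix S' assume *: "same {11} {5} S1 S' \<and> ?T 5 ?R' S'"
      have "same {10, 11, 12} {4, 5} S S'"
        by (rule same_trans[of _ _ S S1 "{11}" "{5}"]) (use S1 * in auto)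
      then show "?I {4, 5} S' \<and> ?T 4 ?R S' \<and> ?T 5 ?R' S'"
        using * S1 same_imem[of "{11}" "{5}" S1 S' 10] same_rmem[of "{11}" "{5}" S1 S' 4] by simp
    qed (use S1 n NB d(1) in simp_all)
    let ?Inv = "\<lambda>acc S'. ready pol r s P S' \<and> rmem S' 1 0 = acc"
    have 4: "run B (For 11 0 correction_step) S1 (n * ((16 + (n * (pcost margin_step + 12) + 9) + 100) + 12) + 9) (?Inv (- correction {..<n} ?R ?R'))"
      if S1: "?I {4, 5} S1 \<and> ?T 4 ?R S1 \<and> ?T 5 ?R' S1" for S1
    proof (rule run_mono[OF run_correction[where R = ?R and R' = ?R' and n = n]])
      have S1I: "?I {4, 5} S1"
        using S1 by blast
      note I = I[OF this]
      then show "imem S1 0 0 = n" "rmem S1 1 0 = 0"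
        by simp_all
      fix S' assume *: "same {11, 12} {1, 6, 7, 8, 9} S1 S' \<and> rmem S' 1 0 = - correction {..<n} ?R ?R'"
      have "imem S1 aT = imem S aT" "rmem S1 rT = rmem S rT"
        using S1I by (auto simp: same_def)
      then have "ready pol r s P S1"
        unfolding ready_def n(1) d(1)[symmetric] using S1 I tab S(3,4) by simp
      then have "ready pol r s P S'"
        by (rule ready_same[of _ _ _ _ S1 "{11, 12}" "{1, 6, 7, 8, 9}"]) (use * in auto)
      then show "?Inv (- correction {..<n} ?R ?R') S'"
        using * by blast
    qed (use S1 n NB in simp_all)
    define M where "M = n * n * levels (2 * (n * n)) ^ (2 * d - 1)"
    let ?sum = "sum_list (map (term_value pol r s P) terms)"
    have 5: "run B (seqs (map (term_prog pol r s) terms)) S1 (sum_list (map (\<lambda>x. K x * M) terms) + 1)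
      (?Inv (- correction {..<n} ?R ?R' + ?sum))" if S1: "?Inv (- correction {..<n} ?R ?R') S1" for S1
      by (rule run_seqs[where Inv = ?Inv, OF _ S1]) (unfold M_def, rule K[OF n B])
    let ?res = "1 / falling n 4 * (?sum - correction {..<n} ?R ?R')"
    have 6: "run B ?last S1 (pcost ?last) (\<lambda>S'. rmem S' 1 0 = ?res)"
      if S1: "?Inv (- correction {..<n} ?R ?R' + ?sum) S1" for S1
    proof (rule run_straight)
      have "imem S1 0 0 = n"
        using S1 n by (simp add: ready_def)
      then show "psafe B ?last S1" "rmem (effect ?last S1) 1 0 = ?res"
        using S1 NB by (simp_all add: rsafe_falling_exp del: falling_exp.simps)
    qed simp
    have "run B (covariance_prog pol r s) S (10 + (n * n * (pcost ?tx + 12) + 9) + (n * n * (pcost ?ty + 12) + 9) +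
      (n * ((16 + (n * (pcost margin_step + 12) + 9) + 100) + 12) + 9) + (sum_list (map (\<lambda>x. K x * M) terms) + 1) + pcost ?last)
      (\<lambda>S'. rmem S' 1 0 = ?res)"
      unfolding covariance_prog_def Let_def d(1)[symmetric]
      by (intro run_Seq[OF run_Seq[OF run_Seq[OF run_Seq[OF run_Seq[OF 1 2] 3] 4] 5] 6])
    moreover have "10 + (n * n * (pcost ?tx + 12) + 9) + (n * n * (pcost ?ty + 12) + 9) +
      (n * ((16 + (n * (pcost margin_step + 12) + 9) + 100) + 12) + 9) + (sum_list (map (\<lambda>x. K x * M) terms) + 1) + pcost ?last \<le> K' * M"
    proof -
      have "levels (2 * (n * n)) \<ge> 1"
        using levels_pos[of "2 * (n * n)"] n by simp
      then have "n * n * 1 \<le> M"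
        unfolding M_def by (intro mult_left_mono) auto
      moreover have "n * n \<ge> 1"
        using n by (simp add: Suc_le_eq)
      ultimately have M: "n * n \<le> M" "1 \<le> M"
        by linarith+
      have "n * n * (pcost ?tx + 12) \<le> M * (pcost ?tx + 12)" "n * n * (pcost ?ty + 12) \<le> M * (pcost ?ty + 12)" "n * n * (pcost margin_step + 12) \<le> M * (pcost margin_step + 12)"
        "pcost ?last * 1 \<le> pcost ?last * M"
        by (rule mult_le_mono1 mult_le_mono2, fact)+
      moreover have "n * ((16 + (n * (pcost margin_step + 12) + 9) + 100) + 12) + 9 = n * n * (pcost margin_step + 12) + 137 * n + 9"
        by (simp add: distrib_left)
      moreover have "n \<le> M"
        using M(1) n le_square[of n] by linarith
      moreover have "sum_list (map (\<lambda>x. K x * M) terms) = sum_list (map K terms) * M"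
        by (simp add: sum_list_mult_const)
      ultimately have "10 + (n * n * (pcost ?tx + 12) + 9) + (n * n * (pcost ?ty + 12) + 9) +
      (n * ((16 + (n * (pcost margin_step + 12) + 9) + 100) + 12) + 9) + (sum_list (map (\<lambda>x. K x * M) terms) + 1) + pcost ?last
        \<le> 10 * M + (M * (pcost ?tx + 12) + 9 * M) + (M * (pcost ?ty + 12) + 9 * M) + (M * (pcost margin_step + 12) + 137 * M + 9 * M) + (sum_list (map K terms) * M + M) + pcost ?last * M"
        using M(2) by linarith
      also have "\<dots> = K' * M"
        unfolding K'_def by (simp only: distrib_right mult.commute[of M])
      finally show ?thesis .
    qed
    ultimately show "run B (covariance_prog pol r s) S (K' * (n * n * levels (2 * (n * n)) ^ (2 * d - 1)))
      (\<lambda>S'. rmem S' 1 0 = 1 / falling n 4 * (4 * (\<Sum>i<n. \<Sum>j<n. \<Sum>k<n. \<Sum>l<n. rel4 ?R i j k l * alt4 ?R' i j k l)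
         - correction {..<n} ?R ?R'))"
      unfolding M_def[symmetric] sum_term_value[OF n(1) d(2,3), of pol] by (rule run_mono)
  qed
qed

definition two_tables :: "nat \<Rightarrow> rexp \<Rightarrow> rexp \<Rightarrow> prog" where
  "two_tables d f g = ISet 2 (IMul (Var 0) (IConst d)) ;; For 3 2 (RAssign 3 (Var 3) f) ;; For 3 2 (RAssign 2 (Var 3) g)"

lemma run_two_tables:
  assumes n: "imem S 0 0 = n" "n > 0" and B: "n * d < B"
    and step: "\<And>x S'. x < n * d \<Longrightarrow> same {2, 3} {2, 3} S S' \<Longrightarrow> imem S' 3 0 = x \<Longrightarrow>
      rsafe B S' f \<and> rsafe B S' g \<and> rval S' f = F x \<and> rval S' g = G x"
  shows "run B (two_tables d f g) S (10 + (n * d * (pcost (RAssign 3 (Var 3) f) + 12) + 9) + (n * d * (pcost (RAssign 2 (Var 3) g) + 12) + 9))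
    (\<lambda>S'. same {2, 3} {2, 3} S S' \<and> (\<forall>x<n * d. rmem S' 2 x = G x \<and> rmem S' 3 x = F x))"
proof -
  have "1 * d \<le> n * d"
    using n by (intro mult_right_mono) auto
  then have dB: "d < B" "0 < B"
    using B by linarith+
  let ?I = "\<lambda>S'. same {2, 3} {2, 3} S S' \<and> imem S' 2 0 = n * d"
  have 1: "run B (ISet 2 (IMul (Var 0) (IConst d))) S 10 ?I"
    by (rule run_straight) (use n B dB in auto)
  have 2: "run B (For 3 2 (RAssign 3 (Var 3) f)) S1 (n * d * (pcost (RAssign 3 (Var 3) f) + 12) + 9)
    (\<lambda>S'. ?I S' \<and> (\<forall>x<n * d. rmem S' 3 x = F x))" if S1: "?I S1" for S1
  proof (rule run_mono[OF run_fill_prog[where N = "n * d" and F = F and a = 3]])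
    fix i S' assume i: "i < n * d" "same {3} {3} S1 S'" "imem S' 3 0 = i"
    have "same {2, 3} {2, 3} S S'"
      by (rule same_trans[of _ _ S S1 "{3}" "{3}"]) (use S1 i in auto)
    then show "psafe B (RAssign 3 (Var 3) f) S' \<and> effect (RAssign 3 (Var 3) f) S' = rupd 3 i (F i) S'"
      using step[OF i(1) _ i(3)] i(3) by simp
  next
    fix S' assume *: "same {3} {3} S1 S' \<and> (\<forall>i<n * d. rmem S' 3 i = F i)"
    have "same {2, 3} {2, 3} S S'"
      by (rule same_trans[of _ _ S S1 "{3}" "{3}"]) (use S1 * in auto)
    then show "?I S' \<and> (\<forall>x<n * d. rmem S' 3 x = F x)"
      using * S1 same_imem[of "{3}" "{3}" S1 S' 2] by simp
  qed (use S1 B in auto)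
  have 3: "run B (For 3 2 (RAssign 2 (Var 3) g)) S1 (n * d * (pcost (RAssign 2 (Var 3) g) + 12) + 9)
    (\<lambda>S'. same {2, 3} {2, 3} S S' \<and> (\<forall>x<n * d. rmem S' 2 x = G x \<and> rmem S' 3 x = F x))"
    if S1: "?I S1 \<and> (\<forall>x<n * d. rmem S1 3 x = F x)" for S1
  proof (rule run_mono[OF run_fill_prog[where N = "n * d" and F = G and a = 2]])
    fix i S' assume i: "i < n * d" "same {3} {2} S1 S'" "imem S' 3 0 = i"
    have "same {2, 3} {2, 3} S S'"
      by (rule same_trans[of _ _ S S1 "{3}" "{2}"]) (use S1 i in auto)
    then show "psafe B (RAssign 2 (Var 3) g) S' \<and> effect (RAssign 2 (Var 3) g) S' = rupd 2 i (G i) S'"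
      using step[OF i(1) _ i(3)] i(3) by simp
  next
    fix S' assume *: "same {3} {2} S1 S' \<and> (\<forall>i<n * d. rmem S' 2 i = G i)"
    have "same {2, 3} {2, 3} S S'"
      by (rule same_trans[of _ _ S S1 "{3}" "{2}"]) (use S1 * in auto)
    then show "same {2, 3} {2, 3} S S' \<and> (\<forall>x<n * d. rmem S' 2 x = G x \<and> rmem S' 3 x = F x)"
      using * S1 same_rmem[of "{3}" "{2}" S1 S' 3] by simp
  qed (use S1 B in auto)
  show ?thesis
    unfolding two_tables_def by (rule run_Seq[OF run_Seq[OF 1 2] 3])
qed

text \<open>The difference between the two covariances is confined to \<open>pre\<close>, which
  brings the relations into the form of a \<open>problem\<close> and may take quadratic time.
  Irreflexivity is what \<open>sum_distinct_alt4\<close> needs to remove coinciding columns.\<close>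

lemma computable_U_tau:
  fixes r s d C :: nat and Rx Ry :: "(nat \<Rightarrow> real) \<Rightarrow> (nat \<Rightarrow> real) \<Rightarrow> bool"
  assumes d: "d = r + s" "r \<ge> 1" "s \<ge> 1"
    and alt: "\<And>z. alternating (IX r) z = alt4 (\<lambda>i j. Rx (z i) (z j)) 1 2 3 4"
      "\<And>z. alternating (IY s) z = alt4 (\<lambda>i j. Ry (z i) (z j)) 1 2 3 4"
    and irrefl: "\<And>a. \<not> Rx a a" "\<And>a. \<not> Ry a a"
    and pre: "\<And>B n z. n \<ge> 4 \<Longrightarrow> n * d < B \<Longrightarrow> \<exists>P :: problem. n_of P = n \<and>
      (\<forall>i<n. \<forall>j<n. rel_block pol 0 r P i j = Rx (z (Suc i)) (z (Suc j)) \<and>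
         rel_block pol r s P i j = Ry (y_part r z (Suc i)) (y_part r z (Suc j))) \<and>
      run B pre (input_store d n z) (C * (n * n)) (\<lambda>S'. same {2, 3, 4, 5} {2, 3} (input_store d n z) S' \<and>
        (\<forall>i<n. \<forall>l<d. rmem S' 2 (i * d + l) = lo P i l \<and> rmem S' 3 (i * d + l) = hi P i l))"
  shows "computable_in_time d 4 (U_stat 4 (symmetrize 4 (kernel r s 4 1 IX IY)))
    (\<lambda>n. real n ^ 2 * log 2 (real n) ^ (2 * d - 1))"
proof (rule run_covariance_prog[OF d])
  fix K
  assume K: "\<And>B n (P :: problem) (S :: store). \<lbrakk>n_of P = n; n \<ge> 4; 20 * (n * n * d) < B; (8 * (n * n)) ^ (2 * d - 1) < B;
      imem S 0 0 = n; rmem S 1 0 = 0; \<And>v. imem S aT v = 0; \<And>a. rmem S rT a = 0;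
      \<And>i l. i < n \<Longrightarrow> l < d \<Longrightarrow> rmem S 2 (i * d + l) = lo P i l \<and> rmem S 3 (i * d + l) = hi P i l\<rbrakk> \<Longrightarrow>
    run B (covariance_prog pol r s) S (K * (n * n * levels (2 * (n * n)) ^ (2 * d - 1)))
      (\<lambda>S'. rmem S' 1 0 = 1 / falling n 4 * (4 * (\<Sum>i<n. \<Sum>j<n. \<Sum>k<n. \<Sum>l<n.
         rel4 (rel_block pol 0 r P) i j k l * alt4 (rel_block pol r s P) i j k l)
         - correction {..<n} (rel_block pol 0 r P) (rel_block pol r s P)))"
  let ?t = "\<lambda>n. (C + K) * (n * n * levels (2 * (n * n)) ^ (2 * d - 1))"
  show ?thesis
  proof (rule computable_in_timeI)
    fix n :: nat and z assume n: "4 \<le> n"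
    define B where "B = n ^ (8 * d + 10)"
    define S where "S = input_store d n z"
    \<comment> \<open>Here \<open>n \<ge> 4\<close> enters: powers of \<open>n\<close> replace the
      constants 20 and 8.\<close>
    have n64: "20 \<le> n ^ 3" "8 * (n * n) \<le> n ^ 4"
      using power_mono[OF n, of 3] mult_right_mono[OF power_mono[OF n, of 2], of "n * n"]
      by (simp_all add: eval_nat_numeral)
    have "20 * (n * n * d) \<le> n ^ 3 * (n * n * n ^ d)"
      using const_le_power[of n d] n n64(1) by (intro mult_mono) auto
    also have "\<dots> = n ^ (5 + d)"
      by (simp add: power_add eval_nat_numeral)
    also have "\<dots> < B"
      unfolding B_def using n by (intro power_strict_increasing) auto
    finally have B1: "20 * (n * n * d) < B" .
    have "(8 * (n * n)) ^ (2 * d - 1) \<le> (n ^ 4) ^ (2 * d - 1)"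
      using n64(2) by (intro power_mono) auto
    also have "\<dots> = n ^ (4 * (2 * d - 1))"
      by (simp add: power_mult)
    also have "\<dots> < B"
      unfolding B_def using n by (intro power_strict_increasing) auto
    finally have B2: "(8 * (n * n)) ^ (2 * d - 1) < B" .
    have "n * d * 1 \<le> n * d * n"
      using n by (intro mult_left_mono) auto
    moreover have "n * d * n = n * n * d"
      by simp
    ultimately have "n * d < B"
      using B1 by linarith
    from pre[OF n this, of z] obtain P :: problem where P: "n_of P = n"
      "\<And>i j. i < n \<Longrightarrow> j < n \<Longrightarrow> rel_block pol 0 r P i j = Rx (z (Suc i)) (z (Suc j))"
      "\<And>i j. i < n \<Longrightarrow> j < n \<Longrightarrow> rel_block pol r s P i j = Ry (y_part r z (Suc i)) (y_part r z (Suc j))"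
      "run B pre S (C * (n * n)) (\<lambda>S'. same {2, 3, 4, 5} {2, 3} S S' \<and>
        (\<forall>i<n. \<forall>l<d. rmem S' 2 (i * d + l) = lo P i l \<and> rmem S' 3 (i * d + l) = hi P i l))"
      unfolding S_def[symmetric] by blast
    let ?R = "rel_block pol 0 r P" and ?R' = "rel_block pol r s P"
    have "U_stat 4 (symmetrize 4 (kernel r s 4 1 IX IY)) n z = 1 / falling n 4 * (4 * (\<Sum>i<n. \<Sum>j<n. \<Sum>k<n. \<Sum>l<n.
         rel4 ?R i j k l * alt4 ?R' i j k l) - correction {..<n} ?R ?R')"
      unfolding U_tau_formula[of IX r Rx IY s Ry, OF alt irrefl]
      by (simp only: sum_rel4_alt4_Suc[where Q = ?R and Q' = ?R', OF P(2,3)] correction_Suc[where Q = ?R and Q' = ?R', OF P(2,3)])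
    moreover have "run B (pre ;; covariance_prog pol r s) S (C * (n * n) + K * (n * n * levels (2 * (n * n)) ^ (2 * d - 1)))
      (\<lambda>S'. rmem S' 1 0 = 1 / falling n 4 * (4 * (\<Sum>i<n. \<Sum>j<n. \<Sum>k<n. \<Sum>l<n.
         rel4 ?R i j k l * alt4 ?R' i j k l) - correction {..<n} ?R ?R'))"
    proof (rule run_Seq[OF P(4)], rule K[OF P(1) n B1 B2])
      fix S' assume *: "same {2, 3, 4, 5} {2, 3} S S' \<and>
        (\<forall>i<n. \<forall>l<d. rmem S' 2 (i * d + l) = lo P i l \<and> rmem S' 3 (i * d + l) = hi P i l)"
      show "imem S' 0 0 = n" "rmem S' 1 0 = 0" "imem S' aT v = 0" "rmem S' rT a = 0" for v a
        using * by (simp_all add: same_def S_def input_store_def)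
      show "rmem S' 2 (i * d + l) = lo P i l \<and> rmem S' 3 (i * d + l) = hi P i l" if "i < n" "l < d" for i l
        using * that by blast
    qed
    moreover have "C * (n * n) + K * (n * n * levels (2 * (n * n)) ^ (2 * d - 1)) \<le> ?t n"
    proof -
      have "levels (2 * (n * n)) \<ge> 1"
        using levels_pos[of "2 * (n * n)"] n by simp
      then have "n * n * 1 \<le> n * n * levels (2 * (n * n)) ^ (2 * d - 1)"
        by (intro mult_left_mono) auto
      then have "C * (n * n) \<le> C * (n * n * levels (2 * (n * n)) ^ (2 * d - 1))"
        by (intro mult_left_mono) auto
      then show ?thesis
        unfolding distrib_right by linarith
    qed
    ultimately show "run (n ^ (8 * d + 10)) (pre ;; covariance_prog pol r s) (input_store d n z) (?t n)
      (\<lambda>S'. output_of S' = U_stat 4 (symmetrize 4 (kernel r s 4 1 IX IY)) n z)"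
      unfolding B_def[symmetric] S_def[symmetric] output_of_def by (simp only: run_mono)
  next
    \<comment> \<open>Squaring \<open>n\<close> doubles the logarithm, and the factor 2 in front of
      \<open>n * n\<close> contributes the second unit, so the identity is exact.\<close>
    have "real (levels (2 * (n * n))) \<le> 2 * (1 + log 2 (real n))" if "n \<ge> 2" for n
    proof -
      have "real (levels (2 * (n * n))) \<le> 1 + log 2 (real (2 * (n * n)))"
        using that by (intro levels_le_log) simp
      also have "\<dots> = 2 * (1 + log 2 (real n))"
        using that by (simp add: log_mult)
      finally show ?thesis .
    qed
    then have "(\<lambda>n. real (C + K) * (real n ^ 2 * real (levels (2 * (n * n))) ^ (2 * d - 1)))
      \<in> O(\<lambda>n. real n ^ 2 * log 2 (real n) ^ (2 * d - 1))"
      by (intro bigo_log[where c = 2]) auto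
    then show "(\<lambda>n. real (?t n)) \<in> O(\<lambda>n. real n ^ 2 * log 2 (real n) ^ (2 * d - 1))"
      by (simp add: power2_eq_square)
  qed
qed

text \<open>
  Changing signs turns \<open>\<preceq>\<close> with the columns exchanged into a comparison of tables.
\<close>

theorem computable_U_tau_P:
  assumes d: "r \<ge> 1" "s \<ge> 1" "d = r + s"
  shows "computable_in_time d 4 (U_tau_P r s) (\<lambda>n. real n ^ 2 * log 2 (real n) ^ (2 * d - 1))"
proof -
  let ?f = "RSub (ROfNat (IConst 0)) (RArr 0 (Var 3))"
  define m where "m = pcost (RAssign 3 (Var 3) ?f) + 12"
  define C where "C = 28 + 2 * d * m"
  show ?thesis
    unfolding U_tau_P_def
  proof (rule computable_U_tau[OF d(3,1,2) alternating_I_P alternating_I_P, where pol = False and pre = "two_tables d ?f ?f" and C = C])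
    fix B n :: nat and z :: tuple assume n: "n \<ge> 4" and B: "n * d < B"
    define P where "P = \<lparr>n_of = n, lo = \<lambda>i l. - z (Suc i) (Suc l), hi = \<lambda>i l. - z (Suc i) (Suc l)\<rparr>"
    define S where "S = input_store d n z"
    show "\<exists>P :: problem. n_of P = n \<and>
      (\<forall>i<n. \<forall>j<n. rel_block False 0 r P i j = (\<not> preceq r (z (Suc j)) (z (Suc i))) \<and>
         rel_block False r s P i j = (\<not> preceq s (y_part r z (Suc j)) (y_part r z (Suc i)))) \<and>
      run B (two_tables d ?f ?f) (input_store d n z) (C * (n * n)) (\<lambda>S'. same {2, 3, 4, 5} {2, 3} (input_store d n z) S' \<and>
        (\<forall>i<n. \<forall>l<d. rmem S' 2 (i * d + l) = lo P i l \<and> rmem S' 3 (i * d + l) = hi P i l))"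
      unfolding S_def[symmetric]
    proof (rule exI[of _ P], intro conjI allI impI)
      show "n_of P = n"
        by (simp add: P_def)
      show "rel_block False 0 r P i j = (\<not> preceq r (z (Suc j)) (z (Suc i)))"
        "rel_block False r s P i j = (\<not> preceq s (y_part r z (Suc j)) (y_part r z (Suc i)))" for i j
        unfolding preceq_def ball_Suc_atLeastAtMost by (simp_all add: rel_block_def P_def y_part_def)
      show "run B (two_tables d ?f ?f) S (C * (n * n)) (\<lambda>S'. same {2, 3, 4, 5} {2, 3} S S' \<and>
        (\<forall>i<n. \<forall>l<d. rmem S' 2 (i * d + l) = lo P i l \<and> rmem S' 3 (i * d + l) = hi P i l))"
      proof (rule run_mono[OF run_two_tables[where n = n and d = d and F = "\<lambda>x. - rmem S 0 x" and G = "\<lambda>x. - rmem S 0 x"]])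
        fix x S' assume "same {2, 3} {2, 3} S S'" "imem S' 3 0 = x"
        then show "rsafe B S' ?f \<and> rsafe B S' ?f \<and> rval S' ?f = - rmem S 0 x \<and> rval S' ?f = - rmem S 0 x"
          by (simp add: same_def)
      next
        fix S' assume *: "same {2, 3} {2, 3} S S' \<and> (\<forall>x<n * d. rmem S' 2 x = - rmem S 0 x \<and> rmem S' 3 x = - rmem S 0 x)"
        have "same {2, 3, 4, 5} {2, 3} S S'"
          by (rule same_mono[of "{2, 3}" "{2, 3}"]) (use * in auto)
        moreover have "rmem S' 2 (i * d + l) = lo P i l \<and> rmem S' 3 (i * d + l) = hi P i l" if "i < n" "l < d" for i l
        proof -
          have "Suc i * d \<le> n * d"
            using that by (intro mult_right_mono) auto
          then have "i * d + l < n * d"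
            using that by simp
          then show ?thesis
            using * input_store_coord[OF that, of z] by (simp add: P_def S_def)
        qed
        ultimately show "same {2, 3, 4, 5} {2, 3} S S' \<and>
          (\<forall>i<n. \<forall>l<d. rmem S' 2 (i * d + l) = lo P i l \<and> rmem S' 3 (i * d + l) = hi P i l)"
          by blast
      next
        have "n * 1 \<le> n * n"
          using n by (intro mult_left_mono) auto
        then have le: "n \<le> n * n" "1 \<le> n * n"
          using n by simp_all
        have "n * (2 * d * m) \<le> n * n * (2 * d * m)"
          by (rule mult_le_mono1, fact)
        moreover have "n * d * (pcost (RAssign 3 (Var 3) ?f) + 12) + n * d * (pcost (RAssign 2 (Var 3) ?f) + 12) = n * (2 * d * m)"
          by (simp add: m_def)
        moreover have "C * (n * n) = 28 * (n * n) + n * n * (2 * d * m)"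
          by (simp add: C_def algebra_simps)
        ultimately show "10 + (n * d * (pcost (RAssign 3 (Var 3) ?f) + 12) + 9) + (n * d * (pcost (RAssign 2 (Var 3) ?f) + 12) + 9) \<le> C * (n * n)"
          using le by linarith
      qed (use n B in \<open>simp_all add: S_def input_store_def\<close>)
    qed
  qed (simp_all add: preceq_def)
qed

text \<open>
  Strict inequality becomes weak by comparing successors of ranks.
\<close>

theorem computable_U_tau_J:
  assumes d: "r \<ge> 1" "s \<ge> 1" "d = r + s"
  shows "computable_in_time d 4 (U_tau_J r s) (\<lambda>n. real n ^ 2 * log 2 (real n) ^ (2 * d - 1))"
proof -
  let ?f = "ROfNat (IArr 5 (Var 3))" and ?g = "ROfNat (IAdd (IArr 5 (Var 3)) (IConst 1))"
  let ?pre = "rank_prog d ;; two_tables d ?f ?g"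
  define m where "m = pcost (RAssign 3 (Var 3) ?f) + 12 + (pcost (RAssign 2 (Var 3) ?g) + 12)"
  define C where "C = 128 + d * 100 + d * m"
  \<comment> \<open>In dimension 0 the strict order would hold vacuously between equal
    points.\<close>
  have irr: "\<not> prec q a a" if "q \<ge> 1" for q a
    using that by (auto simp: prec_def)
  show ?thesis
    unfolding U_tau_J_def
  proof (rule computable_U_tau[where IX = I_J and IY = I_J and Rx = "prec r" and Ry = "prec s",
        OF d(3,1,2) alternating_I_J alternating_I_J irr[OF d(1)] irr[OF d(2)], where pol = True and pre = ?pre and C = C])
    fix B n :: nat and z :: tuple assume n: "n \<ge> 4" and B: "n * d < B"
    define P where "P = \<lparr>n_of = n, lo = \<lambda>i l. real (rank n z i l + 1), hi = \<lambda>i l. real (rank n z i l)\<rparr>"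
    define S where "S = input_store d n z"
    have S0: "imem S 0 0 = n" "imem S 5 a = 0" for a
      by (simp_all add: S_def input_store_def)
    have d0: "d > 0" and n0: "n > 0"
      using d n by simp_all
    have "n * 1 \<le> n * d"
      using d0 by (intro mult_left_mono) auto
    then have nB: "n < B"
      using B by linarith
    have rel: "rel_block True off q P i j \<longleftrightarrow> (\<forall>l<q. z (Suc i) (Suc (off + l)) < z (Suc j) (Suc (off + l)))"
      if "i < n" "j < n" for off q i j
      using that by (simp add: rel_block_def P_def Suc_le_eq rank_less_iff flip: of_nat_Suc)
    have 1: "run B (rank_prog d) S (n * n * (d * 100) + 100)
      (\<lambda>S'. same {2, 3, 4, 5} {} S S' \<and> (\<forall>i<n. \<forall>k<d. imem S' 5 (i * d + k) = rank n z i k))"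
      by (rule run_rank_prog) (use S0 d0 n0 B in \<open>auto simp: S_def input_store_coord\<close>)
    let ?post = "\<lambda>S'. same {2, 3, 4, 5} {2, 3} S S' \<and>
        (\<forall>i<n. \<forall>l<d. rmem S' 2 (i * d + l) = lo P i l \<and> rmem S' 3 (i * d + l) = hi P i l)"
    have 2: "run B (two_tables d ?f ?g) S1 (10 + (n * d * (pcost (RAssign 3 (Var 3) ?f) + 12) + 9) + (n * d * (pcost (RAssign 2 (Var 3) ?g) + 12) + 9)) ?post"
      if S1: "same {2, 3, 4, 5} {} S S1 \<and> (\<forall>i<n. \<forall>k<d. imem S1 5 (i * d + k) = rank n z i k)" for S1
    proof (rule run_mono[OF run_two_tables[where n = n and d = d and F = "\<lambda>x. real (imem S1 5 x)" and G = "\<lambda>x. real (imem S1 5 x + 1)"]])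
      show "imem S1 0 0 = n"
        using S1 S0 by (simp add: same_def)
      fix x S' assume x: "x < n * d" "same {2, 3} {2, 3} S1 S'" "imem S' 3 0 = x"
      have "x div d < n" "x mod d < d"
        using x(1) d0 by (simp_all add: less_mult_imp_div_less)
      then have "imem S1 5 (x div d * d + x mod d) = rank n z (x div d) (x mod d)"
        using S1 by blast
      then have "imem S1 5 x < n"
        using rank_less[OF \<open>x div d < n\<close>, of z "x mod d"] by simp
      then show "rsafe B S' ?f \<and> rsafe B S' ?g \<and> rval S' ?f = real (imem S1 5 x) \<and> rval S' ?g = real (imem S1 5 x + 1)"
        using x nB by (simp add: same_def)
    next
      fix S' assume *: "same {2, 3} {2, 3} S1 S' \<and> (\<forall>x<n * d. rmem S' 2 x = real (imem S1 5 x + 1) \<and> rmem S' 3 x = real (imem S1 5 x))"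
      have "same {2, 3, 4, 5} {2, 3} S S1"
        by (rule same_mono[of "{2, 3, 4, 5}" "{}"]) (use S1 in auto)
      then have "same {2, 3, 4, 5} {2, 3} S S'"
        by (rule same_trans[of _ _ _ S1 "{2, 3}" "{2, 3}"]) (use * in auto)
      moreover have "rmem S' 2 (i * d + l) = lo P i l \<and> rmem S' 3 (i * d + l) = hi P i l" if "i < n" "l < d" for i l
      proof -
        have "Suc i * d \<le> n * d"
          using that by (intro mult_right_mono) auto
        then have "i * d + l < n * d"
          using that by simp
        moreover have "imem S1 5 (i * d + l) = rank n z i l"
          using S1 that by blast
        ultimately show ?thesis
          using * by (simp add: P_def)
      qed
      ultimately show "?post S'"
        by blast
    qed (use n0 B in simp_all)
    have "run B ?pre S (C * (n * n)) ?post"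
    proof (rule run_mono[OF run_Seq[OF 1 2]])
      have "n * 1 \<le> n * n"
        using n by (intro mult_left_mono) auto
      then have le: "n \<le> n * n" "1 \<le> n * n"
        using n by simp_all
      have "n * (d * m) \<le> n * n * (d * m)"
        by (rule mult_le_mono1, fact)
      moreover have "n * d * (pcost (RAssign 3 (Var 3) ?f) + 12) + n * d * (pcost (RAssign 2 (Var 3) ?g) + 12) = n * (d * m)"
        by (simp only: m_def distrib_left mult.assoc)
      moreover have "C * (n * n) = 128 * (n * n) + n * n * (d * 100) + n * n * (d * m)"
        by (simp add: C_def algebra_simps)
      ultimately show "n * n * (d * 100) + 100 + (10 + (n * d * (pcost (RAssign 3 (Var 3) ?f) + 12) + 9) + (n * d * (pcost (RAssign 2 (Var 3) ?g) + 12) + 9)) \<le> C * (n * n)"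
        using le by linarith
    qed
    moreover have "rel_block True 0 r P i j = prec r (z (Suc i)) (z (Suc j)) \<and>
         rel_block True r s P i j = prec s (y_part r z (Suc i)) (y_part r z (Suc j))" if "i < n" "j < n" for i j
      unfolding rel[OF that] prec_def ball_Suc_atLeastAtMost by (simp add: y_part_def)
    moreover have "n_of P = n"
      by (simp add: P_def)
    ultimately show "\<exists>P :: problem. n_of P = n \<and>
      (\<forall>i<n. \<forall>j<n. rel_block True 0 r P i j = prec r (z (Suc i)) (z (Suc j)) \<and>
         rel_block True r s P i j = prec s (y_part r z (Suc i)) (y_part r z (Suc j))) \<and>
      run B ?pre (input_store d n z) (C * (n * n)) (\<lambda>S'. same {2, 3, 4, 5} {2, 3} (input_store d n z) S' \<and>
        (\<forall>i<n. \<forall>l<d. rmem S' 2 (i * d + l) = lo P i l \<and> rmem S' 3 (i * d + l) = hi P i l))"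
      unfolding S_def[symmetric] by blast
  qed
qed

theorem proposition5p5:
  fixes r s d :: nat
  assumes "r \<ge> 1" and "s \<ge> 1" and "d = r + s"
  shows "computable_in_time d 5 (U_D r s) (\<lambda>n. real n * log 2 (real n) ^ (d - 1))
       \<and> computable_in_time d (4 + d) (U_R r s) (\<lambda>n. real n ^ d)
       \<and> computable_in_time d 4 (U_tau_P r s) (\<lambda>n. real n ^ 2 * log 2 (real n) ^ (2 * d - 1))
       \<and> computable_in_time d 4 (U_tau_J r s) (\<lambda>n. real n ^ 2 * log 2 (real n) ^ (2 * d - 1))"
  using computable_U_D[OF assms] computable_U_R[OF assms] computable_U_tau_P[OF assms] computable_U_tau_J[OF assms]
  by blast

end
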